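(* Let $b:\mathbb{R}\to\mathbb{R}$ and $\sigma:\mathbb{R}\to(0,\infty)$ be continuous with period 1, and let $X$ solve $dX_t=b(X_t)dt+\sigma(X_t)dW_t$, $X_0=y\in\mathbb{R}$. Let $I_1:\mathbb{R}^2\to[0,\infty]$ be the good rate function of the large deviation principle (with rate $t$) satisfied by the laws of $(J^+_t,J^-_t)$. Then for all $x_1,x_2\in\mathbb{R}$, $$I_1(x_1,x_2)=I_1(x_2,x_1)-\gamma(x_1-x_2),$$ where $\gamma$ is the affinity of $X$.
   Context: $W$ is a standard Brownian motion; the SDE has a weak solution unique in law. Cycle forming times: $T_0=0$, $T_n=\inf\{t\ge T_{n-1}:|X_t-X_{T_{n-1}}|=1\}$. Let $N_t=\inf\{n\ge0:T_{n+1}>t\}$, $N^+_t=\sum_{n=1}^{N_t}1_{\{X_{T_n}-X_{T_{n-1}}=1\}}$, $N^-_t=\sum_{n=1}^{N_t}1_{\{X_{T_n}-X_{T_{n-1}}=-1\}}$ (numbers of forward/backward cycles formed up to time $t$). Empirical circulations: $J^\pm_t=N^\pm_t/t$. Circulations: $J^\pm=\lim_{t\to\infty}N^\pm_t/t$ (almost sure limits, which exist and are positive deterministic constants). Affinity: $\gamma=\log(J^+/J^-)$. A family of probability measures $\{\mu_t\}_{t>0}$ on a Polish space $E$ satisfies a large deviation principle with rate $t$ and good rate function $I:E\to[0,\infty]$ if all level sets $\{I\le\alpha\}$ are compact, $\limsup_{t\to\infty}\frac1t\log\mu_t(F)\le-\inf_F I$ for closed $F$, and $\liminf_{t\to\infty}\frac1t\log\mu_t(U)\ge-\inf_U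 I$ for open $U$. (The laws of $(J^+_t,J^-_t)$ satisfy such a principle with a convex good rate function $I_1$.) *)

theory Defs
  imports "HOL-Probability.Probability"
begin

definition is_filtration :: "'a measure \<Rightarrow> (real \<Rightarrow> 'a measure) \<Rightarrow> bool" where
  "is_filtration M F \<longleftrightarrow>
     (\<forall>t\<ge>0. space (F t) = space M \<and> sets (F t) \<subseteq> sets M) \<and>
     (\<forall>s t. 0 \<le> s \<longrightarrow> s \<le> t \<longrightarrow> sets (F s) \<subseteq> sets (F t))"

definition brownian_motion :: "'a measure \<Rightarrow> (real \<Rightarrow> 'a measure) \<Rightarrow> (real \<Rightarrow> 'a \<Rightarrow> real) \<Rightarrow> bool" where
  "brownian_motion M F W \<longleftrightarrow>
     (\<forall>\<omega>\<in>space M. W 0 \<omega> = 0) \<and>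
     (\<forall>\<omega>\<in>space M. continuous_on {0..} (\<lambda>t. W t \<omega>)) \<and>
     (\<forall>t\<ge>0. W t \<in> borel_measurable (F t)) \<and>
     (\<forall>s t. 0 \<le> s \<longrightarrow> s < t \<longrightarrow>
        prob_space.indep_set M (sets (F s))
          (sets (vimage_algebra (space M) (\<lambda>\<omega>. W t \<omega> - W s \<omega>) borel)) \<and>
        distributed M lborel (\<lambda>\<omega>. W t \<omega> - W s \<omega>) (\<lambda>x. ennreal (normal_density 0 (sqrt (t - s)) x)))"

definition conv_in_prob :: "'a measure \<Rightarrow> (nat \<Rightarrow> 'a \<Rightarrow> real) \<Rightarrow> ('a \<Rightarrow> real) \<Rightarrow> bool" where
  "conv_in_prob M S Z \<longleftrightarrow>
     (\<forall>\<epsilon>>0. ((\<lambda>n. measure M {\<omega>\<in>space M. \<bar>S n \<omega> - Z \<omega>\<bar> > \<epsilon>}) \<longlonglongrightarrow> 0))"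

definition ito_sum :: "(real \<Rightarrow> 'a \<Rightarrow> real) \<Rightarrow> (real \<Rightarrow> 'a \<Rightarrow> real) \<Rightarrow> real \<Rightarrow> nat \<Rightarrow> 'a \<Rightarrow> real" where
  "ito_sum H W t n \<omega> =
     (\<Sum>k<2^n. H (real k * t / 2^n) \<omega> *
        (W (real (Suc k) * t / 2^n) \<omega> - W (real k * t / 2^n) \<omega>))"

text \<open>Z is (a version of) the Ito integral of the continuous adapted integrand H against W
  over [0,t]: for such integrands the Ito integral is the limit in probability of the
  left-point Riemann sums along partitions with mesh tending to 0.\<close>
definition is_ito_integral :: "'a measure \<Rightarrow> (real \<Rightarrow> 'a \<Rightarrow> real) \<Rightarrow> (real \<Rightarrow> 'a \<Rightarrow> real) \<Rightarrow> real \<Rightarrow> ('a \<Rightarrow> real) \<Rightarrow> bool" where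
  "is_ito_integral M H W t Z \<longleftrightarrow> Z \<in> borel_measurable M \<and> conv_in_prob M (ito_sum H W t) Z"

definition sde_weak_solution :: "'a measure \<Rightarrow> (real \<Rightarrow> 'a measure) \<Rightarrow> (real \<Rightarrow> 'a \<Rightarrow> real) \<Rightarrow>
    (real \<Rightarrow> 'a \<Rightarrow> real) \<Rightarrow> (real \<Rightarrow> real) \<Rightarrow> (real \<Rightarrow> real) \<Rightarrow> real \<Rightarrow> bool" where
  "sde_weak_solution M F W X b \<sigma> y \<longleftrightarrow>
     prob_space M \<and> is_filtration M F \<and> brownian_motion M F W \<and>
     (\<forall>\<omega>\<in>space M. X 0 \<omega> = y) \<and>
     (\<forall>\<omega>\<in>space M. continuous_on {0..} (\<lambda>t. X t \<omega>)) \<and>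
     (\<forall>t\<ge>0. X t \<in> borel_measurable (F t)) \<and>
     (\<forall>t\<ge>0. \<exists>Z. is_ito_integral M (\<lambda>s \<omega>. \<sigma> (X s \<omega>)) W t Z \<and>
        (AE \<omega> in M. X t \<omega> = y + integral {0..t} (\<lambda>s. b (X s \<omega>)) + Z \<omega>))"

primrec cycle_time :: "(real \<Rightarrow> real) \<Rightarrow> nat \<Rightarrow> real" where
  "cycle_time x 0 = 0"
| "cycle_time x (Suc n) =
     Inf {t. t \<ge> cycle_time x n \<and> \<bar>x t - x (cycle_time x n)\<bar> = 1}"

definition num_cycles :: "(real \<Rightarrow> real) \<Rightarrow> real \<Rightarrow> nat" where
  "num_cycles x t = (LEAST n. cycle_time x (Suc n) > t)"

definition num_fwd :: "(real \<Rightarrow> real) \<Rightarrow> real \<Rightarrow> nat" where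
  "num_fwd x t = card {n \<in> {1..num_cycles x t}.
      x (cycle_time x n) - x (cycle_time x (n - 1)) = 1}"

definition num_bwd :: "(real \<Rightarrow> real) \<Rightarrow> real \<Rightarrow> nat" where
  "num_bwd x t = card {n \<in> {1..num_cycles x t}.
      x (cycle_time x n) - x (cycle_time x (n - 1)) = -1}"

definition emp_circ_fwd :: "(real \<Rightarrow> 'a \<Rightarrow> real) \<Rightarrow> real \<Rightarrow> 'a \<Rightarrow> real" where
  "emp_circ_fwd X t \<omega> = real (num_fwd (\<lambda>s. X s \<omega>) t) / t"

definition emp_circ_bwd :: "(real \<Rightarrow> 'a \<Rightarrow> real) \<Rightarrow> real \<Rightarrow> 'a \<Rightarrow> real" where
  "emp_circ_bwd X t \<omega> = real (num_bwd (\<lambda>s. X s \<omega>) t) / t"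

definition circ_fwd :: "'a measure \<Rightarrow> (real \<Rightarrow> 'a \<Rightarrow> real) \<Rightarrow> real" where
  "circ_fwd M X = (THE c. AE \<omega> in M. ((\<lambda>t. emp_circ_fwd X t \<omega>) \<longlongrightarrow> c) at_top)"

definition circ_bwd :: "'a measure \<Rightarrow> (real \<Rightarrow> 'a \<Rightarrow> real) \<Rightarrow> real" where
  "circ_bwd M X = (THE c. AE \<omega> in M. ((\<lambda>t. emp_circ_bwd X t \<omega>) \<longlongrightarrow> c) at_top)"

definition affinity :: "'a measure \<Rightarrow> (real \<Rightarrow> 'a \<Rightarrow> real) \<Rightarrow> real" where
  "affinity M X = ln (circ_fwd M X / circ_bwd M X)"

definition eln :: "real \<Rightarrow> ereal" where
  "eln p = (if p \<le> 0 then -\<infinity> else ereal (ln p))"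

definition ldp :: "(real \<Rightarrow> 'b::topological_space measure) \<Rightarrow> ('b \<Rightarrow> ereal) \<Rightarrow> bool" where
  "ldp \<mu> I \<longleftrightarrow>
     (\<forall>x. I x \<ge> 0) \<and>
     (\<forall>\<alpha>::real. compact {x. I x \<le> ereal \<alpha>}) \<and>
     (\<forall>C. closed C \<longrightarrow>
        Limsup at_top (\<lambda>t. ereal (1 / t) * eln (measure (\<mu> t) C)) \<le> - (INF x\<in>C. I x)) \<and>
     (\<forall>U. open U \<longrightarrow>
        Liminf at_top (\<lambda>t. ereal (1 / t) * eln (measure (\<mu> t) U)) \<ge> - (INF x\<in>U. I x))"

definition circ_law :: "'a measure \<Rightarrow> (real \<Rightarrow> 'a \<Rightarrow> real) \<Rightarrow> real \<Rightarrow> (real \<times> real) measure" where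
  "circ_law M X t = distr M borel (\<lambda>\<omega>. (emp_circ_fwd X t \<omega>, emp_circ_bwd X t \<omega>))"

end

theory Submission
  imports Defs
begin

text \<open>
  Every cycle starts at a point of \<open>y + \<int>\<close>, so by periodicity all cycles see the same coefficients. Let
  \<open>s\<close> and \<open>c\<close> solve \<open>\<sigma>\<^sup>2 u'' / 2 + b u' = \<nu> u\<close> around such a point with \<open>s = 0\<close>, \<open>s' = 1\<close> and \<open>c = 1\<close>,
  \<open>c' = 0\<close> there. Stopping the martingales \<open>exp (- \<nu> t) s(X\<^sub>t)\<close> and \<open>exp (- \<nu> t) c(X\<^sub>t)\<close> at the end of a
  cycle expresses the joint Laplace transform of its sign and duration by the values of \<open>s\<close> and \<open>c\<close> at
  \<open>1\<close> and \<open>-1\<close>. The Wronskian of \<open>s\<close> and its translate by one period gives \<open>s(-1) = - \<kappa> s(1)\<close> with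
  \<open>\<kappa> = exp (\<integral>\<^sub>0\<^sup>1 2 b / \<sigma>\<^sup>2)\<close> independent of \<open>\<nu>\<close>. Hence the cycles are independent and identically
  distributed, sign and duration of a cycle are independent, and forward cycles are \<open>\<kappa>\<close> times as likely as
  backward ones. Therefore \<open>P(N\<^sup>+\<^sub>t = m, N\<^sup>-\<^sub>t = n) = \<kappa>\<^bsup>m - n\<^esup> P(N\<^sup>+\<^sub>t = n, N\<^sup>-\<^sub>t = m)\<close> for every \<open>t\<close>, and the
  law of large numbers gives \<open>J\<^sup>+ / J\<^sup>- = \<kappa>\<close>. The symmetry of the rate function follows because rate
  functions are lower semicontinuous.

  The martingale property is only needed asymptotically along grids: for smooth bounded \<open>f\<close> the conditional
  expectation of \<open>f(X\<^sub>t\<^sub>+\<^sub>d) - f(X\<^sub>t) - d L f(X\<^sub>t)\<close> is \<open>o(d)\<close> uniformly in \<open>t\<close>, which follows directly from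
  the moments of Brownian increments and the approximation of the Ito integral by Riemann sums.
\<close>


subsection \<open>Bounded uniformly continuous functions\<close>

text \<open>The weak solution supplies the stochastic integral only as a limit in probability of
  dyadic left-point sums, separately at each fixed time, so neither an Ito formula nor a Markov
  property is at hand. Conditional expectations are replaced throughout by expectations against
  bounded \<open>F t\<close>-measurable weights; for optional stopping the weight is the indicator
  that a prescribed word of signs is complete and the next cycle is still running. Regeneration at
  the cycle times thereby becomes an induction on words. The eigenvalue \<nu> may also be slightly
  negative. The cosine-type solution then stays positive while its discount factor grows, which
  yields almost sure completion of all cycles, exponential moments, the domination for unbounded
  horizons and the strong laws. The last obstacle is measurability: a path that never completes a
  cycle gives junk values of \<open>cycle_time\<close>, so the empirical circulations are controlled
  only up to a null set and their events are rebuilt from words.\<close>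

definition bounded_ucont :: "(real \<Rightarrow> real) \<Rightarrow> bool" where
  "bounded_ucont f \<longleftrightarrow> (\<exists>B. \<forall>x. \<bar>f x\<bar> \<le> B) \<and> uniformly_continuous_on UNIV f"

lemma bounded_ucontD_bound: assumes "bounded_ucont f" obtains B where "B \<ge> 0" "\<And>x. \<bar>f x\<bar> \<le> B"
proof -
  obtain B where "\<And>x. \<bar>f x\<bar> \<le> B" using assms by (auto simp: bounded_ucont_def)
  moreover from this[of 0] have "B \<ge> 0" by linarith
  ultimately show ?thesis using that by blast
qed

text \<open>Nearby points are handled by uniform continuity, distant ones by the bound. The
  truncated distance is used because its expectation measures convergence in probability, so no
  moment of the solution itself has to be controlled.\<close>

lemma bounded_ucontD_modulus:
  assumes "bounded_ucont f" "\<eta> > 0"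
  obtains C where "C \<ge> 0" "\<And>x z. \<bar>f x - f z\<bar> \<le> \<eta> + C * min 1 \<bar>x - z\<bar>"
proof -
  obtain B where B: "B \<ge> 0" "\<And>x. \<bar>f x\<bar> \<le> B" using bounded_ucontD_bound[OF assms(1)] by blast
  obtain d where d: "d > 0" "\<And>x z. \<bar>x - z\<bar> < d \<Longrightarrow> \<bar>f x - f z\<bar> < \<eta>"
    using assms unfolding bounded_ucont_def uniformly_continuous_on_def dist_real_def by (metis UNIV_I)
  define C where "C = 2 * B / min 1 d"
  have C: "C \<ge> 0" using B d by (simp add: C_def)
  have "\<bar>f x - f z\<bar> \<le> \<eta> + C * min 1 \<bar>x - z\<bar>" for x z
  proof (cases "\<bar>x - z\<bar> < d")
    case True
    have "0 \<le> C * min 1 \<bar>x - z\<bar>" using C by simp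
    with d(2)[OF True] show ?thesis by linarith
  next
    case False
    then have "min 1 d \<le> min 1 \<bar>x - z\<bar>" by auto
    then have "C * min 1 d \<le> C * min 1 \<bar>x - z\<bar>" using C by (intro mult_left_mono)
    moreover have "C * min 1 d = 2 * B" using d by (simp add: C_def)
    moreover have "\<bar>f x - f z\<bar> \<le> 2 * B" using B(2)[of x] B(2)[of z] by linarith
    ultimately show ?thesis using assms(2) by linarith
  qed
  with C show ?thesis using that by blast
qed

lemma periodic_shift:
  fixes f :: "real \<Rightarrow> real"
  assumes per: "\<And>x. f (x + 1) = f x"
  shows "f (x + of_int n) = f x"
proof (induct n rule: int_induct[where k=0])
  case (step1 i) then show ?case using per[of "x + of_int i"] by (simp add: algebra_simps)
next
  case (step2 i) then show ?case using per[of "x + of_int i - 1"] by (simp add: algebra_simps)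
qed simp

text \<open>Shifting both points by the floor of the first puts it into the unit interval and the
  second within distance 1 of it. Hence the compact interval from -1 to 2 rather than a single
  period.\<close>

lemma periodic_bounded_ucont:
  fixes f :: "real \<Rightarrow> real"
  assumes cont: "continuous_on UNIV f" and per: "\<And>x. f (x + 1) = f x"
  shows "bounded_ucont f"
  unfolding bounded_ucont_def
proof
  have c: "continuous_on {-1..2} f" by (rule continuous_on_subset[OF cont]) simp
  have red: "f x = f (frac x)" for x
    using periodic_shift[of f, OF per, of x "- \<lfloor>x\<rfloor>"] by (simp add: frac_def)
  have "bounded (f ` {-1..2})" by (intro compact_imp_bounded compact_continuous_image c) simp
  then obtain B where B0: "\<forall>x\<in>{-1..2}. \<bar>f x\<bar> \<le> B" by (auto simp: bounded_iff)
  have B: "\<bar>f x\<bar> \<le> B" if "x \<in> {-1..2}" for x using B0 that by blast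
  have "\<bar>f x\<bar> \<le> B" for x
    by (subst red, rule B) (auto simp: frac_lt_1 less_imp_le order_trans[OF _ frac_ge_0]
      intro: order_trans[OF less_imp_le[OF frac_lt_1]])
  then show "\<exists>B. \<forall>x. \<bar>f x\<bar> \<le> B" by blast
  have uc: "uniformly_continuous_on {-1..2} f" by (rule compact_uniformly_continuous[OF c]) simp
  show "uniformly_continuous_on UNIV f"
    unfolding uniformly_continuous_on_def
  proof (intro allI impI)
    fix e :: real assume "e > 0"
    then obtain d where d: "d > 0" "\<And>x z. x \<in> {-1..2} \<Longrightarrow> z \<in> {-1..2} \<Longrightarrow> dist z x < d \<Longrightarrow> dist (f z) (f x) < e"
      using uc unfolding uniformly_continuous_on_def by metis
    have "dist (f z) (f x) < e" if "dist z x < min 1 d" for x z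
    proof -
      have "f z = f (z - of_int \<lfloor>x\<rfloor>)" using periodic_shift[of f, OF per, of z "- \<lfloor>x\<rfloor>"] by simp
      moreover have "f x = f (x - of_int \<lfloor>x\<rfloor>)" using periodic_shift[of f, OF per, of x "- \<lfloor>x\<rfloor>"] by simp
      moreover have "dist (f (z - of_int \<lfloor>x\<rfloor>)) (f (x - of_int \<lfloor>x\<rfloor>)) < e"
        using that by (intro d(2)) (auto simp: dist_real_def abs_less_iff; linarith)+
      ultimately show ?thesis by simp
    qed
    then show "\<exists>d>0. \<forall>x\<in>UNIV. \<forall>x'\<in>UNIV. dist x' x < d \<longrightarrow> dist (f x') (f x) < e"
      using d(1) by (intro exI[of _ "min 1 d"]) auto
  qed
qed

lemma bounded_ucont_continuous: "bounded_ucont f \<Longrightarrow> continuous_on A f"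
  unfolding bounded_ucont_def using uniformly_continuous_imp_continuous continuous_on_subset by blast

text \<open>The modulus of \<open>f''\<close> alone would leave a cubic error. Young's inequality,
  \<open>C * \<bar>D\<bar> \<le> \<eta> + C\<^sup>2 / \<eta> * D\<^sup>2\<close>, trades it for even
  powers, so that second and fourth Gaussian moments suffice later.\<close>

lemma taylor2_bound:
  fixes f f' f'' :: "real \<Rightarrow> real"
  assumes d1: "\<And>x. (f has_real_derivative f' x) (at x)"
    and d2: "\<And>x. (f' has_real_derivative f'' x) (at x)"
    and m: "bounded_ucont f''" and \<eta>: "\<eta> > 0"
  obtains C where "C \<ge> 0"
    "\<And>x D. \<bar>f (x + D) - f x - f' x * D - f'' x * D\<^sup>2 / 2\<bar> \<le> \<eta> * D\<^sup>2 + C * D ^ 4"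
proof -
  obtain C where C: "C \<ge> 0" "\<And>x z. \<bar>f'' x - f'' z\<bar> \<le> \<eta> + C * min 1 \<bar>x - z\<bar>"
    using bounded_ucontD_modulus[OF m \<eta>] by blast
  have "\<bar>f (x + D) - f x - f' x * D - f'' x * D\<^sup>2 / 2\<bar> \<le> \<eta> * D\<^sup>2 + (C\<^sup>2 / \<eta>) * D ^ 4" for x D
  proof (cases "D = 0")
    case True then show ?thesis by simp
  next
    case False
    let ?df = "\<lambda>m::nat. if m = 0 then f else if m = 1 then f' else f''"
    have "\<exists>t. (if x + D < x then x + D < t \<and> t < x else x < t \<and> t < x + D) \<and>
        f (x + D) = (\<Sum>m<2. (?df m x / fact m) * ((x + D) - x)^m) + (?df 2 t / fact 2) * ((x + D) - x)^2"
      by (rule Taylor[where a="min x (x+D)" and b="max x (x+D)"])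
        (use False in \<open>auto simp: less_2_cases_iff intro!: d1 d2\<close>)
    then obtain t where t0: "if x + D < x then x + D < t \<and> t < x else x < t \<and> t < x + D"
        "f (x + D) = (\<Sum>m<2. (?df m x / fact m) * ((x + D) - x)^m) + (?df 2 t / fact 2) * ((x + D) - x)^2"
      by blast
    have t: "\<bar>t - x\<bar> \<le> \<bar>D\<bar>" "f (x + D) = f x + f' x * D + f'' t * D\<^sup>2 / 2"
      using t0(1) t0(2) by (auto simp: numeral_2_eq_2 split: if_splits)
    have "\<bar>f'' t - f'' x\<bar> \<le> \<eta> + C * min 1 \<bar>t - x\<bar>" by (rule C)
    also have "\<dots> \<le> \<eta> + C * \<bar>D\<bar>" using t C(1) by (intro add_left_mono mult_left_mono) auto
    also have "C * \<bar>D\<bar> \<le> \<eta> + C\<^sup>2 / \<eta> * D\<^sup>2"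
    proof -
      have "0 \<le> (\<eta> - C * \<bar>D\<bar>)\<^sup>2 + \<eta> * (C * \<bar>D\<bar>)" using \<eta> C by simp
      then have "\<eta> * (C * \<bar>D\<bar>) \<le> \<eta> * \<eta> + C\<^sup>2 * D\<^sup>2"
        by (simp add: power2_eq_square algebra_simps flip: abs_mult)
      then have "C * \<bar>D\<bar> \<le> (\<eta> * \<eta> + C\<^sup>2 * D\<^sup>2) / \<eta>" using \<eta> by (simp add: field_simps)
      also have "\<dots> = \<eta> + C\<^sup>2 / \<eta> * D\<^sup>2" using \<eta> by (simp add: field_simps)
      finally show ?thesis .
    qed
    finally have e: "\<bar>f'' t - f'' x\<bar> \<le> 2 * \<eta> + C\<^sup>2 / \<eta> * D\<^sup>2" by simp
    have "\<bar>f (x + D) - f x - f' x * D - f'' x * D\<^sup>2 / 2\<bar> = \<bar>f'' t - f'' x\<bar> * D\<^sup>2 / 2"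
      unfolding t(2) by (simp add: abs_mult flip: left_diff_distrib diff_divide_distrib)
    also have "\<dots> \<le> (2 * \<eta> + C\<^sup>2 / \<eta> * D\<^sup>2) * D\<^sup>2 / 2"
      using e by (intro divide_right_mono mult_right_mono) auto
    also have "\<dots> = \<eta> * D\<^sup>2 + (C\<^sup>2 / \<eta>) * D ^ 4 / 2" by (simp add: field_simps power2_eq_square power4_eq_xxxx)
    also have "\<dots> \<le> \<eta> * D\<^sup>2 + (C\<^sup>2 / \<eta>) * D ^ 4"
    proof -
      have half: "c / 2 \<le> c" if "0 \<le> c" for c :: real using that by simp
      show ?thesis by (intro add_left_mono half) (use \<eta> in simp)
    qed
    finally show ?thesis .
  qed
  moreover have "C\<^sup>2 / \<eta> \<ge> 0" using \<eta> by simp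
  ultimately show ?thesis using that by blast
qed

subsection \<open>Moments of Brownian increments\<close>

text \<open>The generator estimates see the coefficients only through uniform continuity and one
  common bound \<open>K\<close>; periodicity enters with \<open>periodic_sde\<close>. The
  normalisation \<open>K \<ge> 1\<close> makes divisions by \<open>K\<close> harmless.\<close>

locale sde = prob_space M for M :: "'a measure" +
  fixes F :: "real \<Rightarrow> 'a measure" and W X :: "real \<Rightarrow> 'a \<Rightarrow> real"
    and b \<sigma> :: "real \<Rightarrow> real" and y K :: real
  assumes filt: "is_filtration M F" and bm: "brownian_motion M F W"
    and X0: "\<And>\<omega>. \<omega> \<in> space M \<Longrightarrow> X 0 \<omega> = y"
    and Xc: "\<And>\<omega>. \<omega> \<in> space M \<Longrightarrow> continuous_on {0..} (\<lambda>t. X t \<omega>)"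
    and Xm: "\<And>t. t \<ge> 0 \<Longrightarrow> X t \<in> borel_measurable (F t)"
    and ito: "\<And>t. t \<ge> 0 \<Longrightarrow> \<exists>Z. is_ito_integral M (\<lambda>s \<omega>. \<sigma> (X s \<omega>)) W t Z \<and>
        (AE \<omega> in M. X t \<omega> = y + integral {0..t} (\<lambda>s. b (X s \<omega>)) + Z \<omega>)"
    and mb: "bounded_ucont b" and ms: "bounded_ucont \<sigma>"
    and K1: "K \<ge> 1" and Kb: "\<And>x. \<bar>b x\<bar> \<le> K" and Ks: "\<And>x. \<bar>\<sigma> x\<bar> \<le> K"
begin

lemma space_F: "t \<ge> 0 \<Longrightarrow> space (F t) = space M"
  using filt by (auto simp: is_filtration_def)
lemma sets_F: "t \<ge> 0 \<Longrightarrow> sets (F t) \<subseteq> sets M"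
  using filt by (auto simp: is_filtration_def)
lemma sets_F_mono: "0 \<le> s \<Longrightarrow> s \<le> t \<Longrightarrow> sets (F s) \<subseteq> sets (F t)"
  using filt by (auto simp: is_filtration_def)
lemma meas_F_mono: "0 \<le> s \<Longrightarrow> s \<le> t \<Longrightarrow> A \<in> borel_measurable (F s) \<Longrightarrow> A \<in> borel_measurable (F t)"
  using sets_F_mono[of s t] by (auto simp: measurable_def space_F)
lemma meas_F_M: "0 \<le> s \<Longrightarrow> A \<in> borel_measurable (F s) \<Longrightarrow> A \<in> borel_measurable M"
  using sets_F[of s] by (auto simp: measurable_def space_F)
lemma Wm: "t \<ge> 0 \<Longrightarrow> W t \<in> borel_measurable (F t)"
  using bm by (auto simp: brownian_motion_def)
lemma WmM: "t \<ge> 0 \<Longrightarrow> W t \<in> borel_measurable M" using Wm meas_F_M by blast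
lemma XmM: "t \<ge> 0 \<Longrightarrow> X t \<in> borel_measurable M" using Xm meas_F_M by blast

lemma W_incr_indep:
  assumes st: "0 \<le> s" "s < t" and A: "A \<in> borel_measurable (F s)"
  shows "indep_var borel A borel (\<lambda>\<omega>. W t \<omega> - W s \<omega>)"
  unfolding indep_var_eq
proof (intro conjI)
  show "random_variable borel A" using A st meas_F_M by blast
  show "random_variable borel (\<lambda>\<omega>. W t \<omega> - W s \<omega>)" using WmM[of t] WmM[of s] st by simp
  have i: "indep_set (sets (F s)) (sets (vimage_algebra (space M) (\<lambda>\<omega>. W t \<omega> - W s \<omega>) borel))"
    using bm st by (auto simp: brownian_motion_def)
  have "{A -` B \<inter> space M |B. B \<in> sets borel} \<subseteq> sets (F s)"
    using measurable_sets[OF A] space_F[OF st(1)] by auto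
  then have 1: "sigma_sets (space M) {A -` B \<inter> space M |B. B \<in> sets borel} \<subseteq> sets (F s)"
    using sets.sigma_sets_subset[of "{A -` B \<inter> space M |B. B \<in> sets borel}" "F s"] space_F[OF st(1)] by simp
  show "indep_set (sigma_sets (space M) {A -` B \<inter> space M |B. B \<in> sets borel})
     (sigma_sets (space M) {(\<lambda>\<omega>. W t \<omega> - W s \<omega>) -` A \<inter> space M |A. A \<in> sets borel})"
    using i unfolding indep_set_def sets_vimage_algebra
    by (rule indep_sets_mono_sets) (use 1 in \<open>auto split: bool.splits\<close>)
qed

lemma W_incr_dist:
  assumes st: "0 \<le> s" "s < t"
  shows "distributed M lborel (\<lambda>\<omega>. W t \<omega> - W s \<omega>) (\<lambda>x. ennreal (normal_density 0 (sqrt (t - s)) x))"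
  using bm st by (auto simp: brownian_motion_def)

lemma W_incr_moment_integrable:
  assumes st: "0 \<le> s" "s < t"
  shows "integrable M (\<lambda>\<omega>. (W t \<omega> - W s \<omega>) ^ k)"
proof -
  have "integrable lborel (\<lambda>x. normal_density 0 (sqrt (t - s)) x * (x - 0) ^ k)"
    by (rule integrable_normal_moment) (use st in auto)
  then show ?thesis
    using distributed_integrable[OF W_incr_dist[OF st], of "\<lambda>x. x ^ k"] by simp
qed

lemma W_incr_moment:
  assumes st: "0 \<le> s" "s < t"
  shows "expectation (\<lambda>\<omega>. W t \<omega> - W s \<omega>) = 0"
    "expectation (\<lambda>\<omega>. (W t \<omega> - W s \<omega>)\<^sup>2) = t - s"
    "expectation (\<lambda>\<omega>. (W t \<omega> - W s \<omega>) ^ 4) = 3 * (t - s)\<^sup>2"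
proof -
  have e: "expectation (\<lambda>\<omega>. (W t \<omega> - W s \<omega>) ^ k) =
      integral\<^sup>L lborel (\<lambda>x. normal_density 0 (sqrt (t - s)) x * (x - 0) ^ k)" for k
    using distributed_integral[OF W_incr_dist[OF st], of "\<lambda>x. x ^ k"] by simp
  have p: "sqrt (t - s) > 0" using st by simp
  show "expectation (\<lambda>\<omega>. W t \<omega> - W s \<omega>) = 0"
    using e[of 1] integral_normal_moment_odd[OF p, of 0 0] by simp
  show "expectation (\<lambda>\<omega>. (W t \<omega> - W s \<omega>)\<^sup>2) = t - s"
    using e[of 2] integral_normal_moment_even[OF p, of 0 1] st by simp
  have "fact 4 = (24::real)" by (simp add: fact_numeral)
  then show "expectation (\<lambda>\<omega>. (W t \<omega> - W s \<omega>) ^ 4) = 3 * (t - s)\<^sup>2"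
    using e[of 4] integral_normal_moment_even[OF p, of 0 2] st
    by (simp add: power_divide field_simps)
qed

text \<open>This factorisation over \<open>F s\<close>-measurable factors takes the place of
  conditioning on \<open>F s\<close>; no conditional expectation is ever formed.\<close>

lemma W_incr_mult:
  assumes st: "0 \<le> s" "s < t" and A: "A \<in> borel_measurable (F s)" "integrable M A"
  shows "integrable M (\<lambda>\<omega>. A \<omega> * (W t \<omega> - W s \<omega>) ^ k)"
    "expectation (\<lambda>\<omega>. A \<omega> * (W t \<omega> - W s \<omega>) ^ k) = expectation A * expectation (\<lambda>\<omega>. (W t \<omega> - W s \<omega>) ^ k)"
proof -
  have "indep_var borel (id \<circ> A) borel ((\<lambda>x. x ^ k) \<circ> (\<lambda>\<omega>. W t \<omega> - W s \<omega>))"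
    by (rule indep_var_compose[OF W_incr_indep[OF st A(1)]]) auto
  then have i: "indep_var borel A borel (\<lambda>\<omega>. (W t \<omega> - W s \<omega>) ^ k)" by (simp add: comp_def)
  show "integrable M (\<lambda>\<omega>. A \<omega> * (W t \<omega> - W s \<omega>) ^ k)"
    by (rule indep_var_integrable[OF i A(2) W_incr_moment_integrable[OF st]])
  show "expectation (\<lambda>\<omega>. A \<omega> * (W t \<omega> - W s \<omega>) ^ k) = expectation A * expectation (\<lambda>\<omega>. (W t \<omega> - W s \<omega>) ^ k)"
    by (rule indep_var_lebesgue_integral[OF i A(2) W_incr_moment_integrable[OF st]])
qed

end


text \<open>Turns second moments into bounds on first absolute moments with a free parameter
  \<epsilon>, in place of the Cauchy-Schwarz inequality.\<close>

lemma abs_le_add_square: "\<epsilon> > 0 \<Longrightarrow> \<bar>r::real\<bar> \<le> \<epsilon> + r\<^sup>2 / \<epsilon>"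
proof (cases "\<bar>r\<bar> \<le> \<epsilon>")
  case False
  assume e: "\<epsilon> > 0"
  have "\<epsilon> * \<bar>r\<bar> \<le> \<bar>r\<bar> * \<bar>r\<bar>" using False by (intro mult_right_mono) auto
  then have "\<bar>r\<bar> \<le> r\<^sup>2 / \<epsilon>" using e by (simp add: field_simps power2_eq_square)
  then show ?thesis using e by linarith
next
  case True
  assume e: "\<epsilon> > 0"
  have "0 \<le> r\<^sup>2 / \<epsilon>" using e by simp
  then show ?thesis using True by linarith
qed

lemma left_riemann_bound:
  fixes g :: "real \<Rightarrow> real"
  assumes c: "continuous_on {0..} g" and h: "h > 0"
    and e: "\<And>l r. l < n \<Longrightarrow> real l * h \<le> r \<Longrightarrow> r \<le> real (Suc l) * h \<Longrightarrow> \<bar>g r - g (real l * h)\<bar> \<le> \<epsilon>"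
  shows "\<bar>(\<Sum>l<n. g (real l * h) * h) - integral {0..real n * h} g\<bar> \<le> real n * h * \<epsilon>"
  using e
proof (induct n)
  case (Suc n)
  have i: "g integrable_on {p..q}" if "0 \<le> p" for p q
    by (rule integrable_continuous_interval) (rule continuous_on_subset[OF c], use that in auto)
  have le: "0 \<le> real n * h" "real n * h \<le> real (Suc n) * h" using h by auto
  have s: "integral {0..real (Suc n) * h} g = integral {0..real n * h} g + integral {real n * h..real (Suc n) * h} g"
    by (rule Henstock_Kurzweil_Integration.integral_combine[symmetric, OF le i]) simp
  have "\<bar>integral {real n * h..real (Suc n) * h} (\<lambda>r. g r - g (real n * h))\<bar> \<le> \<epsilon> * (real (Suc n) * h - real n * h)"
    unfolding real_norm_def[symmetric]
    by (rule integral_bound) (use le Suc.prems[of n] in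
      \<open>auto intro!: continuous_intros continuous_on_subset[OF c]\<close>)
  moreover have "integral {real n * h..real (Suc n) * h} (\<lambda>r. g r - g (real n * h)) =
      integral {real n * h..real (Suc n) * h} g - g (real n * h) * h"
    using le by (subst integral_diff) (auto intro!: i simp: algebra_simps)
  moreover have "\<bar>(\<Sum>l<n. g (real l * h) * h) - integral {0..real n * h} g\<bar> \<le> real n * h * \<epsilon>"
    using Suc by auto
  ultimately show ?case unfolding s by (simp add: algebra_simps abs_le_iff)
qed simp

subsection \<open>Discretisation of the equation on dyadic grids\<close>

context sde begin

abbreviation dW :: "real \<Rightarrow> nat \<Rightarrow> 'a \<Rightarrow> real" where
  "dW h l \<omega> \<equiv> W (real (Suc l) * h) \<omega> - W (real l * h) \<omega>"

text \<open>The discrete Ito isometry. Measurability, integrability and the formula are proved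
  together because the inductive step needs all three: the cross term factors through the
  independent centred increment only if the sum so far is adapted and integrable.\<close>

lemma martingale_sum:
  assumes h: "h > 0" and an: "a \<le> n"
    and x: "\<And>l. \<xi> l \<in> borel_measurable (F (real l * h))"
    and B: "\<And>l \<omega>. \<omega> \<in> space M \<Longrightarrow> \<bar>\<xi> l \<omega>\<bar> \<le> C"
  defines "R \<equiv> \<lambda>n \<omega>. \<Sum>l\<in>{a..<n}. \<xi> l \<omega> * dW h l \<omega>"
  shows "R n \<in> borel_measurable (F (real n * h)) \<and> integrable M (\<lambda>\<omega>. (R n \<omega>)\<^sup>2) \<and>
    expectation (\<lambda>\<omega>. (R n \<omega>)\<^sup>2) = (\<Sum>l\<in>{a..<n}. h * expectation (\<lambda>\<omega>. (\<xi> l \<omega>)\<^sup>2))"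
  using an
proof (induct n rule: dec_induct)
  case base
  then show ?case by (simp add: R_def)
next
  case (step n)
  let ?s = "real n * h" and ?t = "real (Suc n) * h"
  have st: "0 \<le> ?s" "?s < ?t" "?s \<le> ?t" "0 \<le> ?t" using h by auto
  have R: "R (Suc n) = (\<lambda>\<omega>. R n \<omega> + \<xi> n \<omega> * dW h n \<omega>)"
    using step by (auto simp: R_def fun_eq_iff)
  have Rm: "R n \<in> borel_measurable (F ?s)" and R2: "integrable M (\<lambda>\<omega>. (R n \<omega>)\<^sup>2)" using step by auto
  note RmM = meas_F_M[OF st(1) Rm]
  have Ri: "integrable M (R n)" by (rule square_integrable_imp_integrable[OF RmM R2])
  note xmM = meas_F_M[OF st(1) x[of n]]
  obtain \<omega>\<^sub>0 where "\<omega>\<^sub>0 \<in> space M" using not_empty by blast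
  then have C: "C \<ge> 0" using B[of \<omega>\<^sub>0 0] by linarith
  have xC: "(\<xi> n \<omega>)\<^sup>2 \<le> C\<^sup>2" if "\<omega> \<in> space M" for \<omega>
    using power_mono[OF B[OF that, of n], of 2] by simp
  have xi2: "integrable M (\<lambda>\<omega>. (\<xi> n \<omega>)\<^sup>2)"
    by (rule integrable_const_bound[where B="C\<^sup>2"])
      (use xmM xC in \<open>auto intro!: AE_I2\<close>)
  \<comment> \<open>\<open>R n\<close> is square integrable, hence integrable, and \<xi> is bounded.
    This is the factor that multiplies the centred increment in the cross term.\<close>
  have Rx: "integrable M (\<lambda>\<omega>. R n \<omega> * \<xi> n \<omega>)"
  proof (rule Bochner_Integration.integrable_bound)
    show "integrable M (\<lambda>\<omega>. C * R n \<omega>)" using Ri by simp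
    show "AE \<omega> in M. norm (R n \<omega> * \<xi> n \<omega>) \<le> norm (C * R n \<omega>)"
      using B C by (auto intro!: AE_I2 mult_left_mono simp: abs_mult mult.commute[of C])
  qed (use RmM xmM in auto)
  have m1: "integrable M (\<lambda>\<omega>. (R n \<omega> * \<xi> n \<omega>) * dW h n \<omega>)"
    "expectation (\<lambda>\<omega>. (R n \<omega> * \<xi> n \<omega>) * dW h n \<omega>) = 0"
    using W_incr_mult[OF st(1,2) _ Rx, of 1] W_incr_moment(1)[OF st(1,2)] Rm x[of n] by auto
  have m2: "integrable M (\<lambda>\<omega>. (\<xi> n \<omega>)\<^sup>2 * (dW h n \<omega>)\<^sup>2)"
    "expectation (\<lambda>\<omega>. (\<xi> n \<omega>)\<^sup>2 * (dW h n \<omega>)\<^sup>2) = h * expectation (\<lambda>\<omega>. (\<xi> n \<omega>)\<^sup>2)"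
    using W_incr_mult[OF st(1,2) _ xi2, of 2] W_incr_moment(2)[OF st(1,2)] x[of n]
    by (auto simp: algebra_simps)
  have sq: "(R (Suc n) \<omega>)\<^sup>2 = (R n \<omega>)\<^sup>2 + 2 * ((R n \<omega> * \<xi> n \<omega>) * dW h n \<omega>) + (\<xi> n \<omega>)\<^sup>2 * (dW h n \<omega>)\<^sup>2" for \<omega>
    unfolding R by (simp add: power2_eq_square algebra_simps)
  have "R (Suc n) \<in> borel_measurable (F ?t)"
    unfolding R using meas_F_mono[OF st(1,3) Rm] meas_F_mono[OF st(1,3) x] Wm[OF st(4)] meas_F_mono[OF st(1,3) Wm[OF st(1)]]
    by (intro borel_measurable_add borel_measurable_times borel_measurable_diff)
  moreover have "integrable M (\<lambda>\<omega>. (R (Suc n) \<omega>)\<^sup>2)"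
    unfolding sq using R2 m1 m2 by auto
  moreover have "expectation (\<lambda>\<omega>. (R (Suc n) \<omega>)\<^sup>2) = expectation (\<lambda>\<omega>. (R n \<omega>)\<^sup>2) + h * expectation (\<lambda>\<omega>. (\<xi> n \<omega>)\<^sup>2)"
    unfolding sq using R2 m1 m2 by simp
  ultimately show ?case using step by simp
qed

text \<open>Unlike in the Euler scheme, the coefficients are evaluated along the solution itself.\<close>
definition euler :: "real \<Rightarrow> nat \<Rightarrow> 'a \<Rightarrow> real" where
  "euler h n \<omega> = y + (\<Sum>l<n. b (X (real l * h) \<omega>) * h + \<sigma> (X (real l * h) \<omega>) * dW h l \<omega>)"

lemma bX_meas: "t \<ge> 0 \<Longrightarrow> (\<lambda>\<omega>. b (X t \<omega>)) \<in> borel_measurable (F t)"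
  using measurable_compose[OF Xm borel_measurable_continuous_onI[OF bounded_ucont_continuous[OF mb]]] by simp
lemma sX_meas: "t \<ge> 0 \<Longrightarrow> (\<lambda>\<omega>. \<sigma> (X t \<omega>)) \<in> borel_measurable (F t)"
  using measurable_compose[OF Xm borel_measurable_continuous_onI[OF bounded_ucont_continuous[OF ms]]] by simp

lemma euler_meas: assumes h: "h > 0" shows "euler h n \<in> borel_measurable (F (real n * h))"
proof -
  have "(\<lambda>\<omega>. b (X (real l * h) \<omega>) * h + \<sigma> (X (real l * h) \<omega>) * dW h l \<omega>) \<in> borel_measurable (F (real n * h))"
    if "l < n" for l
  proof -
    have le: "0 \<le> real l * h" "real l * h \<le> real n * h" "0 \<le> real (Suc l) * h" "real (Suc l) * h \<le> real n * h"
      using h that by (auto intro!: mult_right_mono)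
    show ?thesis
      using meas_F_mono[OF le(1,2) bX_meas[OF le(1)]] meas_F_mono[OF le(1,2) sX_meas[OF le(1)]]
        meas_F_mono[OF le(1,2) Wm[OF le(1)]] meas_F_mono[OF le(3,4) Wm[OF le(3)]]
      by (intro borel_measurable_add borel_measurable_times borel_measurable_diff) auto
  qed
  then have "(\<lambda>\<omega>. \<Sum>l<n. b (X (real l * h) \<omega>) * h + \<sigma> (X (real l * h) \<omega>) * dW h l \<omega>) \<in> borel_measurable (F (real n * h))"
    by (intro borel_measurable_sum) simp
  then show ?thesis unfolding euler_def[abs_def] by (intro borel_measurable_add borel_measurable_const)
qed

text \<open>A distance that metrises convergence in probability. The truncation at 1 makes the
  integrand bounded, so measurability alone gives integrability.\<close>

definition dprob :: "('a \<Rightarrow> real) \<Rightarrow> ('a \<Rightarrow> real) \<Rightarrow> real" where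
  "dprob U V = expectation (\<lambda>\<omega>. min 1 \<bar>U \<omega> - V \<omega>\<bar>)"

lemma dprob_integrable:
  fixes U V :: "'a \<Rightarrow> real"
  assumes [measurable]: "U \<in> borel_measurable M" "V \<in> borel_measurable M"
  shows "integrable M (\<lambda>\<omega>. min 1 \<bar>U \<omega> - V \<omega>\<bar>)"
  by (rule integrable_const_bound[where B=1]) auto

lemma dprob_nonneg: "0 \<le> dprob U V"
  unfolding dprob_def by (rule Bochner_Integration.integral_nonneg) auto

lemma dprob_triangle:
  fixes U V Z :: "'a \<Rightarrow> real"
  assumes [measurable]: "U \<in> borel_measurable M" "V \<in> borel_measurable M" "Z \<in> borel_measurable M"
  shows "dprob U Z \<le> dprob U V + dprob V Z"
  unfolding dprob_def
  by (subst Bochner_Integration.integral_add[symmetric])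
    (auto intro!: Bochner_Integration.integral_mono Bochner_Integration.integrable_add dprob_integrable)

lemma dprob_commute: "dprob U V = dprob V U"
  by (simp add: dprob_def abs_minus_commute)

text \<open>The drift contributes at most \<open>K\<close> times the elapsed time, and by the
  isometry the martingale part has second moment at most \<open>K\<^sup>2\<close> times the elapsed
  time. The bound depends on the mesh only through the elapsed time.\<close>

lemma euler_incr:
  assumes h: "h > 0" and an: "a \<le> n"
  shows "dprob (euler h n) (euler h a) \<le> 2 * (K * (real (n - a) * h) + K * sqrt (real (n - a) * h))"
proof (cases "a = n")
  case True then show ?thesis by (simp add: dprob_def)
next
  case False
  let ?T = "real (n - a) * h" and ?x = "\<lambda>l \<omega>. \<sigma> (X (real l * h) \<omega>)"
  have T: "?T > 0" using h an False by simp
  define R where "R \<omega> = (\<Sum>l\<in>{a..<n}. ?x l \<omega> * dW h l \<omega>)" for \<omega>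
  have xm: "?x l \<in> borel_measurable (F (real l * h))" for l using h by (intro sX_meas) auto
  note ms = martingale_sum[OF h an xm Ks, folded R_def]
  have Rm: "R \<in> borel_measurable M" and R2: "integrable M (\<lambda>\<omega>. (R \<omega>)\<^sup>2)" 
    using ms meas_F_M[of "real n * h"] h by auto
  have x2: "expectation (\<lambda>\<omega>. (?x l \<omega>)\<^sup>2) \<le> K\<^sup>2" for l
  proof -
    have *: "(?x l \<omega>)\<^sup>2 \<le> K\<^sup>2" for \<omega> using power_mono[OF Ks, of _ 2] by simp
    have "expectation (\<lambda>\<omega>. (?x l \<omega>)\<^sup>2) \<le> expectation (\<lambda>\<omega>. K\<^sup>2)"
      by (rule Bochner_Integration.integral_mono)
        (use meas_F_M[OF _ xm[of l]] h * in \<open>auto intro!: integrable_const_bound[where B="K\<^sup>2"]\<close>)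
    then show ?thesis by (simp add: prob_space)
  qed
  have ER: "expectation (\<lambda>\<omega>. (R \<omega>)\<^sup>2) \<le> K\<^sup>2 * ?T"
  proof -
    have "expectation (\<lambda>\<omega>. (R \<omega>)\<^sup>2) \<le> (\<Sum>l\<in>{a..<n}. h * K\<^sup>2)"
      unfolding ms[THEN conjunct2, THEN conjunct2] using h by (intro sum_mono mult_left_mono x2) auto
    then show ?thesis by (simp add: algebra_simps)
  qed
  \<comment> \<open>The parameter of \<open>abs_le_add_square\<close> that balances its two terms:
    the second moment of \<open>R\<close> is at most \<open>?q * ?q\<close>, so both contribute at
    most \<open>?q\<close>.\<close>
  let ?q = "K * sqrt ?T"
  have q: "?q > 0" by (rule mult_pos_pos) (use K1 T in \<open>auto simp del: of_nat_diff\<close>)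
  have pt: "min 1 \<bar>euler h n \<omega> - euler h a \<omega>\<bar> \<le> K * ?T + ?q + (R \<omega>)\<^sup>2 / ?q" for \<omega>
  proof -
    have "euler h n \<omega> - euler h a \<omega> = (\<Sum>l\<in>{a..<n}. b (X (real l * h) \<omega>) * h + \<sigma> (X (real l * h) \<omega>) * dW h l \<omega>)"
      using sum.atLeastLessThan_concat[of 0 a n "\<lambda>l. b (X (real l * h) \<omega>) * h + \<sigma> (X (real l * h) \<omega>) * dW h l \<omega>"] an
      unfolding euler_def lessThan_atLeast0 by linarith
    also have "\<dots> = (\<Sum>l\<in>{a..<n}. b (X (real l * h) \<omega>) * h) + R \<omega>" by (simp add: R_def sum.distrib)
    finally have "\<bar>euler h n \<omega> - euler h a \<omega>\<bar> \<le> \<bar>\<Sum>l\<in>{a..<n}. b (X (real l * h) \<omega>) * h\<bar> + \<bar>R \<omega>\<bar>" by linarith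
    also have "\<bar>\<Sum>l\<in>{a..<n}. b (X (real l * h) \<omega>) * h\<bar> \<le> (\<Sum>l\<in>{a..<n}. K * h)"
      by (rule order_trans[OF sum_abs sum_mono]) (use h Kb in \<open>auto intro!: mult_right_mono simp: abs_mult\<close>)
    also have "(\<Sum>l\<in>{a..<n}. K * h) = K * ?T" by simp
    finally show ?thesis using abs_le_add_square[OF q, of "R \<omega>"] by linarith
  qed
  have em: "euler h n \<in> borel_measurable M" for n
    by (rule meas_F_M[OF _ euler_meas[OF h]]) (use h in simp)
  have "dprob (euler h n) (euler h a) \<le> expectation (\<lambda>\<omega>. K * ?T + ?q + (R \<omega>)\<^sup>2 / ?q)"
    unfolding dprob_def
    by (rule Bochner_Integration.integral_mono[OF dprob_integrable[OF em em] _ pt]) (use R2 in simp)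
  also have "\<dots> = K * ?T + ?q + expectation (\<lambda>\<omega>. (R \<omega>)\<^sup>2) / ?q" using R2 by (simp add: prob_space)
  also have "expectation (\<lambda>\<omega>. (R \<omega>)\<^sup>2) / ?q \<le> ?q"
  proof -
    have sq: "(K * sqrt c) * (K * sqrt c) = K\<^sup>2 * c" if "c \<ge> 0" for c
      using that by (metis power2_eq_square power_mult_distrib real_sqrt_pow2)
    have "?q * ?q = K\<^sup>2 * ?T" by (rule sq[OF less_imp_le[OF T]])
    then have "expectation (\<lambda>\<omega>. (R \<omega>)\<^sup>2) \<le> ?q * ?q" using ER by simp
    then show ?thesis using q by (simp add: divide_le_eq)
  qed
  finally have le: "dprob (euler h n) (euler h a) \<le> K * ?T + ?q + ?q" by simp
  have "0 \<le> K * ?T" by (rule mult_nonneg_nonneg[OF _ less_imp_le[OF T]]) (use K1 in simp)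
  moreover have "0 \<le> p \<Longrightarrow> c \<le> p + q + q \<Longrightarrow> c \<le> 2 * (p + q)" for p q c :: real by simp
  ultimately show ?thesis using le by blast
qed

end

lemma eventually_dyadic_oscillation:
  fixes g :: "real \<Rightarrow> real"
  assumes c: "continuous_on {0..} g" and T: "T \<ge> 0" and e: "e > 0"
  shows "eventually (\<lambda>m. \<forall>r\<in>{0..T}. \<forall>s\<in>{0..T}. \<bar>r - s\<bar> \<le> T / 2^m \<longrightarrow> \<bar>g r - g s\<bar> \<le> e) sequentially"
proof -
  have "uniformly_continuous_on {0..T} g"
    by (rule compact_uniformly_continuous) (auto intro: continuous_on_subset[OF c])
  then obtain d where d: "d > 0" "\<And>r s. r \<in> {0..T} \<Longrightarrow> s \<in> {0..T} \<Longrightarrow> \<bar>r - s\<bar> < d \<Longrightarrow> \<bar>g r - g s\<bar> < e"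
    using e unfolding uniformly_continuous_on_def dist_real_def by metis
  have "(\<lambda>m. T / 2^m) \<longlonglongrightarrow> 0"
    using LIMSEQ_divide_realpow_zero[of 2 T] by simp
  then have "eventually (\<lambda>m. T / 2^m < d) sequentially" using d(1) by (rule order_tendstoD)
  then show ?thesis by eventually_elim (use d(2) in force)
qed

context sde begin

text \<open>The sums defining the integral over \<open>[0, j d]\<close> divide that interval into
  \<open>2 ^ m\<close> pieces, a mesh that depends on \<open>j\<close>. Splitting each piece into
  \<open>j\<close> parts puts all times \<open>j d\<close> on the common grid of mesh
  \<open>d / 2 ^ m\<close>; the integrand stays frozen at the coarse left end points
  \<open>l div j * j\<close>.\<close>

lemma ito_sum_refine:
  assumes j: "j \<ge> 1"
  shows "ito_sum H W (real j * d) m \<omega> =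
    (\<Sum>l<j * 2^m. H (real (l div j * j) * (d / 2^m)) \<omega> * dW (d / 2^m) l \<omega>)"
proof -
  let ?h = "d / 2^m"
  let ?g = "\<lambda>l. H (real (l div j * j) * ?h) \<omega> * dW ?h l \<omega>"
  have "sum ?g {k * j..<k * j + j} = H (real k * (real j * d) / 2^m) \<omega> *
      (W (real (Suc k) * (real j * d) / 2^m) \<omega> - W (real k * (real j * d) / 2^m) \<omega>)" for k
  proof -
    have "sum ?g {k * j..<k * j + j} = (\<Sum>l\<in>{k * j..<k * j + j}. H (real (k * j) * ?h) \<omega> * dW ?h l \<omega>)"
    proof (rule sum.cong[OF refl])
      fix l assume "l \<in> {k * j..<k * j + j}"
      then have "l div j = k" by (intro div_nat_eqI) (auto simp: algebra_simps)
      then show "?g l = H (real (k * j) * ?h) \<omega> * dW ?h l \<omega>" by simp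
    qed
    also have "\<dots> = H (real (k * j) * ?h) \<omega> * (\<Sum>l\<in>{k * j..<k * j + j}. dW ?h l \<omega>)"
      by (simp only: sum_distrib_left)
    also have "(\<Sum>l\<in>{k * j..<k * j + j}. dW ?h l \<omega>) = W (real (k * j + j) * ?h) \<omega> - W (real (k * j) * ?h) \<omega>"
      by (rule sum_Suc_diff'[where f="\<lambda>l. W (real l * ?h) \<omega>"]) simp
    also have "real (k * j + j) * ?h = real (Suc k) * (real j * d) / 2^m" by (simp add: field_simps)
    also have "real (k * j) * ?h = real k * (real j * d) / 2^m" by (simp add: field_simps)
    finally show ?thesis .
  qed
  then have "ito_sum H W (real j * d) m \<omega> = (\<Sum>k<2^m. sum ?g {k * j..<k * j + j})"
    by (simp add: ito_sum_def)
  also have "\<dots> = sum ?g {..<2^m * j}" by (rule sum.nat_group)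
  finally show ?thesis by (simp add: mult.commute)
qed

lemma XcI: "\<omega> \<in> space M \<Longrightarrow> bounded_ucont f \<Longrightarrow> continuous_on {0..} (\<lambda>t. f (X t \<omega>))"
  using continuous_on_compose2[OF bounded_ucont_continuous[of f UNIV] Xc] by auto

lemma drift_riemann:
  assumes w: "\<omega> \<in> space M" and d: "d > 0" and j: "j \<ge> 1"
  shows "(\<lambda>m. \<Sum>l<j * 2^m. b (X (real l * (d / 2^m)) \<omega>) * (d / 2^m)) \<longlonglongrightarrow>
    integral {0..real j * d} (\<lambda>s. b (X s \<omega>))"
proof (rule LIMSEQ_I)
  fix e :: real assume e: "e > 0"
  let ?T = "real j * d"
  have T: "?T > 0" using d j by simp
  define e' where "e' = e / (2 * ?T)"
  have e': "e' > 0" using e T by (simp add: e'_def)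
  obtain N where N: "\<And>m r s. m \<ge> N \<Longrightarrow> r \<in> {0..?T} \<Longrightarrow> s \<in> {0..?T} \<Longrightarrow> \<bar>r - s\<bar> \<le> ?T / 2^m \<Longrightarrow>
      \<bar>b (X r \<omega>) - b (X s \<omega>)\<bar> \<le> e'"
    using eventually_dyadic_oscillation[OF XcI[OF w mb] less_imp_le[OF T] e']
    unfolding eventually_sequentially by blast
  have "norm ((\<Sum>l<j * 2^m. b (X (real l * (d / 2^m)) \<omega>) * (d / 2^m)) - integral {0..?T} (\<lambda>s. b (X s \<omega>))) < e"
    if m: "m \<ge> N" for m
  proof -
    let ?h = "d / 2^m"
    have h: "?h > 0" using d by simp
    have nh: "real (j * 2^m) * ?h = ?T" by simp
    have "\<bar>(\<Sum>l<j * 2^m. b (X (real l * ?h) \<omega>) * ?h) - integral {0..real (j * 2^m) * ?h} (\<lambda>s. b (X s \<omega>))\<bar>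
        \<le> real (j * 2^m) * ?h * e'"
    proof (rule left_riemann_bound[OF XcI[OF w mb] h])
      fix l r assume l: "l < j * 2^m" and r: "real l * ?h \<le> r" "r \<le> real (Suc l) * ?h"
      have "real (Suc l) * ?h \<le> real (j * 2^m) * ?h" using l h by (intro mult_right_mono) (simp_all only: of_nat_le_iff Suc_le_eq less_imp_le)
      then have u: "real (Suc l) * ?h \<le> ?T" using nh by simp
      have 0: "0 \<le> real l * ?h" by (rule mult_nonneg_nonneg) (use d in auto)
      have 1: "real (Suc l) * ?h = real l * ?h + ?h" by (simp add: field_simps)
      have 2: "?h \<le> ?T / 2^m" using d j by (intro divide_right_mono) auto
      show "\<bar>b (X r \<omega>) - b (X (real l * ?h) \<omega>)\<bar> \<le> e'"
      proof (rule N[OF m])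
        show "r \<in> {0..?T}" unfolding atLeastAtMost_iff using 0 r u by linarith
        show "real l * ?h \<in> {0..?T}" unfolding atLeastAtMost_iff using 0 r u by linarith
        have "p \<le> r \<Longrightarrow> r \<le> p + c \<Longrightarrow> c \<le> q \<Longrightarrow> \<bar>r - p\<bar> \<le> q" for p q r c :: real by linarith
        then show "\<bar>r - real l * ?h\<bar> \<le> ?T / 2^m" using r 2 unfolding 1 by blast
      qed
    qed
    also have "\<dots> < e" unfolding nh using T e by (simp add: e'_def)
    finally show ?thesis unfolding nh by simp
  qed
  then show "\<exists>N. \<forall>m\<ge>N. norm ((\<Sum>l<j * 2^m. b (X (real l * (d / 2^m)) \<omega>) * (d / 2^m)) - integral {0..?T} (\<lambda>s. b (X s \<omega>))) < e"
    by blast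
qed

text \<open>Moving the integrand from the coarse to the fine left end points costs, by the isometry,
  the mean of a Riemann sum of squared oscillations of \<open>\<sigma> (X t)\<close>. That sum tends
  to 0 on every path by uniform continuity and is bounded, so dominated convergence applies.\<close>

lemma diffusion_refine:
  assumes d: "d > 0" and j: "j \<ge> 1"
  defines "R \<equiv> \<lambda>m \<omega>. \<Sum>l\<in>{0..<j * 2^m}. (\<sigma> (X (real l * (d / 2^m)) \<omega>) - \<sigma> (X (real (l div j * j) * (d / 2^m)) \<omega>)) * dW (d / 2^m) l \<omega>"
  shows "R m \<in> borel_measurable M" "integrable M (\<lambda>\<omega>. (R m \<omega>)\<^sup>2)"
    "(\<lambda>m. expectation (\<lambda>\<omega>. (R m \<omega>)\<^sup>2)) \<longlonglongrightarrow> 0"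
proof -
  let ?T = "real j * d"
  have T: "?T > 0" using d j by simp
  define \<xi> where "\<xi> m l \<omega> = \<sigma> (X (real l * (d / 2^m)) \<omega>) - \<sigma> (X (real (l div j * j) * (d / 2^m)) \<omega>)" for m l \<omega>
  have h: "d / 2^m > 0" for m :: nat using d by simp
  have divle: "l div j * j \<le> l" for l by simp
  have le: "0 \<le> real (l div j * j) * (d / 2^m)" "real (l div j * j) * (d / 2^m) \<le> real l * (d / 2^m)" "0 \<le> real l * (d / 2^m)" for l m :: nat
    using d divle[of l] by (auto intro!: mult_right_mono mult_nonneg_nonneg divide_right_mono simp del: of_nat_mult times_divide_eq_right)
  have xm: "\<xi> m l \<in> borel_measurable (F (real l * (d / 2^m)))" for m l
    unfolding \<xi>_def[abs_def]
    by (intro borel_measurable_diff sX_meas meas_F_mono[OF le(1,2) sX_meas] le)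
  have xB: "\<bar>\<xi> m l \<omega>\<bar> \<le> 2 * K" for m l \<omega>
    using Ks[of "X (real l * (d / 2^m)) \<omega>"] Ks[of "X (real (l div j * j) * (d / 2^m)) \<omega>"] unfolding \<xi>_def by linarith
  have R: "R m = (\<lambda>\<omega>. \<Sum>l\<in>{0..<j * 2^m}. \<xi> m l \<omega> * dW (d / 2^m) l \<omega>)" for m
    by (simp add: R_def \<xi>_def fun_eq_iff)
  have msq: "R m \<in> borel_measurable (F (real (j * 2^m) * (d / 2^m))) \<and> integrable M (\<lambda>\<omega>. (R m \<omega>)\<^sup>2) \<and>
    expectation (\<lambda>\<omega>. (R m \<omega>)\<^sup>2) = (\<Sum>l\<in>{0..<j * 2^m}. (d / 2^m) * expectation (\<lambda>\<omega>. (\<xi> m l \<omega>)\<^sup>2))" for m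
    unfolding R by (rule martingale_sum[OF h le0 xm xB])
  have nn: "0 \<le> real n * (d / 2^m)" for n m :: nat by (rule mult_nonneg_nonneg) (use d in auto)
  show "R m \<in> borel_measurable M" by (rule meas_F_M[OF nn msq[THEN conjunct1]])
  show "integrable M (\<lambda>\<omega>. (R m \<omega>)\<^sup>2)" by (rule msq[THEN conjunct2, THEN conjunct1])
  define q where "q m \<omega> = (\<Sum>l\<in>{0..<j * 2^m}. (d / 2^m) * (\<xi> m l \<omega>)\<^sup>2)" for m \<omega>
  have xmM: "\<xi> m l \<in> borel_measurable M" for m l by (rule meas_F_M[OF nn xm])
  have x2B: "(\<xi> m l \<omega>)\<^sup>2 \<le> (2 * K)\<^sup>2" for m l \<omega> using power_mono[OF xB, of _ _ _ 2] by simp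
  have x2i: "integrable M (\<lambda>\<omega>. (\<xi> m l \<omega>)\<^sup>2)" for m l
    by (rule integrable_const_bound[where B="(2 * K)\<^sup>2"]) (use x2B xmM in auto)
  have Eq: "expectation (\<lambda>\<omega>. (R m \<omega>)\<^sup>2) = expectation (q m)" for m
    unfolding q_def msq[THEN conjunct2, THEN conjunct2]
    by (subst Bochner_Integration.integral_sum, intro integrable_mult_right impI x2i)
      (simp only: Bochner_Integration.integral_mult_right_zero)
  have sumh: "(\<Sum>l\<in>{0..<j * 2^m}. (d / 2^m) * c) = ?T * c" for c :: real and m :: nat by simp
  have "(\<lambda>m. expectation (q m)) \<longlonglongrightarrow> expectation (\<lambda>\<omega>. 0)"
  proof (rule integral_dominated_convergence[where w="\<lambda>_. ?T * (2 * K)\<^sup>2"])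
    show "q m \<in> borel_measurable M" for m unfolding q_def[abs_def] using xmM by measurable
    have "\<bar>q m \<omega>\<bar> \<le> ?T * (2 * K)\<^sup>2" for m \<omega>
    proof -
      have "0 \<le> q m \<omega>" unfolding q_def using d by (intro sum_nonneg) auto
      moreover have "q m \<omega> \<le> (\<Sum>l\<in>{0..<j * 2^m}. (d / 2^m) * (2 * K)\<^sup>2)"
        unfolding q_def by (intro sum_mono mult_left_mono x2B less_imp_le[OF h])
      ultimately show ?thesis using sumh by simp
    qed
    then show "AE \<omega> in M. norm (q m \<omega>) \<le> ?T * (2 * K)\<^sup>2" for m by simp
    show "AE \<omega> in M. (\<lambda>m. q m \<omega>) \<longlonglongrightarrow> 0"
    proof (rule AE_I2, rule LIMSEQ_I)
      fix \<omega> and e :: real assume w: "\<omega> \<in> space M" and e: "e > 0"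
      define e' where "e' = sqrt (e / (2 * ?T))"
      have e': "e' > 0" using e T unfolding e'_def by (intro real_sqrt_gt_zero divide_pos_pos) auto
      obtain N where N: "\<And>m r s. m \<ge> N \<Longrightarrow> r \<in> {0..?T} \<Longrightarrow> s \<in> {0..?T} \<Longrightarrow> \<bar>r - s\<bar> \<le> ?T / 2^m \<Longrightarrow>
          \<bar>\<sigma> (X r \<omega>) - \<sigma> (X s \<omega>)\<bar> \<le> e'"
        using eventually_dyadic_oscillation[OF XcI[OF w ms] less_imp_le[OF T] e']
        unfolding eventually_sequentially by blast
      have "norm (q m \<omega> - 0) < e" if m: "m \<ge> N" for m
      proof -
        have x2: "(\<xi> m l \<omega>)\<^sup>2 \<le> e'\<^sup>2" if l: "l < j * 2^m" for l
        proof -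
          have "real l * (d / 2^m) \<le> real (j * 2^m) * (d / 2^m)" using l h[of m] by (intro mult_right_mono) (simp_all only: of_nat_le_iff less_imp_le)
          then have u: "real l * (d / 2^m) \<le> ?T" by simp
          have "real l \<le> real (l div j * j) + real j"
          proof -
            have "l \<le> l div j * j + j"
              using div_mult_mod_eq[of l j] mod_less_divisor[of j l] j by linarith
            then show ?thesis by (simp only: of_nat_add[symmetric] of_nat_le_iff)
          qed
          then have "real l * (d / 2^m) \<le> (real (l div j * j) + real j) * (d / 2^m)" using h[of m] by (intro mult_right_mono) auto
          then have "real l * (d / 2^m) - real (l div j * j) * (d / 2^m) \<le> ?T / 2^m" by (simp add: algebra_simps)
          then have 3: "\<bar>real l * (d / 2^m) - real (l div j * j) * (d / 2^m)\<bar> \<le> ?T / 2^m"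
            using le(2)[of l m] by (simp only: abs_of_nonneg diff_ge_0_iff_ge)
          have "\<bar>\<xi> m l \<omega>\<bar> \<le> e'" unfolding \<xi>_def
          proof (rule N[OF m _ _ 3])
            show "real l * (d / 2^m) \<in> {0..?T}" unfolding atLeastAtMost_iff using u le(3)[of l m] by linarith
            show "real (l div j * j) * (d / 2^m) \<in> {0..?T}" unfolding atLeastAtMost_iff using u le(1,2)[of l m] by linarith
          qed
          from power_mono[OF this, of 2] show ?thesis by simp
        qed
        have "0 \<le> q m \<omega>" unfolding q_def using d by (intro sum_nonneg) auto
        moreover have "q m \<omega> \<le> (\<Sum>l\<in>{0..<j * 2^m}. (d / 2^m) * e'\<^sup>2)"
          unfolding q_def using x2 by (intro sum_mono mult_left_mono less_imp_le[OF h]) auto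
        moreover have "?T * e'\<^sup>2 = e / 2" using e T d j by (simp add: e'_def)
        ultimately show ?thesis using sumh[of m "e'\<^sup>2"] e by simp
      qed
      then show "\<exists>N. \<forall>m\<ge>N. norm (q m \<omega> - 0) < e" by blast
    qed
  qed auto
  then show "(\<lambda>m. expectation (\<lambda>\<omega>. (R m \<omega>)\<^sup>2)) \<longlonglongrightarrow> 0" unfolding Eq by simp
qed

text \<open>The error splits into a drift Riemann sum, which converges on every path, the refinement
  error, which converges in mean square, and the Ito sum, which converges only in probability. The
  distance \<open>dprob\<close> accommodates all three.\<close>

lemma euler_conv:
  assumes d: "d > 0"
  shows "(\<lambda>m. dprob (euler (d / 2^m) (j * 2^m)) (X (real j * d))) \<longlonglongrightarrow> 0"
\<comment> \<open>The grouping by \<open>l div j\<close> breaks down at time 0, where both sides are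
  equal to \<open>y\<close>.\<close>
proof (cases "j = 0")
  case True
  have "dprob (euler h 0) (X 0) = 0" for h
    unfolding dprob_def by (subst Bochner_Integration.integral_cong[where g="\<lambda>_. 0", OF refl]) (auto simp: euler_def X0)
  then show ?thesis using True by simp
next
  case False
  then have j: "j \<ge> 1" by simp
  let ?T = "real j * d" and ?h = "\<lambda>m::nat. d / 2^m"
  have T: "?T > 0" using d j by simp
  have h: "?h m > 0" for m using d by simp
  obtain Z where Zi: "is_ito_integral M (\<lambda>s \<omega>. \<sigma> (X s \<omega>)) W ?T Z"
    and Xe: "AE \<omega> in M. X ?T \<omega> = y + integral {0..?T} (\<lambda>s. b (X s \<omega>)) + Z \<omega>"
    using ito[of ?T] T by auto
  have Zm[measurable]: "Z \<in> borel_measurable M" using Zi by (simp add: is_ito_integral_def)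
  let ?S = "\<lambda>m. ito_sum (\<lambda>s \<omega>. \<sigma> (X s \<omega>)) W ?T m"
  have Scp: "(\<lambda>m. measure M {\<omega>\<in>space M. \<bar>?S m \<omega> - Z \<omega>\<bar> > \<epsilon>}) \<longlonglongrightarrow> 0" if "\<epsilon> > 0" for \<epsilon>
    using Zi that by (simp add: is_ito_integral_def conv_in_prob_def)
  have nn: "0 \<le> real n * ?h m" for n m :: nat by (rule mult_nonneg_nonneg) (use d in auto)
  have nn2: "0 \<le> real n * ?T / 2^m" for n m :: nat using T by simp
  have bm: "(\<lambda>\<omega>. b (X t \<omega>)) \<in> borel_measurable M" if "t \<ge> 0" for t by (rule meas_F_M[OF that bX_meas[OF that]])
  have sm: "(\<lambda>\<omega>. \<sigma> (X t \<omega>)) \<in> borel_measurable M" if "t \<ge> 0" for t by (rule meas_F_M[OF that sX_meas[OF that]])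
  have Sm[measurable]: "?S m \<in> borel_measurable M" for m
    unfolding ito_sum_def[abs_def]
    by (intro borel_measurable_sum borel_measurable_times borel_measurable_diff sm WmM nn2)
  define B where "B m \<omega> = (\<Sum>l<j * 2^m. b (X (real l * ?h m) \<omega>) * ?h m)" for m \<omega>
  define I where "I \<omega> = integral {0..?T} (\<lambda>s. b (X s \<omega>))" for \<omega>
  have Bm[measurable]: "B m \<in> borel_measurable M" for m
    unfolding B_def[abs_def] by (intro borel_measurable_sum borel_measurable_times bm nn borel_measurable_const)
  have BI: "(\<lambda>m. B m \<omega>) \<longlonglongrightarrow> I \<omega>" if "\<omega> \<in> space M" for \<omega>
    using drift_riemann[OF that d j] unfolding B_def I_def .
  \<comment> \<open>Measurability of the pathwise drift integral is obtained from its Riemann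
    sums.\<close>
  have Im[measurable]: "I \<in> borel_measurable M"
    by (rule borel_measurable_LIMSEQ_real[of _ B]) (use BI in auto)
  define R where "R m \<omega> = (\<Sum>l\<in>{0..<j * 2^m}. (\<sigma> (X (real l * ?h m) \<omega>) - \<sigma> (X (real (l div j * j) * ?h m) \<omega>)) * dW (?h m) l \<omega>)" for m \<omega>
  have Rm[measurable]: "R m \<in> borel_measurable M" and R2: "integrable M (\<lambda>\<omega>. (R m \<omega>)\<^sup>2)"
    and R0: "(\<lambda>m. expectation (\<lambda>\<omega>. (R m \<omega>)\<^sup>2)) \<longlonglongrightarrow> 0" for m
    using diffusion_refine[OF d j] unfolding R_def[abs_def] by blast+
  have eul: "euler (?h m) (j * 2^m) \<omega> = y + B m \<omega> + R m \<omega> + ?S m \<omega>" for m \<omega>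
    unfolding euler_def B_def R_def ito_sum_refine[OF j] lessThan_atLeast0
    by (simp add: sum.distrib left_diff_distrib sum_subtractf)
  have em[measurable]: "euler (?h m) n \<in> borel_measurable M" for m n by (rule meas_F_M[OF nn euler_meas[OF h]])
  have Xm'[measurable]: "X ?T \<in> borel_measurable M" using XmM T by simp
  have BIe: "(\<lambda>m. dprob (B m) I) \<longlonglongrightarrow> 0"
  proof -
    have "(\<lambda>m. dprob (B m) I) \<longlonglongrightarrow> expectation (\<lambda>\<omega>. 0)"
      unfolding dprob_def
    proof (rule integral_dominated_convergence[where w="\<lambda>_. 1"])
      show "AE \<omega> in M. (\<lambda>m. min 1 \<bar>B m \<omega> - I \<omega>\<bar>) \<longlonglongrightarrow> 0"
      proof (rule AE_I2)
        fix \<omega> assume "\<omega> \<in> space M"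
        then have "(\<lambda>m. min 1 \<bar>B m \<omega> - I \<omega>\<bar>) \<longlonglongrightarrow> min 1 \<bar>I \<omega> - I \<omega>\<bar>"
          by (intro tendsto_intros BI)
        then show "(\<lambda>m. min 1 \<bar>B m \<omega> - I \<omega>\<bar>) \<longlonglongrightarrow> 0" by simp
      qed
    qed auto
    then show ?thesis by simp
  qed
  have bound: "dprob (euler (?h m) (j * 2^m)) (X ?T) \<le> dprob (B m) I + (\<epsilon> + expectation (\<lambda>\<omega>. (R m \<omega>)\<^sup>2) / \<epsilon>)
      + (\<epsilon> + measure M {\<omega>\<in>space M. \<bar>?S m \<omega> - Z \<omega>\<bar> > \<epsilon>})" if e: "\<epsilon> > 0" for m \<epsilon>
  proof -
    let ?A = "{\<omega>\<in>space M. \<bar>?S m \<omega> - Z \<omega>\<bar> > \<epsilon>}"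
    define A where "A = ?A"
    have Am[measurable]: "A \<in> sets M" unfolding A_def by measurable
    have Ai: "integrable M (indicat_real A)" by (simp add: integrable_indicator_iff emeasure_eq_measure)
    have "dprob (euler (?h m) (j * 2^m)) (X ?T) \<le>
        expectation (\<lambda>\<omega>. min 1 \<bar>B m \<omega> - I \<omega>\<bar> + (\<epsilon> + (R m \<omega>)\<^sup>2 / \<epsilon>) + (\<epsilon> + indicator A \<omega>))"
      unfolding dprob_def
    proof (rule integral_mono_AE)
      show "AE \<omega> in M. min 1 \<bar>euler (?h m) (j * 2^m) \<omega> - X ?T \<omega>\<bar> \<le>
        min 1 \<bar>B m \<omega> - I \<omega>\<bar> + (\<epsilon> + (R m \<omega>)\<^sup>2 / \<epsilon>) + (\<epsilon> + indicator A \<omega>)"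
        using Xe AE_space
      proof eventually_elim
        fix \<omega> assume 1: "X ?T \<omega> = y + integral {0..?T} (\<lambda>s. b (X s \<omega>)) + Z \<omega>" and w: "\<omega> \<in> space M"
        have "euler (?h m) (j * 2^m) \<omega> - X ?T \<omega> = (B m \<omega> - I \<omega>) + R m \<omega> + (?S m \<omega> - Z \<omega>)"
          using 1 by (simp add: eul I_def)
        moreover have "\<bar>R m \<omega>\<bar> \<le> \<epsilon> + (R m \<omega>)\<^sup>2 / \<epsilon>" by (rule abs_le_add_square[OF e])
        moreover have "min 1 \<bar>?S m \<omega> - Z \<omega>\<bar> \<le> \<epsilon> + indicator A \<omega>"
          using w e by (auto simp: indicator_def A_def)
        ultimately show "min 1 \<bar>euler (?h m) (j * 2^m) \<omega> - X ?T \<omega>\<bar> \<le>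
            min 1 \<bar>B m \<omega> - I \<omega>\<bar> + (\<epsilon> + (R m \<omega>)\<^sup>2 / \<epsilon>) + (\<epsilon> + indicator A \<omega>)"
          by linarith
      qed
    qed (use R2 Ai in \<open>auto intro!: dprob_integrable Bochner_Integration.integrable_add\<close>)
    also have "\<dots> = dprob (B m) I + (\<epsilon> + expectation (\<lambda>\<omega>. (R m \<omega>)\<^sup>2) / \<epsilon>) + (\<epsilon> + measure M A)"
      using R2 Ai dprob_integrable[OF Bm Im, of m] by (simp add: dprob_def prob_space)
    finally show ?thesis unfolding A_def .
  qed
  show ?thesis
  proof (rule LIMSEQ_I)
    fix e :: real assume e: "e > 0"
    define \<epsilon> where "\<epsilon> = e / 4"
    have ep: "\<epsilon> > 0" using e by (simp add: \<epsilon>_def)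
    have "(\<lambda>m. dprob (B m) I + (\<epsilon> + expectation (\<lambda>\<omega>. (R m \<omega>)\<^sup>2) / \<epsilon>)
      + (\<epsilon> + measure M {\<omega>\<in>space M. \<bar>?S m \<omega> - Z \<omega>\<bar> > \<epsilon>})) \<longlonglongrightarrow> 0 + (\<epsilon> + 0 / \<epsilon>) + (\<epsilon> + 0)"
      using ep by (intro tendsto_intros BIe R0 Scp) auto
    then have "eventually (\<lambda>m. dprob (B m) I + (\<epsilon> + expectation (\<lambda>\<omega>. (R m \<omega>)\<^sup>2) / \<epsilon>)
      + (\<epsilon> + measure M {\<omega>\<in>space M. \<bar>?S m \<omega> - Z \<omega>\<bar> > \<epsilon>}) < e) sequentially"
      by (rule order_tendstoD) (use e in \<open>simp add: \<epsilon>_def\<close>)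
    then have "eventually (\<lambda>m. dprob (euler (?h m) (j * 2^m)) (X ?T) < e) sequentially"
      by eventually_elim (use bound[OF ep] in \<open>auto intro: le_less_trans\<close>)
    then show "\<exists>N. \<forall>m\<ge>N. norm (dprob (euler (?h m) (j * 2^m)) (X ?T) - 0) < e"
      using dprob_nonneg by (simp add: eventually_sequentially abs_of_nonneg)
  qed
qed

text \<open>With both times on the same dyadic grid, the bound of \<open>euler_incr\<close> is the
  same for every \<open>m\<close> and survives the limit.\<close>

lemma X_incr:
  assumes d: "d > 0" and ij: "i \<le> j"
  shows "dprob (X (real j * d)) (X (real i * d)) \<le> 2 * (K * (real (j - i) * d) + K * sqrt (real (j - i) * d))"
proof -
  let ?B = "2 * (K * (real (j - i) * d) + K * sqrt (real (j - i) * d))"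
  have em: "euler (d / 2^m) n \<in> borel_measurable M" for m n
    using euler_meas[of "d / 2^m" n] meas_F_M[of "real n * (d / 2^m)"] d by simp
  have Xmm: "X (real n * d) \<in> borel_measurable M" for n using XmM d by simp
  have "dprob (X (real j * d)) (X (real i * d)) \<le>
      dprob (euler (d / 2^m) (j * 2^m)) (X (real j * d)) + ?B + dprob (euler (d / 2^m) (i * 2^m)) (X (real i * d))" for m
  proof -
    have eq: "real (j * 2^m - i * 2^m) * (d / 2^m) = real (j - i) * d"
      by (simp only: diff_mult_distrib[symmetric] of_nat_mult) simp
    have "dprob (euler (d / 2^m) (j * 2^m)) (euler (d / 2^m) (i * 2^m)) \<le> ?B"
      using euler_incr[of "d / 2^m" "i * 2^m" "j * 2^m"] d ij unfolding eq by simp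
    moreover have "dprob (X (real j * d)) (X (real i * d)) \<le>
      dprob (X (real j * d)) (euler (d / 2^m) (j * 2^m)) + dprob (euler (d / 2^m) (j * 2^m)) (X (real i * d))"
      by (rule dprob_triangle[OF Xmm em Xmm])
    moreover have "dprob (euler (d / 2^m) (j * 2^m)) (X (real i * d)) \<le>
      dprob (euler (d / 2^m) (j * 2^m)) (euler (d / 2^m) (i * 2^m)) + dprob (euler (d / 2^m) (i * 2^m)) (X (real i * d))"
      by (rule dprob_triangle[OF em em Xmm])
    ultimately show ?thesis using dprob_commute[of "X (real j * d)"] by simp
  qed
  moreover have "(\<lambda>m. dprob (euler (d / 2^m) (j * 2^m)) (X (real j * d)) + ?B + dprob (euler (d / 2^m) (i * 2^m)) (X (real i * d))) \<longlonglongrightarrow> 0 + ?B + 0"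
    by (intro tendsto_intros euler_conv d)
  ultimately show ?thesis by (intro LIMSEQ_le_const[where X="\<lambda>m. dprob (euler (d / 2^m) (j * 2^m)) (X (real j * d)) + ?B + dprob (euler (d / 2^m) (i * 2^m)) (X (real i * d))"]) auto
qed

end

subsection \<open>The generator of the solution\<close>

context sde begin

text \<open>Taylor expansion in the increment. The weight \<psi> plays the part of conditioning on
  \<open>F s\<close>. The threshold \<open>h0\<close> is uniform in the time, the weight, the
  starting value and the coefficients, as the later summation over steps requires.\<close>

lemma one_step:
  fixes f f' f'' :: "real \<Rightarrow> real"
  assumes d1: "\<And>x. (f has_real_derivative f' x) (at x)"
    and d2: "\<And>x. (f' has_real_derivative f'' x) (at x)"
    and m0: "bounded_ucont f" and m1: "bounded_ucont f'" and m2: "bounded_ucont f''" and \<eta>: "\<eta> > 0"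
  obtains h0 where "h0 > 0"
    "\<And>h s \<psi> Y \<beta> \<xi>. 0 < h \<Longrightarrow> h < h0 \<Longrightarrow> 0 \<le> s \<Longrightarrow>
      \<psi> \<in> borel_measurable (F s) \<Longrightarrow> Y \<in> borel_measurable (F s) \<Longrightarrow>
      \<beta> \<in> borel_measurable (F s) \<Longrightarrow> \<xi> \<in> borel_measurable (F s) \<Longrightarrow>
      (\<And>\<omega>. \<bar>\<psi> \<omega>\<bar> \<le> 1) \<Longrightarrow> (\<And>\<omega>. \<bar>\<beta> \<omega>\<bar> \<le> K) \<Longrightarrow> (\<And>\<omega>. \<bar>\<xi> \<omega>\<bar> \<le> K) \<Longrightarrow>
      \<bar>expectation (\<lambda>\<omega>. \<psi> \<omega> * (f (Y \<omega> + (\<beta> \<omega> * h + \<xi> \<omega> * (W (s + h) \<omega> - W s \<omega>))) - f (Y \<omega>)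
        - h * (\<beta> \<omega> * f' (Y \<omega>) + (\<xi> \<omega>)\<^sup>2 * f'' (Y \<omega>) / 2)))\<bar> \<le> h * \<eta>"
proof -
  obtain B where B: "B \<ge> 0" "\<And>x. \<bar>f x\<bar> \<le> B" using bounded_ucontD_bound[OF m0] by blast
  obtain B1 where B1: "B1 \<ge> 0" "\<And>x. \<bar>f' x\<bar> \<le> B1" using bounded_ucontD_bound[OF m1] by blast
  obtain B2 where B2: "B2 \<ge> 0" "\<And>x. \<bar>f'' x\<bar> \<le> B2" using bounded_ucontD_bound[OF m2] by blast
  \<comment> \<open>For \<open>h \<le> 1\<close> the squared increment has mean at most
    \<open>4 * K\<^sup>2 * h\<close>, so this choice spends half of the allowance
    \<open>h * \<eta>\<close>.\<close>
  define \<epsilon> where "\<epsilon> = \<eta> / (8 * K\<^sup>2)"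
  have K0: "K > 0" using K1 by simp
  have ep: "\<epsilon> > 0" using \<eta> K0 by (simp add: \<epsilon>_def)
  obtain C where C: "C \<ge> 0"
    "\<And>x D. \<bar>f (x + D) - f x - f' x * D - f'' x * D\<^sup>2 / 2\<bar> \<le> \<epsilon> * D\<^sup>2 + C * D ^ 4"
    using taylor2_bound[OF d1 d2 m2 ep] by blast
  \<comment> \<open>Collects the coefficients of all terms of order \<open>h\<^sup>2\<close>; the
    summand 1 keeps it positive. The bound on \<open>h\<close> then makes these terms at most the
    other half of the allowance.\<close>
  define G where "G = 32 * C * K ^ 4 + B2 * K\<^sup>2 + 1"
  have G: "G > 0" using C B2 by (simp add: G_def add_nonneg_pos)
  define h0 where "h0 = min 1 (\<eta> / (2 * G))"
  have cf: "f \<in> borel_measurable borel" "f' \<in> borel_measurable borel" "f'' \<in> borel_measurable borel"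
    using m0 m1 m2 by (auto intro!: borel_measurable_continuous_onI bounded_ucont_continuous)
  have main: "\<bar>expectation (\<lambda>\<omega>. \<psi> \<omega> * (f (Y \<omega> + (\<beta> \<omega> * h + \<xi> \<omega> * (W (s + h) \<omega> - W s \<omega>))) - f (Y \<omega>)
        - h * (\<beta> \<omega> * f' (Y \<omega>) + (\<xi> \<omega>)\<^sup>2 * f'' (Y \<omega>) / 2)))\<bar> \<le> h * \<eta>"
    if h: "0 < h" "h < h0" and s: "0 \<le> s"
      and mF: "\<psi> \<in> borel_measurable (F s)" "Y \<in> borel_measurable (F s)"
        "\<beta> \<in> borel_measurable (F s)" "\<xi> \<in> borel_measurable (F s)"
      and bd: "\<And>\<omega>. \<bar>\<psi> \<omega>\<bar> \<le> 1" "\<And>\<omega>. \<bar>\<beta> \<omega>\<bar> \<le> K" "\<And>\<omega>. \<bar>\<xi> \<omega>\<bar> \<le> K" for h s \<psi> Y \<beta> \<xi>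
  proof -
    have h1: "h \<le> 1" and hG: "h * G \<le> \<eta> / 2" using h G by (auto simp: h0_def field_simps)
    have st: "0 \<le> s" "s < s + h" using s h by auto
    define V where "V \<omega> = W (s + h) \<omega> - W s \<omega>" for \<omega>
    define D where "D \<omega> = \<beta> \<omega> * h + \<xi> \<omega> * V \<omega>" for \<omega>
    have fF: "(\<lambda>\<omega>. f' (Y \<omega>)) \<in> borel_measurable (F s)" "(\<lambda>\<omega>. f'' (Y \<omega>)) \<in> borel_measurable (F s)"
      using measurable_compose[OF mF(2) cf(2)] measurable_compose[OF mF(2) cf(3)] by simp_all
    have mM[measurable]: "\<psi> \<in> borel_measurable M" "Y \<in> borel_measurable M"
        "\<beta> \<in> borel_measurable M" "\<xi> \<in> borel_measurable M"
      using mF meas_F_M[OF s] by blast+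
    note cf[measurable]
    have Vm[measurable]: "V \<in> borel_measurable M" unfolding V_def[abs_def] using WmM s h by simp
    have Dm[measurable]: "D \<in> borel_measurable M" unfolding D_def[abs_def] by measurable
    \<comment> \<open>The Taylor polynomial sorted by powers of the Brownian increment
      \<open>V\<close>, after the first-order drift term has cancelled: \<open>T1 V\<close> has mean
      zero, \<open>T2 V\<^sup>2\<close> has mean \<open>h\<close> times that of \<open>T2\<close>
      and matches the diffusion part of the generator, and \<open>T3\<close> is of order
      \<open>h\<^sup>2\<close>.\<close>
    define T1 where "T1 \<omega> = \<psi> \<omega> * (f' (Y \<omega>) * \<xi> \<omega> + f'' (Y \<omega>) * \<beta> \<omega> * h * \<xi> \<omega>)" for \<omega>
    define T2 where "T2 \<omega> = \<psi> \<omega> * f'' (Y \<omega>) * (\<xi> \<omega>)\<^sup>2 / 2" for \<omega>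
    define T3 where "T3 \<omega> = \<psi> \<omega> * f'' (Y \<omega>) * (\<beta> \<omega>)\<^sup>2 * h\<^sup>2 / 2" for \<omega>
    have T1F: "T1 \<in> borel_measurable (F s)" and T2F: "T2 \<in> borel_measurable (F s)"
      unfolding T1_def[abs_def] T2_def[abs_def] using mF fF by measurable
    have T1B: "\<bar>T1 \<omega>\<bar> \<le> 1 * (B1 * K + B2 * K * h * K)" for \<omega>
      unfolding T1_def abs_mult
      by (rule mult_mono[OF bd(1) order_trans[OF abs_triangle_ineq add_mono]])
        (use h B1 B2 K0 bd in \<open>auto simp: abs_mult intro!: mult_mono\<close>)
    have sqb: "(\<xi> \<omega>)\<^sup>2 \<le> K\<^sup>2" "(\<beta> \<omega>)\<^sup>2 \<le> K\<^sup>2" for \<omega>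
      using power_mono[OF bd(3)[of \<omega>], of 2] power_mono[OF bd(2)[of \<omega>], of 2] by auto
    have p1: "\<bar>\<psi> \<omega> * f'' (Y \<omega>)\<bar> \<le> 1 * B2" for \<omega>
      unfolding abs_mult by (rule mult_mono[OF bd(1) B2(2)]) auto
    have T2B: "\<bar>T2 \<omega>\<bar> \<le> 1 * B2 * K\<^sup>2 / 2" for \<omega>
    proof -
      have "\<bar>\<psi> \<omega> * f'' (Y \<omega>)\<bar> * (\<xi> \<omega>)\<^sup>2 \<le> 1 * B2 * K\<^sup>2"
        by (rule mult_mono[OF p1 sqb(1)]) (use B2 in auto)
      then show ?thesis unfolding T2_def by (simp add: abs_mult)
    qed
    have T3B: "\<bar>T3 \<omega>\<bar> \<le> 1 * B2 * K\<^sup>2 * h\<^sup>2 / 2" for \<omega>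
    proof -
      have "\<bar>\<psi> \<omega> * f'' (Y \<omega>)\<bar> * (\<beta> \<omega>)\<^sup>2 * h\<^sup>2 \<le> 1 * B2 * K\<^sup>2 * h\<^sup>2"
        by (rule mult_right_mono[OF mult_mono[OF p1 sqb(2)]]) (use B2 in auto)
      then show ?thesis unfolding T3_def by (simp add: abs_mult)
    qed
    have T1i: "integrable M T1"
      by (rule integrable_const_bound[where B="1 * (B1 * K + B2 * K * h * K)"]) (use T1B meas_F_M[OF s T1F] in auto)
    have T2i: "integrable M T2"
      by (rule integrable_const_bound[where B="1 * B2 * K\<^sup>2 / 2"]) (use T2B meas_F_M[OF s T2F] in auto)
    have T3i: "integrable M T3"
      by (rule integrable_const_bound[where B="1 * B2 * K\<^sup>2 * h\<^sup>2 / 2"]) (use T3B in \<open>auto simp: T3_def[abs_def]\<close>)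
    have E1: "integrable M (\<lambda>\<omega>. T1 \<omega> * V \<omega>)" "expectation (\<lambda>\<omega>. T1 \<omega> * V \<omega>) = 0"
      using W_incr_mult[OF st T1F T1i, of 1] W_incr_moment(1)[OF st] by (simp_all add: V_def)
    have E2: "integrable M (\<lambda>\<omega>. T2 \<omega> * (V \<omega>)\<^sup>2)" "expectation (\<lambda>\<omega>. T2 \<omega> * (V \<omega>)\<^sup>2) = expectation T2 * h"
      using W_incr_mult[OF st T2F T2i, of 2] W_incr_moment(2)[OF st] by (simp_all add: V_def)
    have V2: "integrable M (\<lambda>\<omega>. (V \<omega>)\<^sup>2)" "expectation (\<lambda>\<omega>. (V \<omega>)\<^sup>2) = h"
      and V4: "integrable M (\<lambda>\<omega>. (V \<omega>)^4)" "expectation (\<lambda>\<omega>. (V \<omega>)^4) = 3 * h\<^sup>2"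
      using W_incr_moment_integrable[OF st] W_incr_moment[OF st] by (simp_all add: V_def)
    define \<rho> where "\<rho> \<omega> = \<psi> \<omega> * (f (Y \<omega> + D \<omega>) - f (Y \<omega>) - f' (Y \<omega>) * D \<omega> - f'' (Y \<omega>) * (D \<omega>)\<^sup>2 / 2)" for \<omega>
    define U where "U \<omega> = \<epsilon> * (2 * K\<^sup>2 * h\<^sup>2 + 2 * K\<^sup>2 * (V \<omega>)\<^sup>2) + C * (8 * K^4 * h^4 + 8 * K^4 * (V \<omega>)^4)" for \<omega>
    have \<rho>B: "\<bar>\<rho> \<omega>\<bar> \<le> U \<omega>" for \<omega>
    proof -
      have sq2: "(p + q)\<^sup>2 \<le> 2 * p\<^sup>2 + 2 * q\<^sup>2" for p q :: real
        using zero_le_power2[of "p - q"] by (simp add: power2_eq_square algebra_simps)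
      have q4: "(p + q)^4 \<le> 8 * p^4 + 8 * q^4" for p q :: real
      proof -
        have e: "z ^ 4 = (z\<^sup>2)\<^sup>2" for z :: real by simp
        have "((p + q)\<^sup>2)\<^sup>2 \<le> (2 * p\<^sup>2 + 2 * q\<^sup>2)\<^sup>2" by (rule power_mono[OF sq2]) simp
        also have "\<dots> \<le> 2 * (2 * p\<^sup>2)\<^sup>2 + 2 * (2 * q\<^sup>2)\<^sup>2" by (rule sq2)
        finally show ?thesis unfolding e by (simp add: power_mult_distrib)
      qed
      have a: "(\<beta> \<omega> * h)\<^sup>2 \<le> K\<^sup>2 * h\<^sup>2" "(\<xi> \<omega> * V \<omega>)\<^sup>2 \<le> K\<^sup>2 * (V \<omega>)\<^sup>2"
        using sqb[of \<omega>] by (auto simp: power_mult_distrib intro!: mult_right_mono)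
      have a4: "(\<beta> \<omega>)^4 \<le> K^4" "(\<xi> \<omega>)^4 \<le> K^4"
        using power_mono[OF sqb(2)[of \<omega>], of 2] power_mono[OF sqb(1)[of \<omega>], of 2] by auto
      then have "(\<beta> \<omega> * h)^4 \<le> K^4 * h^4" "(\<xi> \<omega> * V \<omega>)^4 \<le> K^4 * (V \<omega>)^4"
        by (auto simp: power_mult_distrib intro!: mult_right_mono)
      then have b4: "(D \<omega>)^4 \<le> 8 * K^4 * h^4 + 8 * K^4 * (V \<omega>)^4"
        using q4[of "\<beta> \<omega> * h" "\<xi> \<omega> * V \<omega>"] unfolding D_def by linarith
      have b2: "(D \<omega>)\<^sup>2 \<le> 2 * K\<^sup>2 * h\<^sup>2 + 2 * K\<^sup>2 * (V \<omega>)\<^sup>2"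
        using sq2[of "\<beta> \<omega> * h" "\<xi> \<omega> * V \<omega>"] a unfolding D_def by linarith
      have "\<bar>\<rho> \<omega>\<bar> \<le> 1 * (\<epsilon> * (D \<omega>)\<^sup>2 + C * (D \<omega>) ^ 4)"
        unfolding \<rho>_def abs_mult by (rule mult_mono[OF bd(1) C(2)]) auto
      also have "\<dots> \<le> U \<omega>" unfolding U_def
        using b2 b4 ep C(1) by (auto intro!: add_mono mult_left_mono)
      finally show ?thesis .
    qed
    have Ui: "integrable M U" unfolding U_def[abs_def] using V2 V4 by auto
    have EU: "expectation U = \<epsilon> * (2 * K\<^sup>2 * h\<^sup>2 + 2 * K\<^sup>2 * h) + C * (8 * K^4 * h^4 + 8 * K^4 * (3 * h\<^sup>2))"
      unfolding U_def[abs_def] using V2 V4 by (simp add: prob_space)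
    have \<rho>i: "integrable M \<rho>"
      by (rule Bochner_Integration.integrable_bound[OF Ui]) (use \<rho>B in \<open>auto simp: \<rho>_def[abs_def] intro!: AE_I2 order_trans[OF _ abs_ge_self]\<close>)
    have E\<rho>: "\<bar>expectation \<rho>\<bar> \<le> expectation U"
    proof -
      have "\<bar>expectation \<rho>\<bar> \<le> expectation (\<lambda>\<omega>. \<bar>\<rho> \<omega>\<bar>)" by (rule integral_abs_bound)
      also have "\<dots> \<le> expectation U" using \<rho>i Ui \<rho>B by (intro Bochner_Integration.integral_mono) auto
      finally show ?thesis .
    qed
    have pw: "\<psi> \<omega> * (f (Y \<omega> + (\<beta> \<omega> * h + \<xi> \<omega> * (W (s + h) \<omega> - W s \<omega>))) - f (Y \<omega>)
        - h * (\<beta> \<omega> * f' (Y \<omega>) + (\<xi> \<omega>)\<^sup>2 * f'' (Y \<omega>) / 2)) =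
        \<rho> \<omega> + T1 \<omega> * V \<omega> + T2 \<omega> * (V \<omega>)\<^sup>2 + T3 \<omega> - h * T2 \<omega>" for \<omega>
      unfolding \<rho>_def T1_def T2_def T3_def V_def[symmetric] D_def
      by (simp add: power2_eq_square field_simps)
    have "expectation (\<lambda>\<omega>. \<rho> \<omega> + T1 \<omega> * V \<omega> + T2 \<omega> * (V \<omega>)\<^sup>2 + T3 \<omega> - h * T2 \<omega>) = expectation \<rho> + expectation T3"
      using \<rho>i E1 E2 T2i T3i by simp
    moreover have "\<bar>expectation T3\<bar> \<le> B2 * K\<^sup>2 * h\<^sup>2 / 2"
    proof -
      have "\<bar>expectation T3\<bar> \<le> expectation (\<lambda>\<omega>. \<bar>T3 \<omega>\<bar>)" by (rule integral_abs_bound)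
      also have "\<dots> \<le> expectation (\<lambda>\<omega>. 1 * B2 * K\<^sup>2 * h\<^sup>2 / 2)" using T3i T3B by (intro Bochner_Integration.integral_mono) auto
      finally show ?thesis by (simp add: prob_space)
    qed
    ultimately have "\<bar>expectation (\<lambda>\<omega>. \<psi> \<omega> * (f (Y \<omega> + (\<beta> \<omega> * h + \<xi> \<omega> * (W (s + h) \<omega> - W s \<omega>))) - f (Y \<omega>)
        - h * (\<beta> \<omega> * f' (Y \<omega>) + (\<xi> \<omega>)\<^sup>2 * f'' (Y \<omega>) / 2)))\<bar> \<le> expectation U + B2 * K\<^sup>2 * h\<^sup>2 / 2"
      unfolding pw using E\<rho> by linarith
    also have "\<dots> \<le> h * \<eta>"
    proof -
      have hh: "h\<^sup>2 \<le> h" "h^4 \<le> h\<^sup>2"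
        using h(1) h1 power_decreasing[of 1 2 h] power_decreasing[of 2 4 h] by auto
      have "\<epsilon> * (2 * K\<^sup>2 * h\<^sup>2 + 2 * K\<^sup>2 * h) \<le> \<epsilon> * (2 * K\<^sup>2 * h + 2 * K\<^sup>2 * h)"
        using hh ep by (intro mult_left_mono add_right_mono) auto
      also have "\<dots> = h * (\<eta> / 2)" using K0 by (simp add: \<epsilon>_def field_simps)
      finally have 1: "\<epsilon> * (2 * K\<^sup>2 * h\<^sup>2 + 2 * K\<^sup>2 * h) \<le> h * (\<eta> / 2)" .
      have "C * (8 * K^4 * h^4 + 8 * K^4 * (3 * h\<^sup>2)) \<le> C * (8 * K^4 * h\<^sup>2 + 8 * K^4 * (3 * h\<^sup>2))"
        using hh C by (intro mult_left_mono add_right_mono) auto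
      moreover have "C * (8 * K^4 * h\<^sup>2 + 8 * K^4 * (3 * h\<^sup>2)) = 32 * C * K^4 * h\<^sup>2" by (simp add: algebra_simps)
      ultimately have "C * (8 * K^4 * h^4 + 8 * K^4 * (3 * h\<^sup>2)) + B2 * K\<^sup>2 * h\<^sup>2 / 2 \<le> 32 * C * K^4 * h\<^sup>2 + B2 * K\<^sup>2 * h\<^sup>2 / 2" by linarith
      also have "\<dots> \<le> 32 * C * K^4 * h\<^sup>2 + B2 * K\<^sup>2 * h\<^sup>2 + h\<^sup>2" using B2 by simp
      also have "\<dots> = h * (h * G)" by (simp add: G_def power2_eq_square algebra_simps)
      also have "\<dots> \<le> h * (\<eta> / 2)" using hG h by (intro mult_left_mono) auto
      finally show ?thesis using 1 unfolding EU by (simp add: algebra_simps)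
    qed
    finally show ?thesis .
  qed
  moreover have "h0 > 0" using G \<eta> by (simp add: h0_def)
  ultimately show ?thesis using that by blast
qed

text \<open>Sums the one-step errors. A weight that is measurable at the starting index remains an
  admissible weight at every later step, so one \<psi> serves for the whole sum.\<close>

lemma euler_generator:
  fixes f f' f'' :: "real \<Rightarrow> real"
  assumes d1: "\<And>x. (f has_real_derivative f' x) (at x)"
    and d2: "\<And>x. (f' has_real_derivative f'' x) (at x)"
    and m0: "bounded_ucont f" and m1: "bounded_ucont f'" and m2: "bounded_ucont f''" and \<eta>: "\<eta> > 0"
  obtains h0 where "h0 > 0"
    "\<And>h a n \<psi>. 0 < h \<Longrightarrow> h < h0 \<Longrightarrow> a \<le> n \<Longrightarrow>
      \<psi> \<in> borel_measurable (F (real a * h)) \<Longrightarrow> (\<And>\<omega>. \<bar>\<psi> \<omega>\<bar> \<le> 1) \<Longrightarrow>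
      \<bar>expectation (\<lambda>\<omega>. \<psi> \<omega> * (f (euler h n \<omega>) - f (euler h a \<omega>) - (\<Sum>l\<in>{a..<n}. h *
        (b (X (real l * h) \<omega>) * f' (euler h l \<omega>) + (\<sigma> (X (real l * h) \<omega>))\<^sup>2 * f'' (euler h l \<omega>) / 2))))\<bar>
      \<le> real (n - a) * h * \<eta>"
proof -
  obtain h0 where h0: "h0 > 0" 
    "\<And>h s \<psi> Y \<beta> \<xi>. 0 < h \<Longrightarrow> h < h0 \<Longrightarrow> 0 \<le> s \<Longrightarrow>
      \<psi> \<in> borel_measurable (F s) \<Longrightarrow> Y \<in> borel_measurable (F s) \<Longrightarrow>
      \<beta> \<in> borel_measurable (F s) \<Longrightarrow> \<xi> \<in> borel_measurable (F s) \<Longrightarrow>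
      (\<And>\<omega>. \<bar>\<psi> \<omega>\<bar> \<le> 1) \<Longrightarrow> (\<And>\<omega>. \<bar>\<beta> \<omega>\<bar> \<le> K) \<Longrightarrow> (\<And>\<omega>. \<bar>\<xi> \<omega>\<bar> \<le> K) \<Longrightarrow>
      \<bar>expectation (\<lambda>\<omega>. \<psi> \<omega> * (f (Y \<omega> + (\<beta> \<omega> * h + \<xi> \<omega> * (W (s + h) \<omega> - W s \<omega>))) - f (Y \<omega>)
        - h * (\<beta> \<omega> * f' (Y \<omega>) + (\<xi> \<omega>)\<^sup>2 * f'' (Y \<omega>) / 2)))\<bar> \<le> h * \<eta>"
    using one_step[OF d1 d2 m0 m1 m2 \<eta>] by blast
  obtain B where B: "B \<ge> 0" "\<And>x. \<bar>f x\<bar> \<le> B" using bounded_ucontD_bound[OF m0] by blast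
  obtain B1 where B1: "B1 \<ge> 0" "\<And>x. \<bar>f' x\<bar> \<le> B1" using bounded_ucontD_bound[OF m1] by blast
  obtain B2 where B2: "B2 \<ge> 0" "\<And>x. \<bar>f'' x\<bar> \<le> B2" using bounded_ucontD_bound[OF m2] by blast
  have K0: "K \<ge> 0" using K1 by simp
  have cf[measurable]: "f \<in> borel_measurable borel" "f' \<in> borel_measurable borel" "f'' \<in> borel_measurable borel"
    using m0 m1 m2 by (auto intro!: borel_measurable_continuous_onI bounded_ucont_continuous)
  have main: "\<bar>expectation (\<lambda>\<omega>. \<psi> \<omega> * (f (euler h n \<omega>) - f (euler h a \<omega>) - (\<Sum>l\<in>{a..<n}. h *
        (b (X (real l * h) \<omega>) * f' (euler h l \<omega>) + (\<sigma> (X (real l * h) \<omega>))\<^sup>2 * f'' (euler h l \<omega>) / 2))))\<bar>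
      \<le> real (n - a) * h * \<eta>"
    if h: "0 < h" "h < h0" and an: "a \<le> n" and p: "\<psi> \<in> borel_measurable (F (real a * h))" "\<And>\<omega>. \<bar>\<psi> \<omega>\<bar> \<le> 1"
    for h a n \<psi>
  proof -
    have nn: "0 \<le> real l * h" for l using h by simp
    have [measurable]: "\<psi> \<in> borel_measurable M" using meas_F_M[OF nn p(1)] .
    have eM[measurable]: "euler h l \<in> borel_measurable M" for l using meas_F_M[OF nn euler_meas[OF h(1)]] .
    have bM[measurable]: "(\<lambda>\<omega>. b (X (real l * h) \<omega>)) \<in> borel_measurable M"
      "(\<lambda>\<omega>. \<sigma> (X (real l * h) \<omega>)) \<in> borel_measurable M" for l
      using meas_F_M[OF nn bX_meas[OF nn]] meas_F_M[OF nn sX_meas[OF nn]] by auto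
    define g where "g l \<omega> = b (X (real l * h) \<omega>) * f' (euler h l \<omega>) + (\<sigma> (X (real l * h) \<omega>))\<^sup>2 * f'' (euler h l \<omega>) / 2" for l \<omega>
    have gm[measurable]: "g l \<in> borel_measurable M" for l unfolding g_def[abs_def] by measurable
    have gB: "\<bar>g l \<omega>\<bar> \<le> K * B1 + K\<^sup>2 * B2 / 2" for l \<omega>
    proof -
      have "\<bar>b (X (real l * h) \<omega>) * f' (euler h l \<omega>)\<bar> \<le> K * B1"
        unfolding abs_mult by (rule mult_mono[OF Kb B1(2)]) (use K0 in auto)
      moreover have "\<bar>(\<sigma> (X (real l * h) \<omega>))\<^sup>2 * f'' (euler h l \<omega>)\<bar> \<le> K\<^sup>2 * B2"
        unfolding abs_mult power_abs using power_mono[OF Ks, of "X (real l * h) \<omega>" 2] by (intro mult_mono B2) auto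
      ultimately show ?thesis unfolding g_def by linarith
    qed
    have int: "integrable M (\<lambda>\<omega>. \<psi> \<omega> * (f (euler h n \<omega>) - f (euler h a \<omega>) - (\<Sum>l\<in>{a..<n}. h * g l \<omega>)))" for n
    proof (rule integrable_const_bound)
      show "AE \<omega> in M. norm (\<psi> \<omega> * (f (euler h n \<omega>) - f (euler h a \<omega>) - (\<Sum>l\<in>{a..<n}. h * g l \<omega>))) \<le>
          1 * (2 * B + (\<Sum>l\<in>{a..<n}. h * (K * B1 + K\<^sup>2 * B2 / 2)))"
      proof (rule AE_I2)
        fix \<omega>
        have "\<bar>\<Sum>l\<in>{a..<n}. h * g l \<omega>\<bar> \<le> (\<Sum>l\<in>{a..<n}. h * (K * B1 + K\<^sup>2 * B2 / 2))"
          by (rule order_trans[OF sum_abs sum_mono]) (use h gB in \<open>auto simp: abs_mult intro!: mult_left_mono\<close>)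
        then have "\<bar>f (euler h n \<omega>) - f (euler h a \<omega>) - (\<Sum>l\<in>{a..<n}. h * g l \<omega>)\<bar> \<le> 2 * B + (\<Sum>l\<in>{a..<n}. h * (K * B1 + K\<^sup>2 * B2 / 2))"
          using B(2)[of "euler h n \<omega>"] B(2)[of "euler h a \<omega>"] by linarith
        then show "norm (\<psi> \<omega> * (f (euler h n \<omega>) - f (euler h a \<omega>) - (\<Sum>l\<in>{a..<n}. h * g l \<omega>))) \<le>
          1 * (2 * B + (\<Sum>l\<in>{a..<n}. h * (K * B1 + K\<^sup>2 * B2 / 2)))"
          unfolding real_norm_def abs_mult by (intro mult_mono p(2)) auto
      qed
    qed measurable
    from an have "\<bar>expectation (\<lambda>\<omega>. \<psi> \<omega> * (f (euler h n \<omega>) - f (euler h a \<omega>) - (\<Sum>l\<in>{a..<n}. h * g l \<omega>)))\<bar> \<le> real (n - a) * h * \<eta>"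
    proof (induct n rule: dec_induct)
      case (step n)
      have le: "real a * h \<le> real n * h" using step h by (intro mult_right_mono) auto
      define Q where "Q \<omega> = \<psi> \<omega> * (f (euler h n \<omega> + (b (X (real n * h) \<omega>) * h + \<sigma> (X (real n * h) \<omega>) * (W (real n * h + h) \<omega> - W (real n * h) \<omega>))) - f (euler h n \<omega>)
        - h * (b (X (real n * h) \<omega>) * f' (euler h n \<omega>) + (\<sigma> (X (real n * h) \<omega>))\<^sup>2 * f'' (euler h n \<omega>) / 2))" for \<omega>
      have Q: "\<bar>expectation Q\<bar> \<le> h * \<eta>"
        unfolding Q_def
        by (rule h0(2)[OF h nn meas_F_mono[OF nn le p(1)] euler_meas[OF h(1)] bX_meas[OF nn] sX_meas[OF nn]])
          (use p(2) Kb Ks in auto)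
      have sn: "real (Suc n) * h = real n * h + h" by (simp add: algebra_simps)
      have es: "euler h (Suc n) \<omega> = euler h n \<omega> + (b (X (real n * h) \<omega>) * h + \<sigma> (X (real n * h) \<omega>) * (W (real n * h + h) \<omega> - W (real n * h) \<omega>))" for \<omega>
        unfolding euler_def sn[symmetric] by simp
      have Qe: "\<psi> \<omega> * (f (euler h (Suc n) \<omega>) - f (euler h a \<omega>) - (\<Sum>l\<in>{a..<Suc n}. h * g l \<omega>)) =
         \<psi> \<omega> * (f (euler h n \<omega>) - f (euler h a \<omega>) - (\<Sum>l\<in>{a..<n}. h * g l \<omega>)) + Q \<omega>" for \<omega>
        using step unfolding Q_def es[symmetric] g_def[symmetric] by (simp add: algebra_simps)
      have Qi: "integrable M Q"
        using Bochner_Integration.integrable_diff[OF int[of "Suc n"] int[of n]] unfolding Qe by simp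
      have "expectation (\<lambda>\<omega>. \<psi> \<omega> * (f (euler h (Suc n) \<omega>) - f (euler h a \<omega>) - (\<Sum>l\<in>{a..<Suc n}. h * g l \<omega>))) =
         expectation (\<lambda>\<omega>. \<psi> \<omega> * (f (euler h n \<omega>) - f (euler h a \<omega>) - (\<Sum>l\<in>{a..<n}. h * g l \<omega>))) + expectation Q"
        unfolding Qe by (rule Bochner_Integration.integral_add[OF int Qi])
      moreover have "real (Suc n - a) * h * \<eta> = real (n - a) * h * \<eta> + h * \<eta>"
        using step by (simp add: Suc_diff_le algebra_simps)
      ultimately show ?case using step Q by linarith
    qed simp
    then show ?thesis unfolding g_def .
  qed
  show ?thesis using that[OF h0(1) main] by blast
qed

end

section \<open>Passage from the Euler sums to the solution, and discounting\<close>

lemma C1_modulus: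
  fixes f f' :: "real \<Rightarrow> real"
  assumes d1: "\<And>x. (f has_real_derivative f' x) (at x)" and m0: "bounded_ucont f" and m1: "bounded_ucont f'"
  obtains L where "L \<ge> 0" "\<And>x z. \<bar>f x - f z\<bar> \<le> L * min 1 \<bar>x - z\<bar>"
proof -
  obtain B where B: "B \<ge> 0" "\<And>x. \<bar>f x\<bar> \<le> B" using bounded_ucontD_bound[OF m0] by blast
  obtain B1 where B1: "B1 \<ge> 0" "\<And>x. \<bar>f' x\<bar> \<le> B1" using bounded_ucontD_bound[OF m1] by blast
  have "\<bar>f x - f z\<bar> \<le> (2 * B + B1) * min 1 \<bar>x - z\<bar>" for x z
  proof (cases "\<bar>x - z\<bar> \<le> 1")
    case True
    have "norm (f x - f z) \<le> B1 * norm (x - z)"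
      by (rule field_differentiable_bound[of UNIV f f']) (use d1 B1 in auto)
    moreover have "B1 * \<bar>x - z\<bar> \<le> (2 * B + B1) * \<bar>x - z\<bar>" using B by (intro mult_right_mono) auto
    ultimately show ?thesis using True by (simp add: min_def)
  next
    case False
    then show ?thesis using B(2)[of x] B(2)[of z] B1(1) by (simp add: min_def)
  qed
  moreover have "2 * B + B1 \<ge> 0" using B B1 by simp
  ultimately show ?thesis using that by blast
qed

text \<open>Both sides follow from \<open>1 + x \<le> exp x\<close>, used at \<open>x\<close> and at
  \<open>- x\<close>. It cancels the discount factor against the linear term of the generator up to
  second order.\<close>

lemma one_minus_exp_second_order:
  fixes x :: real assumes "\<bar>x\<bar> \<le> 1"
  shows "\<bar>exp (- x) * (1 + x) - 1\<bar> \<le> x\<^sup>2"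
proof -
  have "exp (- x) * (1 + x) \<le> exp (- x) * exp x" by (intro mult_left_mono exp_ge_add_one_self) auto
  then have 1: "exp (- x) * (1 + x) \<le> 1" by (simp flip: exp_add)
  have "(1 - x) * (1 + x) \<le> exp (- x) * (1 + x)"
    using exp_ge_add_one_self[of "- x"] assms by (intro mult_right_mono) auto
  then have "1 - x\<^sup>2 \<le> exp (- x) * (1 + x)" by (simp add: algebra_simps power2_eq_square)
  with 1 show ?thesis by linarith
qed

context sde begin

text \<open>Two separate arguments are needed because in the Euler sums the coefficients are
  evaluated at the solution and the derivatives of the test function at the Euler value.\<close>

lemma generator_modulus:
  assumes m1: "bounded_ucont f'" and m2: "bounded_ucont f''" and \<eta>: "\<eta> > 0"
  obtains C where "C \<ge> 0"
    "\<And>x z x0 z0. \<bar>(b x * f' z + (\<sigma> x)\<^sup>2 * f'' z / 2) - (b x0 * f' z0 + (\<sigma> x0)\<^sup>2 * f'' z0 / 2)\<bar>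
      \<le> \<eta> + C * (min 1 \<bar>x - x0\<bar> + min 1 \<bar>z - z0\<bar>)"
proof -
  obtain B1 where B1: "B1 \<ge> 0" "\<And>x. \<bar>f' x\<bar> \<le> B1" using bounded_ucontD_bound[OF m1] by blast
  obtain B2 where B2: "B2 \<ge> 0" "\<And>x. \<bar>f'' x\<bar> \<le> B2" using bounded_ucontD_bound[OF m2] by blast
  define S where "S = B1 + K + B2 * K + K\<^sup>2"
  have K0: "K > 0" using K1 by simp
  have S: "S > 0" using B1 B2 K0 by (simp add: S_def add_nonneg_pos add_pos_nonneg)
  define e where "e = \<eta> / S"
  have e: "e > 0" "e * S = \<eta>" using S \<eta> by (auto simp: e_def)
  obtain C1 where C1: "C1 \<ge> 0" "\<And>x z. \<bar>b x - b z\<bar> \<le> e + C1 * min 1 \<bar>x - z\<bar>" using bounded_ucontD_modulus[OF mb e(1)] by blast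
  obtain C2 where C2: "C2 \<ge> 0" "\<And>x z. \<bar>f' x - f' z\<bar> \<le> e + C2 * min 1 \<bar>x - z\<bar>" using bounded_ucontD_modulus[OF m1 e(1)] by blast
  obtain C3 where C3: "C3 \<ge> 0" "\<And>x z. \<bar>\<sigma> x - \<sigma> z\<bar> \<le> e + C3 * min 1 \<bar>x - z\<bar>" using bounded_ucontD_modulus[OF ms e(1)] by blast
  obtain C4 where C4: "C4 \<ge> 0" "\<And>x z. \<bar>f'' x - f'' z\<bar> \<le> e + C4 * min 1 \<bar>x - z\<bar>" using bounded_ucontD_modulus[OF m2 e(1)] by blast
  define C where "C = B1 * C1 + K * C2 + B2 * K * C3 + K\<^sup>2 * C4"
  have nn: "0 \<le> B1 * C1" "0 \<le> K * C2" "0 \<le> B2 * K * C3" "0 \<le> K\<^sup>2 * C4"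
    using B1 B2 K0 C1 C2 C3 C4 by auto
  have "\<bar>(b x * f' z + (\<sigma> x)\<^sup>2 * f'' z / 2) - (b x0 * f' z0 + (\<sigma> x0)\<^sup>2 * f'' z0 / 2)\<bar>
      \<le> \<eta> + C * (min 1 \<bar>x - x0\<bar> + min 1 \<bar>z - z0\<bar>)" for x z x0 z0
  proof -
    define p where "p = min 1 \<bar>x - x0\<bar>"
    define q where "q = min 1 \<bar>z - z0\<bar>"
    have pq: "0 \<le> p" "0 \<le> q" by (auto simp: p_def q_def)
    have a1: "\<bar>b x - b x0\<bar> * \<bar>f' z\<bar> \<le> (e + C1 * p) * B1"
      unfolding p_def using C1 e by (intro mult_mono C1 B1) auto
    have a2: "\<bar>b x0\<bar> * \<bar>f' z - f' z0\<bar> \<le> K * (e + C2 * q)"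
      unfolding q_def using K0 by (intro mult_mono C2 Kb) auto
    have e1: "b x * f' z - b x0 * f' z0 = (b x - b x0) * f' z + b x0 * (f' z - f' z0)" by (simp add: algebra_simps)
    have 1: "\<bar>b x * f' z - b x0 * f' z0\<bar> \<le> (e + C1 * p) * B1 + K * (e + C2 * q)"
      unfolding e1 by (rule order_trans[OF abs_triangle_ineq add_mono]) (use a1 a2 in \<open>simp_all only: abs_mult\<close>)
    have "\<bar>\<sigma> x + \<sigma> x0\<bar> \<le> 2 * K" using Ks[of x] Ks[of x0] by linarith
    then have a3: "\<bar>\<sigma> x - \<sigma> x0\<bar> * \<bar>\<sigma> x + \<sigma> x0\<bar> * \<bar>f'' z\<bar> \<le> (e + C3 * p) * (2 * K) * B2"
      unfolding p_def using C3 e K0 by (intro mult_mono C3 B2) auto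
    have a4: "\<bar>\<sigma> x0\<bar>\<^sup>2 * \<bar>f'' z - f'' z0\<bar> \<le> K\<^sup>2 * (e + C4 * q)"
      unfolding q_def using power_mono[OF Ks, of x0 2] by (intro mult_mono C4) auto
    have e2: "(\<sigma> x)\<^sup>2 * f'' z - (\<sigma> x0)\<^sup>2 * f'' z0 = (\<sigma> x - \<sigma> x0) * (\<sigma> x + \<sigma> x0) * f'' z + (\<sigma> x0)\<^sup>2 * (f'' z - f'' z0)"
      by (simp add: algebra_simps power2_eq_square)
    have 2: "\<bar>(\<sigma> x)\<^sup>2 * f'' z - (\<sigma> x0)\<^sup>2 * f'' z0\<bar> \<le> (e + C3 * p) * (2 * K) * B2 + K\<^sup>2 * (e + C4 * q)"
      unfolding e2 by (rule order_trans[OF abs_triangle_ineq add_mono]) (use a3 a4 in \<open>simp_all only: abs_mult power_abs\<close>)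
    have 3: "0 \<le> K\<^sup>2 * (e + C4 * q)" using e C4 pq by auto
    have "\<bar>(b x * f' z + (\<sigma> x)\<^sup>2 * f'' z / 2) - (b x0 * f' z0 + (\<sigma> x0)\<^sup>2 * f'' z0 / 2)\<bar>
      \<le> (e + C1 * p) * B1 + K * (e + C2 * q) + (e + C3 * p) * K * B2 + K\<^sup>2 * (e + C4 * q)"
      using 1 2 3 by linarith
    also have "\<dots> = e * S + ((B1 * C1 + B2 * K * C3) * p + (K * C2 + K\<^sup>2 * C4) * q)"
      by (simp add: S_def algebra_simps)
    also have "\<dots> \<le> e * S + (C * p + C * q)"
      using nn pq by (intro add_left_mono add_mono mult_right_mono) (auto simp: C_def)
    finally show ?thesis using e(2) by (simp add: p_def q_def distrib_left)
  qed
  moreover have "C \<ge> 0" using nn by (simp add: C_def)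
  ultimately show ?thesis using that by blast
qed

text \<open>For fixed \<open>d\<close> the inner mesh \<open>d / 2 ^ m\<close> tends to 0, which
  removes the difference between Euler values and solution. What remains is the variation of the
  generator over one step of length \<open>d\<close>; its mean is controlled by increments of order
  \<open>sqrt d\<close> and is multiplied by \<open>d\<close>.\<close>

lemma X_generator:
  fixes f f' f'' :: "real \<Rightarrow> real"
  assumes d1: "\<And>x. (f has_real_derivative f' x) (at x)"
    and d2: "\<And>x. (f' has_real_derivative f'' x) (at x)"
    and m0: "bounded_ucont f" and m1: "bounded_ucont f'" and m2: "bounded_ucont f''" and \<eta>: "\<eta> > 0"
  obtains d0 where "d0 > 0"
    "\<And>d j \<psi>. 0 < d \<Longrightarrow> d < d0 \<Longrightarrow> \<psi> \<in> borel_measurable (F (real j * d)) \<Longrightarrow> (\<And>\<omega>. \<bar>\<psi> \<omega>\<bar> \<le> 1) \<Longrightarrow>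
      \<bar>expectation (\<lambda>\<omega>. \<psi> \<omega> * (f (X (real (Suc j) * d) \<omega>) - f (X (real j * d) \<omega>) - d *
        (b (X (real j * d) \<omega>) * f' (X (real j * d) \<omega>) + (\<sigma> (X (real j * d) \<omega>))\<^sup>2 * f'' (X (real j * d) \<omega>) / 2)))\<bar>
      \<le> d * \<eta>"
proof -
  define \<eta>4 where "\<eta>4 = \<eta> / 4"
  have e4: "\<eta>4 > 0" using \<eta> by (simp add: \<eta>4_def)
  obtain L where L: "L \<ge> 0" "\<And>x z. \<bar>f x - f z\<bar> \<le> L * min 1 \<bar>x - z\<bar>" using C1_modulus[OF d1 m0 m1] by blast
  obtain B where B: "B \<ge> 0" "\<And>x. \<bar>f x\<bar> \<le> B" using bounded_ucontD_bound[OF m0] by blast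
  define G where "G x z = b x * f' z + (\<sigma> x)\<^sup>2 * f'' z / 2" for x z
  obtain C where C: "C \<ge> 0" "\<And>x z x0 z0. \<bar>G x z - G x0 z0\<bar> \<le> \<eta>4 + C * (min 1 \<bar>x - x0\<bar> + min 1 \<bar>z - z0\<bar>)"
    using generator_modulus[OF m1 m2 e4] unfolding G_def by blast
  obtain h0 where h0: "h0 > 0"
    "\<And>h a n \<psi>. 0 < h \<Longrightarrow> h < h0 \<Longrightarrow> a \<le> n \<Longrightarrow>
      \<psi> \<in> borel_measurable (F (real a * h)) \<Longrightarrow> (\<And>\<omega>. \<bar>\<psi> \<omega>\<bar> \<le> 1) \<Longrightarrow>
      \<bar>expectation (\<lambda>\<omega>. \<psi> \<omega> * (f (euler h n \<omega>) - f (euler h a \<omega>) - (\<Sum>l\<in>{a..<n}. h * G (X (real l * h) \<omega>) (euler h l \<omega>))))\<bar>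
      \<le> real (n - a) * h * \<eta>4"
    using euler_generator[OF d1 d2 m0 m1 m2 e4] unfolding G_def by blast
  obtain B1 where B1: "B1 \<ge> 0" "\<And>x. \<bar>f' x\<bar> \<le> B1" using bounded_ucontD_bound[OF m1] by blast
  obtain B2 where B2: "B2 \<ge> 0" "\<And>x. \<bar>f'' x\<bar> \<le> B2" using bounded_ucontD_bound[OF m2] by blast
  have K0: "K > 0" using K1 by simp
  have GB: "\<bar>G x z\<bar> \<le> K * B1 + K\<^sup>2 * B2" for x z
  proof -
    have "\<bar>b x * f' z\<bar> \<le> K * B1" unfolding abs_mult using K0 by (intro mult_mono Kb B1) auto
    moreover have "\<bar>(\<sigma> x)\<^sup>2 * f'' z\<bar> \<le> K\<^sup>2 * B2"
      unfolding abs_mult power_abs using power_mono[OF Ks, of x 2] by (intro mult_mono B2) auto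
    ultimately show ?thesis unfolding G_def by linarith
  qed
  have cf[measurable]: "f \<in> borel_measurable borel" "f' \<in> borel_measurable borel" "f'' \<in> borel_measurable borel"
     "b \<in> borel_measurable borel" "\<sigma> \<in> borel_measurable borel"
    using m0 m1 m2 mb ms by (auto intro!: borel_measurable_continuous_onI bounded_ucont_continuous)
  \<comment> \<open>For \<open>d < r\<^sup>2\<close> and \<open>d < 1\<close> the increment bound
    \<open>D\<close> is at most \<open>4 * K * r\<close>, so
    \<open>C * (2 * D) \<le> 8 * C * K * r \<le> \<eta> / 4\<close>. The summand 1 covers
    \<open>C = 0\<close>.\<close>
  define r where "r = \<eta> / (32 * C * K + 1)"
  have den: "32 * C * K + 1 > 0" using C K0 by (simp add: add_nonneg_pos)
  have r: "r > 0" using \<eta> den by (simp add: r_def)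
  define d0 where "d0 = min 1 (r\<^sup>2)"
  have main: "\<bar>expectation (\<lambda>\<omega>. \<psi> \<omega> * (f (X (real (Suc j) * d) \<omega>) - f (X (real j * d) \<omega>) - d * G (X (real j * d) \<omega>) (X (real j * d) \<omega>)))\<bar>
      \<le> d * \<eta>" (is "?LHS \<le> _")
    if d: "0 < d" "d < d0" and p: "\<psi> \<in> borel_measurable (F (real j * d))" "\<And>\<omega>. \<bar>\<psi> \<omega>\<bar> \<le> 1" for d j \<psi>
  proof -
    have dd: "d < 1" "d < r\<^sup>2" using d by (auto simp: d0_def)
    define D where "D = 2 * (K * d + K * sqrt d)"
    have CD: "C * (2 * D) \<le> \<eta>4"
    proof -
      have sd: "sqrt d < r" using dd r real_sqrt_less_mono[of d "r\<^sup>2"] by simp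
      have "d * d \<le> d * 1" using d dd by (intro mult_left_mono) auto
      then have "d \<le> sqrt d" using d by (intro real_le_rsqrt) (simp add: power2_eq_square)
      then have "D \<le> 4 * K * sqrt d" unfolding D_def using K0 by simp
      also have "\<dots> \<le> 4 * K * r" using sd K0 by simp
      finally have "C * (2 * D) \<le> C * (2 * (4 * K * r))" using C by (intro mult_left_mono) auto
      also have "\<dots> = (8 * C * K) * r" by simp
      also have "\<dots> \<le> \<eta> / 4" using den \<eta> by (simp add: r_def field_simps)
      finally show ?thesis by (simp add: \<eta>4_def)
    qed
    have nnj: "0 \<le> real i * d" for i using d by simp
    have XM[measurable]: "X (real i * d) \<in> borel_measurable M" for i using XmM[OF nnj] .
    have pM[measurable]: "\<psi> \<in> borel_measurable M" by (rule meas_F_M[OF nnj p(1)])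
    define err where "err m = dprob (euler (d / 2^m) (Suc j * 2^m)) (X (real (Suc j) * d)) + dprob (euler (d / 2^m) (j * 2^m)) (X (real j * d))" for m
    have err0: "err \<longlonglongrightarrow> 0"
      unfolding err_def[abs_def] using tendsto_add[OF euler_conv[OF d(1), of "Suc j"] euler_conv[OF d(1), of j]] by simp
    have bound: "?LHS \<le> d * (3 * \<eta>4) + (L + d * C) * err m" if m: "d / 2^m < h0" for m
    proof -
      define h where "h = d / 2^m"
      define a where "a = j * 2^m"
      define n where "n = Suc j * 2^m"
      have h: "0 < h" "h < h0" using d m by (auto simp: h_def)
      have an: "a \<le> n" "n - a = 2^m" by (auto simp: a_def n_def)
      have ah: "real a * h = real j * d" and nh: "real n * h = real (Suc j) * d"
        unfolding a_def n_def h_def of_nat_mult by (simp_all del: of_nat_Suc)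
      have nah: "real (n - a) * h = d" unfolding an(2) by (simp add: h_def)
      have nn: "0 \<le> real l * h" for l using h by simp
      have eM[measurable]: "euler h l \<in> borel_measurable M" for l by (rule meas_F_M[OF nn euler_meas[OF h(1)]])
      have XhM[measurable]: "X (real l * h) \<in> borel_measurable M" for l by (rule XmM[OF nn])
      let ?Y = "euler h"
      let ?X = "X (real j * d)" and ?X' = "X (real (Suc j) * d)"
      have er: "err m = dprob (?Y n) ?X' + dprob (?Y a) ?X" by (simp add: err_def h_def a_def n_def)
      define P0 where "P0 \<omega> = \<psi> \<omega> * (f (?X' \<omega>) - f (?X \<omega>) - d * G (?X \<omega>) (?X \<omega>))" for \<omega>
      define P1 where "P1 \<omega> = \<psi> \<omega> * (f (?Y n \<omega>) - f (?Y a \<omega>) - (\<Sum>l\<in>{a..<n}. h * G (X (real l * h) \<omega>) (?Y l \<omega>)))" for \<omega>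
      have EP1: "\<bar>expectation P1\<bar> \<le> d * \<eta>4"
        using h0(2)[OF h an(1) _ p(2)] p(1) unfolding P1_def nah ah by simp
      have P0m[measurable]: "P0 \<in> borel_measurable M" unfolding P0_def[abs_def] G_def by measurable
      have P1m[measurable]: "P1 \<in> borel_measurable M" unfolding P1_def[abs_def] G_def by measurable
      have P0B: "\<bar>P0 \<omega>\<bar> \<le> 1 * (2 * B + d * (K * B1 + K\<^sup>2 * B2))" for \<omega>
      proof -
        have "\<bar>d * G (?X \<omega>) (?X \<omega>)\<bar> \<le> d * (K * B1 + K\<^sup>2 * B2)"
          unfolding abs_mult using d GB by (intro mult_mono) auto
        then have "\<bar>f (?X' \<omega>) - f (?X \<omega>) - d * G (?X \<omega>) (?X \<omega>)\<bar> \<le> 2 * B + d * (K * B1 + K\<^sup>2 * B2)"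
          using B(2)[of "?X' \<omega>"] B(2)[of "?X \<omega>"] by linarith
        then show ?thesis unfolding P0_def abs_mult by (intro mult_mono p(2)) auto
      qed
      have P0i: "integrable M P0" by (rule integrable_const_bound[OF AE_I2[OF P0B[folded real_norm_def]] P0m])
      \<comment> \<open>Pointwise majorant of the difference: the first two terms exchange the Euler
        values at the ends for the solution, the sum moves both arguments of \<open>G\<close> back
        to the start of the step.\<close>
      define U where "U \<omega> = L * min 1 \<bar>?Y n \<omega> - ?X' \<omega>\<bar> + L * min 1 \<bar>?Y a \<omega> - ?X \<omega>\<bar> +
          (\<Sum>l\<in>{a..<n}. h * (\<eta>4 + C * (min 1 \<bar>X (real l * h) \<omega> - ?X \<omega>\<bar> + min 1 \<bar>?Y l \<omega> - ?X \<omega>\<bar>)))" for \<omega>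
      have UB: "\<bar>P0 \<omega> - P1 \<omega>\<bar> \<le> U \<omega>" for \<omega>
      proof -
        have dG: "d * G (?X \<omega>) (?X \<omega>) = (\<Sum>l\<in>{a..<n}. h * G (?X \<omega>) (?X \<omega>))"
          using nah by (simp add: mult.assoc[symmetric])
        have "P0 \<omega> - P1 \<omega> = \<psi> \<omega> * ((f (?X' \<omega>) - f (?Y n \<omega>)) - (f (?X \<omega>) - f (?Y a \<omega>)) +
           (\<Sum>l\<in>{a..<n}. h * (G (X (real l * h) \<omega>) (?Y l \<omega>) - G (?X \<omega>) (?X \<omega>))))"
          unfolding P0_def P1_def dG right_diff_distrib sum_subtractf by (simp add: algebra_simps)
        also have "\<bar>\<dots>\<bar> \<le> 1 * U \<omega>"
          unfolding abs_mult
        proof (rule mult_mono[OF p(2)])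
          have "\<bar>\<Sum>l\<in>{a..<n}. h * (G (X (real l * h) \<omega>) (?Y l \<omega>) - G (?X \<omega>) (?X \<omega>))\<bar> \<le>
            (\<Sum>l\<in>{a..<n}. h * (\<eta>4 + C * (min 1 \<bar>X (real l * h) \<omega> - ?X \<omega>\<bar> + min 1 \<bar>?Y l \<omega> - ?X \<omega>\<bar>)))"
            by (rule order_trans[OF sum_abs sum_mono]) (use h C(2) in \<open>auto simp: abs_mult intro!: mult_left_mono\<close>)
          moreover have "\<bar>f (?X' \<omega>) - f (?Y n \<omega>)\<bar> \<le> L * min 1 \<bar>?Y n \<omega> - ?X' \<omega>\<bar>"
            using L(2)[of "?X' \<omega>" "?Y n \<omega>"] by (simp add: abs_minus_commute)
          moreover have "\<bar>f (?X \<omega>) - f (?Y a \<omega>)\<bar> \<le> L * min 1 \<bar>?Y a \<omega> - ?X \<omega>\<bar>"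
            using L(2)[of "?X \<omega>" "?Y a \<omega>"] by (simp add: abs_minus_commute)
          ultimately show "\<bar>(f (?X' \<omega>) - f (?Y n \<omega>)) - (f (?X \<omega>) - f (?Y a \<omega>)) +
           (\<Sum>l\<in>{a..<n}. h * (G (X (real l * h) \<omega>) (?Y l \<omega>) - G (?X \<omega>) (?X \<omega>)))\<bar> \<le> U \<omega>"
            unfolding U_def by linarith
        qed auto
        finally show ?thesis by simp
      qed
      have i: "integrable M (\<lambda>\<omega>. min 1 \<bar>?Y n \<omega> - ?X' \<omega>\<bar>)" "integrable M (\<lambda>\<omega>. min 1 \<bar>?Y a \<omega> - ?X \<omega>\<bar>)"
         "integrable M (\<lambda>\<omega>. min 1 \<bar>X (real l * h) \<omega> - ?X \<omega>\<bar>)" "integrable M (\<lambda>\<omega>. min 1 \<bar>?Y l \<omega> - ?X \<omega>\<bar>)" for l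
        by (intro dprob_integrable eM XM XhM)+
      have Ui: "integrable M U" unfolding U_def[abs_def]
        by (intro Bochner_Integration.integrable_add Bochner_Integration.integrable_sum integrable_mult_right impI i integrable_const)
      have sumE: "expectation (\<lambda>\<omega>. h * (\<eta>4 + C * (min 1 \<bar>X (real l * h) \<omega> - ?X \<omega>\<bar> + min 1 \<bar>?Y l \<omega> - ?X \<omega>\<bar>))) =
          h * (\<eta>4 + C * (dprob (X (real l * h)) ?X + dprob (?Y l) ?X))" for l
        unfolding dprob_def using i(3,4)[of l] by (simp add: prob_space)
      have EU: "expectation U = L * err m + (\<Sum>l\<in>{a..<n}. h * (\<eta>4 + C * (dprob (X (real l * h)) ?X + dprob (?Y l) ?X)))"
      proof -
        have "expectation U = expectation (\<lambda>\<omega>. L * min 1 \<bar>?Y n \<omega> - ?X' \<omega>\<bar> + L * min 1 \<bar>?Y a \<omega> - ?X \<omega>\<bar>) +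
          expectation (\<lambda>\<omega>. \<Sum>l\<in>{a..<n}. h * (\<eta>4 + C * (min 1 \<bar>X (real l * h) \<omega> - ?X \<omega>\<bar> + min 1 \<bar>?Y l \<omega> - ?X \<omega>\<bar>)))"
          unfolding U_def[abs_def]
          by (intro Bochner_Integration.integral_add Bochner_Integration.integrable_add Bochner_Integration.integrable_sum integrable_mult_right impI i integrable_const)
        also have "expectation (\<lambda>\<omega>. L * min 1 \<bar>?Y n \<omega> - ?X' \<omega>\<bar> + L * min 1 \<bar>?Y a \<omega> - ?X \<omega>\<bar>) = L * err m"
          unfolding er dprob_def using i(1,2) by (simp add: distrib_left)
        also have "expectation (\<lambda>\<omega>. \<Sum>l\<in>{a..<n}. h * (\<eta>4 + C * (min 1 \<bar>X (real l * h) \<omega> - ?X \<omega>\<bar> + min 1 \<bar>?Y l \<omega> - ?X \<omega>\<bar>))) =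
          (\<Sum>l\<in>{a..<n}. expectation (\<lambda>\<omega>. h * (\<eta>4 + C * (min 1 \<bar>X (real l * h) \<omega> - ?X \<omega>\<bar> + min 1 \<bar>?Y l \<omega> - ?X \<omega>\<bar>))))"
          by (rule Bochner_Integration.integral_sum) (intro Bochner_Integration.integrable_add integrable_mult_right impI i integrable_const)
        finally show ?thesis unfolding sumE .
      qed
      have mono: "2 * (K * (real (l - a) * h) + K * sqrt (real (l - a) * h)) \<le> D" if "l \<in> {a..<n}" for l
      proof -
        have "real (l - a) * h \<le> real (n - a) * h" using that h by (intro mult_right_mono) auto
        then have "real (l - a) * h \<le> d" unfolding nah .
        then show ?thesis unfolding D_def using K0 by (intro mult_left_mono add_mono real_sqrt_le_mono) auto
      qed
      have "(\<Sum>l\<in>{a..<n}. h * (\<eta>4 + C * (dprob (X (real l * h)) ?X + dprob (?Y l) ?X))) \<le>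
          (\<Sum>l\<in>{a..<n}. h * (\<eta>4 + C * (2 * D + err m)))"
      proof (intro sum_mono mult_left_mono add_left_mono)
        fix l assume l: "l \<in> {a..<n}"
        have "dprob (X (real l * h)) ?X \<le> D"
          using X_incr[OF h(1), of a l] mono[OF l] l unfolding ah by auto
        moreover have "dprob (?Y l) (?Y a) \<le> D" using euler_incr[OF h(1), of a l] mono[OF l] l by auto
        moreover have "dprob (?Y l) ?X \<le> dprob (?Y l) (?Y a) + dprob (?Y a) ?X" by (rule dprob_triangle) measurable
        moreover have "dprob (?Y a) ?X \<le> err m" unfolding er using dprob_nonneg by simp
        ultimately show "dprob (X (real l * h)) ?X + dprob (?Y l) ?X \<le> 2 * D + err m" by linarith
      qed (use h C in auto)
      also have "\<dots> = d * (\<eta>4 + C * (2 * D + err m))" using nah by (simp add: mult.assoc[symmetric])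
      also have "\<dots> \<le> d * (2 * \<eta>4) + d * C * err m"
        using mult_left_mono[OF CD less_imp_le[OF d(1)]] by (simp add: algebra_simps)
      finally have EU2: "expectation U \<le> d * (2 * \<eta>4) + (L + d * C) * err m" unfolding EU by (simp add: algebra_simps)
      have P1i: "integrable M P1"
      proof -
        have "integrable M (\<lambda>\<omega>. P0 \<omega> - P1 \<omega>)"
          by (rule Bochner_Integration.integrable_bound[OF Ui]) (use UB in \<open>auto intro!: AE_I2 order_trans[OF _ abs_ge_self]\<close>)
        from Bochner_Integration.integrable_diff[OF P0i this] show ?thesis by simp
      qed
      have "\<bar>expectation P0 - expectation P1\<bar> = \<bar>expectation (\<lambda>\<omega>. P0 \<omega> - P1 \<omega>)\<bar>" using P0i P1i by simp
      also have "\<dots> \<le> expectation (\<lambda>\<omega>. \<bar>P0 \<omega> - P1 \<omega>\<bar>)" by (rule integral_abs_bound)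
      also have "\<dots> \<le> expectation U" using P0i P1i Ui UB by (intro Bochner_Integration.integral_mono) auto
      finally have "\<bar>expectation P0\<bar> \<le> d * \<eta>4 + (d * (2 * \<eta>4) + (L + d * C) * err m)" using EP1 EU2 by linarith
      then show ?thesis unfolding P0_def by (simp add: algebra_simps)
    qed
    have "(\<lambda>m. d / 2^m) \<longlonglongrightarrow> 0" using LIMSEQ_divide_realpow_zero[of 2 d] by simp
    then have ev: "eventually (\<lambda>m. d / 2^m < h0) sequentially" using h0(1) by (rule order_tendstoD)
    have "(\<lambda>m. d * (3 * \<eta>4) + (L + d * C) * err m) \<longlonglongrightarrow> d * (3 * \<eta>4) + (L + d * C) * 0"
      by (intro tendsto_intros err0)
    then have "?LHS \<le> d * (3 * \<eta>4) + (L + d * C) * 0"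
      by (rule tendsto_lowerbound) (use ev bound in \<open>auto elim: eventually_mono\<close>)
    also have "\<dots> \<le> d * \<eta>" using d \<eta> by (simp add: \<eta>4_def)
    finally show ?thesis .
  qed
  have "d0 > 0" using r by (simp add: d0_def)
  then show ?thesis using that main unfolding G_def by blast
qed

text \<open>The bounded test function can satisfy the eigenvalue equation only near the centre
  \<open>c\<close>; the support condition on \<psi> confines the computation to that region.\<close>

lemma discounted_generator:
  fixes f f' f'' :: "real \<Rightarrow> real"
  assumes d1: "\<And>x. (f has_real_derivative f' x) (at x)"
    and d2: "\<And>x. (f' has_real_derivative f'' x) (at x)"
    and m0: "bounded_ucont f" and m1: "bounded_ucont f'" and m2: "bounded_ucont f''" and \<eta>: "\<eta> > 0"
    and eig: "\<And>x. \<bar>x - c\<bar> \<le> 1 \<Longrightarrow> b x * f' x + (\<sigma> x)\<^sup>2 * f'' x / 2 = \<nu> * f x"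
  obtains d0 where "d0 > 0"
    "\<And>d j \<psi>. 0 < d \<Longrightarrow> d < d0 \<Longrightarrow> \<psi> \<in> borel_measurable (F (real j * d)) \<Longrightarrow> (\<And>\<omega>. \<bar>\<psi> \<omega>\<bar> \<le> 1) \<Longrightarrow>
      (\<And>\<omega>. \<omega> \<in> space M \<Longrightarrow> \<psi> \<omega> \<noteq> 0 \<Longrightarrow> \<bar>X (real j * d) \<omega> - c\<bar> \<le> 1) \<Longrightarrow>
      \<bar>expectation (\<lambda>\<omega>. \<psi> \<omega> * (exp (- \<nu> * d) * f (X (real (Suc j) * d) \<omega>) - f (X (real j * d) \<omega>)))\<bar> \<le> d * \<eta>"
proof -
  define \<eta>' where "\<eta>' = \<eta> / (2 * exp 1)"
  have e': "\<eta>' > 0" using \<eta> by (simp add: \<eta>'_def)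
  obtain B where B: "B \<ge> 0" "\<And>x. \<bar>f x\<bar> \<le> B" using bounded_ucontD_bound[OF m0] by blast
  obtain d1 where d1: "d1 > 0"
    "\<And>d j \<psi>. 0 < d \<Longrightarrow> d < d1 \<Longrightarrow> \<psi> \<in> borel_measurable (F (real j * d)) \<Longrightarrow> (\<And>\<omega>. \<bar>\<psi> \<omega>\<bar> \<le> 1) \<Longrightarrow>
      \<bar>expectation (\<lambda>\<omega>. \<psi> \<omega> * (f (X (real (Suc j) * d) \<omega>) - f (X (real j * d) \<omega>) - d *
        (b (X (real j * d) \<omega>) * f' (X (real j * d) \<omega>) + (\<sigma> (X (real j * d) \<omega>))\<^sup>2 * f'' (X (real j * d) \<omega>) / 2)))\<bar>
      \<le> d * \<eta>'"
    using X_generator[OF d1 d2 m0 m1 m2 e'] by blast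
  have cf[measurable]: "f \<in> borel_measurable borel"
    using m0 by (auto intro!: borel_measurable_continuous_onI bounded_ucont_continuous)
  define Q where "Q = 2 * \<nu>\<^sup>2 * B + 1"
  have Q: "Q > 0" using B by (simp add: Q_def add_nonneg_pos)
  \<comment> \<open>The second entry gives \<open>\<bar>\<nu> * d\<bar> \<le> 1\<close>, hence a
    discount factor of at most \<open>exp 1\<close>; the third makes the quadratic remainder at most
    \<open>d * (\<eta> / 2)\<close>.\<close>
  define d0 where "d0 = min d1 (min (1 / (\<bar>\<nu>\<bar> + 1)) (\<eta> / Q))"
  have "d0 > 0" using d1 Q \<eta> by (simp add: d0_def)
  moreover have "\<bar>expectation (\<lambda>\<omega>. \<psi> \<omega> * (exp (- \<nu> * d) * f (X (real (Suc j) * d) \<omega>) - f (X (real j * d) \<omega>)))\<bar> \<le> d * \<eta>"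
    if d: "0 < d" "d < d0" and p: "\<psi> \<in> borel_measurable (F (real j * d))" "\<And>\<omega>. \<bar>\<psi> \<omega>\<bar> \<le> 1"
      and sup: "\<And>\<omega>. \<omega> \<in> space M \<Longrightarrow> \<psi> \<omega> \<noteq> 0 \<Longrightarrow> \<bar>X (real j * d) \<omega> - c\<bar> \<le> 1" for d j \<psi>
  proof -
    have dd: "d < d1" "d * (\<bar>\<nu>\<bar> + 1) < 1" "d * Q < \<eta>" using d Q by (auto simp: d0_def field_simps)
    have ld: "\<bar>\<nu> * d\<bar> \<le> 1" using dd d by (simp add: abs_mult algebra_simps)
    have nnj: "0 \<le> real i * d" for i using d by simp
    let ?X = "X (real j * d)" and ?X' = "X (real (Suc j) * d)"
    have [measurable]: "?X \<in> borel_measurable M" "?X' \<in> borel_measurable M" "\<psi> \<in> borel_measurable M"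
      by (rule XmM[OF nnj], rule XmM[OF nnj], rule meas_F_M[OF nnj p(1)])
    define P0 where "P0 \<omega> = \<psi> \<omega> * (f (?X' \<omega>) - f (?X \<omega>) - d * (\<nu> * f (?X \<omega>)))" for \<omega>
    have pfB: "\<bar>\<psi> \<omega> * f x\<bar> \<le> 1 * B" for \<omega> x unfolding abs_mult by (intro mult_mono p(2) B(2)) auto
    have mm: "(\<lambda>\<omega>. \<psi> \<omega> * f (?X \<omega>)) \<in> borel_measurable M" "(\<lambda>\<omega>. \<psi> \<omega> * f (?X' \<omega>)) \<in> borel_measurable M"
      by measurable
    note i1 = integrable_const_bound[OF AE_I2[OF pfB[folded real_norm_def]] mm(1)]
      integrable_const_bound[OF AE_I2[OF pfB[folded real_norm_def]] mm(2)]
    have P0e: "P0 \<omega> = \<psi> \<omega> * f (?X' \<omega>) - \<psi> \<omega> * f (?X \<omega>) - (d * \<nu>) * (\<psi> \<omega> * f (?X \<omega>))" for \<omega>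
      by (simp add: P0_def algebra_simps)
    have P0i: "integrable M P0" unfolding P0e[abs_def] using i1 by auto
    have EP0: "\<bar>expectation P0\<bar> \<le> d * \<eta>'"
    proof -
      have "expectation P0 = expectation (\<lambda>\<omega>. \<psi> \<omega> * (f (?X' \<omega>) - f (?X \<omega>) - d *
        (b (?X \<omega>) * f' (?X \<omega>) + (\<sigma> (?X \<omega>))\<^sup>2 * f'' (?X \<omega>) / 2)))"
      proof (rule Bochner_Integration.integral_cong[OF refl])
        fix \<omega> assume w: "\<omega> \<in> space M"
        show "P0 \<omega> = \<psi> \<omega> * (f (?X' \<omega>) - f (?X \<omega>) - d * (b (?X \<omega>) * f' (?X \<omega>) + (\<sigma> (?X \<omega>))\<^sup>2 * f'' (?X \<omega>) / 2))"
        proof (cases "\<psi> \<omega> = 0")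
          case False
          then show ?thesis unfolding P0_def using eig[OF sup[OF w False]] by simp
        qed (simp add: P0_def)
      qed
      then show ?thesis using d1(2)[OF d(1) dd(1) p] by simp
    qed
    let ?q = "exp (- (\<nu> * d)) * (1 + \<nu> * d) - 1"
    have pw: "\<psi> \<omega> * (exp (- \<nu> * d) * f (?X' \<omega>) - f (?X \<omega>)) = exp (- (\<nu> * d)) * P0 \<omega> + ?q * (\<psi> \<omega> * f (?X \<omega>))" for \<omega>
      unfolding P0_def by (simp add: algebra_simps)
    have "\<bar>expectation (\<lambda>\<omega>. \<psi> \<omega> * f (?X \<omega>))\<bar> \<le> expectation (\<lambda>\<omega>. \<bar>\<psi> \<omega> * f (?X \<omega>)\<bar>)" by (rule integral_abs_bound)
    also have "\<dots> \<le> expectation (\<lambda>\<omega>. 1 * B)" using i1 pfB by (intro Bochner_Integration.integral_mono) auto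
    finally have Epf: "\<bar>expectation (\<lambda>\<omega>. \<psi> \<omega> * f (?X \<omega>))\<bar> \<le> B" by (simp add: prob_space)
    have "expectation (\<lambda>\<omega>. \<psi> \<omega> * (exp (- \<nu> * d) * f (?X' \<omega>) - f (?X \<omega>))) =
        exp (- (\<nu> * d)) * expectation P0 + ?q * expectation (\<lambda>\<omega>. \<psi> \<omega> * f (?X \<omega>))"
      unfolding pw using P0i i1 by simp
    also have "\<bar>\<dots>\<bar> \<le> exp 1 * (d * \<eta>') + (\<nu> * d)\<^sup>2 * B"
    proof (rule order_trans[OF abs_triangle_ineq add_mono])
      show "\<bar>exp (- (\<nu> * d)) * expectation P0\<bar> \<le> exp 1 * (d * \<eta>')"
        unfolding abs_mult using EP0 ld by (intro mult_mono) auto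
      show "\<bar>?q * expectation (\<lambda>\<omega>. \<psi> \<omega> * f (?X \<omega>))\<bar> \<le> (\<nu> * d)\<^sup>2 * B"
        unfolding abs_mult by (intro mult_mono one_minus_exp_second_order[OF ld] Epf) auto
    qed
    also have "\<dots> \<le> d * \<eta>"
    proof -
      have "(\<nu> * d)\<^sup>2 * B = d * (d * (\<nu>\<^sup>2 * B))" by (simp add: power2_eq_square)
      also have "d * (\<nu>\<^sup>2 * B) \<le> \<eta> / 2"
      proof -
        have "d * (2 * \<nu>\<^sup>2 * B) \<le> d * Q" using d by (intro mult_left_mono) (auto simp: Q_def)
        then show ?thesis using dd(3) by simp
      qed
      finally have "(\<nu> * d)\<^sup>2 * B \<le> d * (\<eta> / 2)" using d by simp
      moreover have "exp 1 * (d * \<eta>') = d * (\<eta> / 2)" by (simp add: \<eta>'_def)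
      moreover have "d * (\<eta> / 2) + d * (\<eta> / 2) = d * \<eta>" by simp
      ultimately show ?thesis by linarith
    qed
    finally show ?thesis .
  qed
  ultimately show ?thesis using that by blast
qed

text \<open>Each of the \<open>Suc N\<close> steps of length \<open>T / Suc N\<close> contributes at
  most its length times \<eta>, up to the discount factor
  \<open>exp (\<bar>\<nu>\<bar> * T)\<close>. The total is a multiple of \<eta> independent of
  \<open>N\<close>, and \<eta> is arbitrary.\<close>

lemma stopped_sum_tendsto:
  fixes f f' f'' :: "real \<Rightarrow> real" and \<psi> :: "real \<Rightarrow> 'a \<Rightarrow> real"
  assumes d1: "\<And>x. (f has_real_derivative f' x) (at x)"
    and d2: "\<And>x. (f' has_real_derivative f'' x) (at x)"
    and m0: "bounded_ucont f" and m1: "bounded_ucont f'" and m2: "bounded_ucont f''"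
    and eig: "\<And>x. \<bar>x - c\<bar> \<le> 1 \<Longrightarrow> b x * f' x + (\<sigma> x)\<^sup>2 * f'' x / 2 = \<nu> * f x"
    and T: "T > 0"
    and pm: "\<And>t. t \<ge> 0 \<Longrightarrow> \<psi> t \<in> borel_measurable (F t)" and p1: "\<And>t \<omega>. \<bar>\<psi> t \<omega>\<bar> \<le> 1"
    and sup: "\<And>t \<omega>. t \<ge> 0 \<Longrightarrow> \<omega> \<in> space M \<Longrightarrow> \<psi> t \<omega> \<noteq> 0 \<Longrightarrow> \<bar>X t \<omega> - c\<bar> \<le> 1"
  defines "g \<equiv> \<lambda>t \<omega>. exp (- \<nu> * t) * f (X t \<omega>)"
  shows "(\<lambda>N. expectation (\<lambda>\<omega>. \<Sum>k<Suc N. \<psi> (real k * (T / real (Suc N))) \<omega> *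
      (g (real (Suc k) * (T / real (Suc N))) \<omega> - g (real k * (T / real (Suc N))) \<omega>))) \<longlonglongrightarrow> 0"
proof (rule LIMSEQ_I)
  fix e :: real assume e: "e > 0"
  obtain B where B: "B \<ge> 0" "\<And>x. \<bar>f x\<bar> \<le> B" using bounded_ucontD_bound[OF m0] by blast
  have cf[measurable]: "f \<in> borel_measurable borel"
    using m0 by (auto intro!: borel_measurable_continuous_onI bounded_ucont_continuous)
  define \<eta> where "\<eta> = e / (2 * T * exp (\<bar>\<nu>\<bar> * T))"
  have eta: "\<eta> > 0" using e T by (simp add: \<eta>_def)
  obtain d0 where d0: "d0 > 0"
    "\<And>d j \<psi>. 0 < d \<Longrightarrow> d < d0 \<Longrightarrow> \<psi> \<in> borel_measurable (F (real j * d)) \<Longrightarrow> (\<And>\<omega>. \<bar>\<psi> \<omega>\<bar> \<le> 1) \<Longrightarrow>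
      (\<And>\<omega>. \<omega> \<in> space M \<Longrightarrow> \<psi> \<omega> \<noteq> 0 \<Longrightarrow> \<bar>X (real j * d) \<omega> - c\<bar> \<le> 1) \<Longrightarrow>
      \<bar>expectation (\<lambda>\<omega>. \<psi> \<omega> * (exp (- \<nu> * d) * f (X (real (Suc j) * d) \<omega>) - f (X (real j * d) \<omega>)))\<bar> \<le> d * \<eta>"
    using discounted_generator[OF d1 d2 m0 m1 m2 eta eig] by blast
  have "(\<lambda>N. T / real (Suc N)) \<longlonglongrightarrow> 0" by (rule LIMSEQ_Suc[OF lim_const_over_n])
  then have "eventually (\<lambda>N. T / real (Suc N) < d0) sequentially" using d0(1) by (rule order_tendstoD)
  then obtain N0 where N0: "\<And>N. N \<ge> N0 \<Longrightarrow> T / real (Suc N) < d0" unfolding eventually_sequentially by blast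
  have "norm (expectation (\<lambda>\<omega>. \<Sum>k<Suc N. \<psi> (real k * (T / real (Suc N))) \<omega> *
      (g (real (Suc k) * (T / real (Suc N))) \<omega> - g (real k * (T / real (Suc N))) \<omega>)) - 0) < e" if N: "N \<ge> N0" for N
  proof -
    define d where "d = T / real (Suc N)"
    have d: "0 < d" "d < d0" "real (Suc N) * d = T" using T N0[OF N] by (auto simp: d_def)
    have nn: "0 \<le> real k * d" for k using d by simp
    have [measurable]: "X (real k * d) \<in> borel_measurable M" "\<psi> (real k * d) \<in> borel_measurable M" for k
      using XmM[OF nn] meas_F_M[OF nn pm[OF nn]] by auto
    define Q where "Q k \<omega> = \<psi> (real k * d) \<omega> * (exp (- \<nu> * d) * f (X (real (Suc k) * d) \<omega>) - f (X (real k * d) \<omega>))" for k \<omega>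
    have eq: "\<psi> (real k * d) \<omega> * (g (real (Suc k) * d) \<omega> - g (real k * d) \<omega>) = exp (- \<nu> * (real k * d)) * Q k \<omega>" for k \<omega>
    proof -
      have "exp (- \<nu> * (real (Suc k) * d)) = exp (- \<nu> * (real k * d)) * exp (- \<nu> * d)"
        unfolding exp_add[symmetric] by (simp add: algebra_simps)
      then show ?thesis unfolding g_def Q_def by (simp add: algebra_simps)
    qed
    have Qi: "integrable M (Q k)" for k
    proof (rule integrable_const_bound)
      show "Q k \<in> borel_measurable M" unfolding Q_def[abs_def] by measurable
      show "AE \<omega> in M. norm (Q k \<omega>) \<le> 1 * (exp (- \<nu> * d) * B + B)"
      proof (rule AE_I2)
        fix \<omega>
        have "\<bar>exp (- \<nu> * d) * f (X (real (Suc k) * d) \<omega>)\<bar> \<le> exp (- \<nu> * d) * B"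
          unfolding abs_mult by (intro mult_mono B) auto
        then have "\<bar>exp (- \<nu> * d) * f (X (real (Suc k) * d) \<omega>) - f (X (real k * d) \<omega>)\<bar> \<le> exp (- \<nu> * d) * B + B"
          using B(2)[of "X (real k * d) \<omega>"] by linarith
        then show "norm (Q k \<omega>) \<le> 1 * (exp (- \<nu> * d) * B + B)"
          unfolding Q_def real_norm_def abs_mult by (intro mult_mono p1) auto
      qed
    qed
    have "expectation (\<lambda>\<omega>. \<Sum>k<Suc N. exp (- \<nu> * (real k * d)) * Q k \<omega>) = (\<Sum>k<Suc N. exp (- \<nu> * (real k * d)) * expectation (Q k))"
      by (subst Bochner_Integration.integral_sum, intro integrable_mult_right impI Qi)
        (simp only: Bochner_Integration.integral_mult_right_zero)
    also have "\<bar>\<dots>\<bar> \<le> (\<Sum>k<Suc N. exp (\<bar>\<nu>\<bar> * T) * (d * \<eta>))"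
    proof (rule order_trans[OF sum_abs sum_mono])
      fix k assume "k \<in> {..<Suc N}"
      then have "real k * d \<le> real (Suc N) * d" using d by (intro mult_right_mono) auto
      then have kT: "real k * d \<le> T" unfolding d(3) .
      have "- \<nu> * (real k * d) \<le> \<bar>\<nu>\<bar> * T"
        using nn[of k] kT by (intro mult_mono) auto
      moreover have "\<bar>expectation (Q k)\<bar> \<le> d * \<eta>"
        unfolding Q_def by (rule d0(2)[OF d(1,2) pm[OF nn] p1 sup[OF nn]])
      ultimately show "\<bar>exp (- \<nu> * (real k * d)) * expectation (Q k)\<bar> \<le> exp (\<bar>\<nu>\<bar> * T) * (d * \<eta>)"
        unfolding abs_mult by (intro mult_mono) auto
    qed
    also have "\<dots> = real (Suc N) * d * (exp (\<bar>\<nu>\<bar> * T) * \<eta>)" by (simp add: algebra_simps)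
    also have "\<dots> = e / 2" unfolding d(3) using T by (simp add: \<eta>_def)
    finally show ?thesis unfolding d_def[symmetric] eq using e by simp
  qed
  then show "\<exists>N0. \<forall>N\<ge>N0. norm (expectation (\<lambda>\<omega>. \<Sum>k<Suc N. \<psi> (real k * (T / real (Suc N))) \<omega> *
      (g (real (Suc k) * (T / real (Suc N))) \<omega> - g (real k * (T / real (Suc N))) \<omega>)) - 0) < e" by blast
qed

end

subsection \<open>Cycles of a continuous path\<close>

definition sg :: "bool \<Rightarrow> real" where "sg e = (if e then 1 else - 1)"

definition disp :: "bool list \<Rightarrow> real" where "disp es = sum_list (map sg es)"

text \<open>Words list the signs of the cycles with the most recent one first. The existence clause is
  needed because \<open>Inf {}\<close> makes \<open>cycle_time\<close> a junk value when the path never completes the cycle.\<close>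
primrec cyc :: "(real \<Rightarrow> real) \<Rightarrow> bool list \<Rightarrow> bool" where
  "cyc x [] = True"
| "cyc x (e # es) = (cyc x es \<and>
     (\<exists>t\<ge>cycle_time x (length es). \<bar>x t - x (cycle_time x (length es))\<bar> = 1) \<and>
     x (cycle_time x (Suc (length es))) - x (cycle_time x (length es)) = sg e)"

definition fin :: "(real \<Rightarrow> real) \<Rightarrow> bool list \<Rightarrow> real \<Rightarrow> bool" where
  "fin x es s \<longleftrightarrow> cyc x es \<and> cycle_time x (length es) \<le> s"

text \<open>The displacement is measured from \<open>x 0 + disp es\<close>, which is the position at
  the start of the cycle. This avoids evaluating the path at a random time, so measurability can be
  read off. The inequality instead of equality is harmless by continuity.\<close>

definition hit :: "(real \<Rightarrow> real) \<Rightarrow> bool \<Rightarrow> bool list \<Rightarrow> real \<Rightarrow> bool" where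
  "hit x e es s \<longleftrightarrow> (\<exists>q\<in>{0..s}. fin x es q \<and> sg e * (x q - x 0 - disp es) \<ge> 1)"

definition active :: "(real \<Rightarrow> real) \<Rightarrow> bool list \<Rightarrow> real \<Rightarrow> bool" where
  "active x es s \<longleftrightarrow> fin x es s \<and> \<not> hit x True es s \<and> \<not> hit x False es s"

lemma exit_exists:
  fixes x :: "real \<Rightarrow> real"
  assumes c: "continuous_on {0..} x" and t: "0 \<le> \<tau>" "\<tau> \<le> r" and r: "\<bar>x r - x \<tau>\<bar> \<ge> (1::real)"
  obtains t where "\<tau> \<le> t" "t \<le> r" "\<bar>x t - x \<tau>\<bar> = 1"
proof -
  have "\<exists>t\<ge>\<tau>. t \<le> r \<and> \<bar>x t - x \<tau>\<bar> = 1"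
    by (rule IVT'[of "\<lambda>t. \<bar>x t - x \<tau>\<bar>"])
      (use t r in \<open>auto intro!: continuous_intros continuous_on_subset[OF c]\<close>)
  then show ?thesis using that by blast
qed

lemma exit_time:
  fixes x :: "real \<Rightarrow> real"
  assumes c: "continuous_on {0..} x" and t: "0 \<le> \<tau>" and ne: "\<exists>t\<ge>\<tau>. \<bar>x t - x \<tau>\<bar> = 1"
  defines "S \<equiv> Inf {t. t \<ge> \<tau> \<and> \<bar>x t - x \<tau>\<bar> = 1}"
  shows "\<tau> < S" "\<bar>x S - x \<tau>\<bar> = 1" "\<And>r. \<tau> \<le> r \<Longrightarrow> r < S \<Longrightarrow> \<bar>x r - x \<tau>\<bar> < 1"
    "\<And>r. \<tau> \<le> r \<Longrightarrow> \<bar>x r - x \<tau>\<bar> \<ge> 1 \<Longrightarrow> S \<le> r"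
proof -
  let ?S = "{t. t \<ge> \<tau> \<and> \<bar>x t - x \<tau>\<bar> = 1}"
  have eq: "?S = {\<tau>..} \<inter> (\<lambda>t. \<bar>x t - x \<tau>\<bar>) -` {1}" by auto
  have cl: "closed ?S" unfolding eq
    by (rule continuous_closed_preimage) (use t in \<open>auto intro!: continuous_intros continuous_on_subset[OF c]\<close>)
  have bb: "bdd_below ?S" by (rule bdd_belowI[of _ \<tau>]) auto
  have "?S \<noteq> {}" using ne by auto
  from closed_contains_Inf[OF this bb cl] have S: "\<tau> \<le> S" "\<bar>x S - x \<tau>\<bar> = 1" unfolding S_def by auto
  then show "\<bar>x S - x \<tau>\<bar> = 1" by simp
  show "\<tau> < S" using S by (cases "\<tau> = S") auto
  show le: "S \<le> r" if r: "\<tau> \<le> r" "\<bar>x r - x \<tau>\<bar> \<ge> 1" for r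
  proof -
    obtain q where q: "\<tau> \<le> q" "q \<le> r" "\<bar>x q - x \<tau>\<bar> = 1" using exit_exists[OF c t r] by blast
    have "S \<le> q" unfolding S_def by (rule cInf_lower[OF _ bb]) (use q in auto)
    then show ?thesis using q by simp
  qed
  show "\<bar>x r - x \<tau>\<bar> < 1" if "\<tau> \<le> r" "r < S" for r
    using le[OF that(1)] that(2) by fastforce
qed

lemma sg_cases: "\<bar>z\<bar> = (1::real) \<Longrightarrow> z = sg e \<or> z = sg (\<not> e)" "sg (\<not> e) = - sg e" "sg e * sg e = 1" "\<bar>sg e\<bar> = 1"
  by (auto simp: sg_def abs_if split: if_splits)

context
  fixes x :: "real \<Rightarrow> real"
  assumes c: "continuous_on {0..} x"
begin

lemma cyc_time_pos: "cyc x es \<Longrightarrow> 0 \<le> cycle_time x (length es)"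
proof (induct es)
  case (Cons e es)
  then show ?case using exit_time(1)[OF c, of "cycle_time x (length es)"] by simp
qed simp

lemma cyc_pos: "cyc x es \<Longrightarrow> x (cycle_time x (length es)) = x 0 + disp es"
proof (induct es)
  case (Cons e es)
  then show ?case by (simp add: disp_def)
qed (simp add: disp_def)

lemma cyc_step:
  assumes "cyc x (e # es)"
  shows "cycle_time x (length es) < cycle_time x (Suc (length es))"
    "\<And>r. cycle_time x (length es) \<le> r \<Longrightarrow> r < cycle_time x (Suc (length es)) \<Longrightarrow> \<bar>x r - x (cycle_time x (length es))\<bar> < 1"
    "x (cycle_time x (Suc (length es))) - x (cycle_time x (length es)) = sg e"
  using assms exit_time(1,3)[OF c cyc_time_pos[of es]] by auto

lemma cyc_exit:
  assumes es: "cyc x es" and r: "cycle_time x (length es) \<le> r" "\<bar>x r - x (cycle_time x (length es))\<bar> \<ge> 1"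
  shows "cycle_time x (Suc (length es)) \<le> r" "\<exists>e. cyc x (e # es)"
proof -
  have ne: "\<exists>t\<ge>cycle_time x (length es). \<bar>x t - x (cycle_time x (length es))\<bar> = 1"
    using exit_exists[OF c cyc_time_pos[OF es] r] by blast
  note ex = exit_time[OF c cyc_time_pos[OF es] ne]
  show "cycle_time x (Suc (length es)) \<le> r" using ex(4)[OF r] by simp
  show "\<exists>e. cyc x (e # es)" using es ne sg_cases(1)[OF ex(2), of True] by auto
qed

declare cycle_time.simps(2)[simp del]

lemma cyc_unique: "cyc x es \<Longrightarrow> cyc x es' \<Longrightarrow> length es = length es' \<Longrightarrow> es = es'"
proof (induct es arbitrary: es')
  case (Cons e es)
  then obtain e' fs where es': "es' = e' # fs" by (cases es') auto
  with Cons have "es = fs" by auto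
  with Cons es' have "sg e = sg e'" by simp
  then show ?case using es' \<open>es = fs\<close> by (auto simp: sg_def split: if_splits)
qed simp

lemma fin_mono: "fin x es s \<Longrightarrow> s \<le> t \<Longrightarrow> fin x es t" by (auto simp: fin_def)

text \<open>From right to left, the displacement attains its maximum between the start of the cycle
  and \<open>s\<close>, and rational times with values close to 1 force this maximum to be at least
  1. The result expresses reaching a level through countably many times not exceeding
  \<open>s\<close>.\<close>

lemma hit_iff_rational:
  assumes s: "s \<ge> 0"
  shows "hit x e es s \<longleftrightarrow> (\<forall>j::nat. \<exists>q\<in>\<rat> \<inter> {0..s}. fin x es q \<and> sg e * (x q - x 0 - disp es) > 1 - 1 / real (Suc j))"
    (is "?L \<longleftrightarrow> ?R")
proof
  let ?v = "\<lambda>q. sg e * (x q - x 0 - disp es)"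
  let ?T = "cycle_time x (length es)"
  have cv: "continuous_on {0..} ?v" by (intro continuous_intros c)
  show ?R if ?L
  proof
    fix j :: nat
    from that obtain q0 where q0: "0 \<le> q0" "q0 \<le> s" "fin x es q0" "?v q0 \<ge> 1" by (auto simp: hit_def)
    have es: "cyc x es" "?T \<le> q0" using q0(3) by (auto simp: fin_def)
    have "?v ?T = 0" using cyc_pos[OF es(1)] by simp
    \<comment> \<open>The displacement is 0 at the start of the cycle and at least 1 at
      \<open>q0\<close>, so a rational time fits strictly between; lying to the left of
      \<open>q0\<close>, it stays within the horizon.\<close>
    then have lt: "?T < q0" using q0(4) es(2) by (cases "?T = q0") auto
    obtain d where d: "d > 0" "\<And>q. q \<ge> 0 \<Longrightarrow> \<bar>q - q0\<bar> < d \<Longrightarrow> \<bar>?v q - ?v q0\<bar> < 1 / real (Suc j)"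
      using cv q0(1) unfolding continuous_on_iff dist_real_def
      by (metis atLeast_iff of_nat_0_less_iff zero_less_Suc zero_less_divide_1_iff)
    obtain q where q: "q \<in> \<rat>" "max ?T (q0 - d) < q" "q < q0"
      using Rats_dense_in_real[of "max ?T (q0 - d)" q0] lt d(1) by auto
    have "q \<ge> 0" using q(2) cyc_time_pos[OF es(1)] by auto
    moreover have "\<bar>?v q - ?v q0\<bar> < 1 / real (Suc j)" using d(2)[OF calculation] q by auto
    moreover have "fin x es q" using es q by (auto simp: fin_def)
    ultimately show "\<exists>q\<in>\<rat> \<inter> {0..s}. fin x es q \<and> ?v q > 1 - 1 / real (Suc j)"
      using q q0 by (intro bexI[of _ q]) auto
  qed
  show ?L if R: ?R
  proof -
    from R obtain q0 where q0: "q0 \<in> {0..s}" "fin x es q0" by blast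
    then have es: "cyc x es" "?T \<le> s" by (auto simp: fin_def)
    have "\<exists>m\<in>{?T..s}. \<forall>q\<in>{?T..s}. ?v q \<le> ?v m"
      by (rule continuous_attains_sup)
        (use es cyc_time_pos[OF es(1)] in \<open>auto intro!: continuous_on_subset[OF cv]\<close>)
    then obtain m where m: "m \<in> {?T..s}" "\<And>q. q \<in> {?T..s} \<Longrightarrow> ?v q \<le> ?v m" by blast
    have "1 - 1 / real (Suc j) \<le> ?v m" for j
    proof -
      obtain q where q: "q \<in> {0..s}" "fin x es q" "?v q > 1 - 1 / real (Suc j)" using R by blast
      then have "q \<in> {?T..s}" by (auto simp: fin_def)
      from m(2)[OF this] q(3) show ?thesis by linarith
    qed
    moreover have "(\<lambda>j. 1 - 1 / real (Suc j)) \<longlonglongrightarrow> 1 - 0"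
      by (intro tendsto_intros LIMSEQ_Suc[OF lim_const_over_n])
    ultimately have "1 \<le> ?v m" by (intro LIMSEQ_le_const2[where a="?v m" and X="\<lambda>j. 1 - 1 / real (Suc j)"]) auto
    then show ?L unfolding hit_def using m(1) es cyc_time_pos[OF es(1)]
      by (intro bexI[of _ m]) (auto simp: fin_def)
  qed
qed

text \<open>The sign of a cycle is the level reached first, that is, there is a moment at which one
  level has been reached and the other has not. Such moments contain an interval after the end of
  the cycle, so rational ones suffice, except when the cycle ends exactly at
  \<open>s\<close>.\<close>

lemma fin_Cons_iff:
  assumes s: "s \<ge> 0"
  shows "fin x (e # es) s \<longleftrightarrow> (\<exists>q\<in>(\<rat> \<inter> {0..s}) \<union> {s}. hit x e es q \<and> \<not> hit x (\<not> e) es q)"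
    (is "?L \<longleftrightarrow> ?R")
proof
  let ?v = "\<lambda>e q. sg e * (x q - x 0 - disp es)"
  let ?T = "cycle_time x (length es)" and ?T' = "cycle_time x (Suc (length es))"
  have cv: "continuous_on {0..} (?v e)" for e by (intro continuous_intros c)
  show ?R if ?L
  proof -
    from that have es: "cyc x (e # es)" "cyc x es" "?T' \<le> s" by (auto simp: fin_def)
    note st = cyc_step[OF es(1)] and pos = cyc_pos[OF es(2)] and T0 = cyc_time_pos[OF es(2)]
    have T'0: "?T' \<ge> 0" using st(1) T0 by linarith
    have vT': "?v e ?T' = 1" using st(3) pos by (simp add: sg_cases(3) algebra_simps)
    have hitT: "hit x e es q" if "?T' \<le> q" for q
      unfolding hit_def using that vT' es st(1) T'0 by (intro bexI[of _ ?T']) (auto simp: fin_def)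
    obtain d where d: "d > 0" "\<And>q. q \<ge> 0 \<Longrightarrow> \<bar>q - ?T'\<bar> < d \<Longrightarrow> \<bar>?v e q - 1\<bar> < 1"
      using cv[of e] T'0 vT' unfolding continuous_on_iff dist_real_def
      by (metis atLeast_iff zero_less_one)
    \<comment> \<open>Before the cycle ends neither level is reached, and for a time
      \<open>d\<close> afterwards continuity keeps the displacement on the side of
      \<open>e\<close>.\<close>
    have nhit: "\<not> hit x (\<not> e) es q" if "q < ?T' + d" for q
    proof
      assume "hit x (\<not> e) es q"
      then obtain r where r: "r \<in> {0..q}" "?T \<le> r" "?v (\<not> e) r \<ge> 1" by (auto simp: hit_def fin_def)
      show False
      proof (cases "r < ?T'")
        case True
        have "\<bar>x r - x ?T\<bar> < 1" using st(2) r(2) True by simp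
        moreover have "?v (\<not> e) r \<le> \<bar>?v (\<not> e) r\<bar>" by simp
        moreover have "\<bar>?v (\<not> e) r\<bar> = \<bar>x r - x ?T\<bar>" unfolding pos by (simp add: abs_mult sg_cases(4) diff_diff_eq)
        ultimately show False using r(3) by linarith
      next
        case False
        then have "\<bar>?v e r - 1\<bar> < 1" using d(2)[of r] r(1) that by auto
        moreover have "?v (\<not> e) r = - ?v e r" by (simp add: sg_cases(2))
        ultimately show False using r(3) by linarith
      qed
    qed
    show ?R
    proof (cases "?T' = s")
      case True
      then show ?thesis using hitT[of s] nhit[of s] d(1) by auto
    next
      case False
      then obtain q where "q \<in> \<rat>" "?T' < q" "q < min s (?T' + d)"
        using Rats_dense_in_real[of ?T' "min s (?T' + d)"] es(3) d(1) by auto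
      then show ?thesis using hitT[of q] nhit[of q] T'0 by (intro bexI[of _ q]) auto
    qed
  qed
  show ?L if ?R
  proof -
    from that obtain q where q: "q \<le> s" "0 \<le> q" "hit x e es q" "\<not> hit x (\<not> e) es q" using s by auto
    then obtain r where r: "r \<le> q" "cyc x es" "?T \<le> r" "?v e r \<ge> 1" by (auto simp: hit_def fin_def)
    note pos = cyc_pos[OF r(2)]
    have "?v e r \<le> \<bar>?v e r\<bar>" by simp
    moreover have "\<bar>?v e r\<bar> = \<bar>x r - x ?T\<bar>" unfolding pos by (simp add: abs_mult sg_cases(4) diff_diff_eq)
    ultimately have "\<bar>x r - x ?T\<bar> \<ge> 1" using r(4) by linarith
    from cyc_exit[OF r(2,3) this] obtain e' where e': "cyc x (e' # es)" and T': "?T' \<le> r" by blast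
    have "e' = e"
    proof (rule ccontr)
      assume "e' \<noteq> e"
      then have ee: "e' = (\<not> e)" by auto
      have "?v e' ?T' = 1" using cyc_step(3)[OF e'] pos by (simp add: sg_cases(3) algebra_simps)
      moreover have "?T' \<in> {0..q}" using T' r(1) cyc_step(1)[OF e'] cyc_time_pos[OF r(2)] by auto
      ultimately have "hit x (\<not> e) es q" unfolding hit_def ee
        using r(2) cyc_step(1)[OF e'] by (intro bexI[of _ ?T']) (auto simp: fin_def)
      then show False using q by simp
    qed
    then show ?L using e' T' r(1) q(1) by (simp add: fin_def)
  qed
qed

lemma active_iff:
  "active x es s \<longleftrightarrow> fin x es s \<and> (\<forall>r. cycle_time x (length es) \<le> r \<longrightarrow> r \<le> s \<longrightarrow> \<bar>x r - x (cycle_time x (length es))\<bar> < 1)"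
    (is "?L \<longleftrightarrow> ?R")
proof (cases "fin x es s")
  case True
  then have es: "cyc x es" by (simp add: fin_def)
  note pos = cyc_pos[OF es] and T0 = cyc_time_pos[OF es]
  have eq: "x r - x 0 - disp es = x r - x (cycle_time x (length es))" for r using pos by simp
  have "hit x True es s \<or> hit x False es s \<longleftrightarrow> (\<exists>r. cycle_time x (length es) \<le> r \<and> r \<le> s \<and> \<bar>x r - x (cycle_time x (length es))\<bar> \<ge> 1)"
  proof
    assume "hit x True es s \<or> hit x False es s"
    then obtain e r where r: "r \<le> s" "cycle_time x (length es) \<le> r" "sg e * (x r - x (cycle_time x (length es))) \<ge> 1"
      unfolding hit_def eq by (auto simp: fin_def)
    have "sg e * (x r - x (cycle_time x (length es))) \<le> \<bar>sg e * (x r - x (cycle_time x (length es)))\<bar>" by simp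
    also have "\<dots> = \<bar>x r - x (cycle_time x (length es))\<bar>" by (simp only: abs_mult sg_cases(4) mult_1)
    finally show "\<exists>r. cycle_time x (length es) \<le> r \<and> r \<le> s \<and> \<bar>x r - x (cycle_time x (length es))\<bar> \<ge> 1"
      using r by (intro exI[of _ r]) auto
  next
    assume "\<exists>r. cycle_time x (length es) \<le> r \<and> r \<le> s \<and> \<bar>x r - x (cycle_time x (length es))\<bar> \<ge> 1"
    then obtain r where r: "cycle_time x (length es) \<le> r" "r \<le> s" "\<bar>x r - x (cycle_time x (length es))\<bar> \<ge> 1" by blast
    have "hit x (0 \<le> x r - x (cycle_time x (length es))) es s"
      unfolding hit_def eq using r es T0 by (intro bexI[of _ r]) (auto simp: fin_def sg_def)
    then show "hit x True es s \<or> hit x False es s" by (cases "0 \<le> x r - x (cycle_time x (length es))") simp_all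
  qed
  then have "(\<not> hit x True es s \<and> \<not> hit x False es s) \<longleftrightarrow> (\<forall>r. cycle_time x (length es) \<le> r \<longrightarrow> r \<le> s \<longrightarrow> \<bar>x r - x (cycle_time x (length es))\<bar> < 1)"
    by (simp add: not_le[symmetric]) blast
  then show ?thesis using True by (simp add: active_def)
qed (simp add: active_def)

lemma active_near: "active x es s \<Longrightarrow> \<bar>x s - (x 0 + disp es)\<bar> \<le> 1"
  unfolding active_iff using cyc_pos[of es] by (force simp: fin_def)

text \<open>The minimum of the end of the running cycle and the horizon. The case distinction keeps
  out the junk value of \<open>cycle_time\<close> on paths that do not leave.\<close>

definition cut_exit :: "bool list \<Rightarrow> real \<Rightarrow> real" where
  "cut_exit es K = (if \<exists>t. cycle_time x (length es) \<le> t \<and> t \<le> K \<and> \<bar>x t - x (cycle_time x (length es))\<bar> = 1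
     then cycle_time x (Suc (length es)) else K)"

lemma cut_exit:
  assumes f: "fin x es K"
  shows "cycle_time x (length es) \<le> cut_exit es K" "cut_exit es K \<le> K"
    "s < K \<Longrightarrow> active x es s \<longleftrightarrow> cycle_time x (length es) \<le> s \<and> s < cut_exit es K"
    "\<bar>x (cut_exit es K) - (x 0 + disp es)\<bar> \<le> 1"
    "fin x (e # es) K \<Longrightarrow> cut_exit es K = cycle_time x (Suc (length es))"
    "\<not> fin x (True # es) K \<Longrightarrow> \<not> fin x (False # es) K \<Longrightarrow> cut_exit es K = K"
proof -
  let ?T = "cycle_time x (length es)" and ?T' = "cycle_time x (Suc (length es))"
  have es: "cyc x es" "?T \<le> K" using f by (auto simp: fin_def)
  note pos = cyc_pos[OF es(1)] and T0 = cyc_time_pos[OF es(1)]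
  have "?T \<le> cut_exit es K \<and> cut_exit es K \<le> K \<and>
    (\<forall>s<K. active x es s \<longleftrightarrow> ?T \<le> s \<and> s < cut_exit es K) \<and>
    \<bar>x (cut_exit es K) - (x 0 + disp es)\<bar> \<le> 1 \<and>
    (\<forall>e. fin x (e # es) K \<longrightarrow> cut_exit es K = ?T') \<and>
    (\<not> fin x (True # es) K \<longrightarrow> \<not> fin x (False # es) K \<longrightarrow> cut_exit es K = K)"
  proof (cases "\<exists>t. ?T \<le> t \<and> t \<le> K \<and> \<bar>x t - x ?T\<bar> = 1")
    case True
    then obtain t where t: "?T \<le> t" "t \<le> K" "\<bar>x t - x ?T\<bar> = 1" by blast
    have K: "cut_exit es K = ?T'" using True by (simp add: cut_exit_def)
    obtain e where e: "cyc x (e # es)" and T': "?T' \<le> t" using cyc_exit[OF es(1) t(1)] t(3) by auto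
    note st = cyc_step[OF e]
    have T1: "\<bar>x ?T' - x ?T\<bar> = 1" using st(3) sg_cases(4) by simp
    have "active x es s \<longleftrightarrow> ?T \<le> s \<and> s < ?T'" for s
    proof
      assume "active x es s"
      then have "?T \<le> s" "\<forall>r. ?T \<le> r \<longrightarrow> r \<le> s \<longrightarrow> \<bar>x r - x ?T\<bar> < 1" by (auto simp: active_iff fin_def)
      moreover from this(2) have "\<not> ?T' \<le> s" using T1 less_imp_le[OF st(1)] by (metis less_irrefl)
      ultimately show "?T \<le> s \<and> s < ?T'" by simp
    next
      assume "?T \<le> s \<and> s < ?T'"
      then show "active x es s" using st(2) es by (auto simp: active_iff fin_def)
    qed
    moreover have "\<not> (\<not> fin x (True # es) K \<and> \<not> fin x (False # es) K)"
      using e T' t(2) by (cases e) (auto simp: fin_def)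
    moreover have "\<bar>x ?T' - (x 0 + disp es)\<bar> \<le> 1" using T1 pos by simp
    ultimately show ?thesis using st(1) T' t(2) unfolding K by auto
  next
    case False
    then have K: "cut_exit es K = K" unfolding cut_exit_def by (rule if_not_P)
    have lt: "\<bar>x r - x ?T\<bar> < 1" if "?T \<le> r" "r \<le> K" for r
    proof (rule ccontr)
      assume "\<not> \<bar>x r - x ?T\<bar> < 1"
      then have "\<bar>x r - x ?T\<bar> \<ge> 1" by simp
      from exit_exists[OF c T0 that(1) this] obtain q where "?T \<le> q" "q \<le> r" "\<bar>x q - x ?T\<bar> = 1" .
      then show False using that(2) False by force
    qed
    have "active x es s \<longleftrightarrow> ?T \<le> s" if "s < K" for s
      using that lt es by (auto simp: active_iff fin_def)
    moreover have "\<not> fin x (e # es) K" for e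
    proof
      assume "fin x (e # es) K"
      then have e: "cyc x (e # es)" "?T' \<le> K" by (auto simp: fin_def)
      have "\<bar>x ?T' - x ?T\<bar> = 1" using cyc_step(3)[OF e(1)] sg_cases(4) by simp
      then show False using lt[of ?T'] cyc_step(1)[OF e(1)] e(2) by simp
    qed
    moreover have "\<bar>x K - (x 0 + disp es)\<bar> \<le> 1" using lt[of K] es(2) pos by simp
    ultimately show ?thesis using es(2) unfolding K by auto
  qed
  then show "?T \<le> cut_exit es K" "cut_exit es K \<le> K"
    "s < K \<Longrightarrow> active x es s \<longleftrightarrow> ?T \<le> s \<and> s < cut_exit es K"
    "\<bar>x (cut_exit es K) - (x 0 + disp es)\<bar> \<le> 1"
    "fin x (e # es) K \<Longrightarrow> cut_exit es K = ?T'"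
    "\<not> fin x (True # es) K \<Longrightarrow> \<not> fin x (False # es) K \<Longrightarrow> cut_exit es K = K" by blast+
qed

end

section \<open>Telescoping of weighted increments along refining grids\<close>

lemma grid_telescope:
  fixes g :: "real \<Rightarrow> real"
  assumes c: "continuous_on {0..T} g" and T: "T > 0" and t: "0 \<le> \<tau>" "\<tau> \<le> \<tau>'" "\<tau>' \<le> T"
  shows "(\<lambda>N. \<Sum>k<Suc N. of_bool (\<tau> \<le> real k * (T / real (Suc N)) \<and> real k * (T / real (Suc N)) < \<tau>') *
      (g (real (Suc k) * (T / real (Suc N))) - g (real k * (T / real (Suc N))))) \<longlonglongrightarrow> g \<tau>' - g \<tau>"
    and "(\<And>t. t \<in> {0..T} \<Longrightarrow> \<bar>g t\<bar> \<le> B) \<Longrightarrow>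
      \<bar>\<Sum>k<Suc N. of_bool (\<tau> \<le> real k * (T / real (Suc N)) \<and> real k * (T / real (Suc N)) < \<tau>') *
      (g (real (Suc k) * (T / real (Suc N))) - g (real k * (T / real (Suc N))))\<bar> \<le> 2 * B"
proof -
  define d where "d N = T / real (Suc N)" for N
  have d: "d N > 0" for N using T by (simp add: d_def)
  have d0: "d \<longlonglongrightarrow> 0" unfolding d_def[abs_def] by (rule LIMSEQ_Suc[OF lim_const_over_n])
  \<comment> \<open>Index of the first grid point at or after \<open>r\<close>. A half-open window
    of times then selects a half-open range of indices, the sum telescopes, and its two end points
    approach the ends of the window from above.\<close>
  define k where "k r N = nat \<lceil>r / d N\<rceil>" for r N
  have kle: "r \<le> real j * d N \<longleftrightarrow> k r N \<le> j" for r j N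
  proof -
    have "r \<le> real j * d N \<longleftrightarrow> r / d N \<le> of_int (int j)" using d[of N] by (simp add: divide_le_eq)
    then show ?thesis unfolding k_def by (simp add: ceiling_le_iff nat_le_iff)
  qed
  have kd: "r \<le> real (k r N) * d N" for r N using kle by blast
  have kd2: "real (k r N) * d N \<le> r + d N" if "r \<ge> 0" for r N
  proof -
    have "real (k r N) = of_int \<lceil>r / d N\<rceil>" unfolding k_def using that d[of N] by (simp add: le_ceiling_iff order_less_le_trans[of "-1" 0])
    also have "\<dots> \<le> r / d N + 1" using ceiling_correct[of "r / d N"] by linarith
    finally have "real (k r N) * d N \<le> (r / d N + 1) * d N" using d[of N] by (intro mult_right_mono) auto
    then show ?thesis using d[of N] by (simp add: algebra_simps)
  qed
  have kT: "real (k r N) * d N \<le> T" "k r N \<le> Suc N" if "r \<le> T" for r N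
  proof -
    have "real (Suc N) * d N = T" by (simp add: d_def)
    then show "k r N \<le> Suc N" using kle[of r "Suc N" N] that by simp
    then have "real (k r N) * d N \<le> real (Suc N) * d N" using d[of N] by (intro mult_right_mono) auto
    then show "real (k r N) * d N \<le> T" by (simp add: d_def)
  qed
  have lim: "(\<lambda>N. g (real (k r N) * d N)) \<longlonglongrightarrow> g r" if r: "0 \<le> r" "r \<le> T" for r
  proof (rule continuous_on_tendsto_compose[OF c])
    have "(\<lambda>N. r + d N) \<longlonglongrightarrow> r + 0" by (intro tendsto_intros d0)
    then show "(\<lambda>N. real (k r N) * d N) \<longlonglongrightarrow> r"
      by (intro tendsto_sandwich[of "\<lambda>_. r" "\<lambda>N. real (k r N) * d N" sequentially "\<lambda>N. r + d N"]) (use kd kd2 r in auto)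
    show "r \<in> {0..T}" using r by auto
    show "\<forall>\<^sub>F N in sequentially. real (k r N) * d N \<in> {0..T}"
      using kT[OF r(2)] order_trans[OF r(1) kd] by (intro always_eventually) auto
  qed
  have sum: "(\<Sum>j<Suc N. of_bool (\<tau> \<le> real j * d N \<and> real j * d N < \<tau>') * (g (real (Suc j) * d N) - g (real j * d N)))
    = g (real (k \<tau>' N) * d N) - g (real (k \<tau> N) * d N)" for N
  proof -
    have kk: "k \<tau> N \<le> k \<tau>' N" using kle[of \<tau> "k \<tau>' N" N] kd[of \<tau>' N] t by simp
    have ind: "\<tau> \<le> real j * d N \<and> real j * d N < \<tau>' \<longleftrightarrow> j \<in> {k \<tau> N..<k \<tau>' N}" for j
      using kle[of \<tau> j N] kle[of \<tau>' j N] by auto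
    have "(\<Sum>j<Suc N. of_bool (\<tau> \<le> real j * d N \<and> real j * d N < \<tau>') * (g (real (Suc j) * d N) - g (real j * d N))) =
      (\<Sum>j<Suc N. if j \<in> {k \<tau> N..<k \<tau>' N} then g (real (Suc j) * d N) - g (real j * d N) else 0)"
      unfolding ind by (intro sum.cong) auto
    also have "\<dots> = (\<Sum>j\<in>{..<Suc N} \<inter> {k \<tau> N..<k \<tau>' N}. g (real (Suc j) * d N) - g (real j * d N))"
      by (rule sum.inter_restrict[symmetric]) simp
    also have "{..<Suc N} \<inter> {k \<tau> N..<k \<tau>' N} = {k \<tau> N..<k \<tau>' N}" using kT(2)[OF t(3), of N] by auto
    also have "(\<Sum>j\<in>{k \<tau> N..<k \<tau>' N}. g (real (Suc j) * d N) - g (real j * d N)) = g (real (k \<tau>' N) * d N) - g (real (k \<tau> N) * d N)"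
      by (rule sum_Suc_diff'[OF kk, of "\<lambda>j. g (real j * d N)"])
    finally show ?thesis .
  qed
  show "(\<lambda>N. \<Sum>k<Suc N. of_bool (\<tau> \<le> real k * (T / real (Suc N)) \<and> real k * (T / real (Suc N)) < \<tau>') *
      (g (real (Suc k) * (T / real (Suc N))) - g (real k * (T / real (Suc N))))) \<longlonglongrightarrow> g \<tau>' - g \<tau>"
    unfolding d_def[symmetric] sum by (intro tendsto_diff lim) (use t in auto)
  show "\<bar>\<Sum>k<Suc N. of_bool (\<tau> \<le> real k * (T / real (Suc N)) \<and> real k * (T / real (Suc N)) < \<tau>') *
      (g (real (Suc k) * (T / real (Suc N))) - g (real k * (T / real (Suc N))))\<bar> \<le> 2 * B"
    if B: "\<And>t. t \<in> {0..T} \<Longrightarrow> \<bar>g t\<bar> \<le> B"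
  proof -
    have m: "real (k r N) * d N \<in> {0..T}" if "r \<le> T" for r
      unfolding atLeastAtMost_iff using kT(1)[OF that] by (intro conjI mult_nonneg_nonneg less_imp_le[OF d]) auto
    have "\<bar>g (real (k \<tau>' N) * d N)\<bar> \<le> B" "\<bar>g (real (k \<tau> N) * d N)\<bar> \<le> B"
      by (rule B[OF m[OF t(3)]], rule B[OF m[OF order_trans[OF t(2,3)]]])
    then show ?thesis unfolding d_def[symmetric] sum by linarith
  qed
qed


subsection \<open>Power series solutions of the eigenvalue equation\<close>

definition prim :: "(real \<Rightarrow> real) \<Rightarrow> real \<Rightarrow> real" where
  "prim g x = (if 0 \<le> x then integral {0..x} g else - integral {x..0} g)"

lemma prim_0 [simp]: "prim g 0 = 0" by (simp add: prim_def)

lemma prim_zero: "prim (\<lambda>_. 0) x = 0" by (simp add: prim_def)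

lemma prim_deriv:
  assumes c: "continuous_on UNIV g"
  shows "(prim g has_real_derivative g x) (at x)"
proof -
  define R where "R = \<bar>x\<bar> + 1"
  have R: "- R < x" "x < R" "0 < R" by (auto simp: R_def)
  have i: "g integrable_on {p..q}" for p q
    by (rule integrable_continuous_interval) (rule continuous_on_subset[OF c], simp)
  have "((\<lambda>z. integral {- R..z} g) has_real_derivative g x) (at x within {- R..R})"
    by (rule integral_has_real_derivative) (use R in \<open>auto intro: continuous_on_subset[OF c]\<close>)
  then have "((\<lambda>z. integral {- R..z} g) has_real_derivative g x) (at x)"
    using R by (simp add: at_within_Icc_at)
  then have d: "((\<lambda>z. integral {- R..z} g - integral {- R..0} g) has_real_derivative g x) (at x)"
    by (auto intro!: derivative_eq_intros)
  show ?thesis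
  proof (rule has_field_derivative_transform_within_open[OF d, of "{- R<..<R}"])
    fix z assume z: "z \<in> {- R<..<R}"
    show "integral {- R..z} g - integral {- R..0} g = prim g z"
    proof (cases "0 \<le> z")
      case True
      then show ?thesis
        using Henstock_Kurzweil_Integration.integral_combine[of "- R" 0 z g] R i by (simp add: prim_def)
    next
      case False
      then show ?thesis
        using Henstock_Kurzweil_Integration.integral_combine[of "- R" z 0 g] z i by (simp add: prim_def)
    qed
  qed (use R in auto)
qed

lemma prim_continuous: "continuous_on UNIV g \<Longrightarrow> continuous_on A (prim g)"
  by (meson DERIV_isCont continuous_at_imp_continuous_on prim_deriv)

lemma prim_linear:
  assumes "continuous_on UNIV g" "continuous_on UNIV h"
  shows "prim (\<lambda>x. g x + c * h x) x = prim g x + c * prim h x"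
proof -
  have i: "g integrable_on {p..q}" for p q
    by (rule integrable_continuous_interval) (rule continuous_on_subset[OF assms(1)], simp)
  have i': "h integrable_on {p..q}" for p q
    by (rule integrable_continuous_interval) (rule continuous_on_subset[OF assms(2)], simp)
  show ?thesis
  proof -
    have "integral S (\<lambda>x. g x + c * h x) = integral S g + c * integral S h" if "S = {p..q}" for S p q
      unfolding that by (intro integral_unique has_integral_add has_integral_mult_right integrable_integral i i')
    then show ?thesis unfolding prim_def by (simp add: algebra_simps)
  qed
qed

lemma prim_unique:
  assumes c: "continuous_on UNIV g" and d: "\<And>x. (G has_real_derivative g x) (at x)"
  shows "prim g x = G x - G 0"
proof -
  have d0: "((\<lambda>x. prim g x - G x) has_real_derivative 0) (at x)" for x
    using DERIV_diff[OF prim_deriv[OF c] d, of x] by simp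
  have "prim g x - G x = prim g 0 - G 0" using d0 by (rule DERIV_isconst_all[OF allI])
  then show ?thesis by simp
qed

lemma prim_nonneg:
  assumes c: "continuous_on UNIV g" and x: "0 \<le> x" and g: "\<And>z. 0 \<le> z \<Longrightarrow> z \<le> x \<Longrightarrow> 0 \<le> g z"
  shows "0 \<le> prim g x"
  using DERIV_nonneg_imp_nondecreasing[OF x, of "prim g"] prim_deriv[OF c] g by fastforce

lemma prim_nonneg':
  assumes c: "continuous_on UNIV g" and x: "x \<le> 0" and g: "\<And>z. x \<le> z \<Longrightarrow> z \<le> 0 \<Longrightarrow> g z \<le> 0"
  shows "0 \<le> prim g x"
  using DERIV_nonpos_imp_nonincreasing[OF x, of "prim g"] prim_deriv[OF c] g by fastforce

lemma prim_pos:
  assumes c: "continuous_on UNIV g" and x: "0 < x" and g: "\<And>z. 0 < z \<Longrightarrow> z < x \<Longrightarrow> 0 < g z"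
  shows "0 < prim g x"
  using DERIV_pos_imp_increasing_open[OF x, of "prim g"] prim_deriv[OF c] g prim_continuous[OF c] by fastforce

lemma prim_pos':
  assumes c: "continuous_on UNIV g" and x: "x < 0" and g: "\<And>z. x < z \<Longrightarrow> z < 0 \<Longrightarrow> g z < 0"
  shows "0 < prim g x"
  using DERIV_neg_imp_decreasing_open[OF x, of "prim g"] prim_deriv[OF c] g prim_continuous[OF c] by fastforce

text \<open>Comparison of derivatives on either side of 0, applied to \<open>g\<close> and to its
  negative. The factor \<open>1 / Suc k\<close> produces the factorials when the bound is
  iterated.\<close>

lemma prim_bound:
  assumes c: "continuous_on UNIV g" and g: "\<And>z. \<bar>z\<bar> \<le> R \<Longrightarrow> \<bar>g z\<bar> \<le> a * \<bar>z\<bar> ^ k" and x: "\<bar>x\<bar> \<le> R"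
  shows "\<bar>prim g x\<bar> \<le> a * \<bar>x\<bar> ^ Suc k / real (Suc k)"
proof -
  have pw: "((\<lambda>z. a * z ^ Suc k / real (Suc k)) has_real_derivative a * z ^ k) (at z)" for z :: real
    by (rule derivative_eq_intros refl | simp)+
  have pw': "((\<lambda>z. a * (- z) ^ Suc k / real (Suc k)) has_real_derivative - (a * (- z) ^ k)) (at z)" for z :: real
  proof -
    have "((\<lambda>z. a * (- z) ^ Suc k / real (Suc k)) has_real_derivative a * (real (Suc k) * (- z) ^ k * (- 1)) / real (Suc k)) (at z)"
      by (auto intro!: derivative_eq_intros simp del: power_Suc)
    then show ?thesis by simp
  qed
  have one: "prim h x \<le> a * \<bar>x\<bar> ^ Suc k / real (Suc k)"
    if ch: "continuous_on UNIV h" and h: "\<And>z. \<bar>z\<bar> \<le> R \<Longrightarrow> \<bar>h z\<bar> \<le> a * \<bar>z\<bar> ^ k" for h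
  proof (cases "0 \<le> x")
    case True
    have "(\<lambda>z. a * z ^ Suc k / real (Suc k) - prim h z) 0 \<le> (\<lambda>z. a * z ^ Suc k / real (Suc k) - prim h z) x"
    proof (rule DERIV_nonneg_imp_nondecreasing[OF True])
      fix z assume z: "0 \<le> z" "z \<le> x"
      have "h z \<le> a * z ^ k" using h[of z] z x by auto
      then show "\<exists>y. ((\<lambda>z. a * z ^ Suc k / real (Suc k) - prim h z) has_real_derivative y) (at z) \<and> y \<ge> 0"
        using DERIV_diff[OF pw prim_deriv[OF ch], of z] by (intro exI[of _ "a * z ^ k - h z"]) auto
    qed
    then show ?thesis using True by simp
  next
    case False
    have "(\<lambda>z. a * (- z) ^ Suc k / real (Suc k) - prim h z) 0 \<le> (\<lambda>z. a * (- z) ^ Suc k / real (Suc k) - prim h z) x"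
    proof (rule DERIV_nonpos_imp_nonincreasing[where f="\<lambda>z. a * (- z) ^ Suc k / real (Suc k) - prim h z"])
      show "x \<le> 0" using False by simp
    next
      fix z assume z: "x \<le> z" "z \<le> 0"
      have "- h z \<le> a * (- z) ^ k" using h[of z] z x by auto
      then show "\<exists>y. ((\<lambda>z. a * (- z) ^ Suc k / real (Suc k) - prim h z) has_real_derivative y) (at z) \<and> y \<le> 0"
        using DERIV_diff[OF pw' prim_deriv[OF ch], of z] by (intro exI[of _ "- (a * (- z) ^ k) - h z"]) auto
    qed
    then show ?thesis using False by simp
  qed
  have "prim (\<lambda>z. 0 + (- 1) * g z) x = - prim g x" 
    by (subst prim_linear) (auto simp: prim_def c)
  then have m: "prim (\<lambda>z. - g z) x = - prim g x" by simp
  have "- prim g x \<le> a * \<bar>x\<bar> ^ Suc k / real (Suc k)"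
    unfolding m[symmetric] by (rule one) (use c g in \<open>auto intro!: continuous_intros\<close>)
  moreover have "prim g x \<le> a * \<bar>x\<bar> ^ Suc k / real (Suc k)" by (rule one[OF c g])
  ultimately show ?thesis by linarith
qed

section \<open>A Sturm-Liouville equation and its Neumann series\<close>

locale sturm =
  fixes p q :: "real \<Rightarrow> real"
  assumes cp: "continuous_on UNIV p" and cq: "continuous_on UNIV q"
    and pp: "\<And>x. p x > 0" and qp: "\<And>x. q x > 0"
begin

text \<open>Right inverse, with zero value and zero derivative at 0, of the operator
  \<open>u \<mapsto> (u' / p)' / q\<close>; here \<open>p\<close> is the scale density and
  \<open>q\<close> the speed density.\<close>

definition iop :: "(real \<Rightarrow> real) \<Rightarrow> real \<Rightarrow> real" where
  "iop v = prim (\<lambda>z. p z * prim (\<lambda>y. q y * v y) z)"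

lemma iop_inner_cont: "continuous_on UNIV v \<Longrightarrow> continuous_on UNIV (\<lambda>y. q y * v y)"
  by (intro continuous_intros cq)
lemma iop_outer_cont: "continuous_on UNIV v \<Longrightarrow> continuous_on UNIV (\<lambda>z. p z * prim (\<lambda>y. q y * v y) z)"
  by (intro continuous_intros cp prim_continuous iop_inner_cont)
lemma iop_cont: "continuous_on UNIV v \<Longrightarrow> continuous_on A (iop v)"
  unfolding iop_def by (intro prim_continuous iop_outer_cont)

lemma iop_linear:
  assumes "continuous_on UNIV u" "continuous_on UNIV v"
  shows "iop (\<lambda>x. u x + c * v x) x = iop u x + c * iop v x"
proof -
  have "prim (\<lambda>y. q y * (u y + c * v y)) z = prim (\<lambda>y. q y * u y) z + c * prim (\<lambda>y. q y * v y) z" for z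
    using prim_linear[OF iop_inner_cont[OF assms(1)] iop_inner_cont[OF assms(2)], of c z]
    by (simp add: algebra_simps)
  then show ?thesis
    unfolding iop_def using prim_linear[OF iop_outer_cont[OF assms(1)] iop_outer_cont[OF assms(2)], of c x]
    by (simp add: algebra_simps)
qed

text \<open>Only the outer integration is charged to the power of \<open>\<bar>x\<bar>\<close>; the
  inner one contributes a mere factor \<open>R\<close>. One gain of \<open>1 / Suc k\<close> per
  application is already enough for factorial decay.\<close>

lemma iop_bound:
  assumes R: "R \<ge> 0"
  obtains C where "C \<ge> 0" "\<And>v k a x. continuous_on UNIV v \<Longrightarrow> a \<ge> 0 \<Longrightarrow>
    (\<And>z. \<bar>z\<bar> \<le> R \<Longrightarrow> \<bar>v z\<bar> \<le> a * \<bar>z\<bar> ^ k) \<Longrightarrow> \<bar>x\<bar> \<le> R \<Longrightarrow> \<bar>iop v x\<bar> \<le> C * a * \<bar>x\<bar> ^ Suc k / real (Suc k)"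
proof -
  have bd: "\<exists>B\<ge>0. \<forall>z. \<bar>z\<bar> \<le> R \<longrightarrow> \<bar>g z\<bar> \<le> B" if "continuous_on UNIV g" for g :: "real \<Rightarrow> real"
  proof -
    have "bounded (g ` {- R..R})" by (intro compact_imp_bounded compact_continuous_image continuous_on_subset[OF that]) auto
    then obtain B where B: "\<forall>z\<in>{- R..R}. \<bar>g z\<bar> \<le> B" by (auto simp: bounded_iff)
    then have "\<bar>g z\<bar> \<le> \<bar>B\<bar>" if "\<bar>z\<bar> \<le> R" for z using that by (auto simp: abs_le_iff order_trans[OF _ abs_ge_self])
    then show ?thesis by (intro exI[of _ "\<bar>B\<bar>"]) auto
  qed
  obtain P where P: "P \<ge> 0" "\<And>z. \<bar>z\<bar> \<le> R \<Longrightarrow> \<bar>p z\<bar> \<le> P" using bd[OF cp] by blast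
  obtain Q where Q: "Q \<ge> 0" "\<And>z. \<bar>z\<bar> \<le> R \<Longrightarrow> \<bar>q z\<bar> \<le> Q" using bd[OF cq] by blast
  have "\<bar>iop v x\<bar> \<le> (P * Q * R) * a * \<bar>x\<bar> ^ Suc k / real (Suc k)"
    if v: "continuous_on UNIV v" and a: "a \<ge> 0" and b: "\<And>z. \<bar>z\<bar> \<le> R \<Longrightarrow> \<bar>v z\<bar> \<le> a * \<bar>z\<bar> ^ k" and x: "\<bar>x\<bar> \<le> R" for v k a x
    unfolding iop_def
  proof (rule prim_bound[OF iop_outer_cont[OF v] _ x])
    fix z assume z: "\<bar>z\<bar> \<le> R"
    have "\<bar>prim (\<lambda>y. q y * v y) z\<bar> \<le> (Q * a) * \<bar>z\<bar> ^ Suc k / real (Suc k)"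
    proof (rule prim_bound[OF iop_inner_cont[OF v] _ z])
      fix y assume y: "\<bar>y\<bar> \<le> R"
      have "\<bar>q y\<bar> * \<bar>v y\<bar> \<le> Q * (a * \<bar>y\<bar> ^ k)" by (intro mult_mono Q b y) (use Q in auto)
      then show "\<bar>q y * v y\<bar> \<le> Q * a * \<bar>y\<bar> ^ k" by (simp add: abs_mult)
    qed
    also have "\<dots> \<le> (Q * a) * \<bar>z\<bar> ^ Suc k / 1" using Q a by (intro divide_left_mono) auto
    also have "\<dots> = (Q * a) * \<bar>z\<bar> ^ k * \<bar>z\<bar>" by simp
    also have "\<dots> \<le> (Q * a) * \<bar>z\<bar> ^ k * R" using z Q a by (intro mult_left_mono) auto
    finally have "\<bar>p z\<bar> * \<bar>prim (\<lambda>y. q y * v y) z\<bar> \<le> P * ((Q * a) * \<bar>z\<bar> ^ k * R)"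
      by (intro mult_mono P z) (use P in auto)
    then show "\<bar>p z * prim (\<lambda>y. q y * v y) z\<bar> \<le> P * Q * R * a * \<bar>z\<bar> ^ k" by (simp add: abs_mult algebra_simps)
  qed
  moreover have "P * Q * R \<ge> 0" using P Q R by simp
  ultimately show ?thesis using that by blast
qed

primrec iter :: "(real \<Rightarrow> real) \<Rightarrow> nat \<Rightarrow> real \<Rightarrow> real" where
  "iter v 0 = v"
| "iter v (Suc k) = iop (iter v k)"

text \<open>The Neumann series of \<open>u = v + \<nu> * iop u\<close>. For \<open>p = q = 1\<close>
  the starts \<open>v = 1\<close> and \<open>v x = x\<close> give
  \<open>cosh (sqrt \<nu> * x)\<close> and \<open>sinh (sqrt \<nu> * x) / sqrt \<nu>\<close> when
  \<nu> is positive.\<close>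

definition ser :: "(real \<Rightarrow> real) \<Rightarrow> real \<Rightarrow> real \<Rightarrow> real" where
  "ser v \<nu> x = (\<Sum>k. \<nu> ^ k * iter v k x)"

lemma iter_cont: "continuous_on UNIV v \<Longrightarrow> continuous_on UNIV (iter v k)"
  by (induct k) (auto intro: iop_cont)

lemma iter_bound:
  assumes v: "continuous_on UNIV v" and R: "R \<ge> 0"
  obtains V C where "V \<ge> 0" "C \<ge> 0" "\<And>k x. \<bar>x\<bar> \<le> R \<Longrightarrow> \<bar>iter v k x\<bar> \<le> V * (C ^ k / fact k)"
proof -
  have "bounded (v ` {- R..R})" by (intro compact_imp_bounded compact_continuous_image continuous_on_subset[OF v]) auto
  then obtain V0 where "\<forall>z\<in>{- R..R}. \<bar>v z\<bar> \<le> V0" by (auto simp: bounded_iff)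
  then obtain V where V: "V \<ge> 0" "\<And>z. \<bar>z\<bar> \<le> R \<Longrightarrow> \<bar>v z\<bar> \<le> V"
    using R by (metis abs_ge_zero abs_le_iff atLeastAtMost_iff order_trans abs_zero minus_le_iff)
  obtain C where C: "C \<ge> 0" "\<And>v k a x. continuous_on UNIV v \<Longrightarrow> a \<ge> 0 \<Longrightarrow>
    (\<And>z. \<bar>z\<bar> \<le> R \<Longrightarrow> \<bar>v z\<bar> \<le> a * \<bar>z\<bar> ^ k) \<Longrightarrow> \<bar>x\<bar> \<le> R \<Longrightarrow> \<bar>iop v x\<bar> \<le> C * a * \<bar>x\<bar> ^ Suc k / real (Suc k)"
    using iop_bound[OF R] by blast
  have b: "\<bar>iter v k x\<bar> \<le> V * C ^ k / fact k * \<bar>x\<bar> ^ k" if "\<bar>x\<bar> \<le> R" for k x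
    using that
  proof (induct k arbitrary: x)
    case 0 then show ?case using V by simp
  next
    case (Suc k)
    have "\<bar>iop (iter v k) x\<bar> \<le> C * (V * C ^ k / fact k) * \<bar>x\<bar> ^ Suc k / real (Suc k)"
      by (rule C(2)[OF iter_cont[OF v]]) (use Suc V C in auto)
    then show ?case by (simp add: field_simps)
  qed
  have "\<bar>iter v k x\<bar> \<le> V * ((C * R) ^ k / fact k)" if "\<bar>x\<bar> \<le> R" for k x
  proof -
    have "\<bar>x\<bar> ^ k \<le> R ^ k" using that by (intro power_mono) auto
    then have "V * C ^ k / fact k * \<bar>x\<bar> ^ k \<le> V * C ^ k / fact k * R ^ k" using V C by (intro mult_left_mono) auto
    with b[OF that, of k] show ?thesis by (simp add: power_mult_distrib)
  qed
  moreover have "C * R \<ge> 0" using C R by simp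
  ultimately show ?thesis using that V(1) by blast
qed

lemma exp_summable: "summable (\<lambda>k. V * ((c::real) ^ k / fact k))"
  using summable_mult[OF summable_exp[of c], of V] by (simp add: divide_inverse mult.commute)

lemma exp_suminf: "(\<Sum>k. (c::real) ^ k / fact k) = exp c"
  by (simp add: exp_def scaleR_conv_of_real divide_inverse mult.commute)

lemma ser_term_bound:
  fixes z V C \<nu> :: real
  assumes "\<bar>z\<bar> \<le> V * (C ^ k / fact k)"
  shows "\<bar>\<nu> ^ k * z\<bar> \<le> V * ((\<bar>\<nu>\<bar> * C) ^ k / fact k)"
proof -
  have "\<bar>\<nu>\<bar> ^ k * \<bar>z\<bar> \<le> \<bar>\<nu>\<bar> ^ k * (V * (C ^ k / fact k))" using assms by (intro mult_left_mono) auto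
  then show ?thesis by (simp add: abs_mult power_abs power_mult_distrib algebra_simps)
qed

lemma ser_summable:
  assumes v: "continuous_on UNIV v"
  shows "summable (\<lambda>k. \<nu> ^ k * iter v k x)"
proof -
  obtain V C where VC: "V \<ge> 0" "C \<ge> 0" "\<And>k z. \<bar>z\<bar> \<le> \<bar>x\<bar> \<Longrightarrow> \<bar>iter v k z\<bar> \<le> V * (C ^ k / fact k)"
    using iter_bound[OF v, of "\<bar>x\<bar>"] by (metis abs_ge_zero)
  show ?thesis
    by (rule summable_comparison_test[OF _ exp_summable[of V "\<bar>\<nu>\<bar> * C"]])
      (use ser_term_bound[OF VC(3)] in auto)
qed

lemma ser_uniform:
  assumes v: "continuous_on UNIV v" and R: "R \<ge> 0"
  shows "uniform_limit {- R..R} (\<lambda>n x. \<Sum>k<n. \<nu> ^ k * iter v k x) (ser v \<nu>) sequentially"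
proof -
  obtain V C where VC: "V \<ge> 0" "C \<ge> 0" "\<And>k z. \<bar>z\<bar> \<le> R \<Longrightarrow> \<bar>iter v k z\<bar> \<le> V * (C ^ k / fact k)"
    using iter_bound[OF v R] by blast
  show ?thesis unfolding ser_def
    by (rule Weierstrass_m_test[OF _ exp_summable[of V "\<bar>\<nu>\<bar> * C"]])
      (use ser_term_bound[OF VC(3)] in \<open>auto simp: abs_le_iff\<close>)
qed

lemma ser_cont:
  assumes v: "continuous_on UNIV v"
  shows "continuous_on UNIV (ser v \<nu>)"
proof (rule continuous_at_imp_continuous_on, rule ballI)
  fix x :: real
  define R where "R = \<bar>x\<bar> + 1"
  have "continuous_on {- R..R} (ser v \<nu>)"
    by (rule uniform_limit_theorem[OF _ ser_uniform[OF v]])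
      (auto simp: R_def intro!: always_eventually continuous_intros continuous_on_subset[OF iter_cont[OF v]])
  then show "isCont (ser v \<nu>) x"
    by (rule continuous_on_interior) (auto simp: R_def)
qed

text \<open>Consecutive partial sums satisfy the equation with a shift of index. Convergence is
  uniform on compact intervals, and there \<open>iop\<close> is continuous in the uniform norm by
  \<open>iop_bound\<close> with \<open>k = 0\<close>, so the limit may be taken inside.\<close>

lemma ser_fixpoint:
  assumes v: "continuous_on UNIV v"
  shows "ser v \<nu> x = v x + \<nu> * iop (ser v \<nu>) x"
proof -
  define R where "R = \<bar>x\<bar>"
  have R: "R \<ge> 0" "\<bar>x\<bar> \<le> R" by (auto simp: R_def)
  obtain C where C: "C \<ge> 0" "\<And>v k a x. continuous_on UNIV v \<Longrightarrow> a \<ge> 0 \<Longrightarrow>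
    (\<And>z. \<bar>z\<bar> \<le> R \<Longrightarrow> \<bar>v z\<bar> \<le> a * \<bar>z\<bar> ^ k) \<Longrightarrow> \<bar>x\<bar> \<le> R \<Longrightarrow> \<bar>iop v x\<bar> \<le> C * a * \<bar>x\<bar> ^ Suc k / real (Suc k)"
    using iop_bound[OF R(1)] by blast
  define u where "u n z = (\<Sum>k<n. \<nu> ^ k * iter v k z)" for n z
  have uc: "continuous_on UNIV (u n)" for n
    unfolding u_def[abs_def] by (intro continuous_intros iter_cont v)
  have rec: "u (Suc n) z = v z + \<nu> * iop (u n) z" for n z
  proof (induct n arbitrary: z)
    case 0
    have "iop (u 0) z = 0" unfolding iop_def u_def by (simp add: prim_zero)
    moreover have "u (Suc 0) z = v z" by (simp add: u_def)
    ultimately show ?case by simp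
  next
    case (Suc n)
    have e: "u (Suc n) = (\<lambda>z. u n z + \<nu> ^ n * iter v n z)" by (auto simp: u_def)
    have a: "iop (u (Suc n)) z = iop (u n) z + \<nu> ^ n * iter v (Suc n) z"
      unfolding e using iop_linear[OF uc[of n] iter_cont[OF v, of n]] by simp
    have b: "u (Suc (Suc n)) z = u (Suc n) z + \<nu> ^ Suc n * iter v (Suc n) z" by (simp add: u_def)
    show ?case unfolding b a Suc[of z] by (simp add: algebra_simps)
  qed
  have sc: "continuous_on UNIV (ser v \<nu>)" by (rule ser_cont[OF v])
  have "(\<lambda>n. iop (u n) x) \<longlonglongrightarrow> iop (ser v \<nu>) x"
  proof (rule LIMSEQ_I)
    fix e :: real assume e: "e > 0"
    define a where "a = e / (C * R + 1)"
    have CR: "C * R + 1 > 0" using C R by (simp add: add_nonneg_pos)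
    have a: "a > 0" using e CR by (simp add: a_def)
    have "eventually (\<lambda>n. \<forall>z\<in>{- R..R}. dist (u n z) (ser v \<nu> z) < a) sequentially"
      using ser_uniform[OF v R(1), of \<nu>] a unfolding uniform_limit_iff u_def by blast
    then obtain N where N: "\<And>n z. n \<ge> N \<Longrightarrow> z \<in> {- R..R} \<Longrightarrow> dist (u n z) (ser v \<nu> z) < a"
      unfolding eventually_sequentially by blast
    have "norm (iop (u n) x - iop (ser v \<nu>) x) < e" if n: "n \<ge> N" for n
    proof -
      have "iop (u n) x - iop (ser v \<nu>) x = iop (\<lambda>z. u n z + (- 1) * ser v \<nu> z) x"
        by (subst iop_linear[OF uc sc]) simp
      also have "\<bar>\<dots>\<bar> \<le> C * a * \<bar>x\<bar> ^ Suc 0 / real (Suc 0)"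
      proof (rule C(2)[OF _ _ _ R(2)])
        show "continuous_on UNIV (\<lambda>z. u n z + - 1 * ser v \<nu> z)" by (intro continuous_intros uc sc)
        show "\<bar>u n z + - 1 * ser v \<nu> z\<bar> \<le> a * \<bar>z\<bar> ^ 0" if "\<bar>z\<bar> \<le> R" for z
          using N[OF n, of z] that by (auto simp: dist_real_def abs_le_iff)
      qed (use a in auto)
      also have "\<dots> = (C * R) * a" by (simp add: R_def)
      also have "\<dots> < (C * R + 1) * a" using a by simp
      also have "\<dots> = e" using CR by (simp add: a_def)
      finally show ?thesis by simp
    qed
    then show "\<exists>N. \<forall>n\<ge>N. norm (iop (u n) x - iop (ser v \<nu>) x) < e" by blast
  qed
  then have "(\<lambda>n. v x + \<nu> * iop (u n) x) \<longlonglongrightarrow> v x + \<nu> * iop (ser v \<nu>) x" by (intro tendsto_intros)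
  then have "(\<lambda>n. u (Suc n) x) \<longlonglongrightarrow> v x + \<nu> * iop (ser v \<nu>) x" by (simp only: rec)
  moreover have "(\<lambda>n. u (Suc n) x) \<longlonglongrightarrow> ser v \<nu> x"
    unfolding u_def ser_def using ser_summable[OF v] by (intro LIMSEQ_Suc summable_LIMSEQ)
  ultimately show ?thesis by (rule LIMSEQ_unique[rotated])
qed

text \<open>For \<open>\<bar>\<nu>\<bar> \<le> 1\<close> the tail from index \<open>n\<close> is at
  most \<open>\<bar>\<nu>\<bar> ^ n\<close> times a convergent exponential series. The first order
  keeps positivity for small negative \<nu>, the second order feeds the law of large numbers for the
  cycle times.\<close>

lemma ser_expansion:
  assumes v: "continuous_on UNIV v" and R: "R \<ge> 0"
  obtains B where "B \<ge> 0" "\<And>\<nu> x. \<bar>\<nu>\<bar> \<le> 1 \<Longrightarrow> \<bar>x\<bar> \<le> R \<Longrightarrow> \<bar>ser v \<nu> x - v x\<bar> \<le> B * \<bar>\<nu>\<bar>"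
    "\<And>\<nu> x. \<bar>\<nu>\<bar> \<le> 1 \<Longrightarrow> \<bar>x\<bar> \<le> R \<Longrightarrow> \<bar>ser v \<nu> x - v x - \<nu> * iop v x\<bar> \<le> B * \<nu>\<^sup>2"
proof -
  obtain V C where VC: "V \<ge> 0" "C \<ge> 0" "\<And>k z. \<bar>z\<bar> \<le> R \<Longrightarrow> \<bar>iter v k z\<bar> \<le> V * (C ^ k / fact k)"
    using iter_bound[OF v R] by blast
  let ?f = "\<lambda>\<nu> x k. \<nu> ^ k * iter v k x"
  have tail: "\<bar>ser v \<nu> x - (\<Sum>k<n. ?f \<nu> x k)\<bar> \<le> (V * exp C) * \<bar>\<nu>\<bar> ^ n" if nu: "\<bar>\<nu>\<bar> \<le> 1" and x: "\<bar>x\<bar> \<le> R" for \<nu> x n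
  proof -
    have s: "summable (?f \<nu> x)" by (rule ser_summable[OF v])
    have "ser v \<nu> x - (\<Sum>k<n. ?f \<nu> x k) = (\<Sum>k. ?f \<nu> x (k + n))"
      unfolding ser_def using suminf_minus_initial_segment[OF s] by simp
    also have "\<bar>\<dots>\<bar> \<le> (\<Sum>k. \<bar>\<nu>\<bar> ^ n * (V * (C ^ (k + n) / fact (k + n))))"
    proof -
      have b: "norm (?f \<nu> x (k + n)) \<le> \<bar>\<nu>\<bar> ^ n * (V * (C ^ (k + n) / fact (k + n)))" for k
      proof -
        have "\<bar>\<nu>\<bar> ^ (k + n) \<le> \<bar>\<nu>\<bar> ^ n" using nu by (intro power_decreasing) auto
        then have "\<bar>\<nu>\<bar> ^ (k + n) * \<bar>iter v (k + n) x\<bar> \<le> \<bar>\<nu>\<bar> ^ n * (V * (C ^ (k + n) / fact (k + n)))"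
          by (intro mult_mono VC(3) x) auto
        then show ?thesis by (simp add: abs_mult power_abs)
      qed
      have s2: "summable (\<lambda>k. \<bar>\<nu>\<bar> ^ n * (V * (C ^ (k + n) / fact (k + n))))"
        by (intro summable_mult summable_ignore_initial_segment[OF exp_summable[of V C], simplified])
          (use summable_ignore_initial_segment[OF exp_summable[of 1 C], of n] in simp)
      show ?thesis using summable_norm_comparison_test[of "\<lambda>k. ?f \<nu> x (k + n)", OF _ s2]
          norm_suminf_le[OF b s2] by simp
    qed
    also have "\<dots> = \<bar>\<nu>\<bar> ^ n * (\<Sum>k. V * (C ^ (k + n) / fact (k + n)))"
      by (rule suminf_mult) (use summable_ignore_initial_segment[OF exp_summable[of V C], of n] in simp)
    also have "\<dots> \<le> \<bar>\<nu>\<bar> ^ n * (V * exp C)"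
    proof (rule mult_left_mono)
      have "(\<Sum>k. V * (C ^ (k + n) / fact (k + n))) = (\<Sum>k. V * (C ^ k / fact k)) - (\<Sum>k<n. V * (C ^ k / fact k))"
        by (rule suminf_minus_initial_segment[OF exp_summable])
      also have "\<dots> \<le> (\<Sum>k. V * (C ^ k / fact k))" using VC by (simp add: sum_nonneg)
      also have "\<dots> = V * exp C"
        using suminf_mult[OF exp_summable[of 1 C, simplified], of V] by (simp add: exp_suminf)
      finally show "(\<Sum>k. V * (C ^ (k + n) / fact (k + n))) \<le> V * exp C" .
    qed simp
    finally show ?thesis by (simp add: mult.commute)
  qed
  have "V * exp C \<ge> 0" using VC by simp
  then show ?thesis
    using tail[of _ _ 1] tail[of _ _ 2] by (intro that[of "V * exp C"]) (auto simp: numeral_2_eq_2 diff_diff_eq)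
qed

end

subsection \<open>Eigenfunctions of the generator\<close>

lemma bounded_ucont_lipschitz:
  assumes "\<And>x. \<bar>f x\<bar> \<le> B" and L: "\<And>x z. \<bar>f x - f z\<bar> \<le> L * \<bar>x - z\<bar>"
  shows "bounded_ucont f"
  unfolding bounded_ucont_def
proof
  show "\<exists>B. \<forall>x. \<bar>f x\<bar> \<le> B" using assms by blast
  show "uniformly_continuous_on UNIV f"
    unfolding uniformly_continuous_on_def dist_real_def
  proof (intro allI impI)
    fix e :: real assume e: "e > 0"
    have L0: "\<bar>L\<bar> + 1 > 0" by simp
    have "\<bar>f z - f x\<bar> < e" if d: "\<bar>z - x\<bar> < e / (\<bar>L\<bar> + 1)" for x z
    proof -
      have "\<bar>f z - f x\<bar> \<le> L * \<bar>z - x\<bar>" by (rule L)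
      also have "\<dots> \<le> (\<bar>L\<bar> + 1) * \<bar>z - x\<bar>" by (intro mult_right_mono) auto
      also have "\<dots> < e" using d L0 by (simp add: field_simps)
      finally show ?thesis .
    qed
    then show "\<exists>d>0. \<forall>x\<in>UNIV. \<forall>x'\<in>UNIV. \<bar>x' - x\<bar> < d \<longrightarrow> \<bar>f x' - f x\<bar> < e"
      using e L0 by (intro exI[of _ "e / (\<bar>L\<bar> + 1)"]) auto
  qed
qed

lemma bounded_ucont_compose:
  assumes g: "bounded_ucont g" and u: "continuous_on UNIV u"
  shows "bounded_ucont (\<lambda>x. u (g x))"
proof -
  obtain B where B: "B \<ge> 0" "\<And>x. \<bar>g x\<bar> \<le> B" using bounded_ucontD_bound[OF g] by blast
  have r: "g x \<in> {- B..B}" for x using B(2)[of x] by (auto simp: abs_le_iff)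
  have cu: "continuous_on {- B..B} u" by (rule continuous_on_subset[OF u]) simp
  have "bounded (u ` {- B..B})" by (intro compact_imp_bounded compact_continuous_image cu) simp
  then obtain A where "\<forall>z\<in>{- B..B}. \<bar>u z\<bar> \<le> A" by (auto simp: bounded_iff)
  then have bd: "\<forall>x. \<bar>u (g x)\<bar> \<le> A" using r by blast
  have "uniformly_continuous_on (g ` UNIV) u"
    unfolding uniformly_continuous_on_def
  proof (intro allI impI)
    fix e :: real assume "e > 0"
    then obtain d where "d > 0" "\<forall>x\<in>{- B..B}. \<forall>x'\<in>{- B..B}. dist x' x < d \<longrightarrow> dist (u x') (u x) < e"
      using compact_uniformly_continuous[OF cu] unfolding uniformly_continuous_on_def by blast
    then show "\<exists>d>0. \<forall>x\<in>g ` UNIV. \<forall>x'\<in>g ` UNIV. dist x' x < d \<longrightarrow> dist (u x') (u x) < e"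
      using r by (intro exI[of _ d]) blast
  qed
  then have "uniformly_continuous_on UNIV (\<lambda>x. u (g x))"
    using g uniformly_continuous_on_compose unfolding bounded_ucont_def by (metis comp_def)
  with bd show ?thesis unfolding bounded_ucont_def by blast
qed

lemma bounded_ucont_add: assumes "bounded_ucont f" "bounded_ucont g" shows "bounded_ucont (\<lambda>x. f x + g x)"
proof -
  obtain B where B: "\<And>x. \<bar>f x\<bar> \<le> B" using bounded_ucontD_bound[OF assms(1)] by blast
  obtain C where C: "\<And>x. \<bar>g x\<bar> \<le> C" using bounded_ucontD_bound[OF assms(2)] by blast
  have "\<bar>f x + g x\<bar> \<le> B + C" for x using B[of x] C[of x] by linarith
  moreover have "uniformly_continuous_on UNIV (\<lambda>x. f x + g x)"
    using assms by (intro uniformly_continuous_on_add) (auto simp: bounded_ucont_def)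
  ultimately show ?thesis unfolding bounded_ucont_def by blast
qed

lemma bounded_ucont_cmult: assumes "bounded_ucont f" shows "bounded_ucont (\<lambda>x. c * f x)"
  by (rule bounded_ucont_compose[OF assms]) (intro continuous_intros)

text \<open>Polarisation reduces products to squares, and squares are compositions with a continuous
  function.\<close>

lemma bounded_ucont_mult: assumes "bounded_ucont f" "bounded_ucont g" shows "bounded_ucont (\<lambda>x. f x * g x)"
proof -
  have "bounded_ucont (\<lambda>x. (1/4) * (f x + g x)\<^sup>2 + (- 1/4) * (f x + (- 1) * g x)\<^sup>2)"
    by (intro bounded_ucont_add bounded_ucont_cmult bounded_ucont_compose[where u="\<lambda>z. z\<^sup>2"] assms) (intro continuous_intros)+
  moreover have "(1/4) * (f x + g x)\<^sup>2 + (- 1/4) * (f x + (- 1) * g x)\<^sup>2 = f x * g x" for x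
    by (simp add: power2_eq_square algebra_simps)
  ultimately show ?thesis by simp
qed

section \<open>Making functions bounded outside an interval of radius 1\<close>

lemma DERIV_glue:
  fixes A B :: "real \<Rightarrow> real"
  assumes A: "\<And>x. (A has_real_derivative A' x) (at x)" and B: "\<And>x. (B has_real_derivative B' x) (at x)"
    and eq: "A a = B a" "A' a = B' a"
  shows "((\<lambda>x. if x \<le> a then A x else B x) has_real_derivative (if x \<le> a then A' x else B' x)) (at x)"
proof -
  let ?f = "\<lambda>x. if x \<le> a then A x else B x"
  consider "x < a" | "x > a" | "x = a" by linarith
  then show ?thesis
  proof cases
    case 1
    then have "(?f has_real_derivative A' x) (at x)"
      by (intro has_field_derivative_transform_within_open[OF A, of "{..<a}"]) auto
    then show ?thesis using 1 by simp
  next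
    case 2
    then have "(?f has_real_derivative B' x) (at x)"
      by (intro has_field_derivative_transform_within_open[OF B, of "{a<..}"]) auto
    then show ?thesis using 2 by simp
  next
    case 3
    have "(?f has_real_derivative A' a) (at a within {..a})"
      by (rule has_field_derivative_transform_within[OF has_field_derivative_at_within[OF A] zero_less_one]) auto
    moreover have "(?f has_real_derivative A' a) (at a within {a..})"
      unfolding eq(2)
      by (rule has_field_derivative_transform_within[OF has_field_derivative_at_within[OF B] zero_less_one]) (use eq in auto)
    ultimately have "(?f has_real_derivative A' a) (at a)"
      unfolding has_field_derivative_iff by (rule Lim_Un_univ) auto
    then show ?thesis using 3 by simp
  qed
qed

text \<open>A bounded \<open>C\<^sup>2\<close> function that is the identity on \<open>[-1,1]\<close>: composing with it makes any
  \<open>C\<^sup>2\<close> function bounded without changing it there.\<close>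
definition clamp :: "real \<Rightarrow> real" where "clamp x = max (- 1) (min 1 x)"
definition fold0 :: "real \<Rightarrow> real" where "fold0 x = clamp x + sin (x - clamp x)"
definition fold1 :: "real \<Rightarrow> real" where "fold1 x = cos (x - clamp x)"
definition fold2 :: "real \<Rightarrow> real" where "fold2 x = - sin (x - clamp x)"

lemma fold_inside: "\<bar>x\<bar> \<le> 1 \<Longrightarrow> fold0 x = x" "\<bar>x\<bar> \<le> 1 \<Longrightarrow> fold1 x = 1" "\<bar>x\<bar> \<le> 1 \<Longrightarrow> fold2 x = 0"
  by (auto simp: fold0_def fold1_def fold2_def clamp_def max_def min_def)

lemma fold_deriv:
  "(fold0 has_real_derivative fold1 x) (at x)" "(fold1 has_real_derivative fold2 x) (at x)"
proof -
  let ?f0 = "\<lambda>x. if x \<le> 1 then (if x \<le> - 1 then - 1 + sin (x + 1) else x) else 1 + sin (x - 1)"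
  let ?f1 = "\<lambda>x. if x \<le> 1 then (if x \<le> - 1 then cos (x + 1) else 1) else cos (x - 1)"
  let ?f2 = "\<lambda>x. if x \<le> 1 then (if x \<le> - 1 then - sin (x + 1) else 0) else - sin (x - 1)"
  have e: "fold0 = ?f0" "fold1 = ?f1" "fold2 = ?f2"
    by (auto simp: fun_eq_iff fold0_def fold1_def fold2_def clamp_def max_def min_def)
  have "((\<lambda>x. if x \<le> - 1 then - 1 + sin (x + 1) else x) has_real_derivative (if x \<le> - 1 then cos (x + 1) else 1)) (at x)" for x :: real
    by (rule DERIV_glue) (auto intro!: derivative_eq_intros)
  then show "(fold0 has_real_derivative fold1 x) (at x)" unfolding e
    by (rule DERIV_glue) (auto intro!: derivative_eq_intros)
  have "((\<lambda>x. if x \<le> - 1 then cos (x + 1) else 1) has_real_derivative (if x \<le> - 1 then - sin (x + 1) else 0)) (at x)" for x :: real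
    by (rule DERIV_glue) (auto intro!: derivative_eq_intros)
  then show "(fold1 has_real_derivative fold2 x) (at x)" unfolding e
    by (rule DERIV_glue) (auto intro!: derivative_eq_intros)
qed

lemma fold_bounded_ucont: "bounded_ucont (\<lambda>x. fold0 (x - c))" "bounded_ucont (\<lambda>x. fold1 (x - c))" "bounded_ucont (\<lambda>x. fold2 (x - c))"
proof -
  have b2: "\<bar>fold2 x\<bar> \<le> 1" and b1: "\<bar>fold1 x\<bar> \<le> 1" for x by (auto simp: fold2_def fold1_def)
  have b0: "\<bar>fold0 x\<bar> \<le> 2" for x
  proof -
    have "- 1 \<le> clamp x" "clamp x \<le> 1" by (auto simp: clamp_def)
    then show ?thesis using sin_le_one[of "x - clamp x"] sin_ge_minus_one[of "x - clamp x"]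
      unfolding fold0_def abs_le_iff by linarith
  qed
  have sl: "\<bar>sin s - sin t\<bar> \<le> 1 * \<bar>s - t\<bar>" for s t :: real
    unfolding real_norm_def[symmetric]
    by (rule field_differentiable_bound[of UNIV sin cos]) (auto intro: derivative_eq_intros)
  have l0: "\<bar>fold0 s - fold0 t\<bar> \<le> 1 * \<bar>s - t\<bar>" for s t
    unfolding real_norm_def[symmetric]
    by (rule field_differentiable_bound[of UNIV fold0 fold1]) (use fold_deriv b1 in auto)
  have l1: "\<bar>fold1 s - fold1 t\<bar> \<le> 1 * \<bar>s - t\<bar>" for s t
    unfolding real_norm_def[symmetric]
    by (rule field_differentiable_bound[of UNIV fold1 fold2]) (use fold_deriv b2 in auto)
  have l2: "\<bar>fold2 s - fold2 t\<bar> \<le> 1 * \<bar>s - t\<bar>" for s t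
  proof -
    have "\<bar>fold2 s - fold2 t\<bar> \<le> 1 * \<bar>(t - clamp t) - (s - clamp s)\<bar>"
      using sl[of "t - clamp t" "s - clamp s"] by (simp add: fold2_def)
    also have "\<dots> \<le> 1 * \<bar>s - t\<bar>" by (auto simp: clamp_def max_def min_def)
    finally show ?thesis .
  qed
  show "bounded_ucont (\<lambda>x. fold0 (x - c))" by (rule bounded_ucont_lipschitz[of _ 2 1]) (use b0 l0[of "_ - c" "_ - c"] in auto)
  show "bounded_ucont (\<lambda>x. fold1 (x - c))" by (rule bounded_ucont_lipschitz[of _ 1 1]) (use b1 l1[of "_ - c" "_ - c"] in auto)
  show "bounded_ucont (\<lambda>x. fold2 (x - c))" by (rule bounded_ucont_lipschitz[of _ 1 1]) (use b2 l2[of "_ - c" "_ - c"] in auto)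
qed

lemma bounded_C2_extension:
  fixes u u1 u2 :: "real \<Rightarrow> real"
  assumes d1: "\<And>x. (u has_real_derivative u1 x) (at x)" and d2: "\<And>x. (u1 has_real_derivative u2 x) (at x)"
    and c2: "continuous_on UNIV u2"
  obtains f f' f'' where
    "\<And>x. (f has_real_derivative f' x) (at x)" "\<And>x. (f' has_real_derivative f'' x) (at x)"
    "bounded_ucont f" "bounded_ucont f'" "bounded_ucont f''"
    "\<And>x. \<bar>x - c\<bar> \<le> 1 \<Longrightarrow> f x = u (x - c) \<and> f' x = u1 (x - c) \<and> f'' x = u2 (x - c)"
proof -
  have c0: "continuous_on UNIV u" and c1: "continuous_on UNIV u1"
    using d1 d2 by (meson DERIV_isCont continuous_at_imp_continuous_on)+
  define f where "f x = u (fold0 (x - c))" for x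
  define f' where "f' x = u1 (fold0 (x - c)) * fold1 (x - c)" for x
  define f'' where "f'' x = u2 (fold0 (x - c)) * (fold1 (x - c) * fold1 (x - c)) + u1 (fold0 (x - c)) * fold2 (x - c)" for x
  have s: "((\<lambda>x. x - c) has_real_derivative 1) (at x)" for x by (auto intro!: derivative_eq_intros)
  have t0: "((\<lambda>x. fold0 (x - c)) has_real_derivative fold1 (x - c)) (at x)" for x
    using DERIV_chain2[OF fold_deriv(1) s] by simp
  have t1: "((\<lambda>x. fold1 (x - c)) has_real_derivative fold2 (x - c)) (at x)" for x
    using DERIV_chain2[OF fold_deriv(2) s] by simp
  have "(f has_real_derivative f' x) (at x)" for x
    unfolding f_def[abs_def] f'_def by (rule DERIV_chain2[OF d1 t0])
  moreover have "(f' has_real_derivative f'' x) (at x)" for x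
    unfolding f'_def[abs_def] f''_def
    using DERIV_mult[OF DERIV_chain2[OF d2 t0] t1, of x] by (simp add: algebra_simps)
  moreover have "bounded_ucont f" "bounded_ucont f'" "bounded_ucont f''"
    unfolding f_def[abs_def] f'_def[abs_def] f''_def[abs_def]
    by (intro bounded_ucont_add bounded_ucont_mult bounded_ucont_compose[OF fold_bounded_ucont(1)] fold_bounded_ucont c0 c1 c2)+
  moreover have "\<bar>x - c\<bar> \<le> 1 \<Longrightarrow> f x = u (x - c) \<and> f' x = u1 (x - c) \<and> f'' x = u2 (x - c)" for x
    by (simp add: f_def f'_def f''_def fold_inside)
  ultimately show ?thesis using that by blast
qed

section \<open>Positivity of the iterated integrals and the first-order system\<close>

context sturm begin

lemma iop_nonneg_right:
  assumes v: "continuous_on UNIV v" and nn: "\<And>z. 0 \<le> z \<Longrightarrow> 0 \<le> v z" and x: "0 \<le> x"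
  shows "0 \<le> iop v x"
  unfolding iop_def
  by (intro prim_nonneg[OF iop_outer_cont[OF v] x] mult_nonneg_nonneg prim_nonneg[OF iop_inner_cont[OF v]])
    (use nn pp qp in \<open>auto intro: less_imp_le\<close>)

lemma prim_neg_left:
  assumes c: "continuous_on UNIV g" and x: "x \<le> 0" and g: "\<And>z. x \<le> z \<Longrightarrow> z \<le> 0 \<Longrightarrow> 0 \<le> g z"
  shows "prim g x \<le> 0"
proof -
  have "prim (\<lambda>z. 0 + (- 1) * g z) x = - prim g x" by (subst prim_linear) (auto simp: c prim_zero)
  moreover have "0 \<le> prim (\<lambda>z. 0 + (- 1) * g z) x"
    by (rule prim_nonneg'[OF _ x]) (use c g in \<open>auto intro!: continuous_intros\<close>)
  ultimately show ?thesis by simp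
qed

lemma iop_nonneg:
  assumes v: "continuous_on UNIV v" and nn: "\<And>z. 0 \<le> v z"
  shows "0 \<le> iop v x"
proof (cases "0 \<le> x")
  case True then show ?thesis by (intro iop_nonneg_right v nn)
next
  case False
  have "prim (\<lambda>y. q y * v y) z \<le> 0" if "z \<le> 0" for z
    by (rule prim_neg_left[OF iop_inner_cont[OF v] that]) (use nn qp in \<open>auto intro: mult_nonneg_nonneg less_imp_le\<close>)
  then show ?thesis unfolding iop_def
    by (intro prim_nonneg'[OF iop_outer_cont[OF v]] mult_nonneg_nonpos) (use False pp in \<open>auto intro: less_imp_le\<close>)
qed

text \<open>\<open>iop (\<lambda>_. 1)\<close> is sent to 1 by the generator and vanishes at the
  start, so its values at the exit points, averaged over the exit sign, give the mean duration of a
  cycle. Strict positivity makes that mean positive.\<close>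

lemma iop_one_pos: "x \<noteq> 0 \<Longrightarrow> 0 < iop (\<lambda>_. 1) x"
proof -
  assume x: "x \<noteq> 0"
  have v: "continuous_on UNIV (\<lambda>_::real. 1::real)" by simp
  show ?thesis
  proof (cases "x > 0")
    case True
    show ?thesis unfolding iop_def
      by (intro prim_pos[OF iop_outer_cont[OF v] True] mult_pos_pos prim_pos[OF iop_inner_cont[OF v]]) (use pp qp in auto)
  next
    case False
    have "prim (\<lambda>y. q y * 1) z < 0" if z: "z < 0" for z
    proof -
      have "prim (\<lambda>z. 0 + (- 1) * (q z * 1)) z = - prim (\<lambda>y. q y * 1) z"
        by (subst prim_linear) (auto simp: prim_zero iop_inner_cont[OF v, simplified])
      moreover have "0 < prim (\<lambda>z. 0 + (- 1) * (q z * 1)) z"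
        by (rule prim_pos'[OF _ z]) (use qp cq in \<open>auto intro!: continuous_intros\<close>)
      ultimately show ?thesis by simp
    qed
    then show ?thesis unfolding iop_def
      by (intro prim_pos'[OF iop_outer_cont[OF v]] mult_pos_neg) (use False x pp in auto)
  qed
qed

lemma ser_ge:
  assumes v: "continuous_on UNIV v" and nu: "\<nu> \<ge> 0" and nn: "\<And>k. 0 \<le> iter v k x"
  shows "v x \<le> ser v \<nu> x"
  unfolding ser_def
  using sum_le_suminf[OF ser_summable[OF v], of "{0}" \<nu> x] nu nn by simp

text \<open>The flux \<open>w = u' / p\<close> turns the second-order equation into
  \<open>u' = p w\<close>, \<open>w' = \<nu> q u\<close>. Its value at 0 is \<alpha>, which is 0 for
  the cosine-type and 1 for the sine-type solution.\<close>

lemma ser_ode: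
  assumes v: "continuous_on UNIV v" and dv: "\<And>x. (v has_real_derivative \<alpha> * p x) (at x)"
  defines "w \<equiv> \<lambda>\<nu> x. \<alpha> + \<nu> * prim (\<lambda>y. q y * ser v \<nu> y) x"
  shows "(ser v \<nu> has_real_derivative p x * w \<nu> x) (at x)"
    "(w \<nu> has_real_derivative \<nu> * (q x * ser v \<nu> x)) (at x)" "w \<nu> 0 = \<alpha>" "ser v \<nu> 0 = v 0"
proof -
  have sc: "continuous_on UNIV (ser v \<nu>)" by (rule ser_cont[OF v])
  have "((\<lambda>x. v x + \<nu> * iop (ser v \<nu>) x) has_real_derivative \<alpha> * p x + \<nu> * (p x * prim (\<lambda>y. q y * ser v \<nu> y) x)) (at x)"
    unfolding iop_def by (intro DERIV_add dv DERIV_cmult prim_deriv iop_outer_cont sc)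
  moreover have "(\<lambda>x. v x + \<nu> * iop (ser v \<nu>) x) = ser v \<nu>" using ser_fixpoint[OF v] by (auto simp: fun_eq_iff)
  ultimately show "(ser v \<nu> has_real_derivative p x * w \<nu> x) (at x)" by (simp add: w_def algebra_simps)
  have "((\<lambda>x. \<alpha> + \<nu> * prim (\<lambda>y. q y * ser v \<nu> y) x) has_real_derivative 0 + \<nu> * (q x * ser v \<nu> x)) (at x)"
    by (intro DERIV_add DERIV_const DERIV_cmult prim_deriv iop_inner_cont sc)
  then show "(w \<nu> has_real_derivative \<nu> * (q x * ser v \<nu> x)) (at x)" by (simp add: w_def)
  show "w \<nu> 0 = \<alpha>" by (simp add: w_def)
  show "ser v \<nu> 0 = v 0" using ser_fixpoint[OF v, of \<nu> 0] by (simp add: iop_def)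
qed

end

section \<open>The periodic generator in scale and speed form\<close>

locale periodic_sde = sde +
  assumes pb: "\<And>x. b (x + 1) = b x" and ps: "\<And>x. \<sigma> (x + 1) = \<sigma> x" and sp: "\<And>x. \<sigma> x > 0"
begin

definition \<beta> :: "real \<Rightarrow> real" where "\<beta> z = 2 * b (y + z) / (\<sigma> (y + z))\<^sup>2"
text \<open>Derivative of the scale function, in coordinates centred at \<open>y\<close>. With the
  speed density \<open>spd\<close> the generator takes the form
  \<open>(u' / scl)' / spd\<close>.\<close>

definition scl :: "real \<Rightarrow> real" where "scl z = exp (- prim \<beta> z)"
definition spd :: "real \<Rightarrow> real" where "spd z = 2 / ((\<sigma> (y + z))\<^sup>2 * scl z)"
definition kap :: real where "kap = exp (prim \<beta> 1)"

lemma coeff_cont: "continuous_on UNIV (\<lambda>z. b (y + z))" "continuous_on UNIV (\<lambda>z. \<sigma> (y + z))"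
  by (rule continuous_on_compose2[OF bounded_ucont_continuous[OF mb]] continuous_on_compose2[OF bounded_ucont_continuous[OF ms]];
      auto intro!: continuous_intros)+

lemma \<beta>_cont: "continuous_on UNIV \<beta>"
  unfolding \<beta>_def[abs_def] using sp by (intro continuous_intros coeff_cont) (auto simp: less_imp_neq[symmetric])

lemma scl_pos: "scl z > 0" by (simp add: scl_def)

lemma scl_deriv: "(scl has_real_derivative - \<beta> z * scl z) (at z)"
  unfolding scl_def[abs_def]
  by (rule DERIV_cong, rule DERIV_fun_exp[OF DERIV_minus[OF prim_deriv[OF \<beta>_cont]]]) simp

lemma scl_cont: "continuous_on UNIV scl"
  using scl_deriv by (meson DERIV_isCont continuous_at_imp_continuous_on)

lemma spd_cont: "continuous_on UNIV spd"
  unfolding spd_def[abs_def] using sp scl_pos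
  by (intro continuous_intros coeff_cont scl_cont) (auto simp: less_imp_neq[symmetric])

lemma spd_pos: "spd z > 0" unfolding spd_def using sp scl_pos by (intro divide_pos_pos mult_pos_pos zero_less_power) auto

sublocale sturm scl spd
  by unfold_locales (rule scl_cont spd_cont scl_pos spd_pos)+

lemma kap_pos: "kap > 0" by (simp add: kap_def)

lemma period_shift: "b (y + (x - 1)) = b (y + x)" "\<sigma> (y + (x - 1)) = \<sigma> (y + x)" "\<beta> (x - 1) = \<beta> x"
  using pb[of "y + x - 1"] ps[of "y + x - 1"] by (auto simp: \<beta>_def algebra_simps)

text \<open>\<beta> is periodic, so its primitive changes by a constant over a period. Scale and
  speed pick up reciprocal factors, hence a translated solution solves the same equation with its
  flux rescaled by \<open>kap\<close>.\<close>

lemma scl_shift: "scl (x - 1) = kap * scl x" and spd_shift: "spd (x - 1) = spd x / kap"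
proof -
  have "((\<lambda>z. prim \<beta> (z - 1)) has_real_derivative \<beta> x) (at x)" for x
  proof -
    have "((\<lambda>z. z - 1) has_real_derivative 1) (at x)" by (auto intro!: derivative_eq_intros)
    from DERIV_chain2[where f="prim \<beta>" and g="\<lambda>z. z - 1" and x=x, OF prim_deriv[OF \<beta>_cont] this]
    show ?thesis using period_shift(3) by simp
  qed
  then have u: "prim \<beta> x = prim \<beta> (x - 1) - prim \<beta> (0 - 1)" for x by (rule prim_unique[OF \<beta>_cont])
  from u[of 1] have "prim \<beta> (0 - 1) = - prim \<beta> 1" by simp
  with u[of x] have "- prim \<beta> (x - 1) = prim \<beta> 1 + - prim \<beta> x" by simp
  then show s: "scl (x - 1) = kap * scl x" unfolding scl_def kap_def exp_add[symmetric] by simp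
  show "spd (x - 1) = spd x / kap" unfolding spd_def s period_shift(2) by (simp add: field_simps)
qed

definition cosf :: "real \<Rightarrow> real \<Rightarrow> real" where "cosf \<nu> = ser (\<lambda>_. 1) \<nu>"
definition sinf :: "real \<Rightarrow> real \<Rightarrow> real" where "sinf \<nu> = ser (prim scl) \<nu>"

lemma one_cont: "continuous_on UNIV (\<lambda>_::real. 1::real)" by simp
lemma S_cont: "continuous_on UNIV (prim scl)" by (rule prim_continuous[OF scl_cont])

lemma ser_eigen:
  assumes v: "continuous_on UNIV v" and dv: "\<And>x. (v has_real_derivative \<alpha> * scl x) (at x)"
  obtains u1 u2 where "\<And>x. (ser v \<nu> has_real_derivative u1 x) (at x)" "\<And>x. (u1 has_real_derivative u2 x) (at x)"
    "continuous_on UNIV u2" "\<And>x. b (y + x) * u1 x + (\<sigma> (y + x))\<^sup>2 * u2 x / 2 = \<nu> * ser v \<nu> x"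
proof -
  define w where "w x = \<alpha> + \<nu> * prim (\<lambda>y. spd y * ser v \<nu> y) x" for x
  note o = ser_ode[OF v dv, of \<nu>, folded w_def]
  define u2 where "u2 x = - \<beta> x * scl x * w x + scl x * (\<nu> * (spd x * ser v \<nu> x))" for x
  have wc: "continuous_on UNIV w" using o(2) by (meson DERIV_isCont continuous_at_imp_continuous_on)
  show ?thesis
  proof (rule that[OF o(1)])
    show "((\<lambda>x. scl x * w x) has_real_derivative u2 x) (at x)" for x
      using DERIV_mult[OF scl_deriv o(2), of x] by (simp add: u2_def algebra_simps)
    show "continuous_on UNIV u2" unfolding u2_def[abs_def]
      by (intro continuous_intros \<beta>_cont scl_cont spd_cont wc ser_cont v)
    show "b (y + x) * (scl x * w x) + (\<sigma> (y + x))\<^sup>2 * u2 x / 2 = \<nu> * ser v \<nu> x" for x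
      using sp[of "y + x"] scl_pos[of x] unfolding u2_def \<beta>_def spd_def
      by (simp add: field_simps power2_eq_square)
  qed
qed

lemma cosf_eigen:
  obtains u1 u2 where "\<And>x. (cosf \<nu> has_real_derivative u1 x) (at x)" "\<And>x. (u1 has_real_derivative u2 x) (at x)"
    "continuous_on UNIV u2" "\<And>x. b (y + x) * u1 x + (\<sigma> (y + x))\<^sup>2 * u2 x / 2 = \<nu> * cosf \<nu> x"
proof -
  have "((\<lambda>_. 1) has_real_derivative 0 * scl x) (at x)" for x by simp
  from ser_eigen[OF one_cont this, of \<nu>] show ?thesis using that unfolding cosf_def by blast
qed

lemma S_deriv: "(prim scl has_real_derivative 1 * scl x) (at x)" using prim_deriv[OF scl_cont] by simp

lemma sinf_eigen:
  obtains u1 u2 where "\<And>x. (sinf \<nu> has_real_derivative u1 x) (at x)" "\<And>x. (u1 has_real_derivative u2 x) (at x)"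
    "continuous_on UNIV u2" "\<And>x. b (y + x) * u1 x + (\<sigma> (y + x))\<^sup>2 * u2 x / 2 = \<nu> * sinf \<nu> x"
  using ser_eigen[OF S_cont S_deriv, of \<nu>] unfolding sinf_def by blast

lemma cosf_0: "cosf \<nu> 0 = 1" unfolding cosf_def using ser_fixpoint[OF one_cont, of \<nu> 0] by (simp add: iop_def)
lemma sinf_0: "sinf \<nu> 0 = 0" unfolding sinf_def using ser_fixpoint[OF S_cont, of \<nu> 0] by (simp add: iop_def)

text \<open>The Wronskian of \<open>sinf \<nu>\<close> and its translate by one period is constant.\<close>
lemma sinf_reflect: "sinf \<nu> (- 1) = - kap * sinf \<nu> 1"
proof -
  define w where "w x = 1 + \<nu> * prim (\<lambda>y. spd y * sinf \<nu> y) x" for x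
  note o = ser_ode[OF S_cont S_deriv, of \<nu>, folded sinf_def, folded w_def]
  have sh: "((\<lambda>x. x - 1) has_real_derivative 1) (at x)" for x :: real by (auto intro!: derivative_eq_intros)
  have o1: "((\<lambda>x. sinf \<nu> (x - 1)) has_real_derivative scl (x - 1) * w (x - 1)) (at x)" for x
    using DERIV_chain2[OF o(1) sh] by simp
  have o2: "((\<lambda>x. w (x - 1)) has_real_derivative \<nu> * (spd (x - 1) * sinf \<nu> (x - 1))) (at x)" for x
    using DERIV_chain2[OF o(2) sh] by simp
  \<comment> \<open>The factor \<open>kap\<close> is needed because the translate has derivative
    \<open>kap * scl x * w (x - 1)\<close>. At 1 and at 0 one term vanishes and the remaining flux
    is 1, leaving \<open>kap * sinf \<nu> 1\<close> and \<open>- sinf \<nu> (- 1)\<close>.\<close>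
  define G where "G x = kap * (sinf \<nu> x * w (x - 1)) - w x * sinf \<nu> (x - 1)" for x
  have "(G has_real_derivative 0) (at x)" for x
  proof -
    have "(G has_real_derivative kap * ((scl x * w x) * w (x - 1) + (\<nu> * (spd (x - 1) * sinf \<nu> (x - 1))) * sinf \<nu> x)
       - ((\<nu> * (spd x * sinf \<nu> x)) * sinf \<nu> (x - 1) + (scl (x - 1) * w (x - 1)) * w x)) (at x)"
      unfolding G_def[abs_def] by (intro DERIV_diff DERIV_cmult DERIV_mult o o1 o2)
    then show ?thesis unfolding scl_shift spd_shift using kap_pos by (simp add: algebra_simps)
  qed
  then have "G 1 = G 0" by (intro DERIV_isconst_all) auto
  then show ?thesis unfolding G_def using o(3,4) by (simp add: sinf_0)
qed

lemma cosf_ge_1: "\<nu> \<ge> 0 \<Longrightarrow> cosf \<nu> x \<ge> 1"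
proof -
  have "0 \<le> iter (\<lambda>_. 1) k x" for k x
    by (induct k arbitrary: x) (auto intro!: iop_nonneg iter_cont one_cont)
  then show "\<nu> \<ge> 0 \<Longrightarrow> cosf \<nu> x \<ge> 1" unfolding cosf_def by (intro ser_ge[OF one_cont])
qed

lemma S1_pos: "prim scl 1 > 0" by (rule prim_pos[OF scl_cont]) (use scl_pos in auto)

lemma sinf_pos: "\<nu> \<ge> 0 \<Longrightarrow> sinf \<nu> 1 > 0"
proof -
  have "0 \<le> iter (prim scl) k x" if "0 \<le> x" for k x
    using that
  proof (induct k arbitrary: x)
    case 0
    then show ?case by simp (rule prim_nonneg[OF scl_cont], auto intro: less_imp_le scl_pos)
  qed (auto intro!: iop_nonneg_right iter_cont S_cont)
  then show "\<nu> \<ge> 0 \<Longrightarrow> sinf \<nu> 1 > 0"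
    unfolding sinf_def using ser_ge[OF S_cont, of \<nu> 1] S1_pos by fastforce
qed

text \<open>For negative \<nu> the series no longer has terms of one sign, so positivity comes from
  expansion around 0. The lower bound 1/2 on the whole interval lets the cosine-type martingale
  dominate the exponential of the exit time.\<close>

lemma small_parameter:
  obtains \<mu> where "\<mu> > 0" "\<mu> \<le> 1" "\<And>\<nu> x. \<nu> \<ge> - \<mu> \<Longrightarrow> \<bar>x\<bar> \<le> 1 \<Longrightarrow> cosf \<nu> x \<ge> 1 / 2" "\<And>\<nu>. \<nu> \<ge> - \<mu> \<Longrightarrow> sinf \<nu> 1 > 0"
proof -
  obtain B where B: "B \<ge> 0" "\<And>\<nu> x. \<bar>\<nu>\<bar> \<le> 1 \<Longrightarrow> \<bar>x\<bar> \<le> 1 \<Longrightarrow> \<bar>cosf \<nu> x - 1\<bar> \<le> B * \<bar>\<nu>\<bar>"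
    using ser_expansion[OF one_cont, of 1] unfolding cosf_def by (metis zero_le_one)
  obtain D where D: "D \<ge> 0" "\<And>\<nu> x. \<bar>\<nu>\<bar> \<le> 1 \<Longrightarrow> \<bar>x\<bar> \<le> 1 \<Longrightarrow> \<bar>sinf \<nu> x - prim scl x\<bar> \<le> D * \<bar>\<nu>\<bar>"
    using ser_expansion[OF S_cont, of 1] unfolding sinf_def by (metis zero_le_one)
  \<comment> \<open>The second entry gives \<open>B * \<mu> \<le> 1 / 2\<close> and the third
    \<open>D * \<mu> < prim scl 1\<close>; these bound the deviations from the values at
    \<open>\<nu> = 0\<close>.\<close>
  define \<mu> where "\<mu> = min 1 (min (1 / (2 * B + 1)) (prim scl 1 / (D + 1)))"
  have m: "\<mu> > 0" "\<mu> \<le> 1" using B(1) D(1) S1_pos by (auto simp: \<mu>_def add_nonneg_pos)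
  have mB: "B * \<mu> \<le> 1 / 2"
  proof -
    have "\<mu> \<le> 1 / (2 * B + 1)" by (simp add: \<mu>_def)
    then have "B * \<mu> \<le> B * (1 / (2 * B + 1))" using B(1) by (intro mult_left_mono)
    also have "\<dots> \<le> 1 / 2" using B(1) by (simp add: field_simps)
    finally show ?thesis .
  qed
  have mD: "D * \<mu> < prim scl 1"
  proof -
    have "\<mu> \<le> prim scl 1 / (D + 1)" by (simp add: \<mu>_def)
    then have "D * \<mu> \<le> D * (prim scl 1 / (D + 1))" using D(1) by (intro mult_left_mono)
    also have "\<dots> < prim scl 1" using D(1) S1_pos by (simp add: field_simps)
    finally show ?thesis .
  qed
  show ?thesis
  proof (rule that[OF m])
    show "cosf \<nu> x \<ge> 1 / 2" if nu: "\<nu> \<ge> - \<mu>" and x: "\<bar>x\<bar> \<le> 1" for \<nu> x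
    proof (cases "\<nu> \<ge> 0")
      case True then show ?thesis using cosf_ge_1[of \<nu> x] by simp
    next
      case False
      then have a: "\<bar>\<nu>\<bar> \<le> \<mu>" "\<bar>\<nu>\<bar> \<le> 1" using nu m by auto
      have "B * \<bar>\<nu>\<bar> \<le> B * \<mu>" using a B(1) by (intro mult_left_mono)
      then show ?thesis using B(2)[OF a(2) x] mB by linarith
    qed
    show "sinf \<nu> 1 > 0" if nu: "\<nu> \<ge> - \<mu>" for \<nu>
    proof (cases "\<nu> \<ge> 0")
      case True then show ?thesis by (rule sinf_pos)
    next
      case False
      then have a: "\<bar>\<nu>\<bar> \<le> \<mu>" "\<bar>\<nu>\<bar> \<le> 1" using nu m by auto
      have "D * \<bar>\<nu>\<bar> \<le> D * \<mu>" using a D(1) by (intro mult_left_mono)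
      then show ?thesis using D(2)[OF a(2), of 1] mD by simp
    qed
  qed
qed

lemma cosf_second_order:
  obtains B where "B \<ge> 0" "\<And>\<nu> x. \<bar>\<nu>\<bar> \<le> 1 \<Longrightarrow> \<bar>x\<bar> \<le> 1 \<Longrightarrow> \<bar>cosf \<nu> x - 1 - \<nu> * iop (\<lambda>_. 1) x\<bar> \<le> B * \<nu>\<^sup>2"
  using ser_expansion[OF one_cont, of 1] unfolding cosf_def by (metis zero_le_one)

end

subsection \<open>Optional stopping at the cycle times\<close>

lemma disp_int: "\<exists>n::int. disp es = of_int n"
proof (induct es)
  case (Cons e es)
  then obtain n where "disp es = of_int n" by blast
  then have "disp (e # es) = of_int ((if e then 1 else - 1) + n)" by (simp add: disp_def sg_def)
  then show ?case by blast
qed (simp add: disp_def)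

context periodic_sde begin

abbreviation path :: "'a \<Rightarrow> real \<Rightarrow> real" where "path \<omega> \<equiv> \<lambda>t. X t \<omega>"

lemma F_sigma: "t \<ge> 0 \<Longrightarrow> sigma_algebra (space M) (sets (F t))"
  using sets.sigma_algebra_axioms[of "F t"] space_F[of t] by simp

lemma hit_meas:
  assumes s: "s \<ge> 0" and fm: "\<And>q. q \<ge> 0 \<Longrightarrow> {\<omega>\<in>space M. fin (path \<omega>) es q} \<in> sets (F q)"
  shows "{\<omega>\<in>space M. hit (path \<omega>) e es s} \<in> sets (F s)"
proof -
  interpret A: sigma_algebra "space M" "sets (F s)" by (rule F_sigma[OF s])
  have cq: "countable (\<rat> \<inter> {0..s})" using countable_rat by blast
  have 1: "{\<omega>\<in>space M. fin (path \<omega>) es q} \<in> sets (F s)" if "q \<in> \<rat> \<inter> {0..s}" for q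
    using fm[of q] sets_F_mono[of q s] that by auto
  have 2: "{\<omega>\<in>space M. sg e * (X q \<omega> - y - disp es) > c} \<in> sets (F s)" if q: "q \<in> \<rat> \<inter> {0..s}" for q c
  proof -
    have [measurable]: "X q \<in> borel_measurable (F s)" using meas_F_mono[OF _ _ Xm[of q]] q by auto
    have "{\<omega>\<in>space (F s). sg e * (X q \<omega> - y - disp es) > c} \<in> sets (F s)" by measurable
    then show ?thesis using space_F[OF s] by simp
  qed
  have "{\<omega>\<in>space M. \<forall>j::nat. \<exists>q\<in>\<rat> \<inter> {0..s}. fin (path \<omega>) es q \<and> sg e * (X q \<omega> - y - disp es) > 1 - 1 / real (Suc j)} \<in> sets (F s)"
    by (intro A.sets_Collect_countable_All A.sets_Collect_countable_Ex' A.sets_Collect_conj 1 2 cq)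
  moreover have "hit (path \<omega>) e es s \<longleftrightarrow> (\<forall>j::nat. \<exists>q\<in>\<rat> \<inter> {0..s}. fin (path \<omega>) es q \<and> sg e * (X q \<omega> - y - disp es) > 1 - 1 / real (Suc j))"
    if "\<omega> \<in> space M" for \<omega>
    using hit_iff_rational[OF Xc[OF that] s] X0[OF that] by simp
  ultimately show ?thesis by (simp cong: conj_cong)
qed

text \<open>The cycle times are stopping times. Right-continuity of the filtration is not among the
  assumptions, so the event has to be expressed by countably many times not exceeding
  \<open>s\<close>; \<open>hit_iff_rational\<close> and \<open>fin_Cons_iff\<close> have that
  shape.\<close>

lemma fin_meas: "s \<ge> 0 \<Longrightarrow> {\<omega>\<in>space M. fin (path \<omega>) es s} \<in> sets (F s)"
proof (induct es arbitrary: s)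
  case Nil
  then show ?case using sets.top[of "F s"] space_F[of s] by (simp add: fin_def)
next
  case (Cons e es)
  interpret A: sigma_algebra "space M" "sets (F s)" by (rule F_sigma[OF Cons.prems])
  have cq: "countable (\<rat> \<inter> {0..s} \<union> {s})" using countable_rat by blast
  have hm: "{\<omega>\<in>space M. hit (path \<omega>) e' es q} \<in> sets (F s)" if "q \<in> \<rat> \<inter> {0..s} \<union> {s}" for q e'
    using hit_meas[OF _ Cons.hyps, of q e'] sets_F_mono[of q s] that Cons.prems by auto
  have "{\<omega>\<in>space M. \<exists>q\<in>\<rat> \<inter> {0..s} \<union> {s}. hit (path \<omega>) e es q \<and> \<not> hit (path \<omega>) (\<not> e) es q} \<in> sets (F s)"
    by (intro A.sets_Collect_countable_Ex' A.sets_Collect_conj A.sets_Collect_neg hm cq)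
  moreover have "fin (path \<omega>) (e # es) s \<longleftrightarrow> (\<exists>q\<in>\<rat> \<inter> {0..s} \<union> {s}. hit (path \<omega>) e es q \<and> \<not> hit (path \<omega>) (\<not> e) es q)"
    if "\<omega> \<in> space M" for \<omega>
    by (rule fin_Cons_iff[OF Xc[OF that] Cons.prems])
  ultimately show ?case by (simp cong: conj_cong)
qed

lemma active_meas: "s \<ge> 0 \<Longrightarrow> {\<omega>\<in>space M. active (path \<omega>) es s} \<in> sets (F s)"
proof -
  assume s: "s \<ge> 0"
  interpret A: sigma_algebra "space M" "sets (F s)" by (rule F_sigma[OF s])
  show ?thesis unfolding active_def
    by (intro A.sets_Collect_conj A.sets_Collect_neg fin_meas hit_meas s)
qed

definition Cyc :: "bool list \<Rightarrow> 'a set" where "Cyc es = {\<omega>\<in>space M. cyc (path \<omega>) es}"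
definition Fin :: "bool list \<Rightarrow> real \<Rightarrow> 'a set" where "Fin es s = {\<omega>\<in>space M. fin (path \<omega>) es s}"
text \<open>The default 0 off \<open>Cyc es\<close> replaces junk values of
  \<open>cycle_time\<close> and makes the function nonnegative and measurable on the whole
  space.\<close>

definition ctime :: "bool list \<Rightarrow> 'a \<Rightarrow> real" where
  "ctime es \<omega> = (if \<omega> \<in> Cyc es then cycle_time (path \<omega>) (length es) else 0)"

lemma Fin_iff: "\<omega> \<in> Fin es s \<longleftrightarrow> \<omega> \<in> Cyc es \<and> ctime es \<omega> \<le> s"
  by (auto simp: Fin_def Cyc_def ctime_def fin_def)

lemma ctime_nonneg: "0 \<le> ctime es \<omega>"
  using cyc_time_pos[OF Xc] by (auto simp: ctime_def Cyc_def)

lemma Fin_meas [measurable]: "Fin es s \<in> sets M"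
proof (cases "s \<ge> 0")
  case True
  then show ?thesis using fin_meas[OF True, of es] sets_F[OF True] by (auto simp: Fin_def)
next
  case False
  have "\<omega> \<notin> Fin es s" for \<omega> using False ctime_nonneg[of es \<omega>] by (auto simp: Fin_iff)
  then have "Fin es s = {}" by blast
  then show ?thesis by simp
qed

lemma Cyc_meas [measurable]: "Cyc es \<in> sets M"
proof -
  have "Cyc es = (\<Union>n::nat. Fin es (real n))"
    using real_arch_simple by (fastforce simp: Fin_iff)
  then show ?thesis by simp
qed

lemma ctime_meas [measurable]: "ctime es \<in> borel_measurable M"
  unfolding borel_measurable_iff_le
proof
  fix a
  have "{\<omega>\<in>space M. ctime es \<omega> \<le> a} = (if a < 0 then {} else (space M - Cyc es) \<union> Fin es a)"
  proof (rule set_eqI)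
    fix \<omega>
    show "\<omega> \<in> {\<omega>\<in>space M. ctime es \<omega> \<le> a} \<longleftrightarrow> \<omega> \<in> (if a < 0 then {} else (space M - Cyc es) \<union> Fin es a)"
      using ctime_nonneg[of es \<omega>] by (cases "\<omega> \<in> Cyc es") (auto simp: Fin_iff Cyc_def ctime_def)
  qed
  then show "{\<omega>\<in>space M. ctime es \<omega> \<le> a} \<in> sets M" by auto
qed

definition cexit :: "bool list \<Rightarrow> real \<Rightarrow> 'a \<Rightarrow> real" where
  "cexit es H \<omega> = cut_exit (path \<omega>) es H"

lemma Cyc_Cons: "\<omega> \<in> Cyc (e # es) \<Longrightarrow> \<omega> \<in> Cyc es" by (simp add: Cyc_def)

lemma Fin_Cons: "\<omega> \<in> Fin (e # es) s \<Longrightarrow> \<omega> \<in> Fin es s"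
  using cyc_step(1)[OF Xc] by (fastforce simp: Fin_def fin_def)

lemma X_at_ctime:
  assumes "\<omega> \<in> Cyc es" shows "X (ctime es \<omega>) \<omega> = y + disp es"
  using cyc_pos[OF Xc, of \<omega> es] X0[of \<omega>] assms by (simp add: ctime_def Cyc_def)

lemma cexit_props:
  assumes f: "\<omega> \<in> Fin es H"
  shows "ctime es \<omega> \<le> cexit es H \<omega>" "cexit es H \<omega> \<le> H"
    "\<bar>X (cexit es H \<omega>) \<omega> - (y + disp es)\<bar> \<le> 1"
    "\<omega> \<in> Fin (e # es) H \<Longrightarrow> cexit es H \<omega> = ctime (e # es) \<omega>"
    "\<omega> \<notin> Fin (True # es) H \<Longrightarrow> \<omega> \<notin> Fin (False # es) H \<Longrightarrow> cexit es H \<omega> = H"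
proof -
  have w: "\<omega> \<in> space M" "fin (path \<omega>) es H" using f by (auto simp: Fin_def)
  note c = cut_exit[OF Xc[OF w(1)] w(2)]
  have es: "\<omega> \<in> Cyc es" using f by (simp add: Fin_iff)
  show "ctime es \<omega> \<le> cexit es H \<omega>" using c(1) es by (simp add: ctime_def cexit_def)
  show "cexit es H \<omega> \<le> H" using c(2) by (simp add: cexit_def)
  show "\<bar>X (cexit es H \<omega>) \<omega> - (y + disp es)\<bar> \<le> 1" using c(4) X0[OF w(1)] by (simp add: cexit_def)
  show "\<omega> \<in> Fin (e # es) H \<Longrightarrow> cexit es H \<omega> = ctime (e # es) \<omega>"
    using c(5)[of e] by (auto simp: ctime_def cexit_def Fin_def Cyc_def fin_def)
  show "\<omega> \<notin> Fin (True # es) H \<Longrightarrow> \<omega> \<notin> Fin (False # es) H \<Longrightarrow> cexit es H \<omega> = H"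
    using c(6) w(1) by (auto simp: cexit_def Fin_def)
qed

lemma X_exit:
  assumes f: "\<omega> \<in> Cyc (e # es)" shows "X (ctime (e # es) \<omega>) \<omega> - (y + disp es) = sg e"
  using X_at_ctime[OF f] by (simp add: disp_def)

text \<open>The weight \<open>active\<close> is the indicator of the half-open window from the start
  of the cycle to \<open>cexit\<close>. The weighted increments of the discounted eigenfunction
  therefore telescope along fine grids to \<open>D\<close>, while their expectations tend to 0. The
  bounded horizon provides the dominating constant.\<close>

lemma optional_stopping:
  fixes u u1 u2 :: "real \<Rightarrow> real" and \<nu> H :: real and es :: "bool list"
  assumes d1: "\<And>x. (u has_real_derivative u1 x) (at x)" and d2: "\<And>x. (u1 has_real_derivative u2 x) (at x)"
    and c2: "continuous_on UNIV u2"
    and eig: "\<And>x. b (y + x) * u1 x + (\<sigma> (y + x))\<^sup>2 * u2 x / 2 = \<nu> * u x"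
    and H: "H > 0"
  defines "D \<equiv> \<lambda>\<omega>. indicator (Fin es H) \<omega> *
    (exp (- \<nu> * cexit es H \<omega>) * u (X (cexit es H \<omega>) \<omega> - (y + disp es)) - exp (- \<nu> * ctime es \<omega>) * u 0)"
  shows "integrable M D" "expectation D = 0"
proof -
  define c where "c = y + disp es"
  obtain f f' f'' where f: "\<And>x. (f has_real_derivative f' x) (at x)" "\<And>x. (f' has_real_derivative f'' x) (at x)"
    "bounded_ucont f" "bounded_ucont f'" "bounded_ucont f''"
    "\<And>x. \<bar>x - c\<bar> \<le> 1 \<Longrightarrow> f x = u (x - c) \<and> f' x = u1 (x - c) \<and> f'' x = u2 (x - c)"
    using bounded_C2_extension[OF d1 d2 c2, of c] by blast
  \<comment> \<open>The cycle starts an integer away from \<open>y\<close>, so periodicity carries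
    the equation for \<open>u\<close> around 0 over to the centre \<open>c\<close>.\<close>
  obtain n where n: "disp es = of_int n" using disp_int by blast
  have sh: "b (y + (x - c)) = b x" "\<sigma> (y + (x - c)) = \<sigma> x" for x
    using periodic_shift[of b x "- n", OF pb] periodic_shift[of \<sigma> x "- n", OF ps] by (auto simp: c_def n algebra_simps)
  have feig: "b x * f' x + (\<sigma> x)\<^sup>2 * f'' x / 2 = \<nu> * f x" if "\<bar>x - c\<bar> \<le> 1" for x
    using eig[of "x - c"] f(6)[OF that] unfolding sh by simp
  define \<psi> :: "real \<Rightarrow> 'a \<Rightarrow> real" where "\<psi> t \<omega> = indicator {\<omega>\<in>space M. active (path \<omega>) es t} \<omega>" for t \<omega>
  have p1: "\<bar>\<psi> t \<omega>\<bar> \<le> (1::real)" for t \<omega> by (auto simp: \<psi>_def indicator_def)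
  have pm: "\<psi> t \<in> borel_measurable (F t)" if "t \<ge> 0" for t
    unfolding \<psi>_def[abs_def] by (rule borel_measurable_indicator[OF active_meas[OF that]])
  have psup: "\<bar>X t \<omega> - c\<bar> \<le> 1" if "\<omega> \<in> space M" "\<psi> t \<omega> \<noteq> (0::real)" for t \<omega>
    using active_near[OF Xc[OF that(1)], of es t] that X0[OF that(1)] by (auto simp: \<psi>_def c_def indicator_def split: if_splits)
  define g where "g t \<omega> = exp (- \<nu> * t) * f (X t \<omega>)" for t \<omega>
  define S where "S N \<omega> = (\<Sum>k<Suc N. \<psi> (real k * (H / real (Suc N))) \<omega> *
      (g (real (Suc k) * (H / real (Suc N))) \<omega> - g (real k * (H / real (Suc N))) \<omega>))" for N \<omega>
  have lim0: "(\<lambda>N. expectation (S N)) \<longlonglongrightarrow> 0"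
    unfolding S_def[abs_def] g_def
    by (rule stopped_sum_tendsto[OF f(1-5) feig H pm p1 psup])
  have Sm: "S N \<in> borel_measurable M" for N
  proof -
    have nn: "0 \<le> real k * (H / real (Suc N))" for k using H by (intro mult_nonneg_nonneg divide_nonneg_nonneg) auto
    have fm: "f \<in> borel_measurable borel" by (intro borel_measurable_continuous_onI bounded_ucont_continuous f)
    have gm: "g t \<in> borel_measurable M" if "t \<ge> 0" for t
      unfolding g_def[abs_def] by (intro borel_measurable_times borel_measurable_const measurable_compose[OF XmM[OF that] fm])
    show ?thesis unfolding S_def[abs_def]
      by (intro borel_measurable_sum borel_measurable_times borel_measurable_diff meas_F_M[OF nn pm[OF nn]] gm nn)
  qed
  obtain B where B: "B \<ge> 0" "\<And>x. \<bar>f x\<bar> \<le> B" using bounded_ucontD_bound[OF f(3)] by blast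
  have gB: "\<bar>g t \<omega>\<bar> \<le> exp (\<bar>\<nu>\<bar> * H) * B" if "t \<in> {0..H}" for t \<omega>
  proof -
    have "- \<nu> * t \<le> \<bar>\<nu>\<bar> * H" using that by (intro mult_mono) auto
    then show ?thesis unfolding g_def abs_mult by (intro mult_mono B) auto
  qed
  have conv: "(\<lambda>N. S N \<omega>) \<longlonglongrightarrow> D \<omega>" and SB: "\<bar>S N \<omega>\<bar> \<le> 2 * (exp (\<bar>\<nu>\<bar> * H) * B)" if w: "\<omega> \<in> space M" for \<omega> N
  proof -
    have lt: "real k * (H / real (Suc N)) < H" if "k < Suc N" for k N
    proof -
      have "real k * (H / real (Suc N)) < real (Suc N) * (H / real (Suc N))"
        using that H by (intro mult_strict_right_mono divide_pos_pos) auto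
      then show ?thesis by simp
    qed
    have "(\<lambda>N. S N \<omega>) \<longlonglongrightarrow> D \<omega> \<and> (\<forall>N. \<bar>S N \<omega>\<bar> \<le> 2 * (exp (\<bar>\<nu>\<bar> * H) * B))"
    proof (cases "\<omega> \<in> Fin es H")
      case False
      have "\<psi> (real k * (H / real (Suc N))) \<omega> = 0" if "k < Suc N" for k N
        using False w lt[OF that] fin_mono[OF Xc[OF w]] by (auto simp: \<psi>_def Fin_def active_def indicator_def)
      then have "S N \<omega> = 0" for N unfolding S_def by (intro sum.neutral) auto
      then show ?thesis using False B by (simp add: D_def)
    next
      case True
      have fi: "fin (path \<omega>) es H" using True by (simp add: Fin_def)
      have es: "\<omega> \<in> Cyc es" using True by (simp add: Fin_iff)
      note ce = cexit_props[OF True]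
      have c0: "0 \<le> ctime es \<omega>" by (rule ctime_nonneg)
      have gc: "continuous_on {0..H} (\<lambda>t. g t \<omega>)" unfolding g_def
        by (intro continuous_intros continuous_on_compose2[OF bounded_ucont_continuous[OF f(3), of UNIV] continuous_on_subset[OF Xc[OF w]]]) auto
      have Se: "S N \<omega> = (\<Sum>k<Suc N. of_bool (ctime es \<omega> \<le> real k * (H / real (Suc N)) \<and> real k * (H / real (Suc N)) < cexit es H \<omega>) *
          (g (real (Suc k) * (H / real (Suc N))) \<omega> - g (real k * (H / real (Suc N))) \<omega>))" for N
        unfolding S_def
      proof (rule sum.cong[OF refl])
        fix k assume "k \<in> {..<Suc N}"
        then have k: "real k * (H / real (Suc N)) < H" using lt by simp
        have "\<psi> (real k * (H / real (Suc N))) \<omega> = of_bool (ctime es \<omega> \<le> real k * (H / real (Suc N)) \<and> real k * (H / real (Suc N)) < cexit es H \<omega>)"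
          using cut_exit(3)[OF Xc[OF w] fi k] es w by (simp add: \<psi>_def ctime_def cexit_def indicator_def)
        then show "\<psi> (real k * (H / real (Suc N))) \<omega> * (g (real (Suc k) * (H / real (Suc N))) \<omega> - g (real k * (H / real (Suc N))) \<omega>) =
          of_bool (ctime es \<omega> \<le> real k * (H / real (Suc N)) \<and> real k * (H / real (Suc N)) < cexit es H \<omega>) *
          (g (real (Suc k) * (H / real (Suc N))) \<omega> - g (real k * (H / real (Suc N))) \<omega>)" by simp
      qed
      have "g (cexit es H \<omega>) \<omega> = exp (- \<nu> * cexit es H \<omega>) * u (X (cexit es H \<omega>) \<omega> - (y + disp es))"
        unfolding g_def using f(6)[of "X (cexit es H \<omega>) \<omega>"] ce(3) by (simp add: c_def)
      moreover have "g (ctime es \<omega>) \<omega> = exp (- \<nu> * ctime es \<omega>) * u 0"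
        unfolding g_def using f(6)[of c] X_at_ctime[OF es] by (simp add: c_def)
      ultimately have De: "D \<omega> = g (cexit es H \<omega>) \<omega> - g (ctime es \<omega>) \<omega>" using True by (simp add: D_def)
      show ?thesis unfolding Se De
        using grid_telescope(1)[OF gc H c0 ce(1,2)] grid_telescope(2)[OF gc H c0 ce(1,2) gB] by blast
    qed
    then show "(\<lambda>N. S N \<omega>) \<longlonglongrightarrow> D \<omega>" "\<bar>S N \<omega>\<bar> \<le> 2 * (exp (\<bar>\<nu>\<bar> * H) * B)" by blast+
  qed
  have Dm: "D \<in> borel_measurable M"
    by (rule borel_measurable_LIMSEQ_real[of _ S]) (use conv Sm in auto)
  show "integrable M D"
    by (rule integrable_dominated_convergence[where w="\<lambda>_. 2 * (exp (\<bar>\<nu>\<bar> * H) * B)" and s=S])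
      (use Dm Sm conv SB in auto)
  have "(\<lambda>N. expectation (S N)) \<longlonglongrightarrow> expectation D"
    by (rule integral_dominated_convergence[where w="\<lambda>_. 2 * (exp (\<bar>\<nu>\<bar> * H) * B)"])
      (use Dm Sm conv SB in auto)
  then show "expectation D = 0" using lim0 by (rule LIMSEQ_unique)
qed

end

section \<open>Laplace transforms of the cycle times\<close>

definition nT :: "bool list \<Rightarrow> nat" where "nT es = length (filter id es)"

context periodic_sde begin

definition lap :: "bool list \<Rightarrow> real \<Rightarrow> real" where
  "lap es \<nu> = expectation (\<lambda>\<omega>. indicator (Cyc es) \<omega> * exp (- \<nu> * ctime es \<omega>))"

lemma Cyc_exclusive: "\<omega> \<in> Cyc (True # es) \<Longrightarrow> \<omega> \<notin> Cyc (False # es)"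
  using cyc_unique[OF Xc, of \<omega> "True # es" "False # es"] by (auto simp: Cyc_def)

lemma laplace_integrable:
  assumes i: "integrable M (\<lambda>\<omega>. indicator (Cyc es) \<omega> * exp (\<mu> * ctime es \<omega>))" and nu: "\<nu> \<ge> - \<mu>"
  shows "integrable M (\<lambda>\<omega>. indicator (Cyc es) \<omega> * exp (- \<nu> * ctime es \<omega>))"
proof (rule Bochner_Integration.integrable_bound[OF i])
  show "AE \<omega> in M. norm (indicator (Cyc es) \<omega> * exp (- \<nu> * ctime es \<omega>)) \<le> norm (indicator (Cyc es) \<omega> * exp (\<mu> * ctime es \<omega>))"
  proof (rule AE_I2)
    fix \<omega>
    have "- \<nu> * ctime es \<omega> \<le> \<mu> * ctime es \<omega>" using nu ctime_nonneg[of es \<omega>] by (intro mult_right_mono) auto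
    then show "norm (indicator (Cyc es) \<omega> * exp (- \<nu> * ctime es \<omega>)) \<le> norm (indicator (Cyc es) \<omega> * exp (\<mu> * ctime es \<omega>))"
      by (simp add: abs_mult indicator_def)
  qed
qed measurable

text \<open>The discounted \<open>cosf\<close>-martingale at a negative discount rate gives exponential moments of the
  exit times, hence almost sure exit.\<close>
lemma exit_moments:
  assumes mu: "\<mu> > 0" and cp: "\<forall>x. \<bar>x\<bar> \<le> 1 \<longrightarrow> cosf (- \<mu>) x \<ge> 1 / 2"
    and i: "integrable M (\<lambda>\<omega>. indicator (Cyc es) \<omega> * exp (\<mu> * ctime es \<omega>))"
  shows "AE \<omega> in M. \<omega> \<in> Cyc es \<longrightarrow> (\<exists>e. \<omega> \<in> Cyc (e # es))"
    "integrable M (\<lambda>\<omega>. indicator (Cyc (e # es)) \<omega> * exp (\<mu> * ctime (e # es) \<omega>))"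
proof -
  obtain u1 u2 where u: "\<And>x. (cosf (- \<mu>) has_real_derivative u1 x) (at x)" "\<And>x. (u1 has_real_derivative u2 x) (at x)"
    "continuous_on UNIV u2" "\<And>x. b (y + x) * u1 x + (\<sigma> (y + x))\<^sup>2 * u2 x / 2 = (- \<mu>) * cosf (- \<mu>) x"
    using cosf_eigen[of "- \<mu>"] by blast
  define A where "A = expectation (\<lambda>\<omega>. indicator (Cyc es) \<omega> * exp (\<mu> * ctime es \<omega>))"
  \<comment> \<open>The martingale at the capped exit. It is at least half of
    \<open>exp (\<mu> * cexit es H \<omega>)\<close> on \<open>Fin es H\<close>, while optional
    stopping bounds its mean by \<open>A\<close> for every horizon.\<close>
  define Z where "Z H \<omega> = indicator (Fin es H) \<omega> * (exp (\<mu> * cexit es H \<omega>) * cosf (- \<mu>) (X (cexit es H \<omega>) \<omega> - (y + disp es)))" for H \<omega>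
  have Zi: "integrable M (Z H)" and EZ: "expectation (Z H) \<le> A" if H: "H > 0" for H
  proof -
    define D where "D \<omega> = indicator (Fin es H) \<omega> *
      (exp (- (- \<mu>) * cexit es H \<omega>) * cosf (- \<mu>) (X (cexit es H \<omega>) \<omega> - (y + disp es)) - exp (- (- \<mu>) * ctime es \<omega>) * cosf (- \<mu>) 0)" for \<omega>
    have D: "integrable M D" "expectation D = 0"
      unfolding D_def[abs_def] by (rule optional_stopping[OF u H])+
    have le: "indicator (Fin es H) \<omega> * exp (\<mu> * ctime es \<omega>) \<le> indicator (Cyc es) \<omega> * exp (\<mu> * ctime es \<omega>)" for \<omega>
      by (auto simp: indicator_def Fin_iff)
    have i2: "integrable M (\<lambda>\<omega>. indicator (Fin es H) \<omega> * exp (\<mu> * ctime es \<omega>))"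
      by (rule Bochner_Integration.integrable_bound[OF i]) (use le in auto)
    have Ze: "Z H \<omega> = D \<omega> + indicator (Fin es H) \<omega> * exp (\<mu> * ctime es \<omega>)" for \<omega>
      by (simp add: Z_def D_def cosf_0 algebra_simps)
    show "integrable M (Z H)" unfolding Ze[abs_def] by (intro Bochner_Integration.integrable_add D i2)
    have "expectation (Z H) = expectation (\<lambda>\<omega>. indicator (Fin es H) \<omega> * exp (\<mu> * ctime es \<omega>))"
      unfolding Ze[abs_def] using D i2 by simp
    also have "\<dots> \<le> A" unfolding A_def by (rule Bochner_Integration.integral_mono[OF i2 i le])
    finally show "expectation (Z H) \<le> A" .
  qed
  have Zge: "1 / 2 * exp (\<mu> * cexit es H \<omega>) \<le> Z H \<omega>" if "\<omega> \<in> Fin es H" for H \<omega>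
    using mult_left_mono[OF cp[rule_format, OF cexit_props(3)[OF that]], of "exp (\<mu> * cexit es H \<omega>)"] that by (simp add: Z_def)
  have Z0: "0 \<le> Z H \<omega>" for H \<omega>
  proof (cases "\<omega> \<in> Fin es H")
    case True
    have "0 \<le> 1 / 2 * exp (\<mu> * cexit es H \<omega>)" by simp
    also have "\<dots> \<le> Z H \<omega>" by (rule Zge[OF True])
    finally show ?thesis .
  qed (simp add: Z_def)
  \<comment> \<open>On this set the capped exit equals the horizon \<open>n\<close> for all large
    \<open>n\<close>, so half its probability times \<open>exp (\<mu> * n)\<close> stays below
    \<open>A\<close>.\<close>
  have null: "measure M (Fin es (real m) - (\<Union>e. Cyc (e # es))) = 0" for m :: nat
  proof -
    let ?N = "Fin es (real m) - (\<Union>e. Cyc (e # es))"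
    have [measurable]: "?N \<in> sets M" by measurable
    have "measure M ?N \<le> 2 * A * exp (- \<mu> * real n)" if n: "n \<ge> Suc m" for n :: nat
    proof -
      have pos: "real n > 0" using n by simp
      have le: "1 / 2 * exp (\<mu> * real n) * indicator ?N \<omega> \<le> Z (real n) \<omega>" for \<omega>
      proof (cases "\<omega> \<in> ?N")
        case True
        then have f: "\<omega> \<in> Fin es (real n)" using n by (auto simp: Fin_iff)
        have "\<omega> \<notin> Fin (e # es) (real n)" for e using True by (auto simp: Fin_iff)
        then have "cexit es (real n) \<omega> = real n" using cexit_props(5)[OF f] by blast
        then show ?thesis using Zge[OF f] True by simp
      qed (use Z0 in simp)
      have "expectation (\<lambda>\<omega>. 1 / 2 * exp (\<mu> * real n) * indicator ?N \<omega>) \<le> expectation (Z (real n))"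
        by (rule Bochner_Integration.integral_mono[OF _ Zi[OF pos] le]) (auto simp: integrable_indicator_iff emeasure_eq_measure)
      also have "\<dots> \<le> A" by (rule EZ[OF pos])
      finally have "1 / 2 * exp (\<mu> * real n) * measure M ?N \<le> A" by simp
      then show ?thesis by (simp add: exp_minus field_simps)
    qed
    moreover have "(\<lambda>n. 2 * A * exp (- \<mu> * real n)) \<longlonglongrightarrow> 0"
    proof -
      have "exp (- \<mu>) < 1" by (simp only: exp_less_one_iff neg_less_0_iff_less mu)
      from LIMSEQ_realpow_zero[OF exp_ge_zero this] have "(\<lambda>n. exp (- \<mu>) ^ n) \<longlonglongrightarrow> 0" .
      then have "(\<lambda>n. 2 * A * exp (- \<mu>) ^ n) \<longlonglongrightarrow> 2 * A * 0" by (rule tendsto_mult_left)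
      moreover have "exp (- \<mu> * real n) = exp (- \<mu>) ^ n" for n
        using exp_of_nat_mult[of n "- \<mu>"] by (simp only: mult.commute)
      ultimately show ?thesis by (simp only: mult_zero_right)
    qed
    ultimately have "measure M ?N \<le> 0"
      by (intro LIMSEQ_le_const[of "\<lambda>n. 2 * A * exp (- \<mu> * real n)"]) blast+
    then show ?thesis using measure_nonneg[of M ?N] by linarith
  qed
  have "AE \<omega> in M. \<forall>m::nat. \<omega> \<notin> Fin es (real m) - (\<Union>e. Cyc (e # es))"
    unfolding AE_all_countable
  proof
    fix m :: nat
    have "Fin es (real m) - (\<Union>e. Cyc (e # es)) \<in> null_sets M"
      using null[of m] by (intro null_setsI) (auto simp: emeasure_eq_measure)
    then show "AE \<omega> in M. \<omega> \<notin> Fin es (real m) - (\<Union>e. Cyc (e # es))" by (rule AE_not_in)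
  qed
  then show "AE \<omega> in M. \<omega> \<in> Cyc es \<longrightarrow> (\<exists>e. \<omega> \<in> Cyc (e # es))"
  proof eventually_elim
    fix \<omega> assume n: "\<forall>m::nat. \<omega> \<notin> Fin es (real m) - (\<Union>e. Cyc (e # es))"
    show "\<omega> \<in> Cyc es \<longrightarrow> (\<exists>e. \<omega> \<in> Cyc (e # es))"
    proof
      assume c: "\<omega> \<in> Cyc es"
      obtain m :: nat where "ctime es \<omega> \<le> real m" using real_arch_simple by blast
      with c have "\<omega> \<in> Fin es (real m)" by (simp add: Fin_iff)
      with n show "\<exists>e. \<omega> \<in> Cyc (e # es)" by blast
    qed
  qed
  \<comment> \<open>Truncations by the horizon. They increase to the wanted function and their means
    stay below \<open>2 * A\<close>, so monotone convergence gives integrability.\<close>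
  define f where "f n \<omega> = indicator (Fin (e # es) (real (Suc n))) \<omega> * exp (\<mu> * ctime (e # es) \<omega>)" for n :: nat and \<omega>
  have fm: "f n \<in> borel_measurable M" for n unfolding f_def[abs_def] by measurable
  have fZ: "f n \<omega> \<le> 2 * Z (real (Suc n)) \<omega>" for n \<omega>
  proof (cases "\<omega> \<in> Fin (e # es) (real (Suc n))")
    case True
    then have g: "\<omega> \<in> Fin es (real (Suc n))" by (rule Fin_Cons)
    show ?thesis using Zge[OF g] cexit_props(4)[OF g True] True by (simp add: f_def)
  qed (use Z0 in \<open>simp add: f_def\<close>)
  have f0: "0 \<le> f n \<omega>" for n \<omega> by (simp add: f_def)
  have Zi2: "integrable M (\<lambda>\<omega>. 2 * Z (real (Suc n)) \<omega>)" for n by (intro integrable_mult_right impI Zi) simp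
  have fi: "integrable M (f n)" for n
    by (rule Bochner_Integration.integrable_bound[OF Zi2 fm]) (use fZ f0 Z0 in auto)
  have fA: "expectation (f n) \<le> 2 * A" for n
  proof -
    have "expectation (f n) \<le> expectation (\<lambda>\<omega>. 2 * Z (real (Suc n)) \<omega>)"
      by (rule Bochner_Integration.integral_mono[OF fi Zi2 fZ])
    also have "\<dots> \<le> 2 * A" using EZ[of "real (Suc n)"] by simp
    finally show ?thesis .
  qed
  have fmono: "f n \<omega> \<le> f m \<omega>" if "n \<le> m" for n m \<omega>
    using that by (auto simp: f_def indicator_def Fin_iff)
  have "incseq (\<lambda>n. expectation (f n))"
    by (intro incseq_SucI Bochner_Integration.integral_mono fi fmono) simp
  then obtain l where l: "(\<lambda>n. expectation (f n)) \<longlonglongrightarrow> l" using incseq_convergent fA by blast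
  show "integrable M (\<lambda>\<omega>. indicator (Cyc (e # es)) \<omega> * exp (\<mu> * ctime (e # es) \<omega>))"
  proof (rule integrable_monotone_convergence[OF fi _ _ l])
    show "AE \<omega> in M. mono (\<lambda>n. f n \<omega>)" by (intro AE_I2 monoI fmono)
    show "AE \<omega> in M. (\<lambda>n. f n \<omega>) \<longlonglongrightarrow> indicator (Cyc (e # es)) \<omega> * exp (\<mu> * ctime (e # es) \<omega>)"
    proof (rule AE_I2)
      fix \<omega>
      obtain m :: nat where m: "ctime (e # es) \<omega> \<le> real m" using real_arch_simple by blast
      have "f n \<omega> = indicator (Cyc (e # es)) \<omega> * exp (\<mu> * ctime (e # es) \<omega>)" if "n \<ge> m" for n
        using that m by (auto simp: f_def indicator_def Fin_iff)
      then have "eventually (\<lambda>n. f n \<omega> = indicator (Cyc (e # es)) \<omega> * exp (\<mu> * ctime (e # es) \<omega>)) sequentially"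
        unfolding eventually_sequentially by blast
      then show "(\<lambda>n. f n \<omega>) \<longlonglongrightarrow> indicator (Cyc (e # es)) \<omega> * exp (\<mu> * ctime (e # es) \<omega>)"
        by (rule tendsto_eventually)
    qed
  qed measurable
qed

text \<open>Optional stopping with the horizon tending to infinity. Almost sure exit turns
  \<open>cexit\<close> into the end of the next cycle, where the eigenfunction takes its value at 1
  or -1, and \<open>\<nu> \<ge> - \<mu>\<close> lets the exponential moments dominate.\<close>

lemma laplace_step:
  assumes mu: "\<mu> > 0" and cp: "\<forall>x. \<bar>x\<bar> \<le> 1 \<longrightarrow> cosf (- \<mu>) x \<ge> 1 / 2"
    and i: "integrable M (\<lambda>\<omega>. indicator (Cyc es) \<omega> * exp (\<mu> * ctime es \<omega>))"
    and d1: "\<And>x. (u has_real_derivative u1 x) (at x)" and d2: "\<And>x. (u1 has_real_derivative u2 x) (at x)"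
    and c2: "continuous_on UNIV u2"
    and eig: "\<And>x. b (y + x) * u1 x + (\<sigma> (y + x))\<^sup>2 * u2 x / 2 = \<nu> * u x"
    and nu: "\<nu> \<ge> - \<mu>"
  shows "lap (True # es) \<nu> * u 1 + lap (False # es) \<nu> * u (- 1) = lap es \<nu> * u 0"
proof -
  note em = exit_moments[OF mu cp i]
  have uc: "continuous_on UNIV u" using d1 by (meson DERIV_isCont continuous_at_imp_continuous_on)
  have "bounded (u ` {- 1..1})" by (intro compact_imp_bounded compact_continuous_image continuous_on_subset[OF uc]) auto
  then obtain B where B0: "\<forall>x\<in>{- 1..1}. \<bar>u x\<bar> \<le> B" by (auto simp: bounded_iff)
  have B: "\<bar>u x\<bar> \<le> B" if "\<bar>x\<bar> \<le> 1" for x using B0 that by (auto simp: abs_le_iff)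
  have Bn: "0 \<le> B" using B[of 0] by simp
  define D where "D n \<omega> = indicator (Fin es (real (Suc n))) \<omega> *
      (exp (- \<nu> * cexit es (real (Suc n)) \<omega>) * u (X (cexit es (real (Suc n)) \<omega>) \<omega> - (y + disp es)) - exp (- \<nu> * ctime es \<omega>) * u 0)" for n :: nat and \<omega>
  have pos: "0 < real (Suc n)" for n by simp
  have D: "integrable M (D n)" "expectation (D n) = 0" for n
    unfolding D_def[abs_def] by (rule optional_stopping[OF d1 d2 c2 eig pos])+
  define l where "l es \<omega> = indicator (Cyc es) \<omega> * exp (- \<nu> * ctime es \<omega>)" for es \<omega>
  define m where "m es \<omega> = indicator (Cyc es) \<omega> * exp (\<mu> * ctime es \<omega>)" for es \<omega>
  have li: "integrable M (l es)" "integrable M (l (e # es))" for e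
    unfolding l_def[abs_def] by (rule laplace_integrable[OF i nu], rule laplace_integrable[OF em(2) nu])
  have mi: "integrable M (m es)" "integrable M (m (e # es))" for e
    unfolding m_def[abs_def] by (rule i, rule em(2))
  define L where "L \<omega> = l (True # es) \<omega> * u 1 + l (False # es) \<omega> * u (- 1) - l es \<omega> * u 0" for \<omega>
  have Li: "integrable M L" unfolding L_def[abs_def]
    by (intro Bochner_Integration.integrable_add Bochner_Integration.integrable_diff integrable_mult_left impI li)
  \<comment> \<open>Integrable majorant for all horizons: the capped exit never exceeds the end of
    the next cycle, and \<open>B\<close> bounds \<open>u\<close> on the interval that the path has
    not left.\<close>
  define w where "w \<omega> = (m (True # es) \<omega> + m (False # es) \<omega>) * B + m es \<omega> * \<bar>u 0\<bar>" for \<omega>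
  have wi: "integrable M w" unfolding w_def[abs_def]
    by (intro Bochner_Integration.integrable_add integrable_mult_left impI mi)
  have ex: "L \<omega> = exp (- \<nu> * ctime (e # es) \<omega>) * u (sg e) - exp (- \<nu> * ctime es \<omega>) * u 0"
      "m (True # es) \<omega> + m (False # es) \<omega> = exp (\<mu> * ctime (e # es) \<omega>)"
    if "\<omega> \<in> Cyc (e # es)" for \<omega> e
  proof -
    have "L \<omega> = exp (- \<nu> * ctime (e # es) \<omega>) * u (sg e) - exp (- \<nu> * ctime es \<omega>) * u 0 \<and>
      m (True # es) \<omega> + m (False # es) \<omega> = exp (\<mu> * ctime (e # es) \<omega>)"
    proof (cases e)
      case True
      with that have "\<omega> \<in> Cyc (True # es)" by simp
      with True Cyc_exclusive[OF this] Cyc_Cons[OF this] show ?thesis by (simp add: L_def l_def m_def sg_def)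
    next
      case False
      with that have f: "\<omega> \<in> Cyc (False # es)" by simp
      then have "\<omega> \<notin> Cyc (True # es)" using Cyc_exclusive by blast
      with f False Cyc_Cons[OF f] show ?thesis by (simp add: L_def l_def m_def sg_def)
    qed
    then show "L \<omega> = exp (- \<nu> * ctime (e # es) \<omega>) * u (sg e) - exp (- \<nu> * ctime es \<omega>) * u 0"
      "m (True # es) \<omega> + m (False # es) \<omega> = exp (\<mu> * ctime (e # es) \<omega>)" by blast+
  qed
  have conv: "AE \<omega> in M. (\<lambda>n. D n \<omega>) \<longlonglongrightarrow> L \<omega>"
    using em(1)
  proof eventually_elim
    fix \<omega> assume a: "\<omega> \<in> Cyc es \<longrightarrow> (\<exists>e. \<omega> \<in> Cyc (e # es))"
    show "(\<lambda>n. D n \<omega>) \<longlonglongrightarrow> L \<omega>"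
    proof (cases "\<omega> \<in> Cyc es")
      case False
      then have "\<omega> \<notin> Cyc (e # es)" for e using Cyc_Cons by blast
      with False have "L \<omega> = 0" "D n \<omega> = 0" for n by (auto simp: L_def l_def D_def Fin_iff)
      then show ?thesis by simp
    next
      case True
      with a obtain e where e: "\<omega> \<in> Cyc (e # es)" by blast
      obtain k :: nat where k: "ctime (e # es) \<omega> \<le> real k" using real_arch_simple by blast
      have "D n \<omega> = L \<omega>" if "n \<ge> k" for n
      proof -
        have f: "\<omega> \<in> Fin (e # es) (real (Suc n))" using e k that by (simp add: Fin_iff)
        note f' = Fin_Cons[OF f]
        show ?thesis unfolding ex(1)[OF e] D_def cexit_props(4)[OF f' f] X_exit[OF e] using f' by simp
      qed
      then have "eventually (\<lambda>n. D n \<omega> = L \<omega>) sequentially" unfolding eventually_sequentially by blast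
      then show ?thesis by (rule tendsto_eventually)
    qed
  qed
  have bound: "AE \<omega> in M. norm (D n \<omega>) \<le> w \<omega>" for n
    using em(1)
  proof eventually_elim
    fix \<omega> assume a: "\<omega> \<in> Cyc es \<longrightarrow> (\<exists>e. \<omega> \<in> Cyc (e # es))"
    show "norm (D n \<omega>) \<le> w \<omega>"
    proof (cases "\<omega> \<in> Fin es (real (Suc n))")
      case False
      then show ?thesis using Bn by (simp add: D_def w_def m_def)
    next
      case True
      then have es: "\<omega> \<in> Cyc es" by (simp add: Fin_iff)
      with a obtain e where e: "\<omega> \<in> Cyc (e # es)" by blast
      note ce = cexit_props[OF True]
      have le: "cexit es (real (Suc n)) \<omega> \<le> ctime (e # es) \<omega>"
      proof (cases "\<omega> \<in> Fin (e # es) (real (Suc n))")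
        case True then show ?thesis using ce(4) by simp
      next
        case False
        then have "real (Suc n) < ctime (e # es) \<omega>" using e by (simp add: Fin_iff)
        then show ?thesis using ce(2) by linarith
      qed
      have c0: "0 \<le> cexit es (real (Suc n)) \<omega>" using ce(1) ctime_nonneg[of es \<omega>] by linarith
      have "- \<nu> * cexit es (real (Suc n)) \<omega> \<le> \<mu> * ctime (e # es) \<omega>"
        using nu le c0 mu by (intro mult_mono) auto
      then have 1: "\<bar>exp (- \<nu> * cexit es (real (Suc n)) \<omega>) * u (X (cexit es (real (Suc n)) \<omega>) \<omega> - (y + disp es))\<bar> \<le> exp (\<mu> * ctime (e # es) \<omega>) * B"
        unfolding abs_mult using ce(3) by (intro mult_mono B) auto
      have "- \<nu> * ctime es \<omega> \<le> \<mu> * ctime es \<omega>" using nu ctime_nonneg[of es \<omega>] by (intro mult_right_mono) auto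
      then have 2: "\<bar>exp (- \<nu> * ctime es \<omega>) * u 0\<bar> \<le> exp (\<mu> * ctime es \<omega>) * \<bar>u 0\<bar>"
        unfolding abs_mult by (intro mult_mono) auto
      have "w \<omega> = exp (\<mu> * ctime (e # es) \<omega>) * B + exp (\<mu> * ctime es \<omega>) * \<bar>u 0\<bar>"
        unfolding w_def ex(2)[OF e] using es by (simp add: m_def)
      then show ?thesis using 1 2 True by (simp add: D_def)
    qed
  qed
  have "(\<lambda>n. expectation (D n)) \<longlonglongrightarrow> expectation L"
    by (rule integral_dominated_convergence[OF _ _ wi conv bound]) (use Li D in \<open>auto dest: borel_measurable_integrable\<close>)
  then have "expectation L = 0" unfolding D(2) by (simp add: LIMSEQ_const_iff)
  moreover have "expectation L = expectation (l (True # es)) * u 1 + expectation (l (False # es)) * u (- 1) - expectation (l es) * u 0"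
    unfolding L_def[abs_def] using li by simp
  ultimately show ?thesis unfolding lap_def l_def[symmetric] by simp
qed

text \<open>Its reciprocal is the factor that one backward cycle contributes to the transform; a
  forward cycle contributes \<open>kap\<close> times as much.\<close>

definition lapden :: "real \<Rightarrow> real" where "lapden \<nu> = kap * cosf \<nu> 1 + cosf \<nu> (- 1)"

text \<open>Two eigenfunctions give two linear equations for the two possible continuations of a
  word: the sine-type equation fixes their ratio, the cosine-type equation their size. The threshold
  \<mu> is the same for all words, which the induction relies on.\<close>

lemma cycle_laplace:
  "\<exists>\<mu>>0. \<mu> \<le> 1 \<and> (\<forall>\<nu>\<ge>- \<mu>. lapden \<nu> > 0) \<and>
    (\<forall>es. AE \<omega> in M. \<omega> \<in> Cyc es \<longrightarrow> (\<exists>e. \<omega> \<in> Cyc (e # es))) \<and>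
    (\<forall>es. \<forall>\<nu>\<ge>- \<mu>. integrable M (\<lambda>\<omega>. indicator (Cyc es) \<omega> * exp (- \<nu> * ctime es \<omega>))) \<and>
    (\<forall>es. \<forall>\<nu>\<ge>- \<mu>. lap es \<nu> = kap ^ nT es * (1 / lapden \<nu>) ^ length es)"
proof -
  obtain \<mu> where mu: "\<mu> > 0" "\<mu> \<le> 1" and c: "\<And>\<nu> x. \<nu> \<ge> - \<mu> \<Longrightarrow> \<bar>x\<bar> \<le> 1 \<Longrightarrow> cosf \<nu> x \<ge> 1 / 2"
    and s: "\<And>\<nu>. \<nu> \<ge> - \<mu> \<Longrightarrow> sinf \<nu> 1 > 0"
    using small_parameter by blast
  have cp: "\<forall>x. \<bar>x\<bar> \<le> 1 \<longrightarrow> cosf (- \<mu>) x \<ge> 1 / 2" using c by auto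
  have i: "integrable M (\<lambda>\<omega>. indicator (Cyc es) \<omega> * exp (\<mu> * ctime es \<omega>))" for es
  proof (induct es)
    case Nil
    have "ctime [] \<omega> = 0" for \<omega> by (simp add: ctime_def)
    then show ?case by (simp add: integrable_indicator_iff emeasure_eq_measure)
  next
    case (Cons e es)
    show ?case by (rule exit_moments(2)[OF mu(1) cp Cons])
  qed
  have pos: "lapden \<nu> > 0" if "\<nu> \<ge> - \<mu>" for \<nu>
    using c[OF that, of 1] c[OF that, of "- 1"] kap_pos unfolding lapden_def by (intro add_pos_pos mult_pos_pos) auto
  have f: "lap es \<nu> = kap ^ nT es * (1 / lapden \<nu>) ^ length es" if nu: "\<nu> \<ge> - \<mu>" for es \<nu>
  proof (induct es)
    case Nil
    have "ctime [] \<omega> = 0" for \<omega> by (simp add: ctime_def)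
    moreover have "Cyc [] = space M" by (auto simp: Cyc_def)
    ultimately show ?case by (simp add: lap_def nT_def prob_space)
  next
    case (Cons e es)
    have 1: "lap (True # es) \<nu> * cosf \<nu> 1 + lap (False # es) \<nu> * cosf \<nu> (- 1) = lap es \<nu>"
    proof -
      obtain u1 u2 where "\<And>x. (cosf \<nu> has_real_derivative u1 x) (at x)" "\<And>x. (u1 has_real_derivative u2 x) (at x)"
        "continuous_on UNIV u2" "\<And>x. b (y + x) * u1 x + (\<sigma> (y + x))\<^sup>2 * u2 x / 2 = \<nu> * cosf \<nu> x"
        using cosf_eigen by blast
      from laplace_step[OF mu(1) cp i this nu] show ?thesis by (simp add: cosf_0)
    qed
    have 2: "lap (True # es) \<nu> * sinf \<nu> 1 + lap (False # es) \<nu> * sinf \<nu> (- 1) = 0"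
    proof -
      obtain u1 u2 where "\<And>x. (sinf \<nu> has_real_derivative u1 x) (at x)" "\<And>x. (u1 has_real_derivative u2 x) (at x)"
        "continuous_on UNIV u2" "\<And>x. b (y + x) * u1 x + (\<sigma> (y + x))\<^sup>2 * u2 x / 2 = \<nu> * sinf \<nu> x"
        using sinf_eigen by blast
      from laplace_step[OF mu(1) cp i this nu] show ?thesis by (simp add: sinf_0)
    qed
    \<comment> \<open>After \<open>sinf_reflect\<close> both terms carry
      \<open>sinf \<nu> 1\<close>, which is positive and cancels; this is why the ratio of the signs
      does not depend on \<nu>.\<close>
    have "(lap (True # es) \<nu> - kap * lap (False # es) \<nu>) * sinf \<nu> 1 = 0"
      using 2 unfolding sinf_reflect by (simp add: algebra_simps)
    then have T: "lap (True # es) \<nu> = kap * lap (False # es) \<nu>" using s[OF nu] by simp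
    have "lap (False # es) \<nu> * lapden \<nu> = lap es \<nu>" using 1 unfolding T lapden_def by (simp add: algebra_simps)
    then have F: "lap (False # es) \<nu> = lap es \<nu> / lapden \<nu>" using pos[OF nu] by (simp add: field_simps)
    show ?case using T F Cons by (cases e) (auto simp: nT_def)
  qed
  show ?thesis
    using mu pos exit_moments(1)[OF mu(1) cp i] laplace_integrable[OF i] f
    by (intro exI[of _ \<mu>] conjI allI impI) simp_all
qed

end

subsection \<open>Laplace transforms and exponential tails\<close>

lemma (in prob_space) expectation_exp_poly:
  fixes T :: "'a \<Rightarrow> real" and g :: "real \<Rightarrow> real"
  assumes A [measurable]: "A \<in> sets M" and T [measurable]: "T \<in> borel_measurable M" and T0: "\<And>\<omega>. 0 \<le> T \<omega>"
    and g: "g \<in> borel_measurable borel" and gB: "\<And>z. z \<in> {0..1} \<Longrightarrow> \<bar>g z\<bar> \<le> B"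
  shows "integrable M (\<lambda>\<omega>. indicator A \<omega> * g (exp (- T \<omega>)))"
proof (rule integrable_const_bound)
  note g[measurable]
  show "(\<lambda>\<omega>. indicator A \<omega> * g (exp (- T \<omega>))) \<in> borel_measurable M" by measurable
  have B: "\<bar>g (exp (- T \<omega>))\<bar> \<le> B" for \<omega> by (rule gB) (use T0[of \<omega>] in auto)
  have "0 \<le> B" using gB[of 0] by simp
  then show "AE \<omega> in M. norm (indicator A \<omega> * g (exp (- T \<omega>))) \<le> B"
    using B by (intro AE_I2) (simp add: indicator_def)
qed

text \<open>A law on \<open>[0,\<infinity>)\<close> is determined by its Laplace transform at the natural numbers:
  these are the moments of \<open>exp (- T)\<close>, and polynomials are dense in \<open>C[0,1]\<close>.\<close>
lemma (in prob_space) laplace_determines: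
  fixes S T :: "'a \<Rightarrow> real"
  assumes A [measurable]: "A \<in> sets M" and C [measurable]: "C \<in> sets M"
    and S [measurable]: "S \<in> borel_measurable M" and T [measurable]: "T \<in> borel_measurable M"
    and S0: "\<And>\<omega>. 0 \<le> S \<omega>" and T0: "\<And>\<omega>. 0 \<le> T \<omega>"
    and eq: "\<And>k::nat. expectation (\<lambda>\<omega>. indicator A \<omega> * exp (- real k * S \<omega>)) = c * expectation (\<lambda>\<omega>. indicator C \<omega> * exp (- real k * T \<omega>))"
  shows "prob {\<omega>\<in>A. S \<omega> \<le> t} = c * prob {\<omega>\<in>C. T \<omega> \<le> t}"
proof -
  have pow: "expectation (\<lambda>\<omega>. indicator A \<omega> * exp (- S \<omega>) ^ k) = c * expectation (\<lambda>\<omega>. indicator C \<omega> * exp (- T \<omega>) ^ k)" for k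
    using eq[of k] by (simp add: exp_of_nat_mult[symmetric])
  have int: "integrable M (\<lambda>\<omega>. indicator A \<omega> * g (exp (- S \<omega>)))" "integrable M (\<lambda>\<omega>. indicator C \<omega> * g (exp (- T \<omega>)))"
    if g: "continuous_on UNIV g" for g :: "real \<Rightarrow> real"
  proof -
    have "bounded (g ` {0..1})" by (intro compact_imp_bounded compact_continuous_image continuous_on_subset[OF g]) auto
    then obtain B where B0: "\<forall>z\<in>{0..1}. \<bar>g z\<bar> \<le> B" by (auto simp: bounded_iff)
    have B: "\<bar>g z\<bar> \<le> B" if "z \<in> {0..1}" for z using B0 that by blast
    show "integrable M (\<lambda>\<omega>. indicator A \<omega> * g (exp (- S \<omega>)))"
      by (rule expectation_exp_poly[OF A S S0 borel_measurable_continuous_onI[OF g] B])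
    show "integrable M (\<lambda>\<omega>. indicator C \<omega> * g (exp (- T \<omega>)))"
      by (rule expectation_exp_poly[OF C T T0 borel_measurable_continuous_onI[OF g] B])
  qed
  have poly: "expectation (\<lambda>\<omega>. indicator A \<omega> * (\<Sum>i\<le>n. a i * exp (- S \<omega>) ^ i)) = c * expectation (\<lambda>\<omega>. indicator C \<omega> * (\<Sum>i\<le>n. a i * exp (- T \<omega>) ^ i))"
    for a :: "nat \<Rightarrow> real" and n
  proof -
    have i: "integrable M (\<lambda>\<omega>. indicator A \<omega> * exp (- S \<omega>) ^ i)" "integrable M (\<lambda>\<omega>. indicator C \<omega> * exp (- T \<omega>) ^ i)" for i
      by (rule int[of "\<lambda>z. z ^ i"], intro continuous_intros)+
    have e: "indicator D \<omega> * (\<Sum>i\<le>n. a i * z ^ i) = (\<Sum>i\<le>n. a i * (indicator D \<omega> * z ^ i))" for D and \<omega> :: 'a and z :: real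
      by (simp add: sum_distrib_left algebra_simps)
    have "expectation (\<lambda>\<omega>. \<Sum>i\<le>n. a i * (indicator A \<omega> * exp (- S \<omega>) ^ i)) = (\<Sum>i\<le>n. a i * expectation (\<lambda>\<omega>. indicator A \<omega> * exp (- S \<omega>) ^ i))"
      by (subst Bochner_Integration.integral_sum, intro integrable_mult_right impI i) simp
    also have "\<dots> = c * (\<Sum>i\<le>n. a i * expectation (\<lambda>\<omega>. indicator C \<omega> * exp (- T \<omega>) ^ i))"
      unfolding pow sum_distrib_left by (simp add: algebra_simps)
    also have "(\<Sum>i\<le>n. a i * expectation (\<lambda>\<omega>. indicator C \<omega> * exp (- T \<omega>) ^ i)) = expectation (\<lambda>\<omega>. \<Sum>i\<le>n. a i * (indicator C \<omega> * exp (- T \<omega>) ^ i))"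
      by (subst Bochner_Integration.integral_sum, intro integrable_mult_right impI i) simp
    finally show ?thesis unfolding e .
  qed
  have cont: "expectation (\<lambda>\<omega>. indicator A \<omega> * g (exp (- S \<omega>))) = c * expectation (\<lambda>\<omega>. indicator C \<omega> * g (exp (- T \<omega>)))"
    if g: "continuous_on UNIV g" for g :: "real \<Rightarrow> real"
  proof -
    let ?d = "expectation (\<lambda>\<omega>. indicator A \<omega> * g (exp (- S \<omega>))) - c * expectation (\<lambda>\<omega>. indicator C \<omega> * g (exp (- T \<omega>)))"
    have "\<bar>?d\<bar> \<le> e" if e: "e > 0" for e
    proof -
      \<comment> \<open>The polynomial approximation is used once on each side of the identity, the
        second time with weight \<open>c\<close>.\<close>
      define e' where "e' = e / (1 + \<bar>c\<bar>)"
      have e': "e' > 0" using e by (simp add: e'_def add_pos_nonneg)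
      obtain h where h: "real_polynomial_function h" "\<And>x. x \<in> {0..1} \<Longrightarrow> \<bar>g x - h x\<bar> < e'"
        using Stone_Weierstrass_real_polynomial_function[of "{0..1}" g e'] e' continuous_on_subset[OF g] by auto
      obtain a n where an: "h = (\<lambda>x. \<Sum>i\<le>n. a i * x ^ i)" using h(1) unfolding real_polynomial_function_iff_sum by blast
      have hc: "continuous_on UNIV h" unfolding an by (intro continuous_intros)
      have near: "\<bar>expectation (\<lambda>\<omega>. indicator D \<omega> * g (exp (- R \<omega>))) - expectation (\<lambda>\<omega>. indicator D \<omega> * h (exp (- R \<omega>)))\<bar> \<le> e'"
        if ig: "integrable M (\<lambda>\<omega>. indicator D \<omega> * g (exp (- R \<omega>)))" and ih: "integrable M (\<lambda>\<omega>. indicator D \<omega> * h (exp (- R \<omega>)))"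
          and R0: "\<And>\<omega>. 0 \<le> R \<omega>" for D and R :: "'a \<Rightarrow> real"
      proof -
        have pw: "\<bar>indicator D \<omega> * g (exp (- R \<omega>)) - indicator D \<omega> * h (exp (- R \<omega>))\<bar> \<le> e'" for \<omega>
          using h(2)[of "exp (- R \<omega>)"] R0[of \<omega>] e' by (auto simp: indicator_def)
        have "\<bar>expectation (\<lambda>\<omega>. indicator D \<omega> * g (exp (- R \<omega>)) - indicator D \<omega> * h (exp (- R \<omega>)))\<bar> \<le>
          expectation (\<lambda>\<omega>. \<bar>indicator D \<omega> * g (exp (- R \<omega>)) - indicator D \<omega> * h (exp (- R \<omega>))\<bar>)" by (rule integral_abs_bound)
        also have "\<dots> \<le> expectation (\<lambda>\<omega>. e')" using ig ih pw by (intro Bochner_Integration.integral_mono) auto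
        finally show ?thesis using ig ih by (simp add: prob_space)
      qed
      have hp: "expectation (\<lambda>\<omega>. indicator A \<omega> * h (exp (- S \<omega>))) = c * expectation (\<lambda>\<omega>. indicator C \<omega> * h (exp (- T \<omega>)))"
        unfolding an by (rule poly)
      have 1: "\<bar>expectation (\<lambda>\<omega>. indicator A \<omega> * g (exp (- S \<omega>))) - expectation (\<lambda>\<omega>. indicator A \<omega> * h (exp (- S \<omega>)))\<bar> \<le> e'"
        by (rule near[OF int(1)[OF g] int(1)[OF hc] S0])
      have "\<bar>c\<bar> * \<bar>expectation (\<lambda>\<omega>. indicator C \<omega> * g (exp (- T \<omega>))) - expectation (\<lambda>\<omega>. indicator C \<omega> * h (exp (- T \<omega>)))\<bar> \<le> \<bar>c\<bar> * e'"
        by (intro mult_left_mono near[OF int(2)[OF g] int(2)[OF hc] T0]) auto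
      then have 2: "\<bar>c * expectation (\<lambda>\<omega>. indicator C \<omega> * g (exp (- T \<omega>))) - c * expectation (\<lambda>\<omega>. indicator C \<omega> * h (exp (- T \<omega>)))\<bar> \<le> \<bar>c\<bar> * e'"
        by (simp only: abs_mult[symmetric] right_diff_distrib)
      have "\<bar>?d\<bar> \<le> e' + \<bar>c\<bar> * e'" using 1 2 hp by linarith
      also have "\<dots> = (1 + \<bar>c\<bar>) * e'" by (simp add: algebra_simps)
      also have "\<dots> = e" by (simp add: e'_def add_nonneg_eq_0_iff)
      finally show ?thesis .
    qed
    then have "\<bar>?d\<bar> \<le> 0 + e" if "e > 0" for e using that by simp
    then have "\<bar>?d\<bar> \<le> 0" by (rule field_le_epsilon)
    then show ?thesis by simp
  qed
  \<comment> \<open>Continuous ramps equal to 1 from \<open>exp (- t)\<close> upwards. They decrease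
    to the indicator of that half-line, which includes its end point and so matches the event that
    the time is at most \<open>t\<close>.\<close>
  define g where "g n z = min 1 (max 0 (1 + real (Suc n) * (z - exp (- t))))" for n :: nat and z :: real
  have gc: "continuous_on UNIV (g n)" for n unfolding g_def[abs_def] by (intro continuous_intros)
  have glim: "(\<lambda>n. g n (exp (- r))) \<longlonglongrightarrow> of_bool (r \<le> t)" for r
  proof (cases "r \<le> t")
    case True
    then have "g n (exp (- r)) = 1" for n by (simp add: g_def)
    then show ?thesis using True by simp
  next
    case False
    then have d: "exp (- t) - exp (- r) > 0" by simp
    obtain N :: nat where N: "1 / (exp (- t) - exp (- r)) < real N" using reals_Archimedean2 by blast
    have "g n (exp (- r)) = 0" if "n \<ge> N" for n
    proof -
      have "1 < real N * (exp (- t) - exp (- r))" using N d by (simp add: field_simps)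
      also have "\<dots> \<le> real (Suc n) * (exp (- t) - exp (- r))" using that d by (intro mult_right_mono) auto
      finally have "1 + real (Suc n) * (exp (- r) - exp (- t)) \<le> 0" by (simp add: algebra_simps)
      then show ?thesis unfolding g_def by (simp add: max_def)
    qed
    then have "eventually (\<lambda>n. g n (exp (- r)) = of_bool (r \<le> t)) sequentially"
      using False unfolding eventually_sequentially by auto
    then show ?thesis by (rule tendsto_eventually)
  qed
  have lim: "(\<lambda>n. expectation (\<lambda>\<omega>. indicator D \<omega> * g n (exp (- R \<omega>)))) \<longlonglongrightarrow> prob {\<omega>\<in>D. R \<omega> \<le> t}"
    if D[measurable]: "D \<in> sets M" and R[measurable]: "R \<in> borel_measurable M" for D and R :: "'a \<Rightarrow> real"
  proof -
    have sub: "{\<omega>\<in>D. R \<omega> \<le> t} = D \<inter> {\<omega>\<in>space M. R \<omega> \<le> t}" using sets.sets_into_space[OF D] by auto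
    have [measurable]: "{\<omega>\<in>D. R \<omega> \<le> t} \<in> sets M" unfolding sub by measurable
    have gm: "(\<lambda>\<omega>. g n (exp (- R \<omega>))) \<in> borel_measurable M" for n
      by (rule measurable_compose[OF _ borel_measurable_continuous_onI[OF gc]]) measurable
    have "(\<lambda>n. expectation (\<lambda>\<omega>. indicator D \<omega> * g n (exp (- R \<omega>)))) \<longlonglongrightarrow> expectation (indicat_real {\<omega>\<in>D. R \<omega> \<le> t})"
    proof (rule integral_dominated_convergence[where w="\<lambda>_. 1"])
      show "AE \<omega> in M. (\<lambda>n. indicator D \<omega> * g n (exp (- R \<omega>))) \<longlonglongrightarrow> indicat_real {\<omega>\<in>D. R \<omega> \<le> t} \<omega>"
      proof (rule AE_I2)
        fix \<omega>
        have "(\<lambda>n. indicat_real D \<omega> * g n (exp (- R \<omega>))) \<longlonglongrightarrow> indicat_real D \<omega> * of_bool (R \<omega> \<le> t)"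
          by (intro tendsto_mult tendsto_const glim)
        also have "indicat_real D \<omega> * of_bool (R \<omega> \<le> t) = indicat_real {\<omega>\<in>D. R \<omega> \<le> t} \<omega>" by (simp add: indicator_def)
        finally show "(\<lambda>n. indicator D \<omega> * g n (exp (- R \<omega>))) \<longlonglongrightarrow> indicat_real {\<omega>\<in>D. R \<omega> \<le> t} \<omega>" .
      qed
      show "AE \<omega> in M. norm (indicator D \<omega> * g n (exp (- R \<omega>))) \<le> 1" for n
        by (intro AE_I2) (simp add: g_def indicator_def)
    qed (use gm in auto)
    then show ?thesis by simp
  qed
  have "(\<lambda>n. expectation (\<lambda>\<omega>. indicator A \<omega> * g n (exp (- S \<omega>)))) \<longlonglongrightarrow> c * prob {\<omega>\<in>C. T \<omega> \<le> t}"
    unfolding cont[OF gc] by (intro tendsto_mult_left lim C T)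
  with lim[OF A S] show ?thesis by (rule LIMSEQ_unique)
qed

text \<open>A quadratic bound on the logarithmic moment generating functions, for both signs of
  \<theta>, makes both tails geometric in \<open>n\<close>; Borel-Cantelli then gives almost sure
  convergence. It applies directly to the transforms of the accumulated quantities.\<close>

lemma (in prob_space) chernoff_strong_law:
  fixes Z :: "nat \<Rightarrow> 'a \<Rightarrow> real"
  assumes Zm [measurable]: "\<And>n. Z n \<in> borel_measurable M" and \<delta>: "\<delta> > 0" and C: "C \<ge> 0"
    and mgf: "\<And>n \<theta>. \<bar>\<theta>\<bar> \<le> \<delta> \<Longrightarrow> integrable M (\<lambda>\<omega>. exp (\<theta> * Z n \<omega>)) \<and>
      expectation (\<lambda>\<omega>. exp (\<theta> * Z n \<omega>)) \<le> exp (real n * (\<theta> * m + C * \<theta>\<^sup>2))"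
  shows "AE \<omega> in M. (\<lambda>n. Z n \<omega> / real n) \<longlonglongrightarrow> m"
proof -
  have tail: "\<exists>r<1. 0 \<le> r \<and> (\<forall>n. prob {\<omega>\<in>space M. s * (Z n \<omega> - real n * m) \<ge> real n * \<epsilon>} \<le> r ^ n)"
    if e: "\<epsilon> > 0" and s: "\<bar>s\<bar> = 1" for \<epsilon> s :: real
  proof -
    \<comment> \<open>Small enough for \<open>C * \<theta> < \<epsilon>\<close>, which makes the
      exponent \<open>\<theta> * (C * \<theta> - \<epsilon>)\<close> of the rate \<open>r\<close>
      negative. The sign \<open>s\<close> selects the upper or the lower tail.\<close>
    define \<theta> where "\<theta> = min \<delta> (\<epsilon> / (2 * (C + 1)))"
    have th: "\<theta> > 0" "\<theta> \<le> \<delta>" using e \<delta> C by (auto simp: \<theta>_def)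
    have "\<theta> * (2 * (C + 1)) \<le> \<epsilon>"
    proof -
      have "\<theta> \<le> \<epsilon> / (2 * (C + 1))" by (simp add: \<theta>_def)
      then show ?thesis using C by (simp add: field_simps)
    qed
    moreover have "\<theta> * (2 * (C + 1)) = 2 * \<theta> + 2 * (C * \<theta>)" by (simp add: algebra_simps)
    moreover have "0 \<le> C * \<theta>" using th C by simp
    ultimately have Cth: "C * \<theta> < \<epsilon>" using th by linarith
    define r where "r = exp (\<theta> * (C * \<theta> - \<epsilon>))"
    have r: "0 \<le> r" "r < 1" using th Cth by (auto simp: r_def mult_less_0_iff)
    have "prob {\<omega>\<in>space M. s * (Z n \<omega> - real n * m) \<ge> real n * \<epsilon>} \<le> r ^ n" for n
    proof -
      let ?A = "{\<omega>\<in>space M. s * (Z n \<omega> - real n * m) \<ge> real n * \<epsilon>}"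
      let ?c = "exp (- \<theta> * real n * \<epsilon> - \<theta> * s * real n * m)"
      have Am: "?A \<in> sets M" by measurable
      have a: "\<bar>\<theta> * s\<bar> \<le> \<delta>" using th s by (simp add: abs_mult)
      note g = mgf[OF a, of n]
      have ss: "s * s = 1" using s by (metis abs_mult_self_eq mult_1)
      have le: "indicat_real ?A \<omega> \<le> ?c * exp (\<theta> * s * Z n \<omega>)" for \<omega>
      proof (cases "\<omega> \<in> ?A")
        case True
        have "0 \<le> \<theta> * (s * (Z n \<omega> - real n * m) - real n * \<epsilon>)" using True th by simp
        then have "1 \<le> exp (\<theta> * (s * (Z n \<omega> - real n * m) - real n * \<epsilon>))" by simp
        also have "\<dots> = ?c * exp (\<theta> * s * Z n \<omega>)" unfolding exp_add[symmetric] by (simp add: algebra_simps)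
        finally show ?thesis using True by simp
      qed simp
      have "expectation (indicat_real ?A) \<le> expectation (\<lambda>\<omega>. ?c * exp (\<theta> * s * Z n \<omega>))"
        by (rule Bochner_Integration.integral_mono[OF _ _ le])
          (use g Am in \<open>auto simp: integrable_indicator_iff emeasure_eq_measure\<close>)
      also have "\<dots> = ?c * expectation (\<lambda>\<omega>. exp (\<theta> * s * Z n \<omega>))" by simp
      also have "\<dots> \<le> ?c * exp (real n * (\<theta> * s * m + C * (\<theta> * s)\<^sup>2))" using g by (intro mult_left_mono) auto
      also have "\<dots> = exp (real n * (\<theta> * (C * \<theta> - \<epsilon>)))"
      proof -
        have "(\<theta> * s)\<^sup>2 = \<theta> * \<theta>" using ss by (simp add: power2_eq_square)
        then show ?thesis unfolding exp_add[symmetric] by (simp add: algebra_simps)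
      qed
      also have "\<dots> = r ^ n" by (simp add: r_def exp_of_nat_mult)
      finally show ?thesis using Am by simp
    qed
    with r show ?thesis by blast
  qed
  have bc: "AE \<omega> in M. eventually (\<lambda>n. \<bar>Z n \<omega> - real n * m\<bar> < real n * \<epsilon>) sequentially" if e: "\<epsilon> > 0" for \<epsilon>
  proof -
    have ev: "AE \<omega> in M. eventually (\<lambda>n. s * (Z n \<omega> - real n * m) < real n * \<epsilon>) sequentially" if s: "\<bar>s\<bar> = 1" for s
    proof -
      obtain r where r: "r < 1" "0 \<le> r" "\<And>n. prob {\<omega>\<in>space M. s * (Z n \<omega> - real n * m) \<ge> real n * \<epsilon>} \<le> r ^ n"
        using tail[OF e s] by blast
      have "summable (\<lambda>n. prob {\<omega>\<in>space M. s * (Z n \<omega> - real n * m) \<ge> real n * \<epsilon>})"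
        by (rule summable_comparison_test[OF _ summable_geometric[of r]]) (use r in auto)
      then have "AE \<omega> in M. eventually (\<lambda>n. \<omega> \<in> space M - {\<omega>\<in>space M. s * (Z n \<omega> - real n * m) \<ge> real n * \<epsilon>}) sequentially"
        by (intro borel_cantelli_AE1) (auto simp: emeasure_eq_measure)
      then show ?thesis
      proof eventually_elim
        fix \<omega> assume "eventually (\<lambda>n. \<omega> \<in> space M - {\<omega>\<in>space M. s * (Z n \<omega> - real n * m) \<ge> real n * \<epsilon>}) sequentially"
        then show "eventually (\<lambda>n. s * (Z n \<omega> - real n * m) < real n * \<epsilon>) sequentially"
          by eventually_elim auto
      qed
    qed
    have "AE \<omega> in M. eventually (\<lambda>n. 1 * (Z n \<omega> - real n * m) < real n * \<epsilon>) sequentially"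
      "AE \<omega> in M. eventually (\<lambda>n. (- 1) * (Z n \<omega> - real n * m) < real n * \<epsilon>) sequentially"
      by (rule ev; simp)+
    then show ?thesis
    proof eventually_elim
      fix \<omega> assume "eventually (\<lambda>n. 1 * (Z n \<omega> - real n * m) < real n * \<epsilon>) sequentially"
        "eventually (\<lambda>n. (- 1) * (Z n \<omega> - real n * m) < real n * \<epsilon>) sequentially"
      then show "eventually (\<lambda>n. \<bar>Z n \<omega> - real n * m\<bar> < real n * \<epsilon>) sequentially"
        by eventually_elim auto
    qed
  qed
  have "AE \<omega> in M. \<forall>k::nat. eventually (\<lambda>n. \<bar>Z n \<omega> - real n * m\<bar> < real n * (1 / real (Suc k))) sequentially"
    unfolding AE_all_countable by (intro allI bc) simp
  then show ?thesis
  proof eventually_elim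
    fix \<omega> assume h: "\<forall>k::nat. eventually (\<lambda>n. \<bar>Z n \<omega> - real n * m\<bar> < real n * (1 / real (Suc k))) sequentially"
    show "(\<lambda>n. Z n \<omega> / real n) \<longlonglongrightarrow> m"
    proof (rule tendstoI)
      fix e :: real assume "e > 0"
      then obtain k where k: "1 / real (Suc k) < e" using nat_approx_posE by blast
      from h have "eventually (\<lambda>n. \<bar>Z n \<omega> - real n * m\<bar> < real n * (1 / real (Suc k))) sequentially" by blast
      then show "eventually (\<lambda>n. dist (Z n \<omega> / real n) m < e) sequentially"
        using eventually_gt_at_top[of 0]
      proof eventually_elim
        case (elim n)
        have "\<bar>Z n \<omega> / real n - m\<bar> = \<bar>Z n \<omega> - real n * m\<bar> / real n" using elim by (simp add: field_simps)
        also have "\<dots> < 1 / real (Suc k)" using elim by (simp add: field_simps)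
        finally show ?case using k by (simp add: dist_real_def)
      qed
    qed
  qed
qed


subsection \<open>Laws of large numbers and the affinity\<close>

definition words :: "nat \<Rightarrow> bool list set" where "words n = {es. length es = n}"

lemma words_finite [simp]: "finite (words n)"
  using finite_lists_length_eq[of "UNIV :: bool set" n] by (simp add: words_def)

lemma words_Suc: "words (Suc n) = (#) True ` words n \<union> (#) False ` words n"
  by (auto simp: words_def length_Suc_conv image_iff)

text \<open>The binomial identity, kept as a sum over words because the transforms are indexed by
  words.\<close>

lemma sum_words:
  fixes z :: real
  shows "(\<Sum>es\<in>words n. z ^ nT es) = (1 + z) ^ n"
proof (induct n)
  case 0
  have "words 0 = {[]}" by (auto simp: words_def)
  then show ?case by (simp add: nT_def)
next
  case (Suc n)
  have "(\<Sum>es\<in>words (Suc n). z ^ nT es) = (\<Sum>es\<in>(#) True ` words n. z ^ nT es) + (\<Sum>es\<in>(#) False ` words n. z ^ nT es)"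
    unfolding words_Suc by (rule sum.union_disjoint) auto
  also have "\<dots> = z * (\<Sum>es\<in>words n. z ^ nT es) + (\<Sum>es\<in>words n. z ^ nT es)"
    by (simp add: sum.reindex nT_def sum_distrib_left)
  finally show ?case using Suc by (simp add: algebra_simps)
qed

context periodic_sde begin

lemma lapden_0: "lapden 0 = 1 + kap"
  using ser_fixpoint[OF one_cont, of 0] unfolding lapden_def cosf_def by simp

definition Good :: "'a set" where "Good = {\<omega>\<in>space M. \<forall>n. \<exists>es\<in>words n. \<omega> \<in> Cyc es}"

text \<open>There are only countably many words, so the exceptional sets of the individual cycles
  together form a null set.\<close>

lemma AE_Good: "AE \<omega> in M. \<omega> \<in> Good"
proof -
  have "\<forall>es. AE \<omega> in M. \<omega> \<in> Cyc es \<longrightarrow> (\<exists>e. \<omega> \<in> Cyc (e # es))" using cycle_laplace by blast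
  then have "AE \<omega> in M. \<forall>es. \<omega> \<in> Cyc es \<longrightarrow> (\<exists>e. \<omega> \<in> Cyc (e # es))" unfolding AE_all_countable by blast
  then show ?thesis using AE_space
  proof eventually_elim
    fix \<omega> assume s: "\<forall>es. \<omega> \<in> Cyc es \<longrightarrow> (\<exists>e. \<omega> \<in> Cyc (e # es))" and w: "\<omega> \<in> space M"
    have "\<exists>es\<in>words n. \<omega> \<in> Cyc es" for n
    proof (induct n)
      case 0
      then show ?case using w by (auto simp: words_def Cyc_def)
    next
      case (Suc n)
      then obtain es where es: "es \<in> words n" "\<omega> \<in> Cyc es" by blast
      obtain e where e: "\<omega> \<in> Cyc (e # es)" using s[rule_format, OF es(2)] ..
      show ?case by (rule bexI[of _ "e # es"], rule e) (use es(1) in \<open>simp add: words_def\<close>)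
    qed
    then show "\<omega> \<in> Good" using w by (simp add: Good_def)
  qed
qed

lemma sum_words_Cyc:
  fixes h :: "bool list \<Rightarrow> real"
  assumes "\<omega> \<in> Cyc es"
  shows "(\<Sum>fs\<in>words (length es). indicator (Cyc fs) \<omega> * h fs) = h es"
proof -
  have "indicator (Cyc fs) \<omega> * h fs = (if fs = es then h fs else 0)" if "fs \<in> words (length es)" for fs
  proof (cases "fs = es")
    case False
    have "\<omega> \<notin> Cyc fs"
    proof
      assume "\<omega> \<in> Cyc fs"
      then have "fs = es"
        using cyc_unique[OF Xc[of \<omega>]] assms that by (simp add: Cyc_def words_def)
      with False show False ..
    qed
    with False show ?thesis by simp
  qed (use assms in simp)
  then have "(\<Sum>fs\<in>words (length es). indicator (Cyc fs) \<omega> * h fs) = (\<Sum>fs\<in>words (length es). if fs = es then h fs else 0)"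
    by (rule sum.cong[OF refl])
  also have "\<dots> = h es" using words_finite by (simp add: words_def)
  finally show ?thesis .
qed

text \<open>At most one word of length \<open>n\<close> fits a path, so the sum has at most one
  nonzero term. Written as a finite sum it is visibly measurable.\<close>

definition ctm :: "nat \<Rightarrow> 'a \<Rightarrow> real" where "ctm n \<omega> = (\<Sum>es\<in>words n. indicator (Cyc es) \<omega> * ctime es \<omega>)"
definition cnt :: "nat \<Rightarrow> 'a \<Rightarrow> real" where "cnt n \<omega> = (\<Sum>es\<in>words n. indicator (Cyc es) \<omega> * real (nT es))"

lemma ctm_meas [measurable]: "ctm n \<in> borel_measurable M" unfolding ctm_def[abs_def] by measurable
lemma cnt_meas [measurable]: "cnt n \<in> borel_measurable M" unfolding cnt_def[abs_def] by measurable

lemma expectation_words: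
  fixes H :: "'a \<Rightarrow> real" and h :: "bool list \<Rightarrow> 'a \<Rightarrow> real"
  assumes H [measurable]: "H \<in> borel_measurable M"
    and i: "\<And>es. integrable M (\<lambda>\<omega>. indicator (Cyc es) \<omega> * h es \<omega>)"
    and eq: "\<And>\<omega> es. es \<in> words n \<Longrightarrow> \<omega> \<in> Cyc es \<Longrightarrow> H \<omega> = h es \<omega>"
  shows "integrable M H" "expectation H = (\<Sum>es\<in>words n. expectation (\<lambda>\<omega>. indicator (Cyc es) \<omega> * h es \<omega>))"
proof -
  let ?S = "\<lambda>\<omega>. \<Sum>es\<in>words n. indicator (Cyc es) \<omega> * h es \<omega>"
  have ae: "AE \<omega> in M. ?S \<omega> = H \<omega>"
    using AE_Good
  proof eventually_elim
    fix \<omega> assume "\<omega> \<in> Good"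
    then obtain es where es: "es \<in> words n" "\<omega> \<in> Cyc es" by (auto simp: Good_def)
    then show "?S \<omega> = H \<omega>" using sum_words_Cyc[OF es(2), of "\<lambda>es. h es \<omega>"] eq[OF es] by (simp add: words_def)
  qed
  have Si: "integrable M ?S" by (intro Bochner_Integration.integrable_sum i)
  show "integrable M H"
    by (rule integrable_cong_AE_imp[OF Si H ae])
  have ae': "AE \<omega> in M. H \<omega> = ?S \<omega>" using ae by eventually_elim simp
  have "expectation H = expectation ?S"
    by (rule integral_cong_AE[OF H borel_measurable_integrable[OF Si] ae'])
  also have "\<dots> = (\<Sum>es\<in>words n. expectation (\<lambda>\<omega>. indicator (Cyc es) \<omega> * h es \<omega>))"
    by (rule Bochner_Integration.integral_sum) (rule i)
  finally show "expectation H = (\<Sum>es\<in>words n. expectation (\<lambda>\<omega>. indicator (Cyc es) \<omega> * h es \<omega>))" .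
qed

lemma ctm_Cyc: "\<omega> \<in> Cyc es \<Longrightarrow> ctm (length es) \<omega> = ctime es \<omega>"
  unfolding ctm_def by (rule sum_words_Cyc)
lemma cnt_Cyc: "\<omega> \<in> Cyc es \<Longrightarrow> cnt (length es) \<omega> = real (nT es)"
  unfolding cnt_def by (rule sum_words_Cyc)

text \<open>The mean duration of a cycle: the logarithmic derivative of \<open>lapden\<close> at
  0.\<close>

definition drift :: real where "drift = (kap * iop (\<lambda>_. 1) 1 + iop (\<lambda>_. 1) (- 1)) / (1 + kap)"

lemma drift_pos: "drift > 0"
  unfolding drift_def using iop_one_pos[of 1] iop_one_pos[of "- 1"] kap_pos
  by (intro divide_pos_pos add_pos_pos mult_pos_pos) auto

text \<open>Summing the transforms over all words of length \<open>n\<close> gives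
  \<open>((1 + kap) / lapden \<nu>) ^ n\<close> with \<open>\<nu> = - \<theta>\<close>, and the
  second-order expansion of \<open>cosf\<close> in \<nu> supplies the quadratic bound. Both signs of
  \<theta> are available because \<nu> may be negative.\<close>

lemma cycle_time_lln: "AE \<omega> in M. (\<lambda>n. ctm n \<omega> / real n) \<longlonglongrightarrow> drift"
proof -
  obtain \<mu> where mu: "\<mu> > 0" "\<mu> \<le> 1" and pos': "\<forall>\<nu>\<ge>- \<mu>. lapden \<nu> > 0"
    and i': "\<forall>es. \<forall>\<nu>\<ge>- \<mu>. integrable M (\<lambda>\<omega>. indicator (Cyc es) \<omega> * exp (- \<nu> * ctime es \<omega>))"
    and f': "\<forall>es. \<forall>\<nu>\<ge>- \<mu>. lap es \<nu> = kap ^ nT es * (1 / lapden \<nu>) ^ length es"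
    using cycle_laplace by blast
  note pos = pos'[rule_format] and i = i'[rule_format] and f = f'[rule_format]
  obtain B where B: "B \<ge> 0" "\<And>\<nu> x. \<bar>\<nu>\<bar> \<le> 1 \<Longrightarrow> \<bar>x\<bar> \<le> 1 \<Longrightarrow> \<bar>cosf \<nu> x - 1 - \<nu> * iop (\<lambda>_. 1) x\<bar> \<le> B * \<nu>\<^sup>2"
    using cosf_second_order by blast
  \<comment> \<open>Lipschitz constant at 0 of the quantity \<open>z\<close> below, as
    \<open>\<nu>\<^sup>2 \<le> \<bar>\<nu>\<bar>\<close>. With
    \<open>\<delta> \<le> 1 / (2 * E)\<close> it keeps \<open>\<bar>z\<bar> \<le> 1 / 2\<close>, the
    range in which the logarithm estimate holds.\<close>
  define E where "E = drift + B"
  have E: "E > 0" using drift_pos B by (simp add: E_def)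
  define \<delta> where "\<delta> = min \<mu> (1 / (2 * E))"
  have d: "\<delta> > 0" "\<delta> \<le> \<mu>" "\<delta> \<le> 1" using mu E by (auto simp: \<delta>_def)
  have dE: "\<delta> * E \<le> 1 / 2"
  proof -
    have "\<delta> \<le> 1 / (2 * E)" by (simp add: \<delta>_def)
    then show ?thesis using E by (simp add: field_simps)
  qed
  show ?thesis
  proof (rule chernoff_strong_law[of ctm \<delta> "B + 2 * E\<^sup>2"])
    fix n and \<theta> :: real assume th: "\<bar>\<theta>\<bar> \<le> \<delta>"
    define \<nu> where "\<nu> = - \<theta>"
    have nu: "\<bar>\<nu>\<bar> \<le> \<delta>" "\<nu> \<ge> - \<mu>" "\<bar>\<nu>\<bar> \<le> 1" using th d by (auto simp: \<nu>_def)
    have m: "(\<lambda>\<omega>. exp (\<theta> * ctm n \<omega>)) \<in> borel_measurable M" by measurable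
    have eq: "exp (\<theta> * ctm n \<omega>) = exp (- \<nu> * ctime es \<omega>)" if "es \<in> words n" "\<omega> \<in> Cyc es" for \<omega> es
      using that ctm_Cyc[OF that(2)] by (simp add: words_def \<nu>_def)
    have e: "integrable M (\<lambda>\<omega>. exp (\<theta> * ctm n \<omega>))"
      "expectation (\<lambda>\<omega>. exp (\<theta> * ctm n \<omega>)) = (\<Sum>es\<in>words n. expectation (\<lambda>\<omega>. indicator (Cyc es) \<omega> * exp (- \<nu> * ctime es \<omega>)))"
      by (rule expectation_words[OF m i[OF nu(2)]], erule (1) eq)+
    have "expectation (\<lambda>\<omega>. exp (\<theta> * ctm n \<omega>)) = (\<Sum>es\<in>words n. kap ^ nT es * (1 / lapden \<nu>) ^ n)"
      unfolding e(2) lap_def[symmetric] by (rule sum.cong[OF refl]) (simp add: f[OF nu(2)] words_def)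
    also have "\<dots> = ((1 + kap) / lapden \<nu>) ^ n"
      unfolding sum_distrib_right[symmetric] sum_words by (simp add: power_divide)
    also have "\<dots> \<le> exp (\<theta> * drift + (B + 2 * E\<^sup>2) * \<theta>\<^sup>2) ^ n"
    proof (rule power_mono)
      \<comment> \<open>Relative deviation of \<open>lapden\<close> from its value at 0; its part
        linear in \<nu> is \<open>\<nu> * drift\<close>.\<close>
      define z where "z = lapden \<nu> / (1 + kap) - 1"
      have K: "1 + kap > 0" using kap_pos by simp
      have zb: "\<bar>z - \<nu> * drift\<bar> \<le> B * \<nu>\<^sup>2"
      proof -
        have a1: "\<bar>cosf \<nu> 1 - 1 - \<nu> * iop (\<lambda>_. 1) 1\<bar> \<le> B * \<nu>\<^sup>2" and a2: "\<bar>cosf \<nu> (- 1) - 1 - \<nu> * iop (\<lambda>_. 1) (- 1)\<bar> \<le> B * \<nu>\<^sup>2"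
          by (rule B(2)[OF nu(3)]; simp)+
        have e1: "(z - \<nu> * drift) * (1 + kap) = kap * (cosf \<nu> 1 - 1 - \<nu> * iop (\<lambda>_. 1) 1) + (cosf \<nu> (- 1) - 1 - \<nu> * iop (\<lambda>_. 1) (- 1))"
        proof -
          have zK: "z * (1 + kap) = lapden \<nu> - (1 + kap)" unfolding z_def using K by (simp add: left_diff_distrib)
          have dK: "drift * (1 + kap) = kap * iop (\<lambda>_. 1) 1 + iop (\<lambda>_. 1) (- 1)" unfolding drift_def using K by simp
          have "(z - \<nu> * drift) * (1 + kap) = z * (1 + kap) - \<nu> * (drift * (1 + kap))" by (simp only: left_diff_distrib mult.assoc)
          then show ?thesis unfolding zK dK lapden_def by (simp add: algebra_simps)
        qed
        have e2: "\<bar>kap * (cosf \<nu> 1 - 1 - \<nu> * iop (\<lambda>_. 1) 1) + (cosf \<nu> (- 1) - 1 - \<nu> * iop (\<lambda>_. 1) (- 1))\<bar> \<le> kap * (B * \<nu>\<^sup>2) + B * \<nu>\<^sup>2"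
        proof (rule order_trans[OF abs_triangle_ineq add_mono[OF _ a2]])
          show "\<bar>kap * (cosf \<nu> 1 - 1 - \<nu> * iop (\<lambda>_. 1) 1)\<bar> \<le> kap * (B * \<nu>\<^sup>2)"
            unfolding abs_mult abs_of_pos[OF kap_pos] by (rule mult_left_mono[OF a1 less_imp_le[OF kap_pos]])
        qed
        have e3: "kap * (B * \<nu>\<^sup>2) + B * \<nu>\<^sup>2 = (B * \<nu>\<^sup>2) * (1 + kap)" by (simp add: algebra_simps)
        have "\<bar>(z - \<nu> * drift) * (1 + kap)\<bar> \<le> (B * \<nu>\<^sup>2) * (1 + kap)"
          unfolding e1 by (rule order_trans[OF e2 eq_refl[OF e3]])
        then have "\<bar>z - \<nu> * drift\<bar> * (1 + kap) \<le> (B * \<nu>\<^sup>2) * (1 + kap)" using K by (simp only: abs_mult abs_of_pos)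
        then show ?thesis using K by simp
      qed
      have nsq: "\<nu>\<^sup>2 \<le> \<bar>\<nu>\<bar>"
      proof -
        have "\<bar>\<nu>\<bar> * \<bar>\<nu>\<bar> \<le> \<bar>\<nu>\<bar> * 1" using nu(3) by (intro mult_left_mono) auto
        moreover have "\<bar>\<nu>\<bar> * \<bar>\<nu>\<bar> = \<nu>\<^sup>2" by (simp add: power2_eq_square abs_mult_self_eq)
        ultimately show ?thesis by simp
      qed
      have zE: "\<bar>z\<bar> \<le> E * \<bar>\<nu>\<bar>"
      proof -
        have "\<bar>z\<bar> \<le> \<bar>\<nu> * drift\<bar> + B * \<nu>\<^sup>2" using zb by linarith
        also have "\<dots> \<le> \<bar>\<nu>\<bar> * drift + B * \<bar>\<nu>\<bar>"
          using nsq B(1) drift_pos by (intro add_mono mult_left_mono) (auto simp: abs_mult)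
        finally show ?thesis by (simp add: E_def algebra_simps)
      qed
      have "E * \<bar>\<nu>\<bar> \<le> E * \<delta>" using nu(1) E by (intro mult_left_mono) auto
      then have z2: "\<bar>z\<bar> \<le> 1 / 2" using zE dE by (simp add: mult.commute)
      have "\<bar>ln (1 + z) - z\<bar> \<le> 2 * z\<^sup>2" by (rule abs_ln_one_plus_x_minus_x_bound[OF z2])
      moreover have "z\<^sup>2 \<le> E\<^sup>2 * \<theta>\<^sup>2" using power_mono[OF zE, of 2] by (simp add: power_mult_distrib \<nu>_def)
      ultimately have "- ln (1 + z) \<le> \<theta> * drift + (B + 2 * E\<^sup>2) * \<theta>\<^sup>2"
        using zb by (simp add: \<nu>_def algebra_simps)
      then have "exp (- ln (1 + z)) \<le> exp (\<theta> * drift + (B + 2 * E\<^sup>2) * \<theta>\<^sup>2)" by simp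
      moreover have "exp (- ln (1 + z)) = (1 + kap) / lapden \<nu>"
        using pos[OF nu(2)] K by (simp add: exp_minus z_def)
      ultimately show "(1 + kap) / lapden \<nu> \<le> exp (\<theta> * drift + (B + 2 * E\<^sup>2) * \<theta>\<^sup>2)" by simp
      show "0 \<le> (1 + kap) / lapden \<nu>" using pos[OF nu(2)] K by simp
    qed
    also have "\<dots> = exp (real n * (\<theta> * drift + (B + 2 * E\<^sup>2) * \<theta>\<^sup>2))" by (simp add: exp_of_nat_mult)
    finally show "integrable M (\<lambda>\<omega>. exp (\<theta> * ctm n \<omega>)) \<and>
      expectation (\<lambda>\<omega>. exp (\<theta> * ctm n \<omega>)) \<le> exp (real n * (\<theta> * drift + (B + 2 * E\<^sup>2) * \<theta>\<^sup>2))"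
      using e(1) by blast
  qed (use d B in auto)
qed

text \<open>At \<open>\<nu> = 0\<close> the transforms are the probabilities of the words, so the
  count is binomial with success probability \<open>kap / (1 + kap)\<close>.\<close>

lemma forward_lln: "AE \<omega> in M. (\<lambda>n. cnt n \<omega> / real n) \<longlonglongrightarrow> kap / (1 + kap)"
proof -
  obtain \<mu> where mu: "\<mu> > 0" "\<mu> \<le> 1" and pos': "\<forall>\<nu>\<ge>- \<mu>. lapden \<nu> > 0"
    and i': "\<forall>es. \<forall>\<nu>\<ge>- \<mu>. integrable M (\<lambda>\<omega>. indicator (Cyc es) \<omega> * exp (- \<nu> * ctime es \<omega>))"
    and f': "\<forall>es. \<forall>\<nu>\<ge>- \<mu>. lap es \<nu> = kap ^ nT es * (1 / lapden \<nu>) ^ length es"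
    using cycle_laplace by blast
  note pos = pos'[rule_format] and f = f'[rule_format]
  let ?p = "kap / (1 + kap)"
  have K: "1 + kap > 0" using kap_pos by simp
  have p: "?p \<ge> 0" using kap_pos by simp
  show ?thesis
  proof (rule chernoff_strong_law[of cnt 1 ?p])
    fix n and \<theta> :: real assume th: "\<bar>\<theta>\<bar> \<le> 1"
    have i: "integrable M (\<lambda>\<omega>. indicator (Cyc es) \<omega> * exp (\<theta> * real (nT es)))" for es
      by (simp add: integrable_indicator_iff emeasure_eq_measure)
    have m: "(\<lambda>\<omega>. exp (\<theta> * cnt n \<omega>)) \<in> borel_measurable M" by measurable
    have eq: "exp (\<theta> * cnt n \<omega>) = exp (\<theta> * real (nT es))" if "es \<in> words n" "\<omega> \<in> Cyc es" for \<omega> es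
      using that cnt_Cyc[OF that(2)] by (simp add: words_def)
    have e: "integrable M (\<lambda>\<omega>. exp (\<theta> * cnt n \<omega>))"
      "expectation (\<lambda>\<omega>. exp (\<theta> * cnt n \<omega>)) = (\<Sum>es\<in>words n. expectation (\<lambda>\<omega>. indicator (Cyc es) \<omega> * exp (\<theta> * real (nT es))))"
      by (rule expectation_words[OF m i], erule (1) eq)+
    have "expectation (\<lambda>\<omega>. exp (\<theta> * cnt n \<omega>)) = (\<Sum>es\<in>words n. (kap * exp \<theta>) ^ nT es * (1 / (1 + kap)) ^ n)"
      unfolding e(2)
    proof (rule sum.cong[OF refl])
      fix es assume es: "es \<in> words n"
      have "expectation (indicat_real (Cyc es)) = lap es 0" by (simp add: lap_def)
      also have "\<dots> = kap ^ nT es * (1 / (1 + kap)) ^ n" using f[of 0 es] mu es by (simp add: lapden_0 words_def)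
      finally have "expectation (indicat_real (Cyc es)) = kap ^ nT es * (1 / (1 + kap)) ^ n" .
      moreover have "exp (\<theta> * real (nT es)) = exp \<theta> ^ nT es" using exp_of_nat_mult[of "nT es" \<theta>] by (simp only: mult.commute)
      ultimately show "expectation (\<lambda>\<omega>. indicator (Cyc es) \<omega> * exp (\<theta> * real (nT es))) = (kap * exp \<theta>) ^ nT es * (1 / (1 + kap)) ^ n"
        by (simp add: power_mult_distrib)
    qed
    also have "\<dots> = ((1 + kap * exp \<theta>) / (1 + kap)) ^ n"
      unfolding sum_distrib_right[symmetric] sum_words by (simp add: power_divide)
    also have "\<dots> \<le> exp (\<theta> * ?p + ?p * \<theta>\<^sup>2) ^ n"
    proof (rule power_mono)
      have "exp \<theta> \<le> 1 + \<theta> + \<theta>\<^sup>2"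
      proof (cases "\<theta> \<ge> 0")
        case True then show ?thesis using exp_bound[of \<theta>] th by simp
      next
        case False
        define r where "r = - \<theta>"
        have r: "0 < r" using False by (simp add: r_def)
        \<comment> \<open>The product equals \<open>1 + r ^ 3\<close>. Together with
          \<open>1 + r \<le> exp r\<close> this bounds \<open>exp (- r)\<close> by
          \<open>1 - r + r\<^sup>2\<close>.\<close>
        have "1 \<le> (1 + r) * (1 - r + r\<^sup>2)" using r by (simp add: algebra_simps power2_eq_square)
        also have "\<dots> \<le> exp r * (1 - r + r\<^sup>2)"
          using exp_ge_add_one_self[of r] r zero_le_power2[of "r - 1"]
          by (intro mult_right_mono) (auto simp: power2_eq_square algebra_simps)
        finally have "exp \<theta> \<le> 1 - r + r\<^sup>2"
          unfolding r_def by (simp add: exp_minus field_simps)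
        then have "exp \<theta> \<le> 1 + \<theta> + \<theta>\<^sup>2" by (simp add: r_def)
        then show ?thesis by linarith
      qed
      then have "?p * (exp \<theta> - 1) \<le> ?p * (\<theta> + \<theta>\<^sup>2)" using p by (intro mult_left_mono) auto
      moreover have "(1 + kap * exp \<theta>) / (1 + kap) = 1 + ?p * (exp \<theta> - 1)" using K by (simp add: field_simps)
      moreover have "1 + ?p * (exp \<theta> - 1) \<le> exp (?p * (exp \<theta> - 1))" by (rule exp_ge_add_one_self)
      moreover have "?p * (\<theta> + \<theta>\<^sup>2) = \<theta> * ?p + ?p * \<theta>\<^sup>2" by (simp only: distrib_left mult.commute[of \<theta>])
      ultimately show "(1 + kap * exp \<theta>) / (1 + kap) \<le> exp (\<theta> * ?p + ?p * \<theta>\<^sup>2)" by (smt (verit) exp_le_cancel_iff)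
      show "0 \<le> (1 + kap * exp \<theta>) / (1 + kap)" using K kap_pos by (intro divide_nonneg_nonneg add_nonneg_nonneg mult_nonneg_nonneg) auto
    qed
    also have "\<dots> = exp (real n * (\<theta> * ?p + ?p * \<theta>\<^sup>2))" by (simp add: exp_of_nat_mult)
    finally show "integrable M (\<lambda>\<omega>. exp (\<theta> * cnt n \<omega>)) \<and>
      expectation (\<lambda>\<omega>. exp (\<theta> * cnt n \<omega>)) \<le> exp (real n * (\<theta> * ?p + ?p * \<theta>\<^sup>2))"
      using e(1) by blast
  qed (use p in auto)
qed

end

section \<open>Cycle counts along a single path\<close>

declare cycle_time.simps(2) [simp del]

context
  fixes x :: "real \<Rightarrow> real"
  assumes c: "continuous_on {0..} x"
begin

lemma cyc_time_mono: "cyc x es \<Longrightarrow> m \<le> length es \<Longrightarrow> cycle_time x m \<le> cycle_time x (length es)"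
proof (induct es)
  case (Cons e es)
  show ?case
  proof (cases "m \<le> length es")
    case True
    then have "cycle_time x m \<le> cycle_time x (length es)" using Cons by simp
    also have "\<dots> \<le> cycle_time x (Suc (length es))" using cyc_step(1)[OF c Cons.prems(1)] by simp
    finally show ?thesis by simp
  next
    case False
    then have "m = Suc (length es)" using Cons.prems(2) by simp
    then show ?thesis by simp
  qed
qed simp

lemma card_cycles:
  "cyc x es \<Longrightarrow> card {n\<in>{1..length es}. x (cycle_time x n) - x (cycle_time x (n - 1)) = sg e} = length (filter (\<lambda>d. d = e) es)"
proof (induct es)
  case (Cons d es)
  let ?P = "\<lambda>n. x (cycle_time x n) - x (cycle_time x (n - 1)) = sg e"
  have P: "?P (Suc (length es)) \<longleftrightarrow> d = e"
    using cyc_step(3)[OF c Cons.prems] by (simp add: sg_def)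
  have "{n\<in>{1..length (d # es)}. ?P n} = {n\<in>{1..length es}. ?P n} \<union> (if d = e then {Suc (length es)} else {})"
    using P by (auto simp: le_Suc_eq)
  also have "card \<dots> = card {n\<in>{1..length es}. ?P n} + (if d = e then 1 else 0)"
    by (subst card_Un_disjoint) auto
  finally show ?case using Cons by simp
qed simp

text \<open>The hypothesis that some next cycle is completed makes
  \<open>cycle_time x (Suc (length es))\<close> a genuine time; otherwise it would be the infimum of
  the empty set and could lie below \<open>t\<close>.\<close>

lemma num_cycles_eq:
  assumes f: "fin x es t" and n: "\<And>e. \<not> fin x (e # es) t" and e: "cyc x (e # es)"
  shows "num_cycles x t = length es"
  unfolding num_cycles_def
proof (rule Least_equality)
  have "\<not> cycle_time x (length (e # es)) \<le> t" using n[of e] e unfolding fin_def by blast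
  then show "t < cycle_time x (Suc (length es))" by simp
next
  fix m assume m: "t < cycle_time x (Suc m)"
  show "length es \<le> m"
  proof (rule ccontr)
    assume "\<not> length es \<le> m"
    then have "cycle_time x (Suc m) \<le> cycle_time x (length es)" using f by (intro cyc_time_mono) (auto simp: fin_def)
    then show False using m f by (simp add: fin_def)
  qed
qed

end

definition nF :: "bool list \<Rightarrow> nat" where "nF es = length (filter Not es)"

lemma nT_nF: "nT es + nF es = length es"
  using sum_length_filter_compl[of id es] by (simp add: nT_def nF_def)

section \<open>Counts at a fixed time and their long-run rates\<close>

context periodic_sde begin

definition At :: "bool list \<Rightarrow> real \<Rightarrow> 'a set" where
  "At es t = Fin es t - (Fin (True # es) t \<union> Fin (False # es) t)"

lemma At_meas [measurable]: "At es t \<in> sets M" unfolding At_def by measurable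

lemma Good_ext:
  assumes g: "\<omega> \<in> Good" and es: "\<omega> \<in> Cyc es"
  obtains e where "\<omega> \<in> Cyc (e # es)"
proof -
  obtain fs where fs: "length fs = Suc (length es)" "\<omega> \<in> Cyc fs" using g by (auto simp: Good_def words_def)
  then obtain e gs where gs: "fs = e # gs" by (cases fs) auto
  then have "\<omega> \<in> Cyc gs" "length gs = length es" using fs Cyc_Cons by auto
  then have "gs = es" using es cyc_unique[OF Xc[of \<omega>], of gs es] by (simp add: Cyc_def)
  then show ?thesis using that fs(2) gs by blast
qed

lemma At_counts:
  assumes g: "\<omega> \<in> Good" and a: "\<omega> \<in> At es t"
  shows "num_cycles (path \<omega>) t = length es" "num_fwd (path \<omega>) t = nT es" "num_bwd (path \<omega>) t = nF es"
    "ctm (length es) \<omega> \<le> t" "t < ctm (Suc (length es)) \<omega>" "\<omega> \<in> Cyc es"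
proof -
  have w: "\<omega> \<in> space M" using g by (simp add: Good_def)
  have f: "\<omega> \<in> Fin es t" "\<omega> \<notin> Fin (e # es) t" for e using a by (cases e; simp add: At_def)+
  show es: "\<omega> \<in> Cyc es" using f(1) by (simp add: Fin_iff)
  obtain e where e: "\<omega> \<in> Cyc (e # es)" using Good_ext[OF g es] .
  show n: "num_cycles (path \<omega>) t = length es"
    by (rule num_cycles_eq[OF Xc[OF w], of es t e]) (use f e w in \<open>auto simp: Fin_def Cyc_def\<close>)
  have cy: "cyc (path \<omega>) es" using es by (simp add: Cyc_def)
  show "num_fwd (path \<omega>) t = nT es"
    using card_cycles[OF Xc[OF w] cy, of True] unfolding num_fwd_def n by (simp add: sg_def nT_def id_def)
  show "num_bwd (path \<omega>) t = nF es"
    using card_cycles[OF Xc[OF w] cy, of False] unfolding num_bwd_def n by (simp add: sg_def nF_def)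
  show "ctm (length es) \<omega> \<le> t" using ctm_Cyc[OF es] f(1) by (simp add: Fin_iff)
  show "t < ctm (Suc (length es)) \<omega>" using ctm_Cyc[OF e] f(2)[of e] e by (simp add: Fin_iff)
qed

lemma At_exists:
  assumes g: "\<omega> \<in> Good" and inf: "filterlim (\<lambda>n. ctm n \<omega>) at_top sequentially" and t: "t \<ge> 0"
  obtains es where "\<omega> \<in> At es t"
proof -
  have "\<exists>n. t < ctm (Suc n) \<omega>"
  proof -
    have "eventually (\<lambda>n. t < ctm n \<omega>) sequentially" using inf by (simp add: filterlim_at_top_dense)
    then obtain n where "\<forall>m\<ge>n. t < ctm m \<omega>" unfolding eventually_sequentially by blast
    then have "t < ctm (Suc n) \<omega>" by simp
    then show ?thesis ..
  qed
  then obtain n where n: "t < ctm (Suc n) \<omega>" and least: "\<And>m. m < n \<Longrightarrow> \<not> t < ctm (Suc m) \<omega>"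
    using exists_least_iff[of "\<lambda>n. t < ctm (Suc n) \<omega>"] by blast
  obtain es where es: "length es = n" "\<omega> \<in> Cyc es" using g by (auto simp: Good_def words_def)
  have "ctm n \<omega> \<le> t"
  proof (cases n)
    case 0
    then have "ctm n \<omega> = 0" using ctm_Cyc[OF es(2)] es(1) by (simp add: ctime_def)
    then show ?thesis using t by simp
  next
    case (Suc m)
    then show ?thesis using least[of m] by simp
  qed
  then have "\<omega> \<in> Fin es t" using es ctm_Cyc[OF es(2)] by (simp add: Fin_iff)
  moreover have "\<omega> \<notin> Fin (e # es) t" for e
  proof
    assume "\<omega> \<in> Fin (e # es) t"
    then have e: "\<omega> \<in> Cyc (e # es)" "ctime (e # es) \<omega> \<le> t" by (auto simp: Fin_iff)
    then show False using ctm_Cyc[OF e(1)] es(1) n by simp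
  qed
  ultimately have "\<omega> \<in> At es t" by (simp add: At_def)
  then show ?thesis using that by blast
qed

lemma ctm_mono:
  assumes g: "\<omega> \<in> Good" shows "m \<le> n \<Longrightarrow> ctm m \<omega> \<le> ctm n \<omega>"
proof (induct n rule: dec_induct)
  case (step n)
  obtain es where es: "length es = n" "\<omega> \<in> Cyc es" using g by (auto simp: Good_def words_def)
  obtain e where e: "\<omega> \<in> Cyc (e # es)" using Good_ext[OF g es(2)] .
  have w: "\<omega> \<in> space M" using g by (simp add: Good_def)
  have "ctime es \<omega> \<le> ctime (e # es) \<omega>"
    using cyc_step(1)[OF Xc[OF w], of e es] es(2) e by (simp add: ctime_def Cyc_def)
  then show ?case using step ctm_Cyc[OF es(2)] ctm_Cyc[OF e] es(1) by simp
qed simp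

lemma ctm_infinity:
  assumes "(\<lambda>n. ctm n \<omega> / real n) \<longlonglongrightarrow> drift"
  shows "filterlim (\<lambda>n. ctm n \<omega>) at_top sequentially"
proof -
  have "filterlim (\<lambda>n. ctm n \<omega> / real n * real n) at_top sequentially"
    by (rule filterlim_tendsto_pos_mult_at_top[OF assms drift_pos filterlim_real_sequentially])
  moreover have "eventually (\<lambda>n. ctm n \<omega> / real n * real n = ctm n \<omega>) sequentially"
    using eventually_gt_at_top[of 0] by eventually_elim simp
  ultimately show ?thesis using filterlim_cong[OF refl refl] by fastforce
qed

text \<open>The renewal argument: with \<open>k t\<close> cycles complete at time \<open>t\<close>,
  the times of cycles \<open>k t\<close> and \<open>k t + 1\<close> enclose \<open>t\<close>, so
  \<open>t / k t\<close> tends to the mean duration. Counts per unit time are then quotients of two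
  convergent averages.\<close>

lemma circulation_limits:
  assumes g: "\<omega> \<in> Good" and T: "(\<lambda>n. ctm n \<omega> / real n) \<longlonglongrightarrow> drift" and N: "(\<lambda>n. cnt n \<omega> / real n) \<longlonglongrightarrow> p"
  shows "((\<lambda>t. emp_circ_fwd X t \<omega>) \<longlongrightarrow> p / drift) at_top" "((\<lambda>t. emp_circ_bwd X t \<omega>) \<longlongrightarrow> (1 - p) / drift) at_top"
proof -
  define k where "k t = num_cycles (path \<omega>) t" for t
  have inf: "filterlim (\<lambda>n. ctm n \<omega>) at_top sequentially" by (rule ctm_infinity[OF T])
  have props: "ctm (k t) \<omega> \<le> t \<and> t < ctm (Suc (k t)) \<omega> \<and> real (num_fwd (path \<omega>) t) = cnt (k t) \<omega> \<and>
      real (num_bwd (path \<omega>) t) = real (k t) - cnt (k t) \<omega>" if t: "t \<ge> 0" for t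
  proof -
    obtain es where es: "\<omega> \<in> At es t" using At_exists[OF g inf t] .
    note a = At_counts[OF g es]
    have "real (nT es) + real (nF es) = real (length es)" using nT_nF[of es] by linarith
    then show ?thesis unfolding k_def a(1) using a cnt_Cyc[OF a(6)] by simp
  qed
  have kinf: "filterlim k at_top at_top"
    unfolding filterlim_at_top
  proof
    fix m
    show "eventually (\<lambda>t. m \<le> k t) at_top"
      using eventually_ge_at_top[of "max 0 (ctm m \<omega>)"]
    proof eventually_elim
      case (elim t)
      show ?case
      proof (rule ccontr)
        assume "\<not> m \<le> k t"
        then have "ctm (Suc (k t)) \<omega> \<le> ctm m \<omega>" by (intro ctm_mono[OF g]) simp
        then show False using props[of t] elim by auto
      qed
    qed
  qed
  have kpos: "eventually (\<lambda>t. k t > 0) at_top"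
    using filterlim_at_top[THEN iffD1, OF kinf, rule_format, of 1] by eventually_elim simp
  have T1: "((\<lambda>t. ctm (k t) \<omega> / real (k t)) \<longlongrightarrow> drift) at_top" by (rule filterlim_compose[OF T kinf])
  have N1: "((\<lambda>t. cnt (k t) \<omega> / real (k t)) \<longlongrightarrow> p) at_top" by (rule filterlim_compose[OF N kinf])
  \<comment> \<open>The extra factor changes the divisor from \<open>Suc n\<close> to
    \<open>n\<close>, as needed for the upper enclosing sequence.\<close>
  have "(\<lambda>n. ctm (Suc n) \<omega> / real (Suc n) * (1 + 1 / real n)) \<longlonglongrightarrow> drift * (1 + 0)"
    by (intro tendsto_mult tendsto_add tendsto_const LIMSEQ_Suc[OF T] lim_const_over_n)
  then have T2: "((\<lambda>t. ctm (Suc (k t)) \<omega> / real (Suc (k t)) * (1 + 1 / real (k t))) \<longlongrightarrow> drift * (1 + 0)) at_top"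
    by (rule filterlim_compose[OF _ kinf])
  have tk: "((\<lambda>t. t / real (k t)) \<longlongrightarrow> drift) at_top"
  proof (rule tendsto_sandwich[OF _ _ T1 T2[unfolded add_0_right mult_1_right]])
    show "eventually (\<lambda>t. ctm (k t) \<omega> / real (k t) \<le> t / real (k t)) at_top"
      using kpos eventually_ge_at_top[of 0]
      by eventually_elim (use props in \<open>auto intro!: divide_right_mono\<close>)
    show "eventually (\<lambda>t. t / real (k t) \<le> ctm (Suc (k t)) \<omega> / real (Suc (k t)) * (1 + 1 / real (k t))) at_top"
      using kpos eventually_ge_at_top[of 0]
    proof eventually_elim
      case (elim t)
      have "ctm (Suc (k t)) \<omega> / real (Suc (k t)) * (1 + 1 / real (k t)) = ctm (Suc (k t)) \<omega> / real (k t)"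
      proof -
        have "1 + 1 / real (k t) = real (Suc (k t)) / real (k t)" using elim(1) by (simp add: field_simps)
        then show ?thesis by (simp del: of_nat_Suc)
      qed
      then show ?case using props[OF elim(2)] by (auto intro!: divide_right_mono)
    qed
  qed
  have "((\<lambda>t. (cnt (k t) \<omega> / real (k t)) / (t / real (k t))) \<longlongrightarrow> p / drift) at_top"
    using drift_pos by (intro tendsto_divide N1 tk) simp
  moreover have "eventually (\<lambda>t. (cnt (k t) \<omega> / real (k t)) / (t / real (k t)) = emp_circ_fwd X t \<omega>) at_top"
    using kpos eventually_gt_at_top[of 0]
    by eventually_elim (use props in \<open>auto simp: emp_circ_fwd_def\<close>)
  ultimately show "((\<lambda>t. emp_circ_fwd X t \<omega>) \<longlongrightarrow> p / drift) at_top" by (rule Lim_transform_eventually)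
  have "((\<lambda>t. (1 - cnt (k t) \<omega> / real (k t)) / (t / real (k t))) \<longlongrightarrow> (1 - p) / drift) at_top"
    using drift_pos by (intro tendsto_divide tendsto_diff tendsto_const N1 tk) simp
  moreover have "eventually (\<lambda>t. (1 - cnt (k t) \<omega> / real (k t)) / (t / real (k t)) = emp_circ_bwd X t \<omega>) at_top"
    using kpos eventually_gt_at_top[of 0]
  proof eventually_elim
    case (elim t)
    have "1 - cnt (k t) \<omega> / real (k t) = (real (k t) - cnt (k t) \<omega>) / real (k t)"
      using elim(1) by (simp add: diff_divide_distrib)
    then show ?case using props[of t] elim by (simp add: emp_circ_bwd_def)
  qed
  ultimately show "((\<lambda>t. emp_circ_bwd X t \<omega>) \<longlongrightarrow> (1 - p) / drift) at_top" by (rule Lim_transform_eventually)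
qed

text \<open>Two almost sure limits agree on a set of full measure, which is nonempty in a
  probability space; this makes the definite description well defined.\<close>

lemma AE_limit_the:
  assumes "AE \<omega> in M. ((\<lambda>t. f t \<omega>) \<longlongrightarrow> (c::real)) (at_top :: real filter)"
  shows "(THE c. AE \<omega> in M. ((\<lambda>t. f t \<omega>) \<longlongrightarrow> c) at_top) = c"
proof (rule the_equality, rule assms)
  fix c' assume "AE \<omega> in M. ((\<lambda>t. f t \<omega>) \<longlongrightarrow> c') at_top"
  with assms have "AE \<omega> in M. c' = c"
  proof eventually_elim
    fix \<omega> assume "((\<lambda>t. f t \<omega>) \<longlongrightarrow> c) at_top" "((\<lambda>t. f t \<omega>) \<longlongrightarrow> c') at_top"
    then show "c' = c" by (intro tendsto_unique[OF trivial_limit_at_top_linorder])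
  qed
  then show "c' = c" by simp
qed

lemma affinity_eq: "affinity M X = ln kap"
proof -
  let ?p = "kap / (1 + kap)"
  have lim: "AE \<omega> in M. ((\<lambda>t. emp_circ_fwd X t \<omega>) \<longlongrightarrow> ?p / drift) at_top" "AE \<omega> in M. ((\<lambda>t. emp_circ_bwd X t \<omega>) \<longlongrightarrow> (1 - ?p) / drift) at_top"
  proof -
    show "AE \<omega> in M. ((\<lambda>t. emp_circ_fwd X t \<omega>) \<longlongrightarrow> ?p / drift) at_top"
      using AE_Good cycle_time_lln forward_lln by eventually_elim (rule circulation_limits(1))
    show "AE \<omega> in M. ((\<lambda>t. emp_circ_bwd X t \<omega>) \<longlongrightarrow> (1 - ?p) / drift) at_top"
      using AE_Good cycle_time_lln forward_lln by eventually_elim (rule circulation_limits(2))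
  qed
  have f: "circ_fwd M X = ?p / drift" unfolding circ_fwd_def by (rule AE_limit_the[OF lim(1)])
  have b: "circ_bwd M X = (1 - ?p) / drift" unfolding circ_bwd_def by (rule AE_limit_the[OF lim(2)])
  have "1 - ?p = 1 / (1 + kap)" using kap_pos by (simp add: field_simps)
  then have "circ_fwd M X / circ_bwd M X = kap" 
    unfolding f b using kap_pos drift_pos less_imp_neq[OF add_pos_pos[OF zero_less_one kap_pos]] by simp
  then show ?thesis by (simp add: affinity_def)
qed

end

subsection \<open>Symmetry of the rate function\<close>

text \<open>Sublevel sets are compact, hence closed, so a violated inequality at one pair persists
  near the reflected point. The lower bound on a small open square, the comparison of masses and the
  upper bound on the reflected closed square then contradict each other.\<close>

lemma ldp_transfer_bound:
  fixes \<mu> :: "real \<Rightarrow> (real \<times> real) measure" and L x1 x2 :: real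
  assumes l: "ldp \<mu> I"
    and cmp: "\<And>t A d \<epsilon>. t > 0 \<Longrightarrow> A \<in> sets borel \<Longrightarrow> prod.swap ` A \<in> sets borel \<Longrightarrow> (\<And>z. z \<in> A \<Longrightarrow> \<bar>fst z - snd z - d\<bar> \<le> \<epsilon>) \<Longrightarrow>
      measure (\<mu> t) A \<le> exp (t * (L * d + \<bar>L\<bar> * \<epsilon>)) * measure (\<mu> t) (prod.swap ` A)"
    and fin: "\<And>t. t > 0 \<Longrightarrow> finite_measure (\<mu> t) \<and> sets (\<mu> t) = sets borel"
  shows "I (x2, x1) \<le> I (x1, x2) + ereal (L * (x1 - x2))"
proof (rule ccontr)
  define d where "d = x1 - x2"
  assume "\<not> I (x2, x1) \<le> I (x1, x2) + ereal (L * (x1 - x2))"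
  then have lt: "I (x1, x2) + ereal (L * d) < I (x2, x1)" by (simp add: d_def)
  have I0: "0 \<le> I x" for x using l unfolding ldp_def by blast
  have "I (x1, x2) \<noteq> \<infinity>" using lt by auto
  then obtain a where a: "I (x1, x2) = ereal a" using I0[of "(x1, x2)"] by (cases "I (x1, x2)") auto
  \<comment> \<open>A real separating value is chosen so that the case of an infinite
    \<open>I (x2, x1)\<close> needs no separate argument.\<close>
  obtain \<alpha> where al: "a + L * d < \<alpha>" "ereal \<alpha> < I (x2, x1)"
    using ereal_dense3[OF lt[unfolded a]] a lt ereal_dense2[OF lt] by (auto simp: a)
  have "compact {x. I x \<le> ereal \<alpha>}" using l by (simp add: ldp_def)
  then have "open (- {x. I x \<le> ereal \<alpha>})" by (intro open_Compl compact_imp_closed)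
  moreover have "(x2, x1) \<in> - {x. I x \<le> ereal \<alpha>}" using al by simp
  ultimately obtain \<delta> where del0: "\<delta> > 0" "\<forall>z. dist z (x2, x1) < \<delta> \<longrightarrow> z \<in> - {x. I x \<le> ereal \<alpha>}"
    unfolding open_dist by blast
  have del: "\<delta> > 0" "\<And>z. dist z (x2, x1) < \<delta> \<Longrightarrow> ereal \<alpha> < I z" using del0 by (auto simp: not_le)
  \<comment> \<open>The first entry keeps the reflected closed square inside the ball of radius
    \<delta>; the second keeps the loss \<open>2 * \<bar>L\<bar> * \<epsilon>\<close> of the
    comparison below the available gap.\<close>
  define \<epsilon> where "\<epsilon> = min (\<delta> / 3) ((\<alpha> - (a + L * d)) / (4 * (\<bar>L\<bar> + 1)))"
  have ep: "\<epsilon> > 0" using del al by (simp add: \<epsilon>_def)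
  have eL: "2 * (\<bar>L\<bar> * \<epsilon>) < \<alpha> - (a + L * d)"
  proof -
    have "\<epsilon> \<le> (\<alpha> - (a + L * d)) / (4 * (\<bar>L\<bar> + 1))" by (simp add: \<epsilon>_def)
    then have "\<epsilon> * (4 * (\<bar>L\<bar> + 1)) \<le> \<alpha> - (a + L * d)" by (simp add: field_simps)
    moreover have "\<epsilon> * (4 * (\<bar>L\<bar> + 1)) = 2 * (\<bar>L\<bar> * \<epsilon>) + (2 * (\<bar>L\<bar> * \<epsilon>) + 4 * \<epsilon>)" by (simp add: algebra_simps)
    moreover have "0 \<le> \<bar>L\<bar> * \<epsilon>" using ep by simp
    ultimately show ?thesis using ep by linarith
  qed
  \<comment> \<open>Each coordinate varies by less than \<epsilon> on \<open>U\<close>, so the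
    difference of the coordinates is within \<open>2 * \<epsilon>\<close> of
    \<open>d\<close>.\<close>
  define c where "c = L * d + \<bar>L\<bar> * (2 * \<epsilon>)"
  define U where "U = {x1 - \<epsilon><..<x1 + \<epsilon>} \<times> {x2 - \<epsilon><..<x2 + \<epsilon>}"
  define C where "C = {x2 - \<epsilon>..x2 + \<epsilon>} \<times> {x1 - \<epsilon>..x1 + \<epsilon>}"
  have Uo: "open U" unfolding U_def by (intro open_Times) auto
  have Cc: "closed C" unfolding C_def by (intro closed_Times) auto
  have swU: "prod.swap ` U = {x2 - \<epsilon><..<x2 + \<epsilon>} \<times> {x1 - \<epsilon><..<x1 + \<epsilon>}" unfolding U_def by (auto simp: image_iff)
  have swo: "open (prod.swap ` U)" unfolding swU by (intro open_Times) auto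
  have sub: "prod.swap ` U \<subseteq> C" unfolding swU C_def by auto
  have CI: "ereal \<alpha> \<le> (INF x\<in>C. I x)"
  proof (rule INF_greatest)
    fix z assume z: "z \<in> C"
    have "\<bar>fst z - x2\<bar> \<le> \<epsilon>" "\<bar>snd z - x1\<bar> \<le> \<epsilon>" using z by (auto simp: C_def abs_le_iff)
    moreover have "\<epsilon> \<le> \<delta> / 3" unfolding \<epsilon>_def by (rule min.cobounded1)
    ultimately have "dist (fst z) x2 \<le> \<delta> / 3" "dist (snd z) x1 \<le> \<delta> / 3" unfolding dist_real_def by linarith+
    then have "dist (fst z) x2 + dist (snd z) x1 < \<delta>" using del by linarith
    moreover have "dist z (x2, x1) \<le> dist (fst z) x2 + dist (snd z) x1"
      by (cases z) (auto simp: dist_Pair_Pair intro!: sqrt_sum_squares_le_sum)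
    ultimately show "ereal \<alpha> \<le> I z" using del(2)[of z] by (auto intro: less_imp_le)
  qed
  have "c = L * d + 2 * (\<bar>L\<bar> * \<epsilon>)" by (simp add: c_def)
  then have ac: "a + c < \<alpha>" using eL by linarith
  \<comment> \<open>The midpoint leaves strict room on both sides: \<open>r < \<alpha>\<close> is
    used in the upper bound, \<open>a + c < r\<close> contradicts the lower bound.\<close>
  define r where "r = (\<alpha> + (a + c)) / 2"
  have r: "r < \<alpha>" "a + c < r" using ac by (auto simp: r_def)
  have "Limsup at_top (\<lambda>t. ereal (1 / t) * eln (measure (\<mu> t) C)) \<le> - (INF x\<in>C. I x)"
    using l Cc by (simp add: ldp_def)
  also have "\<dots> \<le> - ereal \<alpha>" using CI by (simp only: ereal_minus_le_minus)
  also have "\<dots> < ereal (- r)" using r by simp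
  finally have "eventually (\<lambda>t. ereal (1 / t) * eln (measure (\<mu> t) C) < ereal (- r)) at_top"
    by (rule Limsup_lessD)
  then have evU: "eventually (\<lambda>t. ereal (1 / t) * eln (measure (\<mu> t) U) \<le> ereal (c - r)) at_top"
    using eventually_gt_at_top[of 0]
  proof eventually_elim
    case (elim t)
    interpret finite_measure "\<mu> t" using fin[OF elim(2)] by simp
    have s: "sets (\<mu> t) = sets borel" using fin[OF elim(2)] by simp
    have "measure (\<mu> t) U \<le> exp (t * (L * d + \<bar>L\<bar> * (2 * \<epsilon>))) * measure (\<mu> t) (prod.swap ` U)"
      by (rule cmp[OF elim(2)]) (use Uo swo in \<open>auto simp: U_def d_def abs_le_iff\<close>)
    also have "\<dots> \<le> exp (t * c) * measure (\<mu> t) C"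
      unfolding c_def by (intro mult_left_mono finite_measure_mono sub) (use Cc s in auto)
    finally have le: "measure (\<mu> t) U \<le> exp (t * c) * measure (\<mu> t) C" .
    show ?case
    proof (cases "measure (\<mu> t) U \<le> 0")
      case True
      then show ?thesis using elim(2) by (simp add: eln_def)
    next
      case False
      then have U: "measure (\<mu> t) U > 0" by simp
      then have Cp: "measure (\<mu> t) C > 0" using le zero_less_mult_pos[of "exp (t * c)" "measure (\<mu> t) C"] by auto
      have "ln (measure (\<mu> t) C) / t < - r" using elim(1) Cp by (simp add: eln_def)
      then have 1: "ln (measure (\<mu> t) C) < - r * t" using elim(2) by (simp add: field_simps)
      have "ln (measure (\<mu> t) U) \<le> ln (exp (t * c) * measure (\<mu> t) C)" using le U by simp
      also have "\<dots> = t * c + ln (measure (\<mu> t) C)" using Cp by (simp add: ln_mult)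
      finally have "ln (measure (\<mu> t) U) \<le> (c - r) * t" using 1 by (simp add: algebra_simps)
      then have "ln (measure (\<mu> t) U) / t \<le> c - r" using elim(2) by (simp add: field_simps)
      then show ?thesis using U by (simp add: eln_def)
    qed
  qed
  have "- (INF x\<in>U. I x) \<le> Liminf at_top (\<lambda>t. ereal (1 / t) * eln (measure (\<mu> t) U))"
    using l Uo by (simp add: ldp_def)
  also have "\<dots> \<le> Limsup at_top (\<lambda>t. ereal (1 / t) * eln (measure (\<mu> t) U))" by (rule Liminf_le_Limsup) simp
  also have "\<dots> \<le> ereal (c - r)" by (rule Limsup_bounded[OF evU])
  finally have 1: "- (INF x\<in>U. I x) \<le> ereal (c - r)" .
  have "(INF x\<in>U. I x) \<le> I (x1, x2)" by (rule INF_lower) (use ep in \<open>simp add: U_def\<close>)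
  then have "- ereal a \<le> - (INF x\<in>U. I x)" unfolding a by (simp only: ereal_minus_le_minus)
  with 1 have "- ereal a \<le> ereal (c - r)" by (rule order_trans[rotated])
  then have "- a \<le> c - r" by simp
  with r show False by linarith
qed

section \<open>Reversal of signs at a finite time\<close>

definition flip :: "bool list \<Rightarrow> bool list" where "flip es = map Not es"

lemma flip_simps: "flip (flip es) = es" "length (flip es) = length es" "nT (flip es) = nF es" "nF (flip es) = nT es"
  by (induct es) (auto simp: flip_def nT_def nF_def)

context periodic_sde begin

text \<open>The all-backward word serves as reference: its probability carries no power of
  \<open>kap\<close>, so it is the common factor for all words of length \<open>n\<close>.\<close>

definition base :: "nat \<Rightarrow> real \<Rightarrow> real" where "base n t = prob (Fin (replicate n False) t)"

text \<open>At every natural number the transform of a word is \<open>kap ^ nT es\<close> times that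
  of the reference word of equal length; \<open>laplace_determines\<close> carries this factor over
  to the distribution functions.\<close>

lemma prob_Fin: "prob (Fin es t) = kap ^ nT es * base (length es) t"
proof -
  let ?fs = "replicate (length es) False"
  obtain \<mu> where mu: "\<mu> > 0" and f': "\<forall>es. \<forall>\<nu>\<ge>- \<mu>. lap es \<nu> = kap ^ nT es * (1 / lapden \<nu>) ^ length es"
    using cycle_laplace by blast
  have f: "lap es (real k) = kap ^ nT es * (1 / lapden (real k)) ^ length es" for es and k :: nat
    using f' mu by (simp add: order_trans[of "- \<mu>" 0])
  have n0: "nT ?fs = 0" by (simp add: nT_def)
  have eq: "lap es (real k) = kap ^ nT es * lap ?fs (real k)" for k :: nat
    using f[of es k] f[of ?fs k] n0 by simp
  have "prob {\<omega>\<in>Cyc es. ctime es \<omega> \<le> t} = kap ^ nT es * prob {\<omega>\<in>Cyc ?fs. ctime ?fs \<omega> \<le> t}"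
    by (rule laplace_determines[OF Cyc_meas Cyc_meas ctime_meas ctime_meas ctime_nonneg ctime_nonneg])
      (rule eq[unfolded lap_def])
  moreover have "{\<omega>\<in>Cyc es. ctime es \<omega> \<le> t} = Fin es t" for es by (auto simp: Fin_iff)
  ultimately show ?thesis by (simp add: base_def)
qed

text \<open>Removing the two exclusive continuations leaves a bracket that depends on the length
  alone. Reversing all signs therefore changes only the power of \<open>kap\<close>, at every fixed
  time.\<close>

lemma prob_At: "prob (At es t) = kap ^ nT es * (base (length es) t - (1 + kap) * base (Suc (length es)) t)"
proof -
  have disj: "Fin (True # es) t \<inter> Fin (False # es) t = {}" using Cyc_exclusive by (auto simp: Fin_iff)
  have sub: "Fin (True # es) t \<union> Fin (False # es) t \<subseteq> Fin es t" using Fin_Cons by blast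
  have "prob (At es t) = prob (Fin es t) - prob (Fin (True # es) t \<union> Fin (False # es) t)"
    unfolding At_def by (rule finite_measure_Diff) (use sub in auto)
  also have "prob (Fin (True # es) t \<union> Fin (False # es) t) = prob (Fin (True # es) t) + prob (Fin (False # es) t)"
    by (rule finite_measure_Union[OF _ _ disj]) auto
  finally show ?thesis unfolding prob_Fin by (simp add: nT_def algebra_simps)
qed

lemma kap_power: "kap ^ n = exp (ln kap * real n)"
  using exp_of_nat_mult[of n "ln kap"] kap_pos by (simp add: mult.commute)

lemma prob_At_flip: "prob (At es t) = exp (ln kap * (real (nT es) - real (nF es))) * prob (At (flip es) t)"
  unfolding prob_At flip_simps kap_power right_diff_distrib by (simp add: exp_diff)

lemma Good_meas [measurable]: "Good \<in> sets M"
proof -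
  have "Good = (\<Inter>n. \<Union>es\<in>words n. Cyc es) \<inter> space M" unfolding Good_def by blast
  then show ?thesis by simp
qed

definition AtG :: "bool list \<Rightarrow> real \<Rightarrow> 'a set" where "AtG es t = At es t \<inter> Good"

lemma AtG_meas [measurable]: "AtG es t \<in> sets M" unfolding AtG_def by measurable

lemma prob_AtG: "emeasure M (AtG es t) = ennreal (prob (At es t))"
proof -
  have "emeasure M (AtG es t) = emeasure M (At es t)"
    by (rule emeasure_eq_AE) (use AE_Good in \<open>auto simp: AtG_def\<close>)
  then show ?thesis by (simp add: emeasure_eq_measure)
qed

lemma AtG_disjoint: "disjoint_family_on (\<lambda>es. AtG es t) S"
  unfolding disjoint_family_on_def
proof (intro ballI impI)
  fix es fs :: "bool list" assume ne: "es \<noteq> fs"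
  show "AtG es t \<inter> AtG fs t = {}"
  proof (rule ccontr)
    assume "AtG es t \<inter> AtG fs t \<noteq> {}"
    then obtain \<omega> where w: "\<omega> \<in> Good" "\<omega> \<in> At es t" "\<omega> \<in> At fs t" by (auto simp: AtG_def)
    note e = At_counts[OF w(1,2)] and f = At_counts[OF w(1,3)]
    have "length es = length fs" using e(1) f(1) by simp
    moreover have "\<omega> \<in> space M" using w(1) by (simp add: Good_def)
    ultimately have "es = fs" using cyc_unique[OF Xc, of \<omega> es fs] e(6) f(6) by (simp add: Cyc_def)
    with ne show False ..
  qed
qed

section \<open>The law of the empirical circulations\<close>

definition Lst :: "real \<Rightarrow> (real \<times> real) set \<Rightarrow> bool list set" where
  "Lst t A = {es. (real (nT es) / t, real (nF es) / t) \<in> A}"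

text \<open>A measurable stand-in for the event that the pair of empirical circulations lies in
  \<open>A\<close>. As a countable union over words it is measurable for every set
  \<open>A\<close>.\<close>

definition Ev :: "real \<Rightarrow> (real \<times> real) set \<Rightarrow> 'a set" where "Ev t A = (\<Union>es\<in>Lst t A. AtG es t)"

lemma Ev_meas [measurable]: "Ev t A \<in> sets M"
  unfolding Ev_def by (rule sets.countable_UN'') auto

lemma Ev_iff: "AE \<omega> in M. (emp_circ_fwd X t \<omega>, emp_circ_bwd X t \<omega>) \<in> A \<longleftrightarrow> \<omega> \<in> Ev t A" if t: "t > 0"
  using AE_Good cycle_time_lln
proof eventually_elim
  fix \<omega> assume g: "\<omega> \<in> Good" and T: "(\<lambda>n. ctm n \<omega> / real n) \<longlonglongrightarrow> drift"
  obtain es where es: "\<omega> \<in> At es t" using At_exists[OF g ctm_infinity[OF T]] t by (metis less_imp_le)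
  have val: "(emp_circ_fwd X t \<omega>, emp_circ_bwd X t \<omega>) = (real (nT fs) / t, real (nF fs) / t)" if "\<omega> \<in> At fs t" for fs
    using At_counts[OF g that] by (simp add: emp_circ_fwd_def emp_circ_bwd_def)
  show "(emp_circ_fwd X t \<omega>, emp_circ_bwd X t \<omega>) \<in> A \<longleftrightarrow> \<omega> \<in> Ev t A"
  proof
    assume "(emp_circ_fwd X t \<omega>, emp_circ_bwd X t \<omega>) \<in> A"
    then show "\<omega> \<in> Ev t A" using val[OF es] es g by (auto simp: Ev_def Lst_def AtG_def)
  next
    assume "\<omega> \<in> Ev t A"
    then obtain fs where "\<omega> \<in> At fs t" "fs \<in> Lst t A" by (auto simp: Ev_def AtG_def)
    then show "(emp_circ_fwd X t \<omega>, emp_circ_bwd X t \<omega>) \<in> A" using val by (auto simp: Lst_def)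
  qed
qed

text \<open>Used in \<open>circ_law_cases\<close>: one-sided estimates on a set and on its
  complement become equalities once both pairs of masses add up to 1.\<close>

lemma Ev_compl: "prob (Ev t A) + prob (Ev t (- A)) = 1" if t: "t > 0"
proof -
  have "AE \<omega> in M. \<omega> \<in> Ev t (- A) \<longleftrightarrow> \<omega> \<in> space M - Ev t A"
    using Ev_iff[OF t, of A] Ev_iff[OF t, of "- A"] AE_space by eventually_elim auto
  then have "prob (Ev t (- A)) = prob (space M - Ev t A)" by (intro finite_measure_eq_AE) auto
  then show ?thesis by (simp add: prob_compl)
qed

text \<open>The map defining \<open>circ_law\<close> is only known to agree almost surely with a measurable one. If it is
  not measurable, \<open>distr\<close> either still yields the right law or degenerates to the null measure.\<close>
lemma circ_law_cases:
  assumes t: "t > 0"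
  shows "(\<forall>A\<in>sets borel. measure (circ_law M X t) A = prob (Ev t A)) \<or> (\<forall>A. measure (circ_law M X t) A = 0)"
proof -
  define f where "f \<omega> = (emp_circ_fwd X t \<omega>, emp_circ_bwd X t \<omega>)" for \<omega>
  define \<mu> where "\<mu> A = emeasure M (f -` A \<inter> space M)" for A
  have cl: "circ_law M X t = measure_of UNIV (sets borel) \<mu>"
    unfolding circ_law_def distr_def \<mu>_def f_def by simp
  have sa: "sigma_sets UNIV (sets borel) = sets (borel :: (real \<times> real) measure)"
    using sets.sigma_sets_eq[of "borel :: (real \<times> real) measure"] by simp
  have em: "emeasure (circ_law M X t) A = (if A \<in> sets borel \<and> measure_space UNIV (sets borel) \<mu> then \<mu> A else 0)" for A
    unfolding cl by (subst emeasure_measure_of_conv) (simp_all add: sa)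
  show ?thesis
  proof (cases "measure_space UNIV (sets (borel :: (real \<times> real) measure)) \<mu>")
    case False
    then have "measure (circ_law M X t) A = 0" for A by (simp add: measure_def em)
    then show ?thesis by blast
  next
    case True
    \<comment> \<open>\<open>emeasure\<close> is 0 on sets that are not measurable, so without
      measurability of the preimage an inequality is all that remains.\<close>
    have le: "\<mu> A \<le> ennreal (prob (Ev t A))" for A
    proof (cases "f -` A \<inter> space M \<in> sets M")
      case True
      have "\<mu> A = emeasure M (Ev t A)" unfolding \<mu>_def
        by (rule emeasure_eq_AE) (use Ev_iff[OF t, of A] True AE_space in \<open>auto simp: f_def\<close>)
      then show ?thesis by (simp add: emeasure_eq_measure)
    next
      case False
      then show ?thesis by (simp add: \<mu>_def emeasure_notin_sets)
    qed
    have "measure (circ_law M X t) A = prob (Ev t A)" if A: "A \<in> sets borel" for A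
    proof -
      have nA: "- A \<in> sets borel" using A by (rule borel_comp)
      have add: "emeasure (circ_law M X t) A + emeasure (circ_law M X t) (- A) = emeasure (circ_law M X t) (A \<union> - A)"
        by (rule plus_emeasure) (use A nA in \<open>auto simp: circ_law_def\<close>)
      have "\<mu> A + \<mu> (- A) = \<mu> UNIV" using add A nA True by (simp add: em)
      also have "\<mu> UNIV = 1" by (simp add: \<mu>_def emeasure_space_1)
      finally have one: "\<mu> A + \<mu> (- A) = 1" .
      obtain u where u: "\<mu> A = ennreal u" "0 \<le> u" using le[of A] by (cases "\<mu> A") (auto simp: top_unique)
      obtain v where v: "\<mu> (- A) = ennreal v" "0 \<le> v" using le[of "- A"] by (cases "\<mu> (- A)") (auto simp: top_unique)
      have "ennreal (u + v) = 1" using one u v by simp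
      then have "u + v = 1" by (simp add: ennreal_eq_1)
      moreover have "u \<le> prob (Ev t A)" "v \<le> prob (Ev t (- A))"
        using le[of A] le[of "- A"] unfolding u(1) v(1) by simp_all
      ultimately have "u = prob (Ev t A)" using Ev_compl[OF t, of A] by linarith
      then show ?thesis using A True u by (simp add: measure_def em)
    qed
    then show ?thesis by blast
  qed
qed

text \<open>Both events are countable disjoint unions over words, and \<open>flip\<close> matches
  the words because it exchanges the two counts. On \<open>A\<close> the exponent
  \<open>nT es - nF es\<close> is within \<open>t * \<epsilon>\<close> of \<open>t * d\<close>,
  which bounds the power of \<open>kap\<close> uniformly.\<close>

lemma Ev_comparison:
  assumes t: "t > 0" and A: "\<And>z. z \<in> A \<Longrightarrow> \<bar>fst z - snd z - d\<bar> \<le> \<epsilon>"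
  shows "prob (Ev t A) \<le> exp (t * (ln kap * d + \<bar>ln kap\<bar> * \<epsilon>)) * prob (Ev t (prod.swap ` A))"
proof -
  define c where "c = exp (t * (ln kap * d + \<bar>ln kap\<bar> * \<epsilon>))"
  have sum: "emeasure M (Ev t B) = (\<integral>\<^sup>+es. ennreal (prob (At es t)) \<partial>count_space (Lst t B))" for B
    unfolding Ev_def prob_AtG[symmetric]
    by (rule emeasure_UN_countable) (auto intro: AtG_disjoint)
  have le: "prob (At es t) \<le> c * prob (At (flip es) t)" if es: "es \<in> Lst t A" for es
  proof -
    define k where "k = real (nT es) - real (nF es)"
    have "\<bar>k / t - d\<bar> \<le> \<epsilon>" using A[of "(real (nT es) / t, real (nF es) / t)"] es by (simp add: Lst_def k_def diff_divide_distrib)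
    then have "\<bar>ln kap\<bar> * \<bar>k / t - d\<bar> \<le> \<bar>ln kap\<bar> * \<epsilon>" by (intro mult_left_mono) auto
    then have "ln kap * (k / t - d) \<le> \<bar>ln kap\<bar> * \<epsilon>" using abs_ge_self[of "ln kap * (k / t - d)"] by (simp add: abs_mult)
    then have "t * (ln kap * (k / t)) \<le> t * (ln kap * d + \<bar>ln kap\<bar> * \<epsilon>)"
      using t by (intro mult_left_mono) (auto simp: right_diff_distrib)
    then have "ln kap * k \<le> t * (ln kap * d + \<bar>ln kap\<bar> * \<epsilon>)" using t by simp
    then show ?thesis unfolding prob_At_flip[of es] c_def k_def[symmetric] by (intro mult_right_mono) auto
  qed
  have bij: "bij_betw flip (Lst t A) (Lst t (prod.swap ` A))"
  proof (rule bij_betw_byWitness[where f'=flip])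
    have sw: "(p, q) \<in> prod.swap ` A \<longleftrightarrow> (q, p) \<in> A" for p q by force
    show "flip ` Lst t A \<subseteq> Lst t (prod.swap ` A)" "flip ` Lst t (prod.swap ` A) \<subseteq> Lst t A"
      by (auto simp: flip_simps Lst_def sw)
  qed (auto simp: flip_simps)
  have "emeasure M (Ev t A) \<le> (\<integral>\<^sup>+es. ennreal c * ennreal (prob (At (flip es) t)) \<partial>count_space (Lst t A))"
    unfolding sum
    by (rule nn_integral_mono) (use le in \<open>auto simp: c_def ennreal_mult[symmetric] intro!: ennreal_leI\<close>)
  also have "\<dots> = ennreal c * (\<integral>\<^sup>+es. ennreal (prob (At (flip es) t)) \<partial>count_space (Lst t A))"
    by (rule nn_integral_cmult) simp
  also have "(\<integral>\<^sup>+es. ennreal (prob (At (flip es) t)) \<partial>count_space (Lst t A)) = emeasure M (Ev t (prod.swap ` A))"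
    unfolding sum by (rule nn_integral_bij_count_space[OF bij])
  finally have "ennreal (prob (Ev t A)) \<le> ennreal (c * prob (Ev t (prod.swap ` A)))"
    by (simp add: emeasure_eq_measure ennreal_mult c_def)
  then show ?thesis unfolding c_def by (subst (asm) ennreal_le_iff) auto
qed

lemma circ_law_comparison:
  assumes t: "t > 0" and A: "A \<in> sets borel" "prod.swap ` A \<in> sets borel" "\<And>z. z \<in> A \<Longrightarrow> \<bar>fst z - snd z - d\<bar> \<le> \<epsilon>"
  shows "measure (circ_law M X t) A \<le> exp (t * (ln kap * d + \<bar>ln kap\<bar> * \<epsilon>)) * measure (circ_law M X t) (prod.swap ` A)"
  using circ_law_cases[OF t]
proof
  assume h: "\<forall>A\<in>sets borel. measure (circ_law M X t) A = prob (Ev t A)"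
  show ?thesis
    unfolding h[rule_format, OF A(1)] h[rule_format, OF A(2)] by (rule Ev_comparison[OF t A(3)])
next
  assume h: "\<forall>A. measure (circ_law M X t) A = 0"
  show ?thesis unfolding h[rule_format] by simp
qed

lemma circ_law_finite: "t > 0 \<Longrightarrow> finite_measure (circ_law M X t) \<and> sets (circ_law M X t) = sets borel"
proof
  show "sets (circ_law M X t) = sets borel" by (simp add: circ_law_def)
  have "emeasure (circ_law M X t) UNIV \<le> 1"
  proof -
    have "emeasure (circ_law M X t) UNIV \<le> emeasure M (space M)"
      unfolding circ_law_def distr_def by (subst emeasure_measure_of_conv) auto
    then show ?thesis by (simp add: emeasure_space_1)
  qed
  then have "emeasure (circ_law M X t) (space (circ_law M X t)) \<noteq> \<infinity>"
    by (auto simp: circ_law_def top_unique)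
  then show "finite_measure (circ_law M X t)" by (rule finite_measureI)
qed

text \<open>The transfer bound is one-sided; exchanging the coordinates reverses the sign of the
  correction and gives the opposite inequality. Since the correction is finite, the two values are
  infinite together.\<close>

lemma rate_symmetry:
  assumes l: "ldp (circ_law M X) I"
  shows "I (x1, x2) = I (x2, x1) - ereal (affinity M X * (x1 - x2))"
proof -
  have le: "I (u2, u1) \<le> I (u1, u2) + ereal (ln kap * (u1 - u2))" for u1 u2
    by (rule ldp_transfer_bound[OF l circ_law_comparison circ_law_finite])
  have "I (x2, x1) \<le> I (x1, x2) + ereal (ln kap * (x1 - x2))"
    "I (x1, x2) \<le> I (x2, x1) + ereal (- (ln kap * (x1 - x2)))"
    using le[of x2 x1] le[of x1 x2] by (simp_all add: algebra_simps)
  then show ?thesis unfolding affinity_eq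
    by (cases "I (x1, x2)"; cases "I (x2, x1)") auto
qed

end

theorem theorem5p1:
  fixes b \<sigma> :: "real \<Rightarrow> real" and y :: real
    and M :: "'a measure" and F :: "real \<Rightarrow> 'a measure"
    and W X :: "real \<Rightarrow> 'a \<Rightarrow> real"
    and I\<^sub>1 :: "real \<times> real \<Rightarrow> ereal"
  assumes "continuous_on UNIV b" and "\<And>x. b (x + 1) = b x"
    and "continuous_on UNIV \<sigma>" and "\<And>x. \<sigma> (x + 1) = \<sigma> x" and "\<And>x. \<sigma> x > 0"
    and "sde_weak_solution M F W X b \<sigma> y"
    and "ldp (circ_law M X) I\<^sub>1"
  shows "\<forall>x\<^sub>1 x\<^sub>2. I\<^sub>1 (x\<^sub>1, x\<^sub>2) = I\<^sub>1 (x\<^sub>2, x\<^sub>1) - ereal (affinity M X * (x\<^sub>1 - x\<^sub>2))"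
proof -
  have mb: "bounded_ucont b" by (rule periodic_bounded_ucont[OF assms(1,2)])
  have ms: "bounded_ucont \<sigma>" by (rule periodic_bounded_ucont[OF assms(3,4)])
  obtain B1 where B1: "B1 \<ge> 0" "\<And>x. \<bar>b x\<bar> \<le> B1" using bounded_ucontD_bound[OF mb] by blast
  obtain B2 where B2: "B2 \<ge> 0" "\<And>x. \<bar>\<sigma> x\<bar> \<le> B2" using bounded_ucontD_bound[OF ms] by blast
  note sol = assms(6)[unfolded sde_weak_solution_def]
  interpret prob_space M using sol by (rule conjunct1)
  \<comment> \<open>A single constant that is at least 1 and bounds both coefficients.\<close>
  interpret periodic_sde M F W X b \<sigma> y "1 + B1 + B2"
  proof unfold_locales
    show "is_filtration M F" "brownian_motion M F W"
      using sol by (rule conjunct1[OF conjunct2], rule conjunct1[OF conjunct2[OF conjunct2]])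
    show "X 0 \<omega> = y" "continuous_on {0..} (\<lambda>t. X t \<omega>)" if "\<omega> \<in> space M" for \<omega>
      using sol that by simp_all
    show "X t \<in> borel_measurable (F t)" if "t \<ge> 0" for t using sol that by simp
    show "\<exists>Z. is_ito_integral M (\<lambda>s \<omega>. \<sigma> (X s \<omega>)) W t Z \<and>
        (AE \<omega> in M. X t \<omega> = y + integral {0..t} (\<lambda>s. b (X s \<omega>)) + Z \<omega>)" if "t \<ge> 0" for t
      using sol that by simp
    show "bounded_ucont b" "bounded_ucont \<sigma>" by (fact mb, fact ms)
    show "1 \<le> 1 + B1 + B2" using B1(1) B2(1) by simp
    show "\<bar>b x\<bar> \<le> 1 + B1 + B2" for x using B1(1) B1(2)[of x] B2(1) by linarith
    show "\<bar>\<sigma> x\<bar> \<le> 1 + B1 + B2" for x using B1(1) B2(2)[of x] B2(1) by linarith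
    show "b (x + 1) = b x" "\<sigma> (x + 1) = \<sigma> x" "\<sigma> x > 0" for x by (rule assms)+
  qed
  show ?thesis using rate_symmetry[OF assms(7)] by blast
qed


end
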